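(* Let $G$ be a sofic group containing an infinite subgroup $\Gamma$ with some non-zero $\ell^2$-Betti number $\beta^p_{(2)}(\Gamma)>0$. Then $G$ admits an algebraic action and an algebraic factor map that simultaneously violates the Yuzvinsky addition formula for topological sofic entropy for all sofic approximations to $G$. That is, there exist compact metrizable groups $H,H'$ on which $G$ acts by continuous group automorphisms and a continuous surjective $G$-equivariant group homomorphism $\phi:H\to H'$ such that, for every sofic approximation $\Sigma$ to $G$, $$h^\Sigma_{\mathrm{top}}(G\curvearrowright H)\ne h^\Sigma_{\mathrm{top}}(G\curvearrowright\ker(\phi))+h^\Sigma_{\mathrm{top}}(G\curvearrowright H').$$
   Context: Sofic approximation: A sofic approximation to a countable group $G$ is a sequence $\Sigma=(\sigma_n:G\to\mathrm{Sym}(D_n))$ of maps (not necessarily homomorphisms), $D_n$ finite sets with $|D_n|\to\infty$, $\sigma_n(1_G)=\mathrm{id}$, such that $|\{i\in D_n:\sigma_n(g)(i)\ne i\}|/|D_n|\to1$ for all $g\ne1_G$, and $|\{i\in D_n:\sigma_n(g)\circ\sigma_n(h)(i)=\sigma_n(gh)(i)\}|/|D_n|\to1$ for all $g,h\in G$. $G$ is sofic if it admits one. Topological sofic entropy: Let $G\curvearrowright X$ be a continuous action on a compact metrizable space. Let $\rho$ be a continuous pseudo-metric on $X$ that is generating (for $x\ne y$ there is $g\in G$ with $\rho(g\cdot x,g\cdot y)>0$). For $\phi,\phi':D_n\to X$ let $\rho_2(\phi,\phi')=\bigl(\frac1{|D_n|}\sum_{i}\rho(\phi(i),\phi'(i))^2\bigr)^{1/2}$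 and $\rho_\infty(\phi,\phi')=\max_i\rho(\phi(i),\phi'(i))$. For finite $F\subseteq G$, $\delta>0$ let $\mathrm{Map}(\rho,F,\delta,\sigma_n)=\{\phi:D_n\to X:\rho_2(\phi\circ\sigma_n(f),f\cdot\phi)<\delta\ \forall f\in F\}$, and let $N_\kappa(\cdot,\rho_\infty)$ be the maximum cardinality of a subset whose distinct elements satisfy $\rho_\infty(\phi,\phi')\ge\kappa$. Then $$h^\Sigma_{\mathrm{top}}(G\curvearrowright X)=\sup_{\kappa>0}\inf_{\delta>0}\inf_{F}\limsup_{n\to\infty}\frac1{|D_n|}\log N_\kappa(\mathrm{Map}(\rho,F,\delta,\sigma_n),\rho_\infty)$$ ($F$ ranging over finite subsets of $G$, $\log 0=-\infty$); this is independent of $\rho$. $\ell^2$-Betti numbers: Suppose a countable group $\Gamma$ acts freely simplicially on a simplicial complex $L$. If $L$ is cocompact, let $C^p_{(2)}(L)$ be the Hilbert space of square-summable complex $p$-cochains, $\delta^{p+1}_{(2)}:C^p_{(2)}(L)\to C^{p+1}_{(2)}(L)$ the coboundary operator, $\overline H^p_{(2)}(L)=\ker\delta^{p+1}_{(2)}/\overline{\mathrm{Im}\,\delta^p_{(2)}}$, and $\beta^p_{(2)}(L:\Gamma)=\dim_\Gamma\overline H^p_{(2)}(L)$ (von Neumann dimension). In general write $L=\bigcup_iL_i$ as an increasing union of a sequence of $\Gamma$-invariant cocompact subcomplexes and set $\beta^p_{(2)}(L:\Gamma)=\lim_{i}\lim_{j\ge i}\dim_\Gamma\overline{\mathrm{Im}}(\overline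 H^p_{(2)}(L_j)\to\overline H^p_{(2)}(L_i))$ (maps induced by restriction; independent of the exhaustion). Then $\beta^p_{(2)}(\Gamma):=\beta^p_{(2)}(L:\Gamma)$ for any free simplicial action of $\Gamma$ on an $n$-connected $L$ with $n\ge p$ (independent of $L$). *)

theory Defs
  imports
    "HOL-Analysis.Analysis"
    "HOL-Algebra.Group_Action"
    "HOL-Combinatorics.Permutations"
    "HOL-Library.Extended_Nat"
begin

section \<open>Sofic groups\<close>

text \<open>
  A sofic approximation consists of finite sets \<open>D n\<close> and maps \<open>\<sigma> n\<close> from the group to
  the permutations of \<open>D n\<close>; nothing forces \<open>\<sigma> n\<close> to be a homomorphism.
\<close>

definition sofic_approximation ::
  "('g, 'm) monoid_scheme \<Rightarrow> (nat \<Rightarrow> 'd set) \<Rightarrow> (nat \<Rightarrow> 'g \<Rightarrow> 'd \<Rightarrow> 'd) \<Rightarrow> bool" where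
  "sofic_approximation G D \<sigma> \<longleftrightarrow>
     (\<forall>n. finite (D n)) \<and>
     filterlim (\<lambda>n. card (D n)) at_top sequentially \<and>
     (\<forall>n. \<forall>g\<in>carrier G. \<sigma> n g permutes D n) \<and>
     (\<forall>n. \<sigma> n \<one>\<^bsub>G\<^esub> = id) \<and>
     (\<forall>g\<in>carrier G. g \<noteq> \<one>\<^bsub>G\<^esub> \<longrightarrow>
        (\<lambda>n. real (card {i \<in> D n. \<sigma> n g i \<noteq> i}) / real (card (D n))) \<longlonglongrightarrow> 1) \<and>
     (\<forall>g\<in>carrier G. \<forall>h\<in>carrier G.
        (\<lambda>n. real (card {i \<in> D n. (\<sigma> n g \<circ> \<sigma> n h) i = \<sigma> n (g \<otimes>\<^bsub>G\<^esub> h) i}) / real (card (D n)))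
          \<longlonglongrightarrow> 1)"

text \<open>
  Every finite set is in bijection with a set of natural numbers, so taking \<open>D n \<subseteq> \<nat>\<close> is no
  restriction.
\<close>

definition sofic_group :: "('g, 'm) monoid_scheme \<Rightarrow> bool" where
  "sofic_group G \<longleftrightarrow> group G \<and> countable (carrier G) \<and>
     (\<exists>(D :: nat \<Rightarrow> nat set) \<sigma>. sofic_approximation G D \<sigma>)"


section \<open>Topological sofic entropy\<close>

definition continuous_pseudometric :: "'x topology \<Rightarrow> ('x \<Rightarrow> 'x \<Rightarrow> real) \<Rightarrow> bool" where
  "continuous_pseudometric X \<rho> \<longleftrightarrow>
     (\<forall>x\<in>topspace X. \<rho> x x = 0) \<and>
     (\<forall>x\<in>topspace X. \<forall>y\<in>topspace X. 0 \<le> \<rho> x y \<and> \<rho> x y = \<rho> y x) \<and>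
     (\<forall>x\<in>topspace X. \<forall>y\<in>topspace X. \<forall>z\<in>topspace X. \<rho> x z \<le> \<rho> x y + \<rho> y z) \<and>
     continuous_map (prod_topology X X) euclideanreal (\<lambda>(x, y). \<rho> x y)"

definition generating_pseudometric ::
  "('g, 'm) monoid_scheme \<Rightarrow> 'x topology \<Rightarrow> ('g \<Rightarrow> 'x \<Rightarrow> 'x) \<Rightarrow> ('x \<Rightarrow> 'x \<Rightarrow> real) \<Rightarrow> bool" where
  "generating_pseudometric G X \<alpha> \<rho> \<longleftrightarrow> continuous_pseudometric X \<rho> \<and>
     (\<forall>x\<in>topspace X. \<forall>y\<in>topspace X. x \<noteq> y \<longrightarrow> (\<exists>g\<in>carrier G. \<rho> (\<alpha> g x) (\<alpha> g y) > 0))"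

definition rho_2 :: "('x \<Rightarrow> 'x \<Rightarrow> real) \<Rightarrow> 'd set \<Rightarrow> ('d \<Rightarrow> 'x) \<Rightarrow> ('d \<Rightarrow> 'x) \<Rightarrow> real" where
  "rho_2 \<rho> D \<phi> \<phi>' = sqrt ((1 / real (card D)) * (\<Sum>i\<in>D. (\<rho> (\<phi> i) (\<phi>' i))\<^sup>2))"

definition rho_inf :: "('x \<Rightarrow> 'x \<Rightarrow> real) \<Rightarrow> 'd set \<Rightarrow> ('d \<Rightarrow> 'x) \<Rightarrow> ('d \<Rightarrow> 'x) \<Rightarrow> real" where
  "rho_inf \<rho> D \<phi> \<phi>' = Max ((\<lambda>i. \<rho> (\<phi> i) (\<phi>' i)) ` D)"

definition sofic_Map ::
  "'x topology \<Rightarrow> ('g \<Rightarrow> 'x \<Rightarrow> 'x) \<Rightarrow> ('x \<Rightarrow> 'x \<Rightarrow> real) \<Rightarrow> 'g set \<Rightarrow> real \<Rightarrow>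
     'd set \<Rightarrow> ('g \<Rightarrow> 'd \<Rightarrow> 'd) \<Rightarrow> ('d \<Rightarrow> 'x) set" where
  "sofic_Map X \<alpha> \<rho> F \<delta> D s =
     {\<phi> \<in> D \<rightarrow>\<^sub>E topspace X. \<forall>f\<in>F. rho_2 \<rho> D (\<phi> \<circ> s f) (\<alpha> f \<circ> \<phi>) < \<delta>}"

text \<open>
  The largest cardinality of a \<open>\<kappa>\<close>-separated subset, taken in \<^typ>\<open>enat\<close> so that the
  supremum is meaningful without a finiteness proof.
\<close>

definition separation_number :: "real \<Rightarrow> ('y \<Rightarrow> 'y \<Rightarrow> real) \<Rightarrow> 'y set \<Rightarrow> enat" where
  "separation_number \<kappa> d A =
     (SUP S\<in>{S. finite S \<and> S \<subseteq> A \<and> pairwise (\<lambda>x y. \<kappa> \<le> d x y) S}. enat (card S))"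

definition log_enat :: "enat \<Rightarrow> ereal" where
  "log_enat N = (case N of enat k \<Rightarrow> (if k = 0 then - \<infinity> else ereal (ln (real k))) | \<infinity> \<Rightarrow> \<infinity>)"

definition sofic_entropy_wrt ::
  "('x \<Rightarrow> 'x \<Rightarrow> real) \<Rightarrow> ('g, 'm) monoid_scheme \<Rightarrow> 'x topology \<Rightarrow> ('g \<Rightarrow> 'x \<Rightarrow> 'x) \<Rightarrow>
     (nat \<Rightarrow> 'd set) \<Rightarrow> (nat \<Rightarrow> 'g \<Rightarrow> 'd \<Rightarrow> 'd) \<Rightarrow> ereal" where
  "sofic_entropy_wrt \<rho> G X \<alpha> D \<sigma> =
     (SUP \<kappa>\<in>{0<..}. INF \<delta>\<in>{0<..}. INF F\<in>{F. finite F \<and> F \<subseteq> carrier G}.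
        limsup (\<lambda>n. ereal (1 / real (card (D n))) *
          log_enat (separation_number \<kappa> (rho_inf \<rho> (D n)) (sofic_Map X \<alpha> \<rho> F \<delta> (D n) (\<sigma> n)))))"

text \<open>
  For a continuous action on a compact metrizable space, generating continuous pseudometrics
  exist and all give the same value, hence the choice operator.
\<close>

definition sofic_entropy ::
  "('g, 'm) monoid_scheme \<Rightarrow> 'x topology \<Rightarrow> ('g \<Rightarrow> 'x \<Rightarrow> 'x) \<Rightarrow>
     (nat \<Rightarrow> 'd set) \<Rightarrow> (nat \<Rightarrow> 'g \<Rightarrow> 'd \<Rightarrow> 'd) \<Rightarrow> ereal" where
  "sofic_entropy G X \<alpha> D \<sigma> =
     sofic_entropy_wrt (SOME \<rho>. generating_pseudometric G X \<alpha> \<rho>) G X \<alpha> D \<sigma>"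


section \<open>Algebraic actions\<close>

text \<open>
  Topological groups live on a carrier inside a type. Every compact metrizable space has at most
  continuum many points, so all of them occur, up to isomorphism, on subsets of the type
  \<^typ>\<open>nat \<Rightarrow> real\<close> with an arbitrary topology and group structure.
\<close>

definition topological_group_on :: "('h, 'm) monoid_scheme \<Rightarrow> 'h topology \<Rightarrow> bool" where
  "topological_group_on H T \<longleftrightarrow> group H \<and> topspace T = carrier H \<and>
     continuous_map (prod_topology T T) T (\<lambda>(x, y). x \<otimes>\<^bsub>H\<^esub> y) \<and>
     continuous_map T T (\<lambda>x. inv\<^bsub>H\<^esub> x)"

definition compact_metrizable_group :: "('h, 'm) monoid_scheme \<Rightarrow> 'h topology \<Rightarrow> bool" where
  "compact_metrizable_group H T \<longleftrightarrow>
     topological_group_on H T \<and> compact_space T \<and> metrizable_space T"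

definition acts_by_continuous_automorphisms ::
  "('g, 'm) monoid_scheme \<Rightarrow> ('h, 'k) monoid_scheme \<Rightarrow> 'h topology \<Rightarrow> ('g \<Rightarrow> 'h \<Rightarrow> 'h) \<Rightarrow> bool" where
  "acts_by_continuous_automorphisms G H T \<alpha> \<longleftrightarrow> group_action G (carrier H) \<alpha> \<and>
     (\<forall>g\<in>carrier G. \<alpha> g \<in> iso H H \<and> continuous_map T T (\<alpha> g))"


section \<open>Square-summable functions and von Neumann dimension\<close>

text \<open>
  The Hilbert space of square-summable complex functions on \<open>S\<close>, as functions on the whole type
  vanishing outside \<open>S\<close>.
\<close>

definition l2 :: "'s set \<Rightarrow> ('s \<Rightarrow> complex) set" where
  "l2 S = {f. (\<forall>s. s \<notin> S \<longrightarrow> f s = 0) \<and> (\<lambda>s. (cmod (f s))\<^sup>2) summable_on S}"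

definition l2_inner :: "'s set \<Rightarrow> ('s \<Rightarrow> complex) \<Rightarrow> ('s \<Rightarrow> complex) \<Rightarrow> complex" where
  "l2_inner S f g = (\<Sum>\<^sub>\<infinity>s\<in>S. f s * cnj (g s))"

definition l2_norm :: "'s set \<Rightarrow> ('s \<Rightarrow> complex) \<Rightarrow> real" where
  "l2_norm S f = sqrt (\<Sum>\<^sub>\<infinity>s\<in>S. (cmod (f s))\<^sup>2)"

definition l2_closure :: "'s set \<Rightarrow> ('s \<Rightarrow> complex) set \<Rightarrow> ('s \<Rightarrow> complex) set" where
  "l2_closure S A = {f \<in> l2 S. \<forall>\<epsilon>>0. \<exists>g\<in>A. l2_norm S (\<lambda>s. f s - g s) < \<epsilon>}"

text \<open>Orthogonal projection onto a closed subspace.\<close>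

definition l2_proj :: "'s set \<Rightarrow> ('s \<Rightarrow> complex) set \<Rightarrow> ('s \<Rightarrow> complex) \<Rightarrow> ('s \<Rightarrow> complex)" where
  "l2_proj S V f = (THE g. g \<in> V \<and> (\<forall>v\<in>V. l2_inner S (\<lambda>s. f s - g s) v = 0))"

text \<open>
  The quotient Hilbert space \<open>V / W\<close> of closed subspaces \<open>W \<subseteq> V\<close>: a coset is represented by its
  unique element orthogonal to \<open>W\<close>, which is its element of least norm, and
  \<open>quotient_class W v\<close> is the representative of \<open>v + W\<close>.
\<close>

definition hilbert_quotient ::
  "'s set \<Rightarrow> ('s \<Rightarrow> complex) set \<Rightarrow> ('s \<Rightarrow> complex) set \<Rightarrow> ('s \<Rightarrow> complex) set" where
  "hilbert_quotient S V W = {v \<in> V. \<forall>w\<in>W. l2_inner S v w = 0}"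

definition quotient_class ::
  "'s set \<Rightarrow> ('s \<Rightarrow> complex) set \<Rightarrow> ('s \<Rightarrow> complex) \<Rightarrow> ('s \<Rightarrow> complex)" where
  "quotient_class S W v = (\<lambda>s. v s - l2_proj S W v s)"

text \<open>
  Let \<open>\<Gamma>\<close> act freely on \<open>S\<close> through \<open>a\<close> with finitely many orbits, so that \<open>l2 S\<close> is a
  finitely generated free Hilbert \<open>\<Gamma>\<close>-module. The von Neumann dimension of a closed
  \<open>\<Gamma>\<close>-invariant subspace \<open>V\<close> is the von Neumann trace of the orthogonal projection onto \<open>V\<close>:
  its diagonal entries are constant on orbits, and one entry is added for each orbit.
\<close>

definition point_mass :: "'s \<Rightarrow> 's \<Rightarrow> complex" where
  "point_mass s = (\<lambda>t. if t = s then 1 else 0)"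

definition vn_dim ::
  "('g, 'm) monoid_scheme \<Rightarrow> 's set \<Rightarrow> ('g \<Rightarrow> 's \<Rightarrow> 's) \<Rightarrow> ('s \<Rightarrow> complex) set \<Rightarrow> real" where
  "vn_dim \<Gamma> S a V =
     (\<Sum>orb\<in>orbits \<Gamma> S a.
        let s = (SOME s. s \<in> orb) in Re (l2_inner S (l2_proj S V (point_mass s)) (point_mass s)))"


section \<open>Simplicial complexes with a group action\<close>

text \<open>
  Abstract simplicial complexes: a complex is its set of nonempty finite simplices, with
  \<open>\<Union>K\<close> its set of vertices.
\<close>

definition abstract_complex :: "'v set set \<Rightarrow> bool" where
  "abstract_complex K \<longleftrightarrow>
     (\<forall>s\<in>K. finite s \<and> s \<noteq> {}) \<and> (\<forall>s\<in>K. \<forall>t. t \<subseteq> s \<and> t \<noteq> {} \<longrightarrow> t \<in> K)"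

definition closed_simplex :: "'v set \<Rightarrow> ('v \<Rightarrow> real) set" where
  "closed_simplex s = {x. (\<forall>v. 0 \<le> x v) \<and> (\<forall>v. v \<notin> s \<longrightarrow> x v = 0) \<and> (\<Sum>v\<in>s. x v) = 1}"

text \<open>
  The geometric realization in barycentric coordinates, with the weak topology: a set is open
  iff its intersection with every closed simplex is open in that simplex.
\<close>

definition realization_open :: "'v set set \<Rightarrow> ('v \<Rightarrow> real) set \<Rightarrow> bool" where
  "realization_open K U \<longleftrightarrow> U \<subseteq> (\<Union>s\<in>K. closed_simplex s) \<and>
     (\<forall>s\<in>K. openin (subtopology (powertop_real UNIV) (closed_simplex s)) (U \<inter> closed_simplex s))"

lemma istopology_realization_open: "istopology (realization_open K)"
  unfolding istopology_def
proof (intro conjI allI impI)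
  fix U V assume U: "realization_open K U" and V: "realization_open K V"
  have "U \<inter> V \<inter> closed_simplex s = (U \<inter> closed_simplex s) \<inter> (V \<inter> closed_simplex s)" for s
    by blast
  then show "realization_open K (U \<inter> V)"
    using U V unfolding realization_open_def by (auto simp only: intro: openin_Int)
next
  fix \<U> assume *: "\<forall>U\<in>\<U>. realization_open K U"
  have "openin (subtopology (powertop_real UNIV) (closed_simplex s)) (\<Union>\<U> \<inter> closed_simplex s)"
    if "s \<in> K" for s
  proof -
    have "\<Union>\<U> \<inter> closed_simplex s = \<Union>((\<lambda>U. U \<inter> closed_simplex s) ` \<U>)"
      by blast
    then show ?thesis
      using * that unfolding realization_open_def by (auto simp only: intro!: openin_Union)
  qed
  moreover have "\<Union>\<U> \<subseteq> (\<Union>s\<in>K. closed_simplex s)"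
    using * unfolding realization_open_def by blast
  ultimately show "realization_open K (\<Union>\<U>)"
    unfolding realization_open_def by blast
qed

definition geometric_realization :: "'v set set \<Rightarrow> ('v \<Rightarrow> real) topology" where
  "geometric_realization K = topology (realization_open K)"

lemma openin_geometric_realization: "openin (geometric_realization K) U \<longleftrightarrow> realization_open K U"
  by (simp add: geometric_realization_def istopology_realization_open topology_inverse')

text \<open>
  A space is \<open>n\<close>-connected if it is nonempty and every map from a sphere of dimension at most \<open>n\<close>
  is homotopic to a constant; the case \<open>k = 0\<close> is path-connectedness, as \<open>nsphere 0\<close> has two
  points.
\<close>

definition n_connected_space :: "nat \<Rightarrow> 'x topology \<Rightarrow> bool" where
  "n_connected_space n X \<longleftrightarrow> topspace X \<noteq> {} \<and>
     (\<forall>k\<le>n. \<forall>f. continuous_map (nsphere k) X f \<longrightarrow>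
        (\<exists>c\<in>topspace X. homotopic_with (\<lambda>_. True) (nsphere k) X f (\<lambda>_. c)))"

text \<open>
  Freeness refers to simplices as sets, not only to vertices: this is freeness of the action on
  the geometric realization, because an element preserving a simplex fixes its barycenter.
\<close>

definition free_simplicial_action ::
  "('g, 'm) monoid_scheme \<Rightarrow> 'v set set \<Rightarrow> ('g \<Rightarrow> 'v \<Rightarrow> 'v) \<Rightarrow> bool" where
  "free_simplicial_action \<Gamma> K a \<longleftrightarrow> abstract_complex K \<and> group_action \<Gamma> (\<Union>K) a \<and>
     (\<forall>g\<in>carrier \<Gamma>. \<forall>s\<in>K. a g ` s \<in> K) \<and>
     (\<forall>g\<in>carrier \<Gamma>. g \<noteq> \<one>\<^bsub>\<Gamma>\<^esub> \<longrightarrow> (\<forall>s\<in>K. a g ` s \<noteq> s))"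

definition cocompact_complex ::
  "('g, 'm) monoid_scheme \<Rightarrow> 'v set set \<Rightarrow> ('g \<Rightarrow> 'v \<Rightarrow> 'v) \<Rightarrow> bool" where
  "cocompact_complex \<Gamma> K a \<longleftrightarrow> finite (orbits \<Gamma> K (\<lambda>g. image (a g)))"

definition cocompact_exhaustion ::
  "('g, 'm) monoid_scheme \<Rightarrow> 'v set set \<Rightarrow> ('g \<Rightarrow> 'v \<Rightarrow> 'v) \<Rightarrow> (nat \<Rightarrow> 'v set set) \<Rightarrow> bool" where
  "cocompact_exhaustion \<Gamma> K a L \<longleftrightarrow>
     (\<forall>i. abstract_complex (L i) \<and> (\<forall>g\<in>carrier \<Gamma>. \<forall>s\<in>L i. a g ` s \<in> L i) \<and>
          cocompact_complex \<Gamma> (L i) a) \<and>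
     (\<forall>i. L i \<subseteq> L (Suc i)) \<and> (\<Union>i. L i) = K"


section \<open>Square-summable cochains and their reduced cohomology\<close>

text \<open>
  Ordered simplices with \<open>m\<close> distinct vertices, that is, of dimension \<open>m - 1\<close>. There are none
  with \<open>m = 0\<close>, so that the cochains of degree \<open>-1\<close> form the zero space.
\<close>

definition ordered_simplices :: "'v set set \<Rightarrow> nat \<Rightarrow> 'v list set" where
  "ordered_simplices K m = {xs. length xs = m \<and> distinct xs \<and> set xs \<in> K}"

text \<open>
  Cochains of degree \<open>m - 1\<close> are the alternating functions on ordered simplices with \<open>m\<close>
  vertices. The inner product of \<open>l2 (ordered_simplices K m)\<close> counts every unordered simplex
  \<open>m!\<close> times; this constant factor affects neither closures nor orthogonality nor dimensions.
\<close>

definition l2_cochains :: "'v set set \<Rightarrow> nat \<Rightarrow> ('v list \<Rightarrow> complex) set" where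
  "l2_cochains K m = {c \<in> l2 (ordered_simplices K m).
     \<forall>xs\<in>ordered_simplices K m. \<forall>\<pi>. \<pi> permutes {..<m} \<longrightarrow>
       c (permute_list \<pi> xs) = of_int (sign \<pi>) * c xs}"

definition coboundary :: "'v set set \<Rightarrow> nat \<Rightarrow> ('v list \<Rightarrow> complex) \<Rightarrow> 'v list \<Rightarrow> complex" where
  "coboundary K m c = (\<lambda>xs. if xs \<in> ordered_simplices K (Suc m)
     then (\<Sum>i\<le>m. (- 1) ^ i * c (take i xs @ drop (Suc i) xs)) else 0)"

definition l2_cocycles :: "'v set set \<Rightarrow> nat \<Rightarrow> ('v list \<Rightarrow> complex) set" where
  "l2_cocycles K p = {c \<in> l2_cochains K (Suc p). coboundary K (Suc p) c = (\<lambda>_. 0)}"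

definition l2_coboundaries_closure :: "'v set set \<Rightarrow> nat \<Rightarrow> ('v list \<Rightarrow> complex) set" where
  "l2_coboundaries_closure K p =
     l2_closure (ordered_simplices K (Suc p)) (coboundary K p ` l2_cochains K p)"

definition reduced_l2_cohomology :: "'v set set \<Rightarrow> nat \<Rightarrow> ('v list \<Rightarrow> complex) set" where
  "reduced_l2_cohomology K p =
     hilbert_quotient (ordered_simplices K (Suc p)) (l2_cocycles K p) (l2_coboundaries_closure K p)"

text \<open>
  The map on reduced cohomology induced by restricting cochains to the subcomplex \<open>L\<close>, sending
  the class of a cocycle to the class of its restriction.
\<close>

definition restrict_cochain ::
  "'v set set \<Rightarrow> nat \<Rightarrow> ('v list \<Rightarrow> complex) \<Rightarrow> 'v list \<Rightarrow> complex" where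
  "restrict_cochain L p c = (\<lambda>xs. if xs \<in> ordered_simplices L (Suc p) then c xs else 0)"

definition restriction_map ::
  "'v set set \<Rightarrow> nat \<Rightarrow> ('v list \<Rightarrow> complex) \<Rightarrow> 'v list \<Rightarrow> complex" where
  "restriction_map L p c =
     quotient_class (ordered_simplices L (Suc p)) (l2_coboundaries_closure L p)
       (restrict_cochain L p c)"

definition restriction_image_dim ::
  "('g, 'm) monoid_scheme \<Rightarrow> ('g \<Rightarrow> 'v \<Rightarrow> 'v) \<Rightarrow> nat \<Rightarrow> 'v set set \<Rightarrow> 'v set set \<Rightarrow> real" where
  "restriction_image_dim \<Gamma> a p K L =
     vn_dim \<Gamma> (ordered_simplices L (Suc p)) (\<lambda>g. map (a g))
       (l2_closure (ordered_simplices L (Suc p)) (restriction_map L p ` reduced_l2_cohomology K p))"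


section \<open>L2-Betti numbers\<close>

text \<open>
  For a cocompact complex \<open>K\<close> the constant sequence \<open>K\<close> is an exhaustion, for which
  \<open>l2_betti_exhaustion\<close> is the dimension of the reduced cohomology of \<open>K\<close>, so cocompact
  complexes need no separate clause.
\<close>

definition l2_betti_exhaustion ::
  "('g, 'm) monoid_scheme \<Rightarrow> ('g \<Rightarrow> 'v \<Rightarrow> 'v) \<Rightarrow> (nat \<Rightarrow> 'v set set) \<Rightarrow> nat \<Rightarrow> ereal" where
  "l2_betti_exhaustion \<Gamma> a L p =
     lim (\<lambda>i. lim (\<lambda>j. ereal (restriction_image_dim \<Gamma> a p (L j) (L i))))"

text \<open>
  The value does not depend on the complex, the action or the exhaustion, hence the choice
  operator. A complex with a free action of \<open>\<Gamma>\<close> and a cocompact exhaustion has countably many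
  orbits of vertices, all of them free, so up to equivariant isomorphism its vertices lie in
  \<open>\<Gamma> \<times> \<nat>\<close>; the type of vertices is therefore no restriction.
\<close>

definition l2_betti_number :: "('g, 'm) monoid_scheme \<Rightarrow> nat \<Rightarrow> ereal" where
  "l2_betti_number \<Gamma> p =
     (SOME b. \<exists>(K :: ('g \<times> nat) set set) a L n.
        free_simplicial_action \<Gamma> K a \<and> p \<le> n \<and> n_connected_space n (geometric_realization K) \<and>
        cocompact_exhaustion \<Gamma> K a L \<and> b = l2_betti_exhaustion \<Gamma> a L p)"

end

theory Submission
  imports Defs "HOL-Homology.Homology" "HOL-Number_Theory.Number_Theory" "HOL-Real_Asymp.Real_Asymp"
begin

text \<open>
  The addition formula fails because a full shift can map onto a larger one. Over a finite cyclic
  group of prime order \<open>q\<close>, the shift action of \<open>G\<close> with \<open>k\<close> coordinates has sofic entropy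
  \<open>k * ln q\<close> for every sofic approximation (\<open>sofic_entropy_shift\<close>). If there is a surjective
  equivariant homomorphism from the shift with \<open>m\<close> coordinates onto the one with \<open>m + 1\<close>, the
  formula would make \<open>m * ln q\<close> equal to the entropy of the kernel plus \<open>(m + 1) * ln q\<close>. The
  kernel contains a fixed point, so its entropy is nonnegative (\<open>sofic_entropy_nonneg\<close>), and the
  formula cannot hold.

  Such a homomorphism exists as soon as some subgroup \<open>\<Gamma>\<close> violates the Folner condition. It is a
  convolution of finite support. The exponential expansion of finite sets in \<open>\<Gamma>\<close> leaves in every
  finite subset of \<open>G\<close> an element \<open>g\<close> that sees more than \<open>m\<close> coordinates which no other element of
  the subset sees (\<open>not_folner_private_coordinates\<close>). Vandermonde weights let these coordinates
  adjust the \<open>m + 1\<close> values at \<open>g\<close> arbitrarily, so the convolution can be solved on finite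
  sets one element at a time (\<open>convolution_finitely_surjective\<close>), and compactness yields global
  solutions (\<open>convolution_map_surjective\<close>).

  It remains to see that an infinite group satisfying the Folner condition has vanishing l2-Betti
  numbers (\<open>folner_l2_betti_number_eq_0\<close>). Consider the image of the reduced cohomology of \<open>L j\<close> in
  that of \<open>L i\<close>, and a finite subcomplex \<open>Y\<close> of \<open>L i\<close> made of translates by a Folner set. In positive
  degree, if an element of the image vanishes on the simplices adjacent to \<open>Y\<close>, then its conjugate
  is a cycle of \<open>Y\<close>. For large \<open>j\<close> it also annihilates all cycles of \<open>Y\<close>, because \<open>K\<close> is highly connected and
  cocycles of \<open>L j\<close> are coboundaries on \<open>Y\<close>
  (\<open>cocycle_is_coboundary_on_finite_subcomplex\<close>); hence it is zero on \<open>Y\<close>. The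
  trace of the projection onto the image over \<open>Y\<close> is therefore at most the number of
  adjacent simplices (\<open>l2_proj_trace_le_card\<close>), which is small compared with the Folner
  set. In degree zero an element of the image is determined on \<open>Y\<close> by its value at one point, and one
  is small because \<open>\<Gamma>\<close> is infinite. The definition of the l2-Betti number chooses among the values given by all highly connected
  complexes with a free action; the infinite join of \<open>\<Gamma>\<close> shows that there are such values.
\<close>

section \<open>Linear surjections onto larger shifts over groups that are not Folner\<close>

text \<open>
  The Folner condition for amenability, with translation on the right.
\<close>

definition folner :: "('g, 'm) monoid_scheme \<Rightarrow> bool" where
  "folner G \<longleftrightarrow> (\<forall>T \<epsilon>. finite T \<longrightarrow> T \<subseteq> carrier G \<longrightarrow> 0 < \<epsilon> \<longrightarrow>
     (\<exists>F. finite F \<and> F \<noteq> {} \<and> F \<subseteq> carrier G \<and> real (card ((F <#>\<^bsub>G\<^esub> T) - F)) \<le> \<epsilon> * real (card F)))"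

lemma finite_set_mult: "finite A \<Longrightarrow> finite B \<Longrightarrow> finite (A <#>\<^bsub>G\<^esub> B)"
  by (auto simp: set_mult_def)

lemma set_mult_image: "A <#>\<^bsub>G\<^esub> B = (\<lambda>(a, b). a \<otimes>\<^bsub>G\<^esub> b) ` (A \<times> B)"
  by (auto simp: set_mult_def)

context group begin

text \<open>
  Iterating a set that expands every finite set by a factor \<open>1 + \<epsilon>\<close> gives an exponential
  expansion rate, while the logarithm of the cardinality of the expanding set grows only linearly.
\<close>

lemma not_folner_expanding_set:
  assumes "\<not> folner G"
  obtains S b k where "finite S" "S \<subseteq> carrier G" "card S \<le> 2 ^ (k * b)"
    "\<And>F. \<lbrakk>finite F; F \<noteq> {}; F \<subseteq> carrier G\<rbrakk> \<Longrightarrow> 8 * (real (k * b) + 1) * card F < card (F <#> S)"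
proof -
  from assms obtain T and \<epsilon> :: real where T: "finite T" "T \<subseteq> carrier G" and \<epsilon>: "0 < \<epsilon>"
    and "\<not> (\<exists>F. finite F \<and> F \<noteq> {} \<and> F \<subseteq> carrier G \<and> real (card ((F <#> T) - F)) \<le> \<epsilon> * card F)"
    unfolding folner_def by blast
  then have ex: "\<epsilon> * card F < card ((F <#> T) - F)" if "finite F" "F \<noteq> {}" "F \<subseteq> carrier G" for F
    using that not_le by blast
  define S0 where "S0 = insert \<one> T"
  have S0: "finite S0" "S0 \<subseteq> carrier G" using T by (auto simp: S0_def)
  have step: "(1 + \<epsilon>) * card F \<le> card (F <#> S0)" if F: "finite F" "F \<subseteq> carrier G" for F
  proof (cases "F = {}")
    case False
    have "F \<union> ((F <#> T) - F) \<subseteq> F <#> S0"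
      using F by (force simp: set_mult_def S0_def)
    then have "card (F \<union> ((F <#> T) - F)) \<le> card (F <#> S0)"
      by (intro card_mono finite_set_mult F S0)
    also have "card (F \<union> ((F <#> T) - F)) = card F + card ((F <#> T) - F)"
      using F T by (intro card_Un_disjoint) (auto simp: finite_set_mult)
    finally show ?thesis using ex[OF F(1) False F(2)] by (simp add: algebra_simps)
  qed simp
  define S where "S = (\<lambda>k. ((\<lambda>A. A <#> S0) ^^ k) {\<one>})"
  have S: "finite (S k)" "S k \<subseteq> carrier G" for k
    using S0 by (induction k) (auto simp: S_def finite_set_mult set_mult_closed)
  have card_S: "card (S k) \<le> card S0 ^ k" for k
  proof (induction k)
    case (Suc k)
    have "S (Suc k) = (\<lambda>(a, b). a \<otimes> b) ` (S k \<times> S0)"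
      using set_mult_image[of G "S k" S0] by (simp add: S_def)
    then have "card (S (Suc k)) \<le> card (S k \<times> S0)"
      using card_image_le[of "S k \<times> S0"] S S0 by simp
    also have "\<dots> \<le> card S0 ^ Suc k" using Suc by (simp add: card_cartesian_product)
    finally show ?case .
  qed (simp add: S_def)
  have growth: "(1 + \<epsilon>) ^ k * card F \<le> card (F <#> S k)" if F: "finite F" "F \<subseteq> carrier G" for F k
  proof (induction k)
    case 0
    have "F <#> S 0 = F" using F by (force simp: S_def set_mult_def)
    then show ?case by simp
  next
    case (Suc k)
    have "(1 + \<epsilon>) ^ Suc k * card F \<le> (1 + \<epsilon>) * card (F <#> S k)"
      using Suc \<epsilon> by (simp add: mult.assoc)
    also have "\<dots> \<le> card ((F <#> S k) <#> S0)"
      using F S by (intro step) (auto simp: finite_set_mult set_mult_closed)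
    also have "(F <#> S k) <#> S0 = F <#> S (Suc k)"
      using set_mult_assoc[OF F(2) S(2) S0(2)] by (simp add: S_def)
    finally show ?case .
  qed
  define b where "b = card S0"
  have "filterlim (\<lambda>k::nat. (1 + \<epsilon>) ^ k / (8 * (real k * b + 1))) at_top sequentially"
  proof -
    have "real b > 0" using S0(1) by (auto simp: b_def S0_def card_gt_0_iff)
    then show ?thesis using \<epsilon> by real_asymp
  qed
  then have "eventually (\<lambda>k. 1 < (1 + \<epsilon>) ^ k / (8 * (real k * b + 1))) sequentially"
    by (auto simp: filterlim_at_top_dense)
  then obtain k where k: "1 < (1 + \<epsilon>) ^ k / (8 * (real k * b + 1))"
    using eventually_sequentially by auto
  have k: "8 * (real k * b + 1) < (1 + \<epsilon>) ^ k"
    using k by (simp add: less_divide_eq add_nonneg_pos split: if_splits)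
  show thesis
  proof (rule that[of "S k" k b])
    have "card S0 \<le> 2 ^ b" using less_exp[of b] by (simp add: b_def)
    then have "card (S k) \<le> (2 ^ b) ^ k"
      using card_S[of k] power_mono[of "card S0" "2 ^ b" k] by simp
    then show "card (S k) \<le> 2 ^ (k * b)" by (simp add: power_mult[symmetric] mult.commute)
    fix F assume F: "finite F" "F \<noteq> {}" "F \<subseteq> carrier G"
    have "8 * (real (k * b) + 1) * card F < (1 + \<epsilon>) ^ k * card F"
      using k F by (intro mult_strict_right_mono) (auto simp: card_gt_0_iff)
    also have "\<dots> \<le> card (F <#> S k)" using growth F by blast
    finally show "8 * (real (k * b) + 1) * card F < card (F <#> S k)" .
  qed (use S in auto)
qed

end

text \<open>
  With the exponent \<open>2 ^ k\<close> the power equals \<open>1 / 4\<close> at \<open>k = 1\<close>, and it increases with \<open>k\<close> because \<open>1 - 1 / 2 ^ k \<le> (1 - 1 / 2 ^ Suc k)\<^sup>2\<close>.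
\<close>

lemma power_one_minus_inverse_ge:
  fixes k t :: nat assumes "t \<le> 2 ^ k" "1 \<le> t"
  shows "1 / 4 \<le> (1 - 1 / 2 ^ k :: real) ^ (t - 1)"
proof (cases "k = 0")
  case True
  then show ?thesis using assms by simp
next
  case False
  have 2: "(1 / 4 :: real) \<le> (1 - 1 / 2 ^ k) ^ 2 ^ k"
    using False
  proof (induction k)
    case (Suc k)
    show ?case
    proof (cases "k = 0")
      case True then show ?thesis by (simp add: power2_eq_square)
    next
      case False
      have "(1 / 4 :: real) \<le> (1 - 1 / 2 ^ k) ^ 2 ^ k" using Suc False by simp
      also have "\<dots> \<le> ((1 - 1 / 2 ^ Suc k)\<^sup>2) ^ 2 ^ k"
        by (intro power_mono) (auto simp: power2_eq_square field_simps)
      also have "\<dots> = (1 - 1 / 2 ^ Suc k) ^ 2 ^ Suc k"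
        by (simp add: power_mult[symmetric])
      finally show ?thesis .
    qed
  qed simp
  also have "\<dots> \<le> (1 - 1 / 2 ^ k :: real) ^ (t - 1)"
    using assms by (intro power_decreasing) auto
  finally show ?thesis .
qed

text \<open>
  On the layer of scale \<open>k\<close> the members of the family are independent of density \<open>2 ^ -k\<close>, which is the
  right density for subfamilies with about \<open>2 ^ k\<close> members: each member then keeps a fair share of points
  that no other member of the subfamily contains. Having \<open>M + 1\<close> layers only costs this factor.
\<close>

lemma fair_share_family:
  fixes S :: "'a set"
  assumes S: "finite S" and M: "card S \<le> 2 ^ M"
  obtains Y :: "(nat \<times> ('a \<Rightarrow> nat)) set" and X where "finite Y" "Y \<noteq> {}"
    "\<And>I s. \<lbrakk>I \<subseteq> S; s \<in> I\<rbrakk> \<Longrightarrow>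
       real (card Y) / (8 * (real M + 1) * card I) \<le> card {y \<in> Y. y \<in> X s \<and> (\<forall>t\<in>I - {s}. y \<notin> X t)}"
proof -
  define Q :: nat where "Q = 2 ^ M"
  define Y where "Y = {..M} \<times> (S \<rightarrow>\<^sub>E {..<Q})"
  define X where "X = (\<lambda>s. {z :: nat \<times> ('a \<Rightarrow> nat). snd z s < 2 ^ (M - fst z)})"
  have fin: "finite Y" using S by (auto simp: Y_def intro: finite_PiE)
  have card_Y: "card Y = (M + 1) * Q ^ card S"
    using S by (simp add: Y_def card_cartesian_product card_PiE)
  have main: "real (card Y) / (8 * (real M + 1) * card I) \<le> card {y \<in> Y. y \<in> X s \<and> (\<forall>t\<in>I - {s}. y \<notin> X t)}"
    if I: "I \<subseteq> S" "s \<in> I" for I s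
  proof -
    define t where "t = card I"
    have finI: "finite I" using I S finite_subset by blast
    have t1: "1 \<le> t" using I finI by (auto simp: t_def Suc_le_eq card_gt_0_iff)
    have tM: "t \<le> 2 ^ M" using I S M card_mono[of S I] by (simp add: t_def)
    \<comment> \<open>the layer whose density is \<open>1 / t\<close> up to a factor of two\<close>
    define k where "k = (LEAST k. t \<le> 2 ^ k)"
    have tk: "t \<le> 2 ^ k" unfolding k_def using tM by (rule LeastI)
    have kM: "k \<le> M" unfolding k_def using tM by (rule Least_le)
    have kt: "2 ^ k \<le> 2 * t"
    proof (cases k)
      case 0 then show ?thesis using t1 by simp
    next
      case (Suc j)
      then have "\<not> t \<le> 2 ^ j" using not_less_Least[of j "\<lambda>k. t \<le> 2 ^ k"] by (simp add: k_def)
      then show ?thesis using Suc by simp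
    qed
    \<comment> \<open>\<open>PiE S A\<close> consists of the points of that layer which belong to \<open>X s\<close> and to no other member
      of \<open>I\<close>\<close>
    define A where "A = (\<lambda>j. if j = s then {..<2 ^ (M - k)} else if j \<in> I then {2 ^ (M - k)..<Q} else {..<Q})"
    define p :: real where "p = 1 / 2 ^ k"
    have pw: "real (2 ^ (M - k)) = p * Q"
    proof -
      have "(2::real) ^ M = 2 ^ (M - k) * 2 ^ k" using kM by (simp add: power_add[symmetric])
      then show ?thesis by (simp add: p_def Q_def)
    qed
    have le: "(2::nat) ^ (M - k) \<le> Q" by (simp add: Q_def)
    have cA: "real (card (A j)) = Q * (if j = s then p else if j \<in> I then 1 - p else 1)" for j
    proof -
      have "real (Q - 2 ^ (M - k)) = real Q - real (2 ^ (M - k))"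
        using le by (rule of_nat_diff)
      then show ?thesis unfolding A_def using pw by (auto simp: algebra_simps)
    qed
    have "real (card (PiE S A)) = (\<Prod>j\<in>S. real (card (A j)))"
      using S by (simp add: card_PiE)
    also have "\<dots> = real Q ^ card S * (\<Prod>j\<in>S. if j = s then p else if j \<in> I then 1 - p else 1)"
      unfolding cA prod.distrib by simp
    also have "(\<Prod>j\<in>S. if j = s then p else if j \<in> I then 1 - p else 1)
        = (\<Prod>j\<in>I. if j = s then p else 1 - p)"
      using I S by (intro prod.mono_neutral_cong_right) auto
    also have "\<dots> = p * (\<Prod>j\<in>I - {s}. if j = s then p else 1 - p)"
      using I finI by (subst prod.remove[of _ s]) auto
    also have "(\<Prod>j\<in>I - {s}. if j = s then p else 1 - p) = (\<Prod>j\<in>I - {s}. 1 - p)"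
      by (rule prod.cong) auto
    also have "\<dots> = (1 - p) ^ (t - 1)"
      using I finI by (simp add: t_def)
    finally have cardPiE: "real (card (PiE S A)) = real Q ^ card S * (p * (1 - p) ^ (t - 1))" .
    have "(\<lambda>y. (k, y)) ` PiE S A \<subseteq> {y \<in> Y. y \<in> X s \<and> (\<forall>t\<in>I - {s}. y \<notin> X t)}"
    proof (clarsimp, intro conjI ballI)
      fix y assume y: "y \<in> PiE S A"
      have yj: "y j \<in> A j" if "j \<in> S" for j using y that by auto
      have "A j \<subseteq> {..<Q}" for j using le by (auto simp: A_def)
      then show "(k, y) \<in> Y" using y kM by (auto simp: Y_def PiE_iff)
      show "(k, y) \<in> X s" using yj[of s] I by (auto simp: X_def A_def)
      fix j assume "j \<in> I - {s}"
      then show "(k, y) \<notin> X j" using yj[of j] I by (auto simp: X_def A_def)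
    qed
    then have "card ((\<lambda>y. (k, y)) ` PiE S A) \<le> card {y \<in> Y. y \<in> X s \<and> (\<forall>t\<in>I - {s}. y \<notin> X t)}"
      by (rule card_mono[rotated]) (use fin in auto)
    then have ge: "real (card (PiE S A)) \<le> card {y \<in> Y. y \<in> X s \<and> (\<forall>t\<in>I - {s}. y \<notin> X t)}"
      by (simp add: card_image inj_on_def)
    have "real (card Y) / (8 * (real M + 1) * card I) = real Q ^ card S * (1 / (2 * t) * (1 / 4))"
    proof -
      have "real (card Y) = (real M + 1) * real Q ^ card S" by (simp add: card_Y algebra_simps)
      moreover have "(c * x) / (8 * c * t) = x * (1 / (2 * t) * (1 / 4))" if "c \<noteq> 0" for c x :: real
        using that t1 by (simp add: field_simps)
      ultimately show ?thesis unfolding t_def[symmetric]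
        using of_nat_0_le_iff[of M] by (metis add_nonneg_pos less_irrefl zero_less_one)
    qed
    also have "\<dots> \<le> real Q ^ card S * (p * (1 - p) ^ (t - 1))"
    proof (intro mult_left_mono mult_mono)
      have "real (2 ^ k) \<le> real (2 * t)" using kt by (simp only: of_nat_le_iff)
      then show "1 / real (2 * t) \<le> p" unfolding p_def using t1 by (simp add: field_simps)
      show "1 / 4 \<le> (1 - p) ^ (t - 1)"
        unfolding p_def using power_one_minus_inverse_ge[OF tk t1] .
    qed (auto simp: p_def)
    finally show ?thesis using cardPiE ge by linarith
  qed
  have ne: "Y \<noteq> {}" using card_Y by (auto simp: Q_def)
  show thesis by (rule that[OF fin ne main])
qed

text \<open>
  Subtracting \<open>t N\<close> times equation \<open>k\<close> from equation \<open>k + 1\<close> eliminates the last unknown and leaves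
  the same system of size \<open>N\<close> in the unknowns \<open>v j * (t j - t N)\<close>, whose second factor is invertible
  modulo the prime.
\<close>

lemma vandermonde_transpose_solvable:
  fixes q :: int and t :: "nat \<Rightarrow> int"
  assumes q: "prime q" and inj: "\<And>i j. \<lbrakk>i < N; j < N; [t i = t j] (mod q)\<rbrakk> \<Longrightarrow> i = j"
  shows "\<exists>v. \<forall>k<N. [(\<Sum>j<N. v j * t j ^ k) = b k] (mod q)"
  using inj
proof (induction N arbitrary: b)
  case (Suc N)
  obtain v' where v': "\<forall>k<N. [(\<Sum>j<N. v' j * t j ^ k) = b (Suc k) - t N * b k] (mod q)"
    using Suc.IH[of "\<lambda>k. b (Suc k) - t N * b k"] Suc.prems by (metis less_SucI)
  have "\<exists>w. [(t j - t N) * w = 1] (mod q)" if "j < N" for j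
  proof -
    have "\<not> q dvd t j - t N"
      using Suc.prems[of j N] that by (auto simp: cong_iff_dvd_diff)
    then have "coprime (t j - t N) q"
      using q by (metis coprime_commute prime_imp_coprime)
    then show ?thesis by (rule cong_solve_coprime_int)
  qed
  then obtain w where w: "\<And>j. j < N \<Longrightarrow> [(t j - t N) * w j = 1] (mod q)" by metis
  define v where "v = (\<lambda>j. if j < N then v' j * w j else b 0 - (\<Sum>j<N. v' j * w j))"
  have v0: "(\<Sum>j<Suc N. v j) = b 0" by (simp add: v_def)
  have "[(\<Sum>j<Suc N. v j * t j ^ k) = b k] (mod q)" if "k < Suc N" for k
    using that
  proof (induction k)
    case 0 then show ?case using v0 by simp
  next
    case (Suc k)
    have "(\<Sum>j<Suc N. v j * t j ^ Suc k) - t N * (\<Sum>j<Suc N. v j * t j ^ k)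
        = (\<Sum>j<Suc N. v j * (t j - t N) * t j ^ k)"
      by (simp add: sum_distrib_left sum_subtractf[symmetric] algebra_simps del: sum.lessThan_Suc)
    also have "\<dots> = (\<Sum>j<N. v j * (t j - t N) * t j ^ k)" by simp
    also have "[\<dots> = (\<Sum>j<N. v' j * t j ^ k)] (mod q)"
    proof (rule cong_sum)
      fix j assume j: "j \<in> {..<N}"
      have "[v' j * t j ^ k * ((t j - t N) * w j) = v' j * t j ^ k * 1] (mod q)"
        using w j by (intro cong_scalar_left) auto
      then show "[v j * (t j - t N) * t j ^ k = v' j * t j ^ k] (mod q)"
        using j by (simp add: v_def algebra_simps)
    qed
    also have "[(\<Sum>j<N. v' j * t j ^ k) = b (Suc k) - t N * b k] (mod q)"
      using v' Suc.prems by simp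
    finally have 1: "[(\<Sum>j<Suc N. v j * t j ^ Suc k) - t N * (\<Sum>j<Suc N. v j * t j ^ k)
        = b (Suc k) - t N * b k] (mod q)" .
    have "[t N * (\<Sum>j<Suc N. v j * t j ^ k) = t N * b k] (mod q)"
      using Suc by (intro cong_scalar_left) auto
    from cong_add[OF 1 this] show ?case by simp
  qed
  then show ?case by blast
qed simp


context group begin

text \<open>
  Double counting: a point \<open>h\<close> is a product \<open>g \<otimes> s\<close> with \<open>g \<in> F\<close> and \<open>s \<in> S\<close> in as many ways as there
  are \<open>t \<in> S\<close> with \<open>h \<otimes> inv t \<in> F\<close>. Giving each pair \<open>(g, s)\<close> the inverse of this number as its weight
  spreads total weight \<open>card (F <#> S)\<close> over \<open>F\<close>.
\<close>

lemma exists_exposed_element: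
  fixes c :: real
  assumes S: "finite S" "S \<subseteq> carrier G" and F: "finite F" "F \<noteq> {}" "F \<subseteq> carrier G"
    and c: "c * card F < card (F <#> S)"
  shows "\<exists>g\<in>F. c < (\<Sum>s\<in>S. 1 / real (card {t \<in> S. g \<otimes> s \<otimes> inv t \<in> F}))"
proof (rule ccontr)
  define w where "w = (\<lambda>h. 1 / real (card {t \<in> S. h \<otimes> inv t \<in> F}))"
  assume "\<not> ?thesis"
  then have "(\<Sum>s\<in>S. w (g \<otimes> s)) \<le> c" if "g \<in> F" for g
    using that by (auto simp: w_def not_less)
  then have "(\<Sum>g\<in>F. \<Sum>s\<in>S. w (g \<otimes> s)) \<le> of_nat (card F) * c"
    by (rule sum_bounded_above)
  moreover have "(\<Sum>g\<in>F. \<Sum>s\<in>S. w (g \<otimes> s)) = card (F <#> S)"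
  proof -
    let ?m = "\<lambda>(g, s). g \<otimes> s"
    have "(\<Sum>g\<in>F. \<Sum>s\<in>S. w (g \<otimes> s)) = (\<Sum>x\<in>F \<times> S. w (?m x))"
      by (simp add: sum.cartesian_product case_prod_unfold)
    also have "\<dots> = (\<Sum>h\<in>?m ` (F \<times> S). \<Sum>x\<in>{x \<in> F \<times> S. ?m x = h}. w (?m x))"
      using S F by (intro sum.image_gen) auto
    also have "\<dots> = (\<Sum>h\<in>?m ` (F \<times> S). 1)"
    proof (rule sum.cong[OF refl])
      fix h assume h: "h \<in> ?m ` (F \<times> S)"
      then have hG: "h \<in> carrier G" using S F by auto
      have "bij_betw snd {x \<in> F \<times> S. ?m x = h} {t \<in> S. h \<otimes> inv t \<in> F}"
      proof (rule bij_betw_byWitness[where f'="\<lambda>t. (h \<otimes> inv t, t)"])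
        show "\<forall>x\<in>{x \<in> F \<times> S. ?m x = h}. (h \<otimes> inv (snd x), snd x) = x"
          using S F by (auto simp: inv_solve_right subset_iff m_assoc)
        show "\<forall>t\<in>{t \<in> S. h \<otimes> inv t \<in> F}. snd (h \<otimes> inv t, t) = t" by simp
        show "snd ` {x \<in> F \<times> S. ?m x = h} \<subseteq> {t \<in> S. h \<otimes> inv t \<in> F}"
          using S F by (auto simp: subset_iff m_assoc)
        show "(\<lambda>t. (h \<otimes> inv t, t)) ` {t \<in> S. h \<otimes> inv t \<in> F} \<subseteq> {x \<in> F \<times> S. ?m x = h}"
          using S F hG by (auto simp: subset_iff m_assoc)
      qed
      then have "card {x \<in> F \<times> S. ?m x = h} = card {t \<in> S. h \<otimes> inv t \<in> F}"
        by (rule bij_betw_same_card)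
      moreover have "finite {x \<in> F \<times> S. ?m x = h}" "{x \<in> F \<times> S. ?m x = h} \<noteq> {}"
        using S F h by auto
      then have "card {x \<in> F \<times> S. ?m x = h} \<noteq> 0" by (simp only: card_eq_0_iff) blast
      ultimately have "(\<Sum>x\<in>{x \<in> F \<times> S. ?m x = h}. w h) = 1"
        unfolding sum_constant w_def by simp
      then show "(\<Sum>x\<in>{x \<in> F \<times> S. ?m x = h}. w (?m x)) = 1" by simp
    qed
    also have "\<dots> = card (F <#> S)" by (simp add: set_mult_image)
    finally show ?thesis .
  qed
  ultimately show False using c by (simp add: mult.commute)
qed

text \<open>
  The part of \<open>F\<close> in one left coset \<open>g0 \<Gamma>\<close> is a translate of a finite subset of \<open>\<Gamma>\<close>, and the elements
  \<open>g \<otimes> s \<otimes> inv t\<close> stay in the coset of \<open>g\<close>.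
\<close>

lemma exists_exposed_element_of_subgroup:
  fixes c :: real
  assumes \<Gamma>: "subgroup \<Gamma> G" and S: "finite S" "S \<subseteq> \<Gamma>"
    and ex: "\<And>F. \<lbrakk>finite F; F \<noteq> {}; F \<subseteq> \<Gamma>\<rbrakk> \<Longrightarrow> c * card F < card (F <#> S)"
    and F: "finite F" "F \<noteq> {}" "F \<subseteq> carrier G"
  shows "\<exists>g\<in>F. c < (\<Sum>s\<in>S. 1 / real (card {t \<in> S. g \<otimes> s \<otimes> inv t \<in> F}))"
proof -
  obtain g0 where g0: "g0 \<in> F" "g0 \<in> carrier G" using F by auto
  have \<Gamma>G: "\<Gamma> \<subseteq> carrier G" using \<Gamma> by (rule subgroup.subset)
  define F' where "F' = {\<gamma> \<in> \<Gamma>. g0 \<otimes> \<gamma> \<in> F}"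
  have "inj_on (\<lambda>\<gamma>. g0 \<otimes> \<gamma>) F'" using g0 \<Gamma>G by (auto simp: F'_def inj_on_def subset_iff)
  moreover have "(\<lambda>\<gamma>. g0 \<otimes> \<gamma>) ` F' \<subseteq> F" by (auto simp: F'_def)
  ultimately have finF': "finite F'" using F finite_subset finite_imageD by metis
  have "\<one> \<in> F'" using g0 \<Gamma> by (auto simp: F'_def subgroup.one_closed)
  then have F': "F' \<noteq> {}" "F' \<subseteq> \<Gamma>" by (auto simp: F'_def)
  interpret \<Gamma>: group "G\<lparr>carrier := \<Gamma>\<rparr>" using \<Gamma> by (rule subgroup_imp_group)
  have "\<exists>g\<in>F'. c < (\<Sum>s\<in>S. 1 / real (card {t \<in> S. g \<otimes> s \<otimes> inv\<^bsub>G\<lparr>carrier := \<Gamma>\<rparr>\<^esub> t \<in> F'}))"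
    using \<Gamma>.exists_exposed_element[of S F' c] S finF' F' ex[OF finF' F'] by (simp add: set_mult_def)
  then obtain \<gamma> where \<gamma>: "\<gamma> \<in> F'"
    "c < (\<Sum>s\<in>S. 1 / real (card {t \<in> S. \<gamma> \<otimes> s \<otimes> inv\<^bsub>G\<lparr>carrier := \<Gamma>\<rparr>\<^esub> t \<in> F'}))" by blast
  have "{t \<in> S. \<gamma> \<otimes> s \<otimes> inv\<^bsub>G\<lparr>carrier := \<Gamma>\<rparr>\<^esub> t \<in> F'} = {t \<in> S. g0 \<otimes> \<gamma> \<otimes> s \<otimes> inv t \<in> F}"
    if s: "s \<in> S" for s
  proof (rule Collect_cong, rule conj_cong[OF refl])
    fix t assume t: "t \<in> S"
    have mem: "\<gamma> \<in> \<Gamma>" "s \<in> \<Gamma>" "t \<in> \<Gamma>" using \<gamma> s t S by (auto simp: F'_def)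
    have "\<gamma> \<otimes> s \<otimes> inv t \<in> \<Gamma>"
      using mem \<Gamma> by (intro subgroup.m_closed subgroup.m_inv_closed)
    moreover have "g0 \<otimes> (\<gamma> \<otimes> s \<otimes> inv t) = g0 \<otimes> \<gamma> \<otimes> s \<otimes> inv t"
      using g0 mem \<Gamma>G by (simp add: m_assoc subset_iff)
    ultimately show "(\<gamma> \<otimes> s \<otimes> inv\<^bsub>G\<lparr>carrier := \<Gamma>\<rparr>\<^esub> t \<in> F') = (g0 \<otimes> \<gamma> \<otimes> s \<otimes> inv t \<in> F)"
      using m_inv_consistent[OF \<Gamma> mem(3)] by (simp add: F'_def)
  qed
  then have "c < (\<Sum>s\<in>S. 1 / real (card {t \<in> S. g0 \<otimes> \<gamma> \<otimes> s \<otimes> inv t \<in> F}))"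
    using \<gamma>(2) by simp
  then show ?thesis using \<gamma> by (auto simp: F'_def)
qed

text \<open>
  The pairs counted here are the coordinates \<open>y\<close> at \<open>g \<otimes> s\<close> which, among the elements of \<open>F\<close>, only \<open>g\<close>
  can see. At an exposed element the fair shares of \<open>X s\<close> add up to more than the whole set of
  coordinates.
\<close>

lemma not_folner_private_coordinates:
  assumes \<Gamma>: "subgroup \<Gamma> G" and nf: "\<not> folner (G\<lparr>carrier := \<Gamma>\<rparr>)"
  obtains S m X where "finite S" "S \<subseteq> carrier G"
    "\<And>F. \<lbrakk>finite F; F \<noteq> {}; F \<subseteq> carrier G\<rbrakk> \<Longrightarrow> \<exists>g\<in>F. (m :: nat) <
       card {(s, y). s \<in> S \<and> y < m \<and> y \<in> X s \<and> (\<forall>t\<in>S. t \<noteq> s \<longrightarrow> g \<otimes> s \<otimes> inv t \<in> F \<longrightarrow> y \<notin> X t)}"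
proof -
  interpret \<Gamma>: group "G\<lparr>carrier := \<Gamma>\<rparr>" using \<Gamma> by (rule subgroup_imp_group)
  obtain S b k where S: "finite S" "S \<subseteq> \<Gamma>" and cS: "card S \<le> 2 ^ (k * b)"
    and ex: "\<And>F. \<lbrakk>finite F; F \<noteq> {}; F \<subseteq> \<Gamma>\<rbrakk> \<Longrightarrow> 8 * (real (k * b) + 1) * card F < card (F <#> S)"
  proof (rule \<Gamma>.not_folner_expanding_set[OF nf])
    have eq: "A <#>\<^bsub>G\<lparr>carrier := \<Gamma>\<rparr>\<^esub> B = A <#> B" for A B by (simp add: set_mult_def)
    fix S b k
    assume a: "finite S" "S \<subseteq> carrier (G\<lparr>carrier := \<Gamma>\<rparr>)" "card S \<le> 2 ^ (k * b)"
      "\<And>F. \<lbrakk>finite F; F \<noteq> {}; F \<subseteq> carrier (G\<lparr>carrier := \<Gamma>\<rparr>)\<rbrakk> \<Longrightarrow>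
        8 * (real (k * b) + 1) * real (card F) < real (card (F <#>\<^bsub>G\<lparr>carrier := \<Gamma>\<rparr>\<^esub> S))"
    show thesis
    proof (rule that[of S k b])
      show "S \<subseteq> \<Gamma>" using a(2) by simp
      fix F assume "finite F" "F \<noteq> {}" "F \<subseteq> \<Gamma>"
      then show "8 * (real (k * b) + 1) * real (card F) < real (card (F <#> S))"
        using a(4)[of F] unfolding eq by simp
    qed (use a in blast)+
  qed
  define M where "M = k * b"
  obtain Y :: "(nat \<times> ('a \<Rightarrow> nat)) set" and X where Y: "finite Y" "Y \<noteq> {}"
    and X: "\<And>I s. \<lbrakk>I \<subseteq> S; s \<in> I\<rbrakk> \<Longrightarrow>
       real (card Y) / (8 * (real M + 1) * card I) \<le> card {y \<in> Y. y \<in> X s \<and> (\<forall>t\<in>I - {s}. y \<notin> X t)}"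
    using fair_share_family[OF S(1) cS[folded M_def]] by blast
  define m where "m = card Y"
  obtain h where h: "bij_betw h {0..<m} Y"
    using ex_bij_betw_nat_finite[OF Y(1)] unfolding m_def by blast
  define X' where "X' = (\<lambda>s. {j. h j \<in> X s})"
  have SG: "S \<subseteq> carrier G" using S subgroup.subset[OF \<Gamma>] by blast
  show thesis
  proof (rule that[of S m X'])
    fix F assume F: "finite F" "F \<noteq> {}" "F \<subseteq> carrier G"
    obtain g where g: "g \<in> F"
      and gc: "8 * (real M + 1) < (\<Sum>s\<in>S. 1 / real (card {t \<in> S. g \<otimes> s \<otimes> inv t \<in> F}))"
      using exists_exposed_element_of_subgroup[OF \<Gamma> S ex F] unfolding M_def by blast
    have gG: "g \<in> carrier G" using g F by auto
    define A where "A = (\<lambda>s. {y. y < m \<and> y \<in> X' s \<and> (\<forall>t\<in>S. t \<noteq> s \<longrightarrow> g \<otimes> s \<otimes> inv t \<in> F \<longrightarrow> y \<notin> X' t)})"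
    have A_ge: "real m / (8 * (real M + 1)) * (1 / real (card {t \<in> S. g \<otimes> s \<otimes> inv t \<in> F})) \<le> card (A s)"
      if s: "s \<in> S" for s
    proof -
      let ?I = "{t \<in> S. g \<otimes> s \<otimes> inv t \<in> F}"
      let ?B = "{y \<in> Y. y \<in> X s \<and> (\<forall>t\<in>?I - {s}. y \<notin> X t)}"
      have "s \<in> ?I" using s g gG SG by (simp add: m_assoc subset_iff)
      then have "real m / (8 * (real M + 1) * card ?I) \<le> card ?B"
        unfolding m_def by (intro X) auto
      moreover have "A s = {j \<in> {0..<m}. h j \<in> ?B}"
        using h bij_betwE[OF h] by (auto simp: A_def X'_def)
      then have "h ` A s = ?B" "inj_on h (A s)"
        using h by (auto simp: bij_betw_def inj_on_def)
      then have "bij_betw h (A s) ?B" by (simp add: bij_betw_def)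
      then have "card (A s) = card ?B" by (rule bij_betw_same_card)
      ultimately show ?thesis by simp
    qed
    have m0: "real m > 0" using Y by (simp add: m_def card_gt_0_iff)
    have "real m = real m / (8 * (real M + 1)) * (8 * (real M + 1))"
      using of_nat_0_le_iff[of M] by (simp add: field_simps)
    also have "\<dots> < real m / (8 * (real M + 1)) * (\<Sum>s\<in>S. 1 / real (card {t \<in> S. g \<otimes> s \<otimes> inv t \<in> F}))"
      using gc m0 by (intro mult_strict_left_mono) auto
    also have "\<dots> = (\<Sum>s\<in>S. real m / (8 * (real M + 1)) * (1 / real (card {t \<in> S. g \<otimes> s \<otimes> inv t \<in> F})))"
      by (rule sum_distrib_left)
    also have "\<dots> \<le> (\<Sum>s\<in>S. real (card (A s)))"
      by (rule sum_mono) (rule A_ge)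
    also have "\<dots> = real (card (Sigma S A))"
      using S by (simp add: A_def)
    also have "Sigma S A = {(s, y). s \<in> S \<and> y < m \<and> y \<in> X' s \<and> (\<forall>t\<in>S. t \<noteq> s \<longrightarrow> g \<otimes> s \<otimes> inv t \<in> F \<longrightarrow> y \<notin> X' t)}"
      by (auto simp: A_def)
    finally show "\<exists>g\<in>F. m < card {(s, y). s \<in> S \<and> y < m \<and> y \<in> X' s \<and> (\<forall>t\<in>S. t \<noteq> s \<longrightarrow> g \<otimes> s \<otimes> inv t \<in> F \<longrightarrow> y \<notin> X' t)}"
      using g by auto
  qed (use S SG in auto)
qed

text \<open>
  The value \<open>k\<close> at \<open>g\<close> weights the pair \<open>x \<in> P\<close> by \<open>\<tau> x ^ k\<close>, so that the \<open>n\<close> values with \<open>k < n\<close> depend on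
  any \<open>n\<close> pairs through a transposed Vandermonde matrix.
\<close>

definition convolution :: "('a \<times> nat) set \<Rightarrow> ('a \<times> nat \<Rightarrow> int) \<Rightarrow> ('a \<Rightarrow> nat \<Rightarrow> int) \<Rightarrow> 'a \<Rightarrow> nat \<Rightarrow> int" where
  "convolution P \<tau> v g k = (\<Sum>(s, y)\<in>P. v (g \<otimes> s) y * \<tau> (s, y) ^ k)"

text \<open>
  A solution on \<open>F - {g}\<close> is corrected at \<open>g\<close> by changing only coordinates that are private to \<open>g\<close>, which
  leaves the equations at the other elements untouched.
\<close>

lemma convolution_finitely_surjective:
  fixes \<tau> :: "'a \<times> nat \<Rightarrow> int"
  assumes S: "finite S" "S \<subseteq> carrier G"
    and P: "P = {(s, y). s \<in> S \<and> y < m \<and> y \<in> X s}"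
    and priv: "\<And>F. \<lbrakk>finite F; F \<noteq> {}; F \<subseteq> carrier G\<rbrakk> \<Longrightarrow> \<exists>g\<in>F. m <
       card {(s, y). s \<in> S \<and> y < m \<and> y \<in> X s \<and> (\<forall>t\<in>S. t \<noteq> s \<longrightarrow> g \<otimes> s \<otimes> inv t \<in> F \<longrightarrow> y \<notin> X t)}"
    and q: "prime (q :: int)"
    and \<tau>: "\<And>x y. \<lbrakk>x \<in> P; y \<in> P; [\<tau> x = \<tau> y] (mod q)\<rbrakk> \<Longrightarrow> x = y"
    and F: "finite F" "F \<subseteq> carrier G"
  shows "\<exists>v. \<forall>g\<in>F. \<forall>k\<le>m. [convolution P \<tau> v g k = b g k] (mod q)"
  using F
proof (induction "card F" arbitrary: F rule: less_induct)
  case less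
  show ?case
  proof (cases "F = {}")
    case False
    have finP: "finite P" unfolding P by (rule finite_subset[of _ "S \<times> {..<m}"]) (use S in auto)
    obtain g where g: "g \<in> F" and big: "m < card {(s, y). s \<in> S \<and> y < m \<and> y \<in> X s \<and>
        (\<forall>t\<in>S. t \<noteq> s \<longrightarrow> g \<otimes> s \<otimes> inv t \<in> F \<longrightarrow> y \<notin> X t)}"
      using priv[OF less.prems(1) False less.prems(2)] by blast
    have gG: "g \<in> carrier G" using g less.prems by auto
    let ?V = "{(s, y). s \<in> S \<and> y < m \<and> y \<in> X s \<and> (\<forall>t\<in>S. t \<noteq> s \<longrightarrow> g \<otimes> s \<otimes> inv t \<in> F \<longrightarrow> y \<notin> X t)}"
    have VP: "?V \<subseteq> P" by (auto simp: P)
    then have finV: "finite ?V" using finP by (rule finite_subset)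
    obtain W where W: "W \<subseteq> ?V" "card W = Suc m"
      by (rule obtain_subset_with_card_n[OF Suc_leI[OF big]])
    then obtain e where e: "bij_betw e {0..<Suc m} W"
      using ex_bij_betw_nat_finite[OF finite_subset[OF W(1) finV]] by auto
    have eW: "e j \<in> W" if "j < Suc m" for j using e that by (auto simp: bij_betw_def)
    have e_inj: "i = j" if "i < Suc m" "j < Suc m" "e i = e j" for i j
      using e that by (auto simp: bij_betw_def inj_on_def)
    have "card (F - {g}) < card F" using g less.prems by (meson card_Diff1_less)
    then obtain v0 where v0: "\<forall>h\<in>F - {g}. \<forall>k\<le>m. [convolution P \<tau> v0 h k = b h k] (mod q)"
      using less.hyps[of "F - {g}"] less.prems by auto
    obtain w where w: "\<forall>k<Suc m. [(\<Sum>j<Suc m. w j * \<tau> (e j) ^ k) = b g k - convolution P \<tau> v0 g k] (mod q)"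
      proof -
        have "i = j" if "i < Suc m" "j < Suc m" "[\<tau> (e i) = \<tau> (e j)] (mod q)" for i j
        proof (rule e_inj[OF that(1,2)], rule \<tau>)
          show "e i \<in> P" "e j \<in> P" using W(1) VP eW that by (meson subsetD)+
        qed (rule that(3))
        then have "\<exists>w. \<forall>k<Suc m. [(\<Sum>j<Suc m. w j * \<tau> (e j) ^ k) = b g k - convolution P \<tau> v0 g k] (mod q)"
          by (intro vandermonde_transpose_solvable[OF q])
        then show thesis by (elim exE that)
      qed
    \<comment> \<open>the correction \<open>w\<close> is placed on the private coordinates \<open>e j\<close> of \<open>g\<close>\<close>
    define v where "v = (\<lambda>h y. v0 h y + (\<Sum>j<Suc m. if h = g \<otimes> fst (e j) \<and> y = snd (e j) then w j else 0))"
    have conv: "convolution P \<tau> v h k = convolution P \<tau> v0 h k +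
        (\<Sum>j<Suc m. \<Sum>x\<in>P. if h \<otimes> fst x = g \<otimes> fst (e j) \<and> snd x = snd (e j) then w j * \<tau> x ^ k else 0)" for h k
    proof -
      have "convolution P \<tau> v h k = (\<Sum>x\<in>P. v (h \<otimes> fst x) (snd x) * \<tau> x ^ k)"
        by (simp add: convolution_def case_prod_unfold)
      also have "\<dots> = (\<Sum>x\<in>P. v0 (h \<otimes> fst x) (snd x) * \<tau> x ^ k) +
         (\<Sum>x\<in>P. \<Sum>j<Suc m. if h \<otimes> fst x = g \<otimes> fst (e j) \<and> snd x = snd (e j) then w j * \<tau> x ^ k else 0)"
        unfolding v_def ring_distribs sum_distrib_right sum.distrib
        by (intro arg_cong2[where f="(+)"] refl sum.cong) auto
      also have "(\<Sum>x\<in>P. v0 (h \<otimes> fst x) (snd x) * \<tau> x ^ k) = convolution P \<tau> v0 h k"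
        by (simp add: convolution_def case_prod_unfold)
      finally show ?thesis by (simp only: sum.swap[of _ "{..<Suc m}" P])
    qed
    have "[convolution P \<tau> v h k = b h k] (mod q)" if h: "h \<in> F" and k: "k \<le> m" for h k
    proof (cases "h = g")
      case True
      have "(\<Sum>x\<in>P. if h \<otimes> fst x = g \<otimes> fst (e j) \<and> snd x = snd (e j) then w j * \<tau> x ^ k else 0) = w j * \<tau> (e j) ^ k"
        if j: "j < Suc m" for j
      proof -
        have ejP: "e j \<in> P" using subsetD[OF VP subsetD[OF W(1) eW[OF j]]] .
        have "(h \<otimes> fst x = g \<otimes> fst (e j) \<and> snd x = snd (e j)) = (x = e j)" if "x \<in> P" for x
        proof -
          have "fst x \<in> carrier G" "fst (e j) \<in> carrier G" using that ejP S by (auto simp: P)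
          then show ?thesis using gG by (simp add: True prod_eq_iff)
        qed
        then have "(\<Sum>x\<in>P. if h \<otimes> fst x = g \<otimes> fst (e j) \<and> snd x = snd (e j) then w j * \<tau> x ^ k else 0)
           = (\<Sum>x\<in>P. if x = e j then w j * \<tau> x ^ k else 0)"
          by (intro sum.cong) auto
        also have "\<dots> = w j * \<tau> (e j) ^ k" using ejP finP by simp
        finally show ?thesis .
      qed
      then have "convolution P \<tau> v h k = convolution P \<tau> v0 g k + (\<Sum>j<Suc m. w j * \<tau> (e j) ^ k)"
        unfolding conv True by (simp del: sum.lessThan_Suc)
      also have "[\<dots> = convolution P \<tau> v0 g k + (b g k - convolution P \<tau> v0 g k)] (mod q)"
        using w k by (intro cong_add cong_refl) auto
      finally show ?thesis by (simp add: True)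
    next
      case False
      have hG: "h \<in> carrier G" using h less.prems by auto
      have "(\<Sum>x\<in>P. if h \<otimes> fst x = g \<otimes> fst (e j) \<and> snd x = snd (e j) then w j * \<tau> x ^ k else 0) = 0"
        if j: "j < Suc m" for j
      proof (rule sum.neutral, rule ballI)
        fix x assume x: "x \<in> P"
        have "\<not> (h \<otimes> fst x = g \<otimes> fst (e j) \<and> snd x = snd (e j))"
        proof
          assume eq: "h \<otimes> fst x = g \<otimes> fst (e j) \<and> snd x = snd (e j)"
          have mem: "fst x \<in> S" "fst (e j) \<in> S" "snd x \<in> X (fst x)"
            and pr: "\<forall>t\<in>S. t \<noteq> fst (e j) \<longrightarrow> g \<otimes> fst (e j) \<otimes> inv t \<in> F \<longrightarrow> snd (e j) \<notin> X t"
            using x subsetD[OF W(1) eW[OF j]] by (auto simp: P)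
          have memG: "fst x \<in> carrier G" "fst (e j) \<in> carrier G" using mem S by auto
          have "fst x \<noteq> fst (e j)"
          proof
            assume "fst x = fst (e j)"
            then show False using eq False memG hG gG by simp
          qed
          moreover have "g \<otimes> fst (e j) \<otimes> inv (fst x) = h"
            using eq inv_solve_right'[of h "g \<otimes> fst (e j)" "fst x"] memG hG gG by (simp add: eq_commute)
          ultimately show False using pr mem eq h by auto
        qed
        then show "(if h \<otimes> fst x = g \<otimes> fst (e j) \<and> snd x = snd (e j) then w j * \<tau> x ^ k else 0) = 0" by auto
      qed
      then have "convolution P \<tau> v h k = convolution P \<tau> v0 h k"
        unfolding conv by (simp del: sum.lessThan_Suc)
      then show ?thesis using v0 h k False by simp
    qed
    then show ?thesis by blast
  qed simp
qed

end


section \<open>Sofic entropy of full shifts\<close>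

lemma log_enat_separation_number_le:
  assumes "\<And>S. \<lbrakk>finite S; S \<subseteq> A; pairwise (\<lambda>x y. \<kappa> \<le> d x y) S\<rbrakk> \<Longrightarrow> real (card S) \<le> exp L"
  shows "log_enat (separation_number \<kappa> d A) \<le> ereal L"
proof -
  define N where "N = nat \<lfloor>exp L\<rfloor>"
  have "separation_number \<kappa> d A \<le> enat N"
    unfolding separation_number_def
    by (rule SUP_least) (use assms in \<open>auto simp: N_def le_nat_floor\<close>)
  then obtain k where k: "separation_number \<kappa> d A = enat k" "k \<le> N"
    using enat_ile by force
  show ?thesis
  proof (cases "k = 0")
    case False
    have "real k \<le> exp L" using k(2) unfolding N_def by (simp add: le_nat_iff le_floor_iff)
    then have "ln (real k) \<le> ln (exp L)" using False by (subst ln_le_cancel_iff) auto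
    then show ?thesis using k False by (simp add: log_enat_def)
  qed (simp add: k log_enat_def)
qed

lemma log_enat_separation_number_ge:
  assumes "finite S" "S \<noteq> {}" "S \<subseteq> A" "pairwise (\<lambda>x y. \<kappa> \<le> d x y) S"
  shows "ereal (ln (card S)) \<le> log_enat (separation_number \<kappa> d A)"
proof -
  have le: "enat (card S) \<le> separation_number \<kappa> d A"
    unfolding separation_number_def by (rule SUP_upper) (use assms in auto)
  have "card S > 0" using assms by (simp add: card_gt_0_iff)
  with le show ?thesis
    by (cases "separation_number \<kappa> d A") (auto simp: log_enat_def)
qed

lemma sum_Pow_power: "finite A \<Longrightarrow> (\<Sum>B\<in>Pow A. (t::real) ^ card B) = (1 + t) ^ card A"
  using prod_add[of A "\<lambda>_. t" "\<lambda>_. 1"] by (simp add: add.commute)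

text \<open>
  Bounding \<open>R ^ card B\<close> by \<open>(R / t) powr (\<epsilon> * card D) * t ^ card B\<close> turns the sum into a binomial
  expansion. The rate \<open>\<epsilon> * ln (R / t) + t\<close> becomes arbitrarily small when \<open>t\<close> is chosen before \<open>\<epsilon>\<close>.
\<close>

lemma count_marked_small_subsets:
  fixes R t \<epsilon> :: real
  assumes D: "finite D" and R: "1 \<le> R" and t: "0 < t" "t \<le> 1" 
  shows "(\<Sum>B\<in>{B. B \<subseteq> D \<and> card B \<le> \<epsilon> * card D}. R ^ card B) \<le> exp (card D * (\<epsilon> * ln (R / t) + t))"
proof -
  let ?\<B> = "{B. B \<subseteq> D \<and> card B \<le> \<epsilon> * card D}"
  have Rt: "1 \<le> R / t" using R t by (simp add: le_divide_eq)
  have "(\<Sum>B\<in>?\<B>. R ^ card B) \<le> (\<Sum>B\<in>?\<B>. (R / t) powr (\<epsilon> * card D) * t ^ card B)"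
  proof (rule sum_mono)
    fix B assume "B \<in> ?\<B>"
    then have "(R / t) powr card B \<le> (R / t) powr (\<epsilon> * card D)"
      using Rt by (intro powr_mono) auto
    then have "(R / t) ^ card B * t ^ card B \<le> (R / t) powr (\<epsilon> * card D) * t ^ card B"
      using Rt R t by (intro mult_right_mono) (auto simp: powr_realpow)
    then show "R ^ card B \<le> (R / t) powr (\<epsilon> * card D) * t ^ card B"
      using t by (simp add: power_divide)
  qed
  also have "\<dots> = (R / t) powr (\<epsilon> * card D) * (\<Sum>B\<in>?\<B>. t ^ card B)"
    by (simp add: sum_distrib_left)
  also have "\<dots> \<le> (R / t) powr (\<epsilon> * card D) * (\<Sum>B\<in>Pow D. t ^ card B)"
    using D t by (intro mult_left_mono sum_mono2) auto
  also have "\<dots> = (R / t) powr (\<epsilon> * card D) * (1 + t) ^ card D"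
    using sum_Pow_power[OF D, of t] by simp
  also have "\<dots> \<le> (R / t) powr (\<epsilon> * card D) * exp t ^ card D"
    using t by (intro mult_left_mono power_mono) auto
  also have "\<dots> = exp (card D * (\<epsilon> * ln (R / t) + t))"
    using Rt R t by (simp add: powr_def exp_of_nat_mult[symmetric] exp_add[symmetric] algebra_simps)
  finally show ?thesis .
qed

lemma sofic_approximation_card_eventually:
  assumes "sofic_approximation G D \<sigma>"
  shows "eventually (\<lambda>n. 0 < card (D n)) sequentially"
proof -
  have "filterlim (\<lambda>n. card (D n)) at_top sequentially"
    using assms by (simp add: sofic_approximation_def)
  then have "eventually (\<lambda>n. 1 \<le> card (D n)) sequentially"
    unfolding filterlim_at_top by blast
  then show ?thesis by (simp add: Suc_le_eq)
qed

lemma sofic_approximation_few_bad_points: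
  fixes \<epsilon> :: real
  assumes sof: "sofic_approximation G D \<sigma>"
    and Q: "finite Q" "Q \<subseteq> carrier G \<times> carrier G" and \<epsilon>: "0 < \<epsilon>"
  shows "eventually (\<lambda>n. card {i \<in> D n. \<exists>(g, h)\<in>Q. \<sigma> n g (\<sigma> n h i) \<noteq> \<sigma> n (g \<otimes>\<^bsub>G\<^esub> h) i}
           \<le> \<epsilon> * card (D n)) sequentially"
proof -
  define b where "b = (\<lambda>n (g, h). {i \<in> D n. \<sigma> n g (\<sigma> n h i) \<noteq> \<sigma> n (g \<otimes>\<^bsub>G\<^esub> h) i})"
  have finD: "finite (D n)" for n using sof by (simp add: sofic_approximation_def)
  have "(\<lambda>n. real (card (b n x)) / real (card (D n))) \<longlonglongrightarrow> 0" if x: "x \<in> Q" for x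
  proof -
    obtain g h where gh: "x = (g, h)" "g \<in> carrier G" "h \<in> carrier G" using x Q by auto
    let ?a = "\<lambda>n. {i \<in> D n. (\<sigma> n g \<circ> \<sigma> n h) i = \<sigma> n (g \<otimes>\<^bsub>G\<^esub> h) i}"
    have "(\<lambda>n. real (card (?a n)) / real (card (D n))) \<longlonglongrightarrow> 1"
      using sof gh by (simp add: sofic_approximation_def)
    then have "(\<lambda>n. 1 - real (card (?a n)) / real (card (D n))) \<longlonglongrightarrow> 1 - 1"
      by (intro tendsto_diff tendsto_const)
    moreover have "eventually (\<lambda>n. 1 - real (card (?a n)) / real (card (D n)) = real (card (b n x)) / real (card (D n))) sequentially"
      using sofic_approximation_card_eventually[OF sof]
    proof eventually_elim
      case (elim n)
      have "card (D n) = card (?a n) + card (b n x)"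
        unfolding b_def gh(1) using finD[of n] by (subst card_Un_disjoint[symmetric]) (auto intro: arg_cong[where f=card])
      then have "real (card (b n x)) = real (card (D n)) - real (card (?a n))" by simp
      then show ?case using elim by (simp add: diff_divide_distrib)
    qed
    ultimately show ?thesis by (simp add: tendsto_cong)
  qed
  then have "(\<lambda>n. \<Sum>x\<in>Q. real (card (b n x)) / real (card (D n))) \<longlonglongrightarrow> (\<Sum>x\<in>Q. 0)"
    by (rule tendsto_sum)
  then have "eventually (\<lambda>n. (\<Sum>x\<in>Q. real (card (b n x)) / real (card (D n))) < \<epsilon>) sequentially"
    using \<epsilon> by (auto dest: order_tendstoD)
  then show ?thesis
    using sofic_approximation_card_eventually[OF sof]
  proof eventually_elim
    case (elim n)
    have "{i \<in> D n. \<exists>(g, h)\<in>Q. \<sigma> n g (\<sigma> n h i) \<noteq> \<sigma> n (g \<otimes>\<^bsub>G\<^esub> h) i} = (\<Union>x\<in>Q. b n x)"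
      by (auto simp: b_def)
    then have "card {i \<in> D n. \<exists>(g, h)\<in>Q. \<sigma> n g (\<sigma> n h i) \<noteq> \<sigma> n (g \<otimes>\<^bsub>G\<^esub> h) i} \<le> (\<Sum>x\<in>Q. card (b n x))"
      using Q card_UN_le[of Q "b n"] by simp
    also have "real \<dots> = (\<Sum>x\<in>Q. real (card (b n x)) / real (card (D n))) * card (D n)"
      using elim by (simp add: sum_distrib_right)
    finally show ?case using elim by (smt (verit) mult_right_mono of_nat_0_le_iff of_nat_mono)
  qed
qed

text \<open>
  This is Chebyshev's inequality.
\<close>

lemma rho_2_less_imp_few_large:
  assumes D: "finite D" "D \<noteq> {}" and lt: "rho_2 \<rho> D \<phi> \<psi> < \<delta>" and \<eta>: "0 < \<eta>"
    and nonneg: "\<And>i. i \<in> D \<Longrightarrow> 0 \<le> \<rho> (\<phi> i) (\<psi> i)"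
  shows "card {i \<in> D. \<eta> \<le> \<rho> (\<phi> i) (\<psi> i)} \<le> (\<delta> / \<eta>)\<^sup>2 * card D"
proof -
  let ?s = "\<Sum>i\<in>D. (\<rho> (\<phi> i) (\<psi> i))\<^sup>2"
  have d: "real (card D) > 0" using D by (simp add: card_gt_0_iff)
  have s0: "0 \<le> ?s" by (rule sum_nonneg) auto
  have "sqrt (?s / card D) < \<delta>" using lt by (simp add: rho_2_def)
  then have "(sqrt (?s / card D))\<^sup>2 \<le> \<delta>\<^sup>2"
    using s0 by (intro power_mono) auto
  then have s: "?s \<le> \<delta>\<^sup>2 * card D" using s0 d by (simp add: field_simps)
  have "card {i \<in> D. \<eta> \<le> \<rho> (\<phi> i) (\<psi> i)} * \<eta>\<^sup>2 = (\<Sum>i\<in>{i \<in> D. \<eta> \<le> \<rho> (\<phi> i) (\<psi> i)}. \<eta>\<^sup>2)" by simp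
  also have "\<dots> \<le> (\<Sum>i\<in>{i \<in> D. \<eta> \<le> \<rho> (\<phi> i) (\<psi> i)}. (\<rho> (\<phi> i) (\<psi> i))\<^sup>2)"
    using \<eta> by (intro sum_mono power_mono) auto
  also have "\<dots> \<le> ?s" using D by (intro sum_mono2) auto
  finally have "card {i \<in> D. \<eta> \<le> \<rho> (\<phi> i) (\<psi> i)} * \<eta>\<^sup>2 \<le> \<delta>\<^sup>2 * card D" using s by linarith
  then show ?thesis using \<eta> by (simp add: power_divide field_simps)
qed

text \<open>
  Systems that look like the full shift over the alphabet \<open>C\<close>, described by the symbol \<open>c x\<close> read at the
  identity. The pseudometric \<open>\<rho>\<close> is arbitrary because the definition of sofic entropy chooses
  one in an unspecified way.
\<close>

locale coded_system = group G for G (structure) +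
  fixes X :: "'x topology" and \<alpha> :: "'a \<Rightarrow> 'x \<Rightarrow> 'x" and c :: "'x \<Rightarrow> 'c" and C :: "'c set"
    and \<rho> :: "'x \<Rightarrow> 'x \<Rightarrow> real"
  assumes compact: "compact_space X"
    and \<alpha>_cont: "g \<in> carrier G \<Longrightarrow> continuous_map X X (\<alpha> g)"
    and \<alpha>_one: "x \<in> topspace X \<Longrightarrow> \<alpha> \<one> x = x"
    and \<alpha>_mult: "\<lbrakk>g \<in> carrier G; h \<in> carrier G; x \<in> topspace X\<rbrakk> \<Longrightarrow> \<alpha> g (\<alpha> h x) = \<alpha> (g \<otimes> h) x"
    and c_cont: "continuous_map X (discrete_topology C) c"
    and finite_C: "finite C"
    and separates: "\<lbrakk>x \<in> topspace X; y \<in> topspace X; x \<noteq> y\<rbrakk> \<Longrightarrow> \<exists>g\<in>carrier G. c (\<alpha> g x) \<noteq> c (\<alpha> g y)"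
    and full: "(\<And>g. g \<in> carrier G \<Longrightarrow> \<omega> g \<in> C) \<Longrightarrow> \<exists>x\<in>topspace X. \<forall>g\<in>carrier G. c (\<alpha> g x) = \<omega> g"
    and generating: "generating_pseudometric G X \<alpha> \<rho>"
begin

lemma \<alpha>_closed: "\<lbrakk>g \<in> carrier G; x \<in> topspace X\<rbrakk> \<Longrightarrow> \<alpha> g x \<in> topspace X"
  using \<alpha>_cont by (auto simp: continuous_map_def)

lemma c_closed: "x \<in> topspace X \<Longrightarrow> c x \<in> C"
  using c_cont by (auto simp: continuous_map_def)

lemma pseudo: "continuous_pseudometric X \<rho>"
  using generating by (simp add: generating_pseudometric_def)

lemma \<rho>_refl: "x \<in> topspace X \<Longrightarrow> \<rho> x x = 0"
  and \<rho>_nonneg: "\<lbrakk>x \<in> topspace X; y \<in> topspace X\<rbrakk> \<Longrightarrow> 0 \<le> \<rho> x y"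
  and \<rho>_sym: "\<lbrakk>x \<in> topspace X; y \<in> topspace X\<rbrakk> \<Longrightarrow> \<rho> x y = \<rho> y x"
  and \<rho>_triangle: "\<lbrakk>x \<in> topspace X; y \<in> topspace X; z \<in> topspace X\<rbrakk> \<Longrightarrow> \<rho> x z \<le> \<rho> x y + \<rho> y z"
  and \<rho>_cont: "continuous_map (prod_topology X X) euclideanreal (\<lambda>(x, y). \<rho> x y)"
  using pseudo by (auto simp: continuous_pseudometric_def)

lemma compact_pairs: "closedin (prod_topology X X) A \<Longrightarrow> compactin (prod_topology X X) A"
  by (rule closedin_compact_space) (simp_all add: compact_space_prod_topology compact)

lemma openin_symbol: "g \<in> carrier G \<Longrightarrow> openin X {x \<in> topspace X. c (\<alpha> g x) = d}"
proof -
  assume g: "g \<in> carrier G"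
  have "continuous_map X (discrete_topology C) (c \<circ> \<alpha> g)"
    using \<alpha>_cont[OF g] c_cont by (rule continuous_map_compose)
  from openin_continuous_map_preimage[OF this, of "{d} \<inter> C"]
  have "openin X {x \<in> topspace X. (c \<circ> \<alpha> g) x \<in> {d} \<inter> C}" by simp
  moreover have "{x \<in> topspace X. (c \<circ> \<alpha> g) x \<in> {d} \<inter> C} = {x \<in> topspace X. c (\<alpha> g x) = d}"
    using c_closed \<alpha>_closed[OF g] by auto
  ultimately show ?thesis by simp
qed

lemma openin_pairs_symbols:
  assumes g: "g \<in> carrier G"
  shows "openin (prod_topology X X) {(x, y). x \<in> topspace X \<and> y \<in> topspace X \<and> c (\<alpha> g x) = c (\<alpha> g y)}" (is "openin _ ?A")
    and "openin (prod_topology X X) {(x, y). x \<in> topspace X \<and> y \<in> topspace X \<and> c (\<alpha> g x) \<noteq> c (\<alpha> g y)}" (is "openin _ ?B")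
proof -
  let ?V = "\<lambda>d. {x \<in> topspace X. c (\<alpha> g x) = d}"
  have "?A = (\<Union>d\<in>UNIV. ?V d \<times> ?V d)" by auto
  moreover have "openin (prod_topology X X) (\<Union>d\<in>UNIV. ?V d \<times> ?V d)"
    using openin_symbol[OF g] by (intro openin_Union) (auto simp: openin_prod_Times_iff)
  ultimately show "openin (prod_topology X X) ?A" by simp
  have "?B = (\<Union>(d, e)\<in>{(d, e). d \<noteq> e}. ?V d \<times> ?V e)" by auto
  moreover have "openin (prod_topology X X) (\<Union>(d, e)\<in>{(d, e). d \<noteq> e}. ?V d \<times> ?V e)"
    using openin_symbol[OF g] by (intro openin_Union) (auto simp: openin_prod_Times_iff)
  ultimately show "openin (prod_topology X X) ?B" by simp
qed

text \<open>
  The pairs at distance at least \<open>\<kappa>\<close> form a compact set, which is covered by the open sets of pairs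
  that are distinguished by the symbol at some group element.
\<close>

lemma finite_window_close:
  assumes \<kappa>: "0 < \<kappa>"
  obtains E where "finite E" "E \<subseteq> carrier G"
    "\<And>x y. \<lbrakk>x \<in> topspace X; y \<in> topspace X; \<And>g. g \<in> E \<Longrightarrow> c (\<alpha> g x) = c (\<alpha> g y)\<rbrakk> \<Longrightarrow> \<rho> x y < \<kappa>"
proof -
  define U where "U = (\<lambda>g. {(x, y). x \<in> topspace X \<and> y \<in> topspace X \<and> c (\<alpha> g x) \<noteq> c (\<alpha> g y)})"
  let ?A = "{z \<in> topspace (prod_topology X X). (\<lambda>(x, y). \<rho> x y) z \<in> {\<kappa>..}}"
  have 1: "compactin (prod_topology X X) ?A"
    by (intro compact_pairs closedin_continuous_map_preimage[OF \<rho>_cont]) simp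
  have 2: "\<And>V. V \<in> U ` carrier G \<Longrightarrow> openin (prod_topology X X) V"
    using openin_pairs_symbols(2) by (auto simp: U_def)
  have 3: "?A \<subseteq> \<Union> (U ` carrier G)"
  proof clarsimp
    fix x y assume xy: "x \<in> topspace X" "y \<in> topspace X" "\<kappa> \<le> \<rho> x y"
    then have "x \<noteq> y" using \<rho>_refl \<kappa> by force
    then show "\<exists>g\<in>carrier G. (x, y) \<in> U g" using separates xy by (auto simp: U_def)
  qed
  obtain \<F> where \<F>: "finite \<F>" "\<F> \<subseteq> U ` carrier G" "?A \<subseteq> \<Union>\<F>"
    using compactinD[OF 1 2 3] by auto
  then obtain E where E: "E \<subseteq> carrier G" "finite E" "\<F> = U ` E"
    using finite_subset_image[OF \<F>(1,2)] by auto
  show thesis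
  proof (rule that[OF E(2,1)])
    fix x y assume xy: "x \<in> topspace X" "y \<in> topspace X" "\<And>g. g \<in> E \<Longrightarrow> c (\<alpha> g x) = c (\<alpha> g y)"
    show "\<rho> x y < \<kappa>"
    proof (rule ccontr)
      assume "\<not> \<rho> x y < \<kappa>"
      then have "(x, y) \<in> ?A" using xy by simp
      then have "(x, y) \<in> \<Union> (U ` E)" using \<F>(3) E(3) by blast
      then show False using xy(3) by (auto simp: U_def)
    qed
  qed
qed

text \<open>
  The pairs with different symbols form a compact set, on which \<open>\<rho>\<close> is positive at some
  translate because it is generating.
\<close>

lemma finite_window_symbol:
  obtains E \<kappa> where "finite E" "E \<subseteq> carrier G" "0 < \<kappa>"
    "\<And>x y. \<lbrakk>x \<in> topspace X; y \<in> topspace X; \<And>g. g \<in> E \<Longrightarrow> \<rho> (\<alpha> g x) (\<alpha> g y) < \<kappa>\<rbrakk> \<Longrightarrow> c x = c y"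
proof -
  define U where "U = (\<lambda>(g, m :: nat). {z \<in> topspace (prod_topology X X).
      ((\<lambda>(x, y). \<rho> x y) \<circ> (\<lambda>(x, y). (\<alpha> g x, \<alpha> g y))) z \<in> {inverse (Suc m)<..}})"
  let ?B = "{(x, y). x \<in> topspace X \<and> y \<in> topspace X \<and> c (\<alpha> \<one> x) = c (\<alpha> \<one> y)}"
  let ?A = "topspace (prod_topology X X) - ?B"
  have 1: "compactin (prod_topology X X) ?A"
    by (rule compact_pairs, rule closedin_diff[OF closedin_topspace openin_pairs_symbols(1)]) simp
  have 2: "openin (prod_topology X X) V" if V: "V \<in> U ` (carrier G \<times> UNIV)" for V
  proof -
    obtain g m where V: "V = U (g, m)" and g: "g \<in> carrier G" using V by auto
    have "continuous_map (prod_topology X X) (prod_topology X X) (\<lambda>(x, y). (\<alpha> g x, \<alpha> g y))"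
    proof -
      have "continuous_map (prod_topology X X) X (\<alpha> g \<circ> fst)" "continuous_map (prod_topology X X) X (\<alpha> g \<circ> snd)"
        by (rule continuous_map_compose[OF _ \<alpha>_cont[OF g]], rule continuous_map_fst continuous_map_snd)+
      then have "continuous_map (prod_topology X X) (prod_topology X X) (\<lambda>z. ((\<alpha> g \<circ> fst) z, (\<alpha> g \<circ> snd) z))"
        by (rule continuous_map_pairedI)
      then show ?thesis by (simp add: case_prod_unfold)
    qed
    then have "continuous_map (prod_topology X X) euclideanreal ((\<lambda>(x, y). \<rho> x y) \<circ> (\<lambda>(x, y). (\<alpha> g x, \<alpha> g y)))"
      using \<rho>_cont by (rule continuous_map_compose)
    then show ?thesis unfolding V U_def prod.case
      by (rule openin_continuous_map_preimage) simp
  qed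
  have 3: "?A \<subseteq> \<Union> (U ` (carrier G \<times> UNIV))"
  proof
    fix z assume z: "z \<in> ?A"
    obtain x y where xy: "z = (x, y)" "x \<in> topspace X" "y \<in> topspace X" "x \<noteq> y" using z by auto
    then obtain g where g: "g \<in> carrier G" "\<rho> (\<alpha> g x) (\<alpha> g y) > 0"
      using generating by (auto simp: generating_pseudometric_def)
    then obtain m where "inverse (real (Suc m)) < \<rho> (\<alpha> g x) (\<alpha> g y)"
      using reals_Archimedean by blast
    then have "z \<in> U (g, m)" using xy by (simp add: U_def)
    then show "z \<in> \<Union> (U ` (carrier G \<times> UNIV))" using g by blast
  qed
  obtain \<F> where \<F>: "finite \<F>" "\<F> \<subseteq> U ` (carrier G \<times> UNIV)" "?A \<subseteq> \<Union>\<F>"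
    using compactinD[OF 1 2 3] by auto
  then obtain I where I: "I \<subseteq> carrier G \<times> UNIV" "finite I" "\<F> = U ` I"
    using finite_subset_image[OF \<F>(1,2)] by auto
  define \<kappa> where "\<kappa> = Min (insert 1 ((\<lambda>(g, m). inverse (real (Suc m))) ` I))"
  have \<kappa>0: "0 < \<kappa>" unfolding \<kappa>_def using I by (subst Min_gr_iff) auto
  have \<kappa>_le: "\<kappa> \<le> inverse (real (Suc m))" if "(g, m) \<in> I" for g m
    unfolding \<kappa>_def using I that by (intro Min_le) (auto intro!: rev_image_eqI)
  show thesis
  proof (rule that[of "fst ` I" \<kappa>])
    fix x y assume xy: "x \<in> topspace X" "y \<in> topspace X" "\<And>g. g \<in> fst ` I \<Longrightarrow> \<rho> (\<alpha> g x) (\<alpha> g y) < \<kappa>"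
    show "c x = c y"
    proof (rule ccontr)
      assume "c x \<noteq> c y"
      then have "(x, y) \<in> ?A" using xy \<alpha>_one by simp
      then have "(x, y) \<in> \<Union> (U ` I)" using \<F>(3) I(3) by blast
      then obtain g m where gm: "(g, m) \<in> I" "inverse (real (Suc m)) < \<rho> (\<alpha> g x) (\<alpha> g y)"
        by (auto simp: U_def)
      moreover have "\<rho> (\<alpha> g x) (\<alpha> g y) < \<kappa>" using xy(3) gm(1) by force
      ultimately show False using \<kappa>_le[OF gm(1)] by linarith
    qed
  qed (use I \<kappa>0 in auto)
qed

lemma \<rho>_bounded:
  obtains K where "0 < K" "\<And>x y. \<lbrakk>x \<in> topspace X; y \<in> topspace X\<rbrakk> \<Longrightarrow> \<rho> x y \<le> K"
proof -
  have "compactin euclideanreal ((\<lambda>(x, y). \<rho> x y) ` topspace (prod_topology X X))"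
    using compact_pairs[OF closedin_topspace] \<rho>_cont by (rule image_compactin)
  then have "bounded ((\<lambda>(x, y). \<rho> x y) ` (topspace X \<times> topspace X))"
    by (simp add: compact_imp_bounded)
  then obtain K where "0 < K" "\<And>r. r \<in> (\<lambda>(x, y). \<rho> x y) ` (topspace X \<times> topspace X) \<Longrightarrow> norm r \<le> K"
    unfolding bounded_pos by blast
  then show thesis by (intro that[of K]) force+
qed

text \<open>
  A model is determined, up to distance \<open>\<kappa>\<close>, by its symbols \<open>c (\<phi> i)\<close> and, at the few points where the
  symbols do not follow the action, by the whole finite window of symbols of \<open>\<phi> i\<close>. There are about
  \<open>card C ^ card D\<close> such descriptions.
\<close>

lemma entropy_upper_bound:
  assumes sof: "sofic_approximation G D \<sigma>"
  shows "sofic_entropy_wrt \<rho> G X \<alpha> D \<sigma> \<le> ereal (ln (card C))"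
  unfolding sofic_entropy_wrt_def
proof (rule SUP_least)
  fix \<kappa> :: real assume "\<kappa> \<in> {0<..}"
  then have \<kappa>: "0 < \<kappa>" by simp
  let ?L = "\<lambda>\<delta> F. limsup (\<lambda>n. ereal (1 / real (card (D n))) *
          log_enat (separation_number \<kappa> (rho_inf \<rho> (D n)) (sofic_Map X \<alpha> \<rho> F \<delta> (D n) (\<sigma> n))))"
  have finD: "finite (D n)" for n using sof by (simp add: sofic_approximation_def)
  have perm: "\<sigma> n g permutes D n" if "g \<in> carrier G" for n g
    using sof that by (simp add: sofic_approximation_def)
  obtain E where E: "finite E" "E \<subseteq> carrier G"
    and close: "\<And>x y. \<lbrakk>x \<in> topspace X; y \<in> topspace X; \<And>g. g \<in> E \<Longrightarrow> c (\<alpha> g x) = c (\<alpha> g y)\<rbrakk> \<Longrightarrow> \<rho> x y < \<kappa>"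
    using finite_window_close[OF \<kappa>] by blast
  obtain E' \<eta> where E': "finite E'" "E' \<subseteq> carrier G" and \<eta>: "0 < \<eta>"
    and symb: "\<And>x y. \<lbrakk>x \<in> topspace X; y \<in> topspace X; \<And>g. g \<in> E' \<Longrightarrow> \<rho> (\<alpha> g x) (\<alpha> g y) < \<eta>\<rbrakk> \<Longrightarrow> c x = c y"
    using finite_window_symbol by blast
  define R where "R = max 1 (real (card C) ^ card E)"
  define F where "F = E' \<union> (\<lambda>(g', g). g' \<otimes> g) ` (E' \<times> E)"
  have F: "finite F" "F \<subseteq> carrier G" using E E' by (auto simp: F_def)
  define M where "M = real (card (E' \<times> E)) + card (E' \<times> E)"
  show "(INF \<delta>\<in>{0<..}. INF F\<in>{F. finite F \<and> F \<subseteq> carrier G}. ?L \<delta> F) \<le> ereal (ln (card C))"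
  proof (rule ereal_le_epsilon2)
    fix \<theta> :: real assume \<theta>: "0 < \<theta>"
    define t where "t = min 1 (\<theta> / 2)"
    have t: "0 < t" "t \<le> 1" "t \<le> \<theta> / 2" using \<theta> by (auto simp: t_def)
    define \<epsilon> where "\<epsilon> = \<theta> / (2 * (1 + ln (R / t)))"
    have Rt: "1 \<le> R / t" using t by (simp add: R_def le_divide_eq)
    then have lnRt: "0 \<le> ln (R / t)" by simp
    have \<epsilon>: "0 < \<epsilon>" "\<epsilon> * ln (R / t) \<le> \<theta> / 2"
      using \<theta> lnRt unfolding \<epsilon>_def by (auto simp: field_simps)
    \<comment> \<open>chosen such that Chebyshev's bound at the threshold \<open>\<eta> / 2\<close> is \<open>\<epsilon> / (2 * (M + 1))\<close>\<close>
    define \<delta> where "\<delta> = \<eta> / 2 * sqrt (\<epsilon> / (2 * (M + 1)))"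
    have M0: "0 \<le> M" by (simp add: M_def)
    have \<delta>0: "0 < \<delta>" using \<eta> \<epsilon> M0 by (simp add: \<delta>_def)
    have \<delta>sq: "(\<delta> / (\<eta> / 2))\<^sup>2 = \<epsilon> / (2 * (M + 1))" using \<eta> \<epsilon> M0 by (simp add: \<delta>_def)
    have few_bad: "eventually (\<lambda>n. card {i \<in> D n. \<exists>(g', g)\<in>E' \<times> E. \<sigma> n g' (\<sigma> n g i) \<noteq> \<sigma> n (g' \<otimes> g) i}
        \<le> \<epsilon> / 2 * card (D n)) sequentially"
      by (rule sofic_approximation_few_bad_points[OF sof]) (use E E' \<epsilon> in auto)
    have "eventually (\<lambda>n. ereal (1 / real (card (D n))) *
          log_enat (separation_number \<kappa> (rho_inf \<rho> (D n)) (sofic_Map X \<alpha> \<rho> F \<delta> (D n) (\<sigma> n)))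
          \<le> ereal (ln (card C)) + ereal \<theta>) sequentially"
      using sofic_approximation_card_eventually[OF sof] few_bad
    proof eventually_elim
      case (elim n)
      let ?D = "D n" and ?s = "\<sigma> n" and ?Map = "sofic_Map X \<alpha> \<rho> F \<delta> (D n) (\<sigma> n)"
      have D: "finite ?D" "?D \<noteq> {}" using elim finD by (auto simp: card_gt_0_iff)
      let ?d = "card ?D"
      have few: "card {i \<in> ?D. \<exists>(g', g)\<in>E' \<times> E. ?s g' (?s g i) \<noteq> ?s (g' \<otimes> g) i} \<le> \<epsilon> / 2 * ?d"
        using elim(2) .
      \<comment> \<open>the points \<open>i\<close> at which the window of \<open>\<phi> i\<close> cannot be read off from the symbols of \<open>\<phi>\<close> at
        the points \<open>\<sigma> n g i\<close>\<close>
      define Bad where "Bad = (\<lambda>\<phi>. {i \<in> ?D. \<exists>g\<in>E. c (\<phi> (?s g i)) \<noteq> c (\<alpha> g (\<phi> i))})"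
      have Bad_le: "card (Bad \<phi>) \<le> \<epsilon> * ?d" if \<phi>: "\<phi> \<in> ?Map" for \<phi>
      proof -
        have \<phi>X: "\<phi> i \<in> topspace X" if "i \<in> ?D" for i using \<phi> that by (auto simp: sofic_Map_def)
        have \<phi>F: "rho_2 \<rho> ?D (\<phi> \<circ> ?s f) (\<alpha> f \<circ> \<phi>) < \<delta>" if "f \<in> F" for f
          using \<phi> that by (auto simp: sofic_Map_def)
        have sD: "?s g i \<in> ?D" if "g \<in> carrier G" "i \<in> ?D" for g i
          using perm[OF that(1)] that(2) by (simp add: permutes_in_image)
        define L where "L = (\<lambda>f. {i \<in> ?D. \<eta> / 2 \<le> \<rho> (\<phi> (?s f i)) (\<alpha> f (\<phi> i))})"
        have cardL: "card (L f) \<le> \<epsilon> / (2 * (M + 1)) * ?d" if f: "f \<in> F" for f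
          using rho_2_less_imp_few_large[OF D \<phi>F[OF f], of "\<eta> / 2"] \<eta> \<rho>_nonneg \<phi>X sD \<alpha>_closed F f \<delta>sq
          by (simp add: L_def subset_iff)
        let ?B0 = "{i \<in> ?D. \<exists>(g', g)\<in>E' \<times> E. ?s g' (?s g i) \<noteq> ?s (g' \<otimes> g) i}"
        let ?B1 = "\<Union>(g', g)\<in>E' \<times> E. L (g' \<otimes> g)"
        let ?B2 = "\<Union>(g', g)\<in>E' \<times> E. {i \<in> ?D. ?s g i \<in> L g'}"
        \<comment> \<open>at a bad point either \<open>\<sigma> n\<close> is not multiplicative, or \<open>\<phi>\<close> is far from equivariant there or at
          its image under \<open>\<sigma> n g\<close>\<close>
        have "Bad \<phi> \<subseteq> ?B0 \<union> ?B1 \<union> ?B2"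
        proof
          fix i assume "i \<in> Bad \<phi>"
          then obtain g where i: "i \<in> ?D" and g: "g \<in> E" and ne: "c (\<phi> (?s g i)) \<noteq> c (\<alpha> g (\<phi> i))"
            by (auto simp: Bad_def)
          have gG: "g \<in> carrier G" using g E by auto
          show "i \<in> ?B0 \<union> ?B1 \<union> ?B2"
          proof (rule ccontr)
            assume n: "i \<notin> ?B0 \<union> ?B1 \<union> ?B2"
            have "c (\<phi> (?s g i)) = c (\<alpha> g (\<phi> i))"
            proof (rule symb)
              show "\<phi> (?s g i) \<in> topspace X" "\<alpha> g (\<phi> i) \<in> topspace X"
                using \<phi>X sD i gG \<alpha>_closed by auto
              fix g' assume g': "g' \<in> E'"
              have g'G: "g' \<in> carrier G" using g' E' by auto
              have "?s g' (?s g i) = ?s (g' \<otimes> g) i" using n i g g' by auto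
              moreover have "i \<notin> L (g' \<otimes> g)" using n g g' by auto
              then have "\<rho> (\<phi> (?s (g' \<otimes> g) i)) (\<alpha> g' (\<alpha> g (\<phi> i))) < \<eta> / 2"
                using i gG g'G \<phi>X[OF i] by (simp add: L_def \<alpha>_mult)
              moreover have "?s g i \<notin> L g'" using n i g g' by auto
              then have "\<rho> (\<phi> (?s g' (?s g i))) (\<alpha> g' (\<phi> (?s g i))) < \<eta> / 2"
                using sD[OF gG i] by (simp add: L_def)
              moreover have "\<rho> (\<alpha> g' (\<phi> (?s g i))) (\<alpha> g' (\<alpha> g (\<phi> i)))
                 \<le> \<rho> (\<phi> (?s g' (?s g i))) (\<alpha> g' (\<phi> (?s g i))) + \<rho> (\<phi> (?s g' (?s g i))) (\<alpha> g' (\<alpha> g (\<phi> i)))"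
                using \<rho>_triangle[of "\<alpha> g' (\<phi> (?s g i))" "\<phi> (?s g' (?s g i))" "\<alpha> g' (\<alpha> g (\<phi> i))"]
                  \<rho>_sym[of "\<alpha> g' (\<phi> (?s g i))" "\<phi> (?s g' (?s g i))"] \<phi>X sD i gG g'G \<alpha>_closed by simp
              ultimately show "\<rho> (\<alpha> g' (\<phi> (?s g i))) (\<alpha> g' (\<alpha> g (\<phi> i))) < \<eta>" by simp
            qed
            then show False using ne by simp
          qed
        qed
        moreover have "finite (?B0 \<union> ?B1 \<union> ?B2)" using D E E' by (auto simp: L_def)
        ultimately have "card (Bad \<phi>) \<le> card (?B0 \<union> ?B1 \<union> ?B2)" by (intro card_mono)
        also have "\<dots> \<le> card ?B0 + card ?B1 + card ?B2"
          using card_Un_le[of "?B0 \<union> ?B1" ?B2] card_Un_le[of ?B0 ?B1] by linarith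
        finally have le: "real (card (Bad \<phi>)) \<le> real (card ?B0) + real (card ?B1) + real (card ?B2)" by simp
        let ?e = "\<epsilon> / (2 * (M + 1)) * ?d"
        have "card ?B1 \<le> (\<Sum>x\<in>E' \<times> E. card (case x of (g', g) \<Rightarrow> L (g' \<otimes> g)))"
          using E E' by (intro card_UN_le) auto
        also have "real \<dots> \<le> (\<Sum>x\<in>E' \<times> E. ?e)"
          unfolding of_nat_sum
        proof (rule sum_mono)
          fix x assume "x \<in> E' \<times> E"
          then obtain g' g where x: "x = (g', g)" "g' \<in> E'" "g \<in> E" by auto
          then have "g' \<otimes> g \<in> F" by (auto simp: F_def)
          from cardL[OF this] show "real (card (case x of (g', g) \<Rightarrow> L (g' \<otimes> g))) \<le> ?e" by (simp only: x prod.case)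
        qed
        finally have B1: "real (card ?B1) \<le> real (card (E' \<times> E)) * ?e" by simp
        have "card {i \<in> ?D. ?s g i \<in> L g'} \<le> ?e" if "g' \<in> E'" "g \<in> E" for g' g
        proof -
          have "card {i \<in> ?D. ?s g i \<in> L g'} \<le> card (L g')"
            using perm[of g n] that E D
            by (intro card_inj_on_le[of "?s g"]) (auto simp: L_def permutes_inj_on)
          also have "real \<dots> \<le> ?e" using that by (intro cardL) (auto simp: F_def)
          finally show ?thesis by simp
        qed
        note B2' = this
        have "card ?B2 \<le> (\<Sum>x\<in>E' \<times> E. card (case x of (g', g) \<Rightarrow> {i \<in> ?D. ?s g i \<in> L g'}))"
          using E E' by (intro card_UN_le) auto
        also have "real \<dots> \<le> (\<Sum>x\<in>E' \<times> E. ?e)"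
          unfolding of_nat_sum
        proof (rule sum_mono)
          fix x assume "x \<in> E' \<times> E"
          then obtain g' g where x: "x = (g', g)" "g' \<in> E'" "g \<in> E" by auto
          from B2'[OF x(2,3)] show "real (card (case x of (g', g) \<Rightarrow> {i \<in> ?D. ?s g i \<in> L g'})) \<le> ?e"
            by (simp only: x prod.case)
        qed
        finally have B2: "real (card ?B2) \<le> real (card (E' \<times> E)) * ?e" by simp
        have "real (card (Bad \<phi>)) \<le> \<epsilon> / 2 * ?d + M * ?e"
          using le few B1 B2 unfolding M_def by (simp only: ring_distribs)
        also have "M * ?e \<le> \<epsilon> / 2 * ?d"
        proof -
          have "M * (\<epsilon> / (2 * (M + 1))) \<le> \<epsilon> / 2" using M0 \<epsilon> by (simp add: field_simps)
          from mult_right_mono[OF this, of ?d] show ?thesis by (simp add: mult.assoc)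
        qed
        finally show ?thesis by simp
      qed
      \<comment> \<open>the description of a model; \<open>T\<close> is the set of all descriptions\<close>
      define data where "data = (\<lambda>\<phi>. (restrict (c \<circ> \<phi>) ?D, Bad \<phi>, \<lambda>i\<in>Bad \<phi>. \<lambda>g\<in>E. c (\<alpha> g (\<phi> i))))"
      define \<B> where "\<B> = {B. B \<subseteq> ?D \<and> card B \<le> \<epsilon> * ?d}"
      define T where "T = (?D \<rightarrow>\<^sub>E C) \<times> Sigma \<B> (\<lambda>B. B \<rightarrow>\<^sub>E (E \<rightarrow>\<^sub>E C))"
      have fin\<B>: "finite \<B>" using D by (auto simp: \<B>_def intro: finite_subset[of _ "Pow ?D"])
      have finB: "finite B" if "B \<in> \<B>" for B using that D finite_subset by (auto simp: \<B>_def)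
      have finT: "finite T"
        unfolding T_def using D E finite_C fin\<B> finB by (intro finite_cartesian_product finite_SigmaI finite_PiE) auto
      have C0: "card C > 0" if nS: "S \<noteq> {}" "S \<subseteq> ?Map" for S
      proof -
        obtain \<phi> i where "\<phi> \<in> ?Map" "i \<in> ?D" using nS D by blast
        then have "c (\<phi> i) \<in> C" using c_closed by (auto simp: sofic_Map_def)
        then show ?thesis using finite_C by (auto simp: card_gt_0_iff)
      qed
      have "real (card S) \<le> exp (?d * (ln (card C) + \<theta>))"
        if S: "finite S" "S \<subseteq> ?Map" "pairwise (\<lambda>x y. \<kappa> \<le> rho_inf \<rho> ?D x y) S" for S
      proof (cases "S = {}")
        case False
        have "data ` S \<subseteq> T"
        proof (rule image_subsetI)
          fix \<phi> assume "\<phi> \<in> S"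
          then have \<phi>: "\<phi> \<in> ?Map" using S by auto
          have \<phi>X: "\<phi> i \<in> topspace X" if "i \<in> ?D" for i using \<phi> that by (auto simp: sofic_Map_def)
          have "Bad \<phi> \<in> \<B>" using Bad_le[OF \<phi>] by (auto simp: \<B>_def Bad_def)
          moreover have "Bad \<phi> \<subseteq> ?D" by (auto simp: Bad_def)
          ultimately show "data \<phi> \<in> T"
            using \<phi>X c_closed \<alpha>_closed E by (auto simp: data_def T_def subset_iff)
        qed
        moreover have "inj_on data S"
        proof (rule inj_onI, rule ccontr)
          fix \<phi> \<psi> assume in_S: "\<phi> \<in> S" "\<psi> \<in> S" and eq: "data \<phi> = data \<psi>" and ne: "\<phi> \<noteq> \<psi>"
          have X: "\<phi> i \<in> topspace X" "\<psi> i \<in> topspace X" if "i \<in> ?D" for i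
            using in_S S that by (auto simp: sofic_Map_def)
          have eqc: "c (\<phi> i) = c (\<psi> i)" if "i \<in> ?D" for i
          proof -
            have "restrict (c \<circ> \<phi>) ?D i = restrict (c \<circ> \<psi>) ?D i" using eq by (simp add: data_def)
            then show ?thesis using that by simp
          qed
          have eqB: "Bad \<phi> = Bad \<psi>" using eq by (simp add: data_def)
          have eqp: "c (\<alpha> g (\<phi> i)) = c (\<alpha> g (\<psi> i))" if "i \<in> Bad \<phi>" "g \<in> E" for i g
          proof -
            have "(\<lambda>i\<in>Bad \<phi>. \<lambda>g\<in>E. c (\<alpha> g (\<phi> i))) = (\<lambda>i\<in>Bad \<psi>. \<lambda>g\<in>E. c (\<alpha> g (\<psi> i)))"
              using eq unfolding data_def prod.inject by blast
            from fun_cong[OF fun_cong[OF this, of i], of g] show ?thesis using that eqB by simp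
          qed
          have "\<rho> (\<phi> i) (\<psi> i) < \<kappa>" if i: "i \<in> ?D" for i
          proof (rule close)
            fix g assume g: "g \<in> E"
            show "c (\<alpha> g (\<phi> i)) = c (\<alpha> g (\<psi> i))"
            proof (cases "i \<in> Bad \<phi>")
              case False
              then have "i \<notin> Bad \<psi>" using eqB by simp
              have "?s g i \<in> ?D" using perm[of g n] g E i by (auto simp: permutes_in_image)
              then have "c (\<phi> (?s g i)) = c (\<psi> (?s g i))" by (rule eqc)
              then show ?thesis using False \<open>i \<notin> Bad \<psi>\<close> i g by (auto simp: Bad_def)
            qed (use eqp g in simp)
          qed (use X i in auto)
          then have "rho_inf \<rho> ?D \<phi> \<psi> < \<kappa>"
            unfolding rho_inf_def using D by (subst Max_less_iff) auto
          moreover have "\<kappa> \<le> rho_inf \<rho> ?D \<phi> \<psi>" using S(3) in_S ne by (simp add: pairwise_def)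
          ultimately show False by simp
        qed
        ultimately have "card S \<le> card T" using finT by (metis card_inj_on_le)
        also have "card T = card C ^ ?d * (\<Sum>B\<in>\<B>. (card C ^ card E) ^ card B)"
        proof -
          have fin: "finite (B \<rightarrow>\<^sub>E (E \<rightarrow>\<^sub>E C))" if "B \<in> \<B>" for B
            using that finB E finite_C by (intro finite_PiE) auto
          have "card (Sigma \<B> (\<lambda>B. B \<rightarrow>\<^sub>E (E \<rightarrow>\<^sub>E C))) = (\<Sum>B\<in>\<B>. card (B \<rightarrow>\<^sub>E (E \<rightarrow>\<^sub>E C)))"
            using fin\<B> fin by (intro card_SigmaI) auto
          also have "\<dots> = (\<Sum>B\<in>\<B>. (card C ^ card E) ^ card B)"
            using finB E by (intro sum.cong) (auto simp: card_PiE)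
          finally show ?thesis unfolding T_def using D by (simp add: card_cartesian_product card_PiE)
        qed
        also have "real \<dots> = real (card C) ^ ?d * (\<Sum>B\<in>\<B>. (real (card C) ^ card E) ^ card B)" by simp
        also have "\<dots> \<le> real (card C) ^ ?d * (\<Sum>B\<in>\<B>. R ^ card B)"
          by (intro mult_left_mono sum_mono power_mono) (auto simp: R_def)
        also have "\<dots> \<le> real (card C) ^ ?d * exp (?d * (\<epsilon> * ln (R / t) + t))"
          unfolding \<B>_def using count_marked_small_subsets[OF D(1), of R t \<epsilon>] t
          by (intro mult_left_mono) (auto simp: R_def)
        also have "\<dots> \<le> real (card C) ^ ?d * exp (?d * \<theta>)"
          using \<epsilon>(2) t(3) by (intro mult_left_mono) (auto intro!: mult_left_mono)
        also have "real (card C) ^ ?d = exp (?d * ln (card C))"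
          using C0[OF False S(2)] by (simp add: exp_of_nat_mult)
        finally show ?thesis by (simp add: exp_add[symmetric] distrib_left)
      qed simp
      then have "log_enat (separation_number \<kappa> (rho_inf \<rho> ?D) ?Map) \<le> ereal (?d * (ln (card C) + \<theta>))"
        by (rule log_enat_separation_number_le)
      then have "ereal (1 / ?d) * log_enat (separation_number \<kappa> (rho_inf \<rho> ?D) ?Map)
          \<le> ereal (1 / ?d) * ereal (?d * (ln (card C) + \<theta>))"
        by (intro ereal_mult_left_mono) auto
      also have "\<dots> = ereal (ln (card C)) + ereal \<theta>" using elim by simp
      finally show ?case .
    qed
    then have "?L \<delta> F \<le> ereal (ln (card C)) + ereal \<theta>" by (rule Limsup_bounded)
    moreover have "(INF \<delta>\<in>{0<..}. INF F\<in>{F. finite F \<and> F \<subseteq> carrier G}. ?L \<delta> F) \<le> ?L \<delta> F"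
      using \<delta>0 F by (intro INF_lower2[of \<delta>] INF_lower) auto
    ultimately show "(INF \<delta>\<in>{0<..}. INF F\<in>{F. finite F \<and> F \<subseteq> carrier G}. ?L \<delta> F) \<le> ereal (ln (card C)) + ereal \<theta>"
      by (rule order_trans[rotated])
  qed
qed

text \<open>
  Any assignment \<open>\<omega>\<close> of symbols to the points where \<open>\<sigma> n\<close> is multiplicative is realized by a model
  whose value at \<open>i\<close> has the symbol \<open>\<omega> (\<sigma> n g i)\<close> at \<open>g\<close>. Models of different assignments have
  different symbols somewhere, and are then separated at a nearby point \<open>\<sigma> n g i\<close>.
\<close>

lemma entropy_lower_bound:
  assumes sof: "sofic_approximation G D \<sigma>" and C: "C \<noteq> {}"
  shows "ereal (ln (card C)) \<le> sofic_entropy_wrt \<rho> G X \<alpha> D \<sigma>"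
proof -
  have finD: "finite (D n)" for n using sof by (simp add: sofic_approximation_def)
  have perm: "\<sigma> n g permutes D n" if "g \<in> carrier G" for n g
    using sof that by (simp add: sofic_approximation_def)
  have \<sigma>1: "\<sigma> n \<one> = id" for n using sof by (simp add: sofic_approximation_def)
  obtain c0 where c0: "c0 \<in> C" using C by auto
  have C1: "1 \<le> card C" using C finite_C by (simp add: Suc_le_eq card_gt_0_iff)
  then have lnC: "0 \<le> ln (card C)" by simp
  obtain E' \<eta> where E': "finite E'" "E' \<subseteq> carrier G" and \<eta>: "0 < \<eta>"
    and symb: "\<And>x y. \<lbrakk>x \<in> topspace X; y \<in> topspace X; \<And>g. g \<in> E' \<Longrightarrow> \<rho> (\<alpha> g x) (\<alpha> g y) < \<eta>\<rbrakk> \<Longrightarrow> c x = c y"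
    using finite_window_symbol by blast
  obtain K where K: "0 < K" "\<And>x y. \<lbrakk>x \<in> topspace X; y \<in> topspace X\<rbrakk> \<Longrightarrow> \<rho> x y \<le> K"
    using \<rho>_bounded by blast
  define \<kappa> where "\<kappa> = \<eta> / 2"
  let ?L = "\<lambda>\<delta> F. limsup (\<lambda>n. ereal (1 / real (card (D n))) *
          log_enat (separation_number \<kappa> (rho_inf \<rho> (D n)) (sofic_Map X \<alpha> \<rho> F \<delta> (D n) (\<sigma> n))))"
  have main: "ereal (ln (card C)) \<le> ?L \<delta> F" if \<delta>: "0 < \<delta>" and F: "finite F" "F \<subseteq> carrier G" for \<delta> F
  proof (rule ereal_le_epsilon2)
    fix \<theta> :: real assume \<theta>: "0 < \<theta>"
    define \<kappa>1 where "\<kappa>1 = min (\<delta> / 2) (\<eta> / 4)"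
    have \<kappa>1: "0 < \<kappa>1" "\<kappa>1 \<le> \<delta> / 2" "\<kappa>1 \<le> \<eta> / 4" using \<delta> \<eta> by (auto simp: \<kappa>1_def)
    obtain E where E: "finite E" "E \<subseteq> carrier G"
      and close: "\<And>x y. \<lbrakk>x \<in> topspace X; y \<in> topspace X; \<And>g. g \<in> E \<Longrightarrow> c (\<alpha> g x) = c (\<alpha> g y)\<rbrakk> \<Longrightarrow> \<rho> x y < \<kappa>1"
      using finite_window_close[OF \<kappa>1(1)] by blast
    define \<epsilon> where "\<epsilon> = min (\<delta>\<^sup>2 / (2 * K\<^sup>2)) (\<theta> / (1 + ln (card C)))"
    have \<epsilon>: "0 < \<epsilon>" "\<epsilon> \<le> \<delta>\<^sup>2 / (2 * K\<^sup>2)" "\<epsilon> \<le> \<theta> / (1 + ln (card C))"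
      using \<delta> K(1) \<theta> lnC by (auto simp: \<epsilon>_def intro!: divide_pos_pos)
    have \<epsilon>\<theta>: "\<epsilon> * ln (card C) \<le> \<theta>"
    proof -
      have "\<epsilon> * (1 + ln (card C)) \<le> \<theta>" using \<epsilon>(3) lnC by (simp add: le_divide_eq)
      then show ?thesis using \<epsilon>(1) by (simp add: distrib_left)
    qed
    have few_bad: "eventually (\<lambda>n. card {i \<in> D n. \<exists>(g, f)\<in>E \<times> (F \<union> E'). \<sigma> n g (\<sigma> n f i) \<noteq> \<sigma> n (g \<otimes> f) i}
        \<le> \<epsilon> * card (D n)) sequentially"
      by (rule sofic_approximation_few_bad_points[OF sof]) (use E E' F \<epsilon> in auto)
    have "eventually (\<lambda>n. ereal (ln (card C) - \<theta>) \<le> ereal (1 / real (card (D n))) *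
          log_enat (separation_number \<kappa> (rho_inf \<rho> (D n)) (sofic_Map X \<alpha> \<rho> F \<delta> (D n) (\<sigma> n)))) sequentially"
      using sofic_approximation_card_eventually[OF sof] few_bad
    proof eventually_elim
      case (elim n)
      let ?D = "D n" and ?s = "\<sigma> n" and ?Map = "sofic_Map X \<alpha> \<rho> F \<delta> (D n) (\<sigma> n)"
      have D: "finite ?D" "?D \<noteq> {}" using elim finD by (auto simp: card_gt_0_iff)
      let ?d = "card ?D"
      define B where "B = {i \<in> ?D. \<exists>(g, f)\<in>E \<times> (F \<union> E'). ?s g (?s f i) \<noteq> ?s (g \<otimes> f) i}"
      have B: "B \<subseteq> ?D" "card B \<le> \<epsilon> * ?d" using elim(2) by (auto simp: B_def)
      have finB: "finite B" using B(1) D(1) finite_subset by blast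
      have sD: "?s g i \<in> ?D" if "g \<in> carrier G" "i \<in> ?D" for g i
        using perm[OF that(1)] that(2) by (simp add: permutes_in_image)
      define \<Omega> where "\<Omega> = (?D - B) \<rightarrow>\<^sub>E C"
      \<comment> \<open>the orbit of a good point may run through bad points, where any symbol will do\<close>
      define ext where "ext = (\<lambda>\<omega> i. if i \<in> ?D - B then \<omega> i else c0)"
      have ext_C: "ext \<omega> i \<in> C" if "\<omega> \<in> \<Omega>" for \<omega> i using that c0 by (auto simp: ext_def \<Omega>_def)
      have "\<exists>x\<in>topspace X. \<forall>g\<in>carrier G. c (\<alpha> g x) = ext \<omega> (?s g i)" if "\<omega> \<in> \<Omega>" for \<omega> i
        by (rule full) (rule ext_C[OF that])
      then obtain \<Phi> where \<Phi>: "\<And>\<omega> i. \<omega> \<in> \<Omega> \<Longrightarrow> \<Phi> \<omega> i \<in> topspace X"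
        "\<And>\<omega> i g. \<lbrakk>\<omega> \<in> \<Omega>; g \<in> carrier G\<rbrakk> \<Longrightarrow> c (\<alpha> g (\<Phi> \<omega> i)) = ext \<omega> (?s g i)" by metis
      define \<phi> where "\<phi> = (\<lambda>\<omega>. restrict (\<Phi> \<omega>) ?D)"
      have near: "\<rho> (\<Phi> \<omega> (?s f i)) (\<alpha> f (\<Phi> \<omega> i)) < \<kappa>1" if "\<omega> \<in> \<Omega>" "f \<in> F \<union> E'" "i \<in> ?D - B" for \<omega> f i
      proof (rule close)
        have fG: "f \<in> carrier G" using that F E' by auto
        show "\<Phi> \<omega> (?s f i) \<in> topspace X" "\<alpha> f (\<Phi> \<omega> i) \<in> topspace X" using \<Phi>(1) \<alpha>_closed fG that by auto
        fix g assume g: "g \<in> E"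
        then have gG: "g \<in> carrier G" using E by auto
        have "?s g (?s f i) = ?s (g \<otimes> f) i" using that g by (auto simp: B_def)
        then show "c (\<alpha> g (\<Phi> \<omega> (?s f i))) = c (\<alpha> g (\<alpha> f (\<Phi> \<omega> i)))"
          using \<Phi> that gG fG by (simp add: \<alpha>_mult)
      qed
      have \<phi>Map: "\<phi> \<omega> \<in> ?Map" if \<omega>: "\<omega> \<in> \<Omega>" for \<omega>
        unfolding sofic_Map_def
      proof (intro CollectI conjI ballI)
        show "\<phi> \<omega> \<in> ?D \<rightarrow>\<^sub>E topspace X" using \<Phi>(1)[OF \<omega>] by (auto simp: \<phi>_def)
        fix f assume f: "f \<in> F"
        then have fG: "f \<in> carrier G" using F by auto
        let ?r = "\<lambda>i. \<rho> ((\<phi> \<omega> \<circ> ?s f) i) ((\<alpha> f \<circ> \<phi> \<omega>) i)"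
        have r: "?r i = \<rho> (\<Phi> \<omega> (?s f i)) (\<alpha> f (\<Phi> \<omega> i))" if "i \<in> ?D" for i
          using that sD[OF fG that] by (simp add: \<phi>_def)
        have r0: "0 \<le> ?r i" "?r i \<le> K" if "i \<in> ?D" for i
          unfolding r[OF that] using \<Phi>(1)[OF \<omega>] \<alpha>_closed[OF fG] \<rho>_nonneg K(2) by auto
        have "(\<Sum>i\<in>?D. (?r i)\<^sup>2) = (\<Sum>i\<in>?D - B. (?r i)\<^sup>2) + (\<Sum>i\<in>B. (?r i)\<^sup>2)"
          using D B by (simp add: sum.subset_diff)
        also have "(\<Sum>i\<in>?D - B. (?r i)\<^sup>2) \<le> (\<Sum>i\<in>?D - B. \<kappa>1\<^sup>2)"
          using near[OF \<omega>] f r r0 by (intro sum_mono power_mono) (auto intro: less_imp_le)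
        also have "\<dots> \<le> (\<Sum>i\<in>?D. \<kappa>1\<^sup>2)" using D by (intro sum_mono2) auto
        also have "(\<Sum>i\<in>B. (?r i)\<^sup>2) \<le> (\<Sum>i\<in>B. K\<^sup>2)"
          using B r0 by (intro sum_mono power_mono) auto
        finally have "(\<Sum>i\<in>?D. (?r i)\<^sup>2) \<le> ?d * \<kappa>1\<^sup>2 + card B * K\<^sup>2" by simp
        also have "\<dots> \<le> ?d * \<kappa>1\<^sup>2 + (\<epsilon> * ?d) * K\<^sup>2"
          using B(2) by (intro add_left_mono mult_right_mono) auto
        also have "\<dots> = ?d * (\<kappa>1\<^sup>2 + \<epsilon> * K\<^sup>2)" by (simp add: algebra_simps)
        finally have "1 / ?d * (\<Sum>i\<in>?D. (?r i)\<^sup>2) \<le> \<kappa>1\<^sup>2 + \<epsilon> * K\<^sup>2"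
          using elim by (simp add: field_simps)
        also have "\<kappa>1\<^sup>2 \<le> (\<delta> / 2)\<^sup>2" using \<kappa>1 by (intro power_mono) auto
        also have "(\<delta> / 2)\<^sup>2 = \<delta>\<^sup>2 / 4" by (simp add: power_divide)
        also have "\<epsilon> * K\<^sup>2 \<le> \<delta>\<^sup>2 / 2" using \<epsilon>(2) K(1) by (simp add: field_simps)
        also have "\<delta>\<^sup>2 / 4 + \<delta>\<^sup>2 / 2 < \<delta>\<^sup>2" using \<delta> by simp
        finally have "sqrt (1 / ?d * (\<Sum>i\<in>?D. (?r i)\<^sup>2)) < sqrt (\<delta>\<^sup>2)" by (simp only: real_sqrt_less_iff) 
        then show "rho_2 \<rho> ?D (\<phi> \<omega> \<circ> ?s f) (\<alpha> f \<circ> \<phi> \<omega>) < \<delta>"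
          using \<delta> by (simp add: rho_2_def)
      qed
      have c\<phi>: "c (\<phi> \<omega> i) = \<omega> i" if "\<omega> \<in> \<Omega>" "i \<in> ?D - B" for \<omega> i
        using \<Phi>(2)[OF that(1) one_closed, of i] \<Phi>(1)[OF that(1)] that(2) by (simp add: \<phi>_def \<alpha>_one \<sigma>1 ext_def)
      have diff: "\<exists>i\<in>?D - B. \<omega> i \<noteq> \<omega>' i" if "\<omega> \<in> \<Omega>" "\<omega>' \<in> \<Omega>" "\<omega> \<noteq> \<omega>'" for \<omega> \<omega>'
        using that PiE_ext[of \<omega> "?D - B" "\<lambda>_. C" \<omega>'] unfolding \<Omega>_def by blast
      have inj: "inj_on \<phi> \<Omega>"
        by (rule inj_onI) (metis c\<phi> diff)
      have sep: "\<kappa> \<le> rho_inf \<rho> ?D (\<phi> \<omega>) (\<phi> \<omega>')" if \<omega>: "\<omega> \<in> \<Omega>" "\<omega>' \<in> \<Omega>" and ne: "\<omega> \<noteq> \<omega>'" for \<omega> \<omega>'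
      proof -
        obtain i where i: "i \<in> ?D - B" "\<omega> i \<noteq> \<omega>' i" using diff[OF \<omega> ne] by blast
        have "c (\<Phi> \<omega> i) \<noteq> c (\<Phi> \<omega>' i)" using c\<phi>[OF \<omega>(1) i(1)] c\<phi>[OF \<omega>(2) i(1)] i by (simp add: \<phi>_def)
        then obtain g where g: "g \<in> E'" "\<eta> \<le> \<rho> (\<alpha> g (\<Phi> \<omega> i)) (\<alpha> g (\<Phi> \<omega>' i))"
          using symb[of "\<Phi> \<omega> i" "\<Phi> \<omega>' i"] \<Phi>(1) \<omega> by (meson not_le)
        have gG: "g \<in> carrier G" using g E' by auto
        let ?j = "?s g i"
        have j: "?j \<in> ?D" using sD[OF gG] i by auto
        have mem: "\<alpha> g (\<Phi> \<omega> i) \<in> topspace X" "\<alpha> g (\<Phi> \<omega>' i) \<in> topspace X" "\<Phi> \<omega> ?j \<in> topspace X" "\<Phi> \<omega>' ?j \<in> topspace X"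
          using \<Phi>(1) \<omega> \<alpha>_closed gG by auto
        have "\<rho> (\<Phi> \<omega> ?j) (\<alpha> g (\<Phi> \<omega> i)) < \<eta> / 4" "\<rho> (\<Phi> \<omega>' ?j) (\<alpha> g (\<Phi> \<omega>' i)) < \<eta> / 4"
          using near[OF \<omega>(1), of g i] near[OF \<omega>(2), of g i] g i \<kappa>1 by auto
        moreover have "\<rho> (\<alpha> g (\<Phi> \<omega> i)) (\<alpha> g (\<Phi> \<omega>' i)) \<le>
            \<rho> (\<Phi> \<omega> ?j) (\<alpha> g (\<Phi> \<omega> i)) + \<rho> (\<Phi> \<omega> ?j) (\<Phi> \<omega>' ?j) + \<rho> (\<Phi> \<omega>' ?j) (\<alpha> g (\<Phi> \<omega>' i))"
          using \<rho>_triangle[of "\<alpha> g (\<Phi> \<omega> i)" "\<Phi> \<omega> ?j" "\<alpha> g (\<Phi> \<omega>' i)"]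
            \<rho>_triangle[of "\<Phi> \<omega> ?j" "\<Phi> \<omega>' ?j" "\<alpha> g (\<Phi> \<omega>' i)"] \<rho>_sym[of "\<alpha> g (\<Phi> \<omega> i)" "\<Phi> \<omega> ?j"] mem by simp
        ultimately have "\<kappa> \<le> \<rho> (\<Phi> \<omega> ?j) (\<Phi> \<omega>' ?j)" using g(2) by (simp add: \<kappa>_def)
        also have "\<dots> = \<rho> (\<phi> \<omega> ?j) (\<phi> \<omega>' ?j)" using j by (simp add: \<phi>_def)
        also have "\<dots> \<le> rho_inf \<rho> ?D (\<phi> \<omega>) (\<phi> \<omega>')"
          unfolding rho_inf_def using D j by (intro Max_ge) auto
        finally show ?thesis .
      qed
      have fin\<Omega>: "finite \<Omega>" using D finite_C by (auto simp: \<Omega>_def intro: finite_PiE)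
      have card\<Omega>: "card \<Omega> = card C ^ card (?D - B)" using D by (simp add: \<Omega>_def card_PiE)
      have \<Omega>0: "\<Omega> \<noteq> {}" using card\<Omega> C1 by auto
      have dB: "real (card (?D - B)) \<ge> (1 - \<epsilon>) * ?d"
      proof -
        have "card (?D - B) = ?d - card B" "card B \<le> ?d"
          using D B finB by (auto simp: card_Diff_subset card_mono)
        then have "real (card (?D - B)) = ?d - card B" by (simp add: of_nat_diff)
        then show ?thesis using B(2) by (simp add: algebra_simps)
      qed
      have "ereal (ln (card (\<phi> ` \<Omega>))) \<le> log_enat (separation_number \<kappa> (rho_inf \<rho> ?D) ?Map)"
        using fin\<Omega> \<Omega>0 \<phi>Map sep by (intro log_enat_separation_number_ge) (auto simp: pairwise_def)
      moreover have "ln (card (\<phi> ` \<Omega>)) = card (?D - B) * ln (card C)"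
        using C1 by (simp add: card_image[OF inj] card\<Omega> ln_realpow)
      ultimately have "ereal (1 / ?d) * ereal (card (?D - B) * ln (card C)) \<le>
          ereal (1 / ?d) * log_enat (separation_number \<kappa> (rho_inf \<rho> ?D) ?Map)"
        by (intro ereal_mult_left_mono) auto
      moreover have "ln (card C) - \<theta> \<le> 1 / ?d * (card (?D - B) * ln (card C))"
      proof -
        have "(1 - \<epsilon>) * ?d * ln (card C) \<le> card (?D - B) * ln (card C)"
          using dB lnC by (intro mult_right_mono)
        then have "(1 - \<epsilon>) * ln (card C) \<le> 1 / ?d * (card (?D - B) * ln (card C))"
          using elim by (simp add: field_simps)
        then show ?thesis using \<epsilon>\<theta> by (simp add: algebra_simps)
      qed
      ultimately show ?case by (metis (no_types, lifting) ereal_less_eq(3) order_trans times_ereal.simps(1))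
    qed
    then have "ereal (ln (card C) - \<theta>) \<le> ?L \<delta> F"
      by (intro le_Limsup) auto
    then have "ereal (ln (card C) - \<theta>) + ereal \<theta> \<le> ?L \<delta> F + ereal \<theta>" by (rule add_right_mono)
    then show "ereal (ln (card C)) \<le> ?L \<delta> F + ereal \<theta>" by simp
  qed
  have "ereal (ln (card C)) \<le> (INF \<delta>\<in>{0<..}. INF F\<in>{F. finite F \<and> F \<subseteq> carrier G}. ?L \<delta> F)"
    using main by (intro INF_greatest) auto
  also have "\<dots> \<le> sofic_entropy_wrt \<rho> G X \<alpha> D \<sigma>"
    unfolding sofic_entropy_wrt_def using \<eta> by (intro SUP_upper) (auto simp: \<kappa>_def)
  finally show ?thesis .
qed

end

lemma generating_pseudometric_exists:
  assumes "metrizable_space X" "group G" "\<And>x. x \<in> topspace X \<Longrightarrow> \<alpha> \<one>\<^bsub>G\<^esub> x = x"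
  shows "\<exists>\<rho>. generating_pseudometric G X \<alpha> \<rho>"
proof -
  obtain M d where M: "Metric_space M d" "X = Metric_space.mtopology M d"
    using assms(1) unfolding metrizable_space_def by blast
  interpret Metric_space M d by (rule M)
  have top: "topspace X = M" using M by simp
  have "continuous_map (prod_topology X X) euclideanreal (\<lambda>(x, y). d x y)"
    unfolding M(2) using continuous_map_mdist[OF continuous_map_fst continuous_map_snd, where m="metric (M, d)"]
    by (simp add: case_prod_unfold)
  then have "continuous_pseudometric X d"
    unfolding continuous_pseudometric_def top using commute triangle by auto
  moreover have "\<exists>g\<in>carrier G. 0 < d (\<alpha> g x) (\<alpha> g y)" if "x \<in> M" "y \<in> M" "x \<noteq> y" for x y
    using that assms(2,3) top by (intro bexI[of _ "\<one>\<^bsub>G\<^esub>"]) (auto simp: group.is_monoid mdist_pos_less)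
  ultimately show ?thesis unfolding generating_pseudometric_def top by blast
qed

text \<open>
  The model that is constantly the fixed point is exactly equivariant, so no separation number is
  zero.
\<close>

lemma sofic_entropy_nonneg:
  assumes "metrizable_space X" "group G" "\<And>x. x \<in> topspace X \<Longrightarrow> \<alpha> \<one>\<^bsub>G\<^esub> x = x"
    and x: "x \<in> topspace X" "\<And>g. g \<in> carrier G \<Longrightarrow> \<alpha> g x = x"
    and sof: "sofic_approximation G D \<sigma>"
  shows "0 \<le> sofic_entropy G X \<alpha> D \<sigma>"
proof -
  define \<rho> where "\<rho> = (SOME \<rho>. generating_pseudometric G X \<alpha> \<rho>)"
  have "generating_pseudometric G X \<alpha> \<rho>"
  proof -
    have "\<exists>\<rho>. generating_pseudometric G X \<alpha> \<rho>"
      by (rule generating_pseudometric_exists) (use assms in auto)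
    then show ?thesis unfolding \<rho>_def by (rule someI_ex)
  qed
  then have \<rho>x: "\<rho> x x = 0"
    using x by (auto simp: generating_pseudometric_def continuous_pseudometric_def)
  have perm: "\<sigma> n g permutes D n" if "g \<in> carrier G" for n g
    using sof that by (simp add: sofic_approximation_def)
  have "0 \<le> limsup (\<lambda>n. ereal (1 / real (card (D n))) *
          log_enat (separation_number 1 (rho_inf \<rho> (D n)) (sofic_Map X \<alpha> \<rho> F \<delta> (D n) (\<sigma> n))))"
    if \<delta>: "0 < \<delta>" and F: "F \<subseteq> carrier G" for \<delta> F
  proof -
    have "0 \<le> ereal (1 / real (card (D n))) *
          log_enat (separation_number 1 (rho_inf \<rho> (D n)) (sofic_Map X \<alpha> \<rho> F \<delta> (D n) (\<sigma> n)))" for n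
    proof -
      let ?\<phi> = "\<lambda>i\<in>D n. x"
      have "rho_2 \<rho> (D n) (?\<phi> \<circ> \<sigma> n f) (\<alpha> f \<circ> ?\<phi>) = 0" if f: "f \<in> F" for f
      proof -
        have "f \<in> carrier G" using f F by auto
        then have "\<rho> ((?\<phi> \<circ> \<sigma> n f) i) ((\<alpha> f \<circ> ?\<phi>) i) = 0" if "i \<in> D n" for i
          using that perm[of f n] x \<rho>x by (simp add: permutes_in_image)
        then show ?thesis by (simp add: rho_2_def)
      qed
      then have "?\<phi> \<in> sofic_Map X \<alpha> \<rho> F \<delta> (D n) (\<sigma> n)" using \<delta> x by (auto simp: sofic_Map_def)
      then have "ereal (ln (card {?\<phi>})) \<le> log_enat (separation_number 1 (rho_inf \<rho> (D n)) (sofic_Map X \<alpha> \<rho> F \<delta> (D n) (\<sigma> n)))"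
        by (intro log_enat_separation_number_ge) auto
      then have "0 \<le> log_enat (separation_number 1 (rho_inf \<rho> (D n)) (sofic_Map X \<alpha> \<rho> F \<delta> (D n) (\<sigma> n)))"
        by (simp add: zero_ereal_def)
      then show ?thesis by (intro ereal_0_le_mult) auto
    qed
    then show ?thesis by (intro le_Limsup always_eventually) auto
  qed
  then have "0 \<le> (INF \<delta>\<in>{0<..}. INF F\<in>{F. finite F \<and> F \<subseteq> carrier G}.
      limsup (\<lambda>n. ereal (1 / real (card (D n))) *
        log_enat (separation_number 1 (rho_inf \<rho> (D n)) (sofic_Map X \<alpha> \<rho> F \<delta> (D n) (\<sigma> n)))))"
    by (intro INF_greatest) auto
  also have "\<dots> \<le> sofic_entropy_wrt \<rho> G X \<alpha> D \<sigma>"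
    unfolding sofic_entropy_wrt_def by (intro SUP_upper) auto
  finally show ?thesis by (simp add: sofic_entropy_def \<rho>_def)
qed


section \<open>Filling spheres of singular simplices\<close>

lemma continuous_map_Min_coordinates:
  fixes f :: "'a \<Rightarrow> nat \<Rightarrow> real"
  assumes "\<And>i. i \<le> n \<Longrightarrow> continuous_map X euclideanreal (\<lambda>x. f x i)"
  shows "continuous_map X euclideanreal (\<lambda>x. Min ((\<lambda>i. f x i) ` {..n}))"
  using assms
proof (induction n)
  case 0
  then show ?case by simp
next
  case (Suc n)
  have eq: "Min ((\<lambda>i. f x i) ` {..Suc n}) = min (f x (Suc n)) (Min ((\<lambda>i. f x i) ` {..n}))" for x
    by (simp add: atMost_Suc)
  show ?case unfolding eq
    by (intro continuous_map_real_min) (use Suc in auto)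
qed

definition drop_coordinate :: "nat \<Rightarrow> (nat \<Rightarrow> 'a) \<Rightarrow> nat \<Rightarrow> 'a" where
  "drop_coordinate i y = (\<lambda>j. if j < i then y j else y (Suc j))"

lemma simplical_face_drop_coordinate:
  "(y :: nat \<Rightarrow> real) i = 0 \<Longrightarrow> simplical_face i (drop_coordinate i y) = y"
  by (auto simp: simplical_face_def drop_coordinate_def fun_eq_iff)

lemma drop_coordinate_simplical_face:
  "drop_coordinate i (simplical_face i y) = y"
  by (auto simp: simplical_face_def drop_coordinate_def fun_eq_iff)

lemma drop_coordinate_in_standard_simplex:
  assumes "y \<in> standard_simplex (Suc k)" "y i = 0" "i \<le> Suc k"
  shows "drop_coordinate i y \<in> standard_simplex k"
proof -
  have "(\<Sum>j\<le>k. drop_coordinate i y j) = (\<Sum>j\<in>{..Suc k} - {i}. y j)"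
    by (rule sum.reindex_bij_witness[where i="\<lambda>j. if j < i then j else j - 1"
          and j="\<lambda>j. if j < i then j else Suc j"])
      (use assms in \<open>auto simp: drop_coordinate_def split: if_splits\<close>)
  also have "\<dots> = (\<Sum>j\<in>{..Suc k}. y j)"
    using assms by (intro sum.mono_neutral_left) auto
  finally show ?thesis
    using assms by (auto simp: standard_simplex_def drop_coordinate_def)
qed

lemma singular_face_apply:
  "x \<in> standard_simplex (p - Suc 0) \<Longrightarrow> singular_face p k f x = f (simplical_face k x)"
  by (simp add: singular_face_def)

text \<open>
  The compatibility of the faces is the simplicial identity, which says that the maps agree where two
  closed faces of the simplex meet. When \<open>k = 0\<close> the two faces are disjoint points.
\<close>

lemma glue_singular_faces:
  fixes g :: "nat \<Rightarrow> (nat \<Rightarrow> real) \<Rightarrow> 'a"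
  assumes g: "\<And>i. i \<le> Suc k \<Longrightarrow> singular_simplex k X (g i)"
    and compat: "\<And>i j. \<lbrakk>0 < k; i < j; j \<le> Suc k\<rbrakk> \<Longrightarrow> singular_face k i (g j) = singular_face k (j - 1) (g i)"
  obtains b where
    "continuous_map (subtopology (powertop_real UNIV) {y \<in> standard_simplex (Suc k). \<exists>i\<le>Suc k. y i = 0}) X b"
    "\<And>i y. \<lbrakk>i \<le> Suc k; y \<in> standard_simplex (Suc k); y i = 0\<rbrakk> \<Longrightarrow> b y = g i (drop_coordinate i y)"
proof -
  let ?P = "powertop_real (UNIV :: nat set)"
  let ?D = "{y \<in> standard_simplex (Suc k). \<exists>i\<le>Suc k. y i = 0}"
  have less: "g i (drop_coordinate i y) = g j (drop_coordinate j y)"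
    if y: "y \<in> standard_simplex (Suc k)" "y i = 0" "y j = 0" and ij: "i < j" "j \<le> Suc k" for i j y
  proof -
    have k: "0 < k"
    proof (rule ccontr)
      assume "\<not> 0 < k"
      then have "k = 0" "i = 0" "j = 1" using ij by auto
      then show False using y by (auto simp: standard_simplex_def)
    qed
    define z where "z = drop_coordinate i (drop_coordinate j y)"
    have zi: "drop_coordinate j y i = 0" "drop_coordinate i y (j - 1) = 0"
      using y ij by (auto simp: drop_coordinate_def)
    have z: "drop_coordinate (j - 1) (drop_coordinate i y) = z"
      using ij by (auto simp: z_def drop_coordinate_def fun_eq_iff)
    have dj: "drop_coordinate j y \<in> standard_simplex k"
      using drop_coordinate_in_standard_simplex y ij by blast
    have "z \<in> standard_simplex (k - 1)"
      unfolding z_def using k ij zi dj drop_coordinate_in_standard_simplex[of "drop_coordinate j y" "k - 1" i]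
      by simp
    then have "singular_face k i (g j) z = g j (drop_coordinate j y)"
      and "singular_face k (j - 1) (g i) z = g i (drop_coordinate i y)"
      using zi z by (simp_all add: singular_face_apply simplical_face_drop_coordinate z_def)
        (metis simplical_face_drop_coordinate)
    then show ?thesis using compat[OF k ij] by simp
  qed
  have eq: "g i (drop_coordinate i y) = g j (drop_coordinate j y)"
    if "y \<in> standard_simplex (Suc k)" "y i = 0" "y j = 0" "i \<le> Suc k" "j \<le> Suc k" for i j y
    using less[of y i j] less[of y j i] that by (metis linorder_neqE_nat)
  define T where "T = (\<lambda>i. {y \<in> ?D. y i = 0})"
  have "\<exists>b. continuous_map (subtopology ?P ?D) X b \<and>
      (\<forall>x i. i \<in> {..Suc k} \<and> x \<in> topspace (subtopology ?P ?D) \<inter> T i \<longrightarrow> b x = g i (drop_coordinate i x))"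
  proof (rule pasting_lemma_exists_closed[where I="{..Suc k}" and T=T and f="\<lambda>i x. g i (drop_coordinate i x)"])
    show "topspace (subtopology ?P ?D) \<subseteq> \<Union> (T ` {..Suc k})"
      by (auto simp: T_def)
    show "closedin (subtopology ?P ?D) (T i)" if "i \<in> {..Suc k}" for i
    proof -
      have "closedin (subtopology ?P ?D) {y \<in> topspace (subtopology ?P ?D). y i \<in> {0}}"
        by (rule closedin_continuous_map_preimage)
          (auto intro: continuous_map_from_subtopology continuous_map_product_projection)
      then show ?thesis by (simp add: T_def)
    qed
    show "continuous_map (subtopology (subtopology ?P ?D) (T i)) X (\<lambda>x. g i (drop_coordinate i x))"
      if i: "i \<in> {..Suc k}" for i
    proof -
      have "continuous_map (subtopology ?P ?D) euclideanreal (\<lambda>x. drop_coordinate i x l)" for l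
        unfolding drop_coordinate_def
        by (cases "l < i") (auto intro: continuous_map_from_subtopology continuous_map_product_projection)
      then have "continuous_map (subtopology (subtopology ?P ?D) (T i))
          (subtopology ?P (standard_simplex k)) (drop_coordinate i)"
        using i by (auto simp: continuous_map_in_subtopology continuous_map_componentwise_UNIV T_def
            intro: continuous_map_from_subtopology drop_coordinate_in_standard_simplex)
      moreover have "continuous_map (subtopology ?P (standard_simplex k)) X (g i)"
        using g i by (auto simp: singular_simplex_def)
      ultimately show ?thesis
        using continuous_map_compose by (fastforce simp: o_def)
    qed
  next
    fix i j x
    assume "i \<in> {..Suc k}" "j \<in> {..Suc k}" "x \<in> topspace (subtopology ?P ?D) \<inter> T i \<inter> T j"
    then show "g i (drop_coordinate i x) = g j (drop_coordinate j x)"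
      using eq[of x i j] by (simp add: T_def)
  qed auto
  then obtain b where "continuous_map (subtopology ?P ?D) X b"
    "\<And>x i. \<lbrakk>i \<in> {..Suc k}; x \<in> topspace (subtopology ?P ?D) \<inter> T i\<rbrakk> \<Longrightarrow> b x = g i (drop_coordinate i x)"
    by blast
  then show thesis
    by (intro that[of b]) (auto simp: T_def)
qed

text \<open>
  The radial projection from the barycenter carries the sphere to the boundary of the simplex, so a
  null-homotopy of the resulting map on the sphere is a filling of \<open>b\<close> in polar coordinates.
\<close>

lemma extend_over_standard_simplex:
  fixes b :: "(nat \<Rightarrow> real) \<Rightarrow> 'a"
  assumes conn: "n_connected_space n X" and kn: "k \<le> n"
    and b: "continuous_map (subtopology (powertop_real UNIV)
              {y \<in> standard_simplex (Suc k). \<exists>i\<le>Suc k. y i = 0}) X b"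
  obtains f where "singular_simplex (Suc k) X f"
    "\<And>i y. \<lbrakk>i \<le> Suc k; y \<in> standard_simplex (Suc k); y i = 0\<rbrakk> \<Longrightarrow> f y = b y"
proof -
  let ?P = "powertop_real (UNIV :: nat set)"
  let ?\<Delta> = "standard_simplex (Suc k)"
  let ?D = "{y \<in> standard_simplex (Suc k). \<exists>i\<le>Suc k. y i = 0}"
  define N where "N = real (k + 2)"
  have N: "N > 0" by (simp add: N_def)
  define mn where "mn = (\<lambda>x::nat \<Rightarrow> real. Min ((\<lambda>i. x i) ` {..Suc k}))"
  have mn_le: "mn x \<le> x i" if "i \<le> Suc k" for x i
    using that by (auto simp: mn_def)
  have mn_ex: "\<exists>i\<le>Suc k. mn x = x i" for x
  proof -
    have "mn x \<in> (\<lambda>i. x i) ` {..Suc k}" unfolding mn_def by (rule Min_in) auto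
    then show ?thesis by auto
  qed
  have proj: "continuous_map (subtopology ?P A) euclideanreal (\<lambda>x. x i)" for A i
    by (intro continuous_map_from_subtopology continuous_map_product_projection) auto
  \<comment> \<open>\<open>hat\<close> places the sphere in the hyperplane of coordinate sum zero, and \<open>q\<close> follows the ray from the
    barycenter in this direction until the least coordinate becomes zero\<close>
  define hat where "hat = (\<lambda>(u::nat \<Rightarrow> real) i. if i \<le> k then u i else if i = Suc k then - (\<Sum>j\<le>k. u j) else 0)"
  have sum_hat: "(\<Sum>i\<le>Suc k. hat u i) = 0" for u
    by (simp add: hat_def)
  have mn_hat: "mn (hat u) < 0" if u: "u \<in> topspace (nsphere k)" for u
  proof (rule ccontr)
    assume "\<not> mn (hat u) < 0"
    then have "\<forall>i\<in>{..Suc k}. 0 \<le> hat u i" using mn_le[of _ "hat u"] by force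
    then have "\<forall>i\<in>{..Suc k}. hat u i = 0"
      using sum_hat[of u] by (subst (asm) sum_nonneg_eq_0_iff) auto
    then have "hat u i = 0" if "i \<le> k" for i using that by simp
    then have "\<forall>i\<le>k. u i = 0" by (simp add: hat_def)
    then show False using u by (simp add: nsphere)
  qed
  define q where "q = (\<lambda>u i. if i \<le> Suc k then 1 / N + hat u i / (N * - mn (hat u)) else 0)"
  have q_D: "q u \<in> ?D" if u: "u \<in> topspace (nsphere k)" for u
  proof -
    have m: "mn (hat u) < 0" using mn_hat[OF u] .
    have nonneg: "0 \<le> q u i" for i
    proof (cases "i \<le> Suc k")
      case True
      have "q u i = (- mn (hat u) + hat u i) / (N * - mn (hat u))"
        using True m N by (simp add: q_def field_simps)
      moreover have "0 \<le> (- mn (hat u) + hat u i) / (N * - mn (hat u))"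
        using m N mn_le[OF True, of "hat u"] by (intro divide_nonneg_nonneg mult_nonneg_nonneg) auto
      ultimately show ?thesis by simp
    qed (simp add: q_def)
    have "(\<Sum>i\<le>Suc k. q u i) = (\<Sum>i\<le>Suc k. 1 / N) + (\<Sum>i\<le>Suc k. hat u i) / (N * - mn (hat u))"
      by (simp add: q_def sum.distrib sum_subtractf sum_divide_distrib[symmetric] del: sum.atMost_Suc)
    also have "\<dots> = 1" unfolding sum_hat by (simp add: N_def)
    finally have sum1: "(\<Sum>i\<le>Suc k. q u i) = 1" .
    have "q u i \<le> 1" for i
    proof (cases "i \<le> Suc k")
      case True
      then have "q u i \<le> (\<Sum>i\<le>Suc k. q u i)" using nonneg by (intro member_le_sum) auto
      then show ?thesis using sum1 by simp
    qed (simp add: q_def)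
    moreover obtain i where "i \<le> Suc k" "mn (hat u) = hat u i" using mn_ex by blast
    then have "i \<le> Suc k" "q u i = 0" using m N by (auto simp: q_def field_simps)
    ultimately show ?thesis
      using nonneg sum1 by (auto simp: standard_simplex_def q_def simp del: sum.atMost_Suc)
  qed
  have cont_hat: "continuous_map (nsphere k) euclideanreal (\<lambda>u. hat u i)" for i
    unfolding hat_def
    by (auto intro!: continuous_intros continuous_map_nsphere_projection)
  have q_cont: "continuous_map (nsphere k) (subtopology ?P ?D) q"
    unfolding continuous_map_in_subtopology continuous_map_componentwise_UNIV
  proof (intro conjI allI)
    fix i
    have "continuous_map (nsphere k) euclideanreal (\<lambda>u. mn (hat u))"
      unfolding mn_def by (rule continuous_map_Min_coordinates) (rule cont_hat)
    moreover have "mn (hat u) \<noteq> 0" if "u \<in> topspace (nsphere k)" for u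
      using mn_hat[OF that] by simp
    ultimately show "continuous_map (nsphere k) euclideanreal (\<lambda>u. q u i)"
      unfolding q_def using N
      by (cases "i \<le> Suc k") (auto intro!: continuous_intros cont_hat)
  qed (use q_D in auto)
  have "continuous_map (nsphere k) X (b \<circ> q)"
    using continuous_map_compose[OF q_cont b] .
  then obtain c where c: "c \<in> topspace X" "homotopic_with (\<lambda>_. True) (nsphere k) X (b \<circ> q) (\<lambda>_. c)"
    using conn kn unfolding n_connected_space_def by blast
  then obtain h where h: "continuous_map (prod_topology (top_of_set {0..1::real}) (nsphere k)) X h"
      and h0: "\<And>u. h (0, u) = b (q u)" and h1: "\<And>u. h (1, u) = c"
    unfolding homotopic_with_def by auto
  \<comment> \<open>\<open>t\<close> is \<open>0\<close> at the barycenter and \<open>1\<close> on the boundary, and \<open>dir\<close> inverts \<open>q\<close> on the boundary; the map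
    is constant near the barycenter, where \<open>dir\<close> is undefined\<close>
  define t where "t = (\<lambda>y. 1 - N * mn y)"
  define r where "r = (\<lambda>y. sqrt (\<Sum>i\<le>k. (y i - 1 / N)\<^sup>2))"
  define dir where "dir = (\<lambda>y i. if i \<le> k then (y i - 1 / N) / r y else 0)"
  define f where "f = (\<lambda>y\<in>?\<Delta>. if t y \<le> 1/2 then c else h (2 - 2 * t y, dir y))"
  have mn0: "0 \<le> mn y" if "y \<in> ?\<Delta>" for y
    using mn_ex[of y] that by (auto simp: standard_simplex_def)
  have r_pos: "r y > 0" if y: "y \<in> ?\<Delta>" "t y \<ge> 1/2" for y
  proof (rule ccontr)
    assume "\<not> r y > 0"
    then have "(\<Sum>i\<le>k. (y i - 1 / N)\<^sup>2) = 0"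
      unfolding r_def by (meson real_sqrt_gt_0_iff not_less sum_nonneg zero_le_power2 order_antisym)
    then have *: "\<forall>i\<le>k. y i = 1 / N"
      by (subst (asm) sum_nonneg_eq_0_iff) auto
    have "(\<Sum>i\<le>k. y i) + y (Suc k) = 1" using y by (simp add: standard_simplex_def)
    then have "y (Suc k) = 1 - (real k + 1) / N" using * by (simp add: add.commute eq_diff_eq)
    also have "\<dots> = 1 / N" using N by (simp add: N_def field_simps)
    finally have "\<forall>i\<le>Suc k. y i = 1 / N" using * by (auto simp: le_Suc_eq)
    then have "mn y = 1 / N" using mn_ex[of y] by auto
    then show False using y N by (simp add: t_def)
  qed
  have cont_t: "continuous_map (subtopology ?P A) euclideanreal t" for A
    unfolding t_def mn_def by (intro continuous_intros continuous_map_Min_coordinates proj)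
  have cont_f: "continuous_map (subtopology ?P ?\<Delta>) X (\<lambda>y. if t y \<le> 1/2 then c else h (2 - 2 * t y, dir y))"
  proof (rule continuous_map_cases_le)
    let ?A = "{y \<in> topspace (subtopology ?P ?\<Delta>). 1/2 \<le> t y}"
    have "continuous_map (subtopology (subtopology ?P ?\<Delta>) ?A)
        (prod_topology (top_of_set {0..1::real}) (nsphere k)) (\<lambda>y. (2 - 2 * t y, dir y))"
    proof (rule continuous_map_pairedI)
      show "continuous_map (subtopology (subtopology ?P ?\<Delta>) ?A) (top_of_set {0..1}) (\<lambda>y. 2 - 2 * t y)"
        unfolding continuous_map_in_subtopology
      proof
        show "continuous_map (subtopology (subtopology ?P ?\<Delta>) ?A) euclideanreal (\<lambda>y. 2 - 2 * t y)"
          unfolding subtopology_subtopology by (intro continuous_intros cont_t)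
        show "(\<lambda>y. 2 - 2 * t y) \<in> topspace (subtopology (subtopology ?P ?\<Delta>) ?A) \<rightarrow> {0..1}"
          using mn0 N by (auto simp: t_def)
      qed
      have cont_r: "continuous_map (subtopology ?P ?A) euclideanreal r"
        unfolding r_def by (intro continuous_intros proj) auto
      show "continuous_map (subtopology (subtopology ?P ?\<Delta>) ?A) (nsphere k) dir"
        unfolding nsphere continuous_map_in_subtopology continuous_map_componentwise_UNIV
      proof (intro conjI allI)
        fix i
        have "continuous_map (subtopology ?P ?A) euclideanreal (\<lambda>y. dir y i)"
          unfolding dir_def using r_pos
          by (cases "i \<le> k") (fastforce intro!: continuous_intros proj cont_r)+
        then show "continuous_map (subtopology (subtopology ?P ?\<Delta>) ?A) euclideanreal (\<lambda>y. dir y i)"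
          by (simp add: subtopology_subtopology inf.absorb2 Collect_conj_eq)
      next
        have "(\<Sum>i\<le>k. (dir y i)\<^sup>2) = 1" if "y \<in> ?\<Delta>" "1/2 \<le> t y" for y
        proof -
          have "(\<Sum>i\<le>k. (dir y i)\<^sup>2) = (\<Sum>i\<le>k. (y i - 1 / N)\<^sup>2) / (r y)\<^sup>2"
            by (simp add: dir_def power_divide sum_divide_distrib)
          moreover have "(r y)\<^sup>2 = (\<Sum>i\<le>k. (y i - 1 / N)\<^sup>2)"
            by (simp add: r_def sum_nonneg)
          ultimately show ?thesis using r_pos[OF that] by auto
        qed
        then show "dir \<in> topspace (subtopology (subtopology ?P ?\<Delta>) ?A) \<rightarrow>
            {x. (\<Sum>i\<le>k. (x i)\<^sup>2) = 1 \<and> (\<forall>i>k. x i = 0)}"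
          by (auto simp: dir_def)
      qed
    qed
    from continuous_map_compose[OF this h]
    show "continuous_map (subtopology (subtopology ?P ?\<Delta>) ?A) X (\<lambda>y. h (2 - 2 * t y, dir y))"
      by (simp add: o_def)
  next
    fix y assume "t y = 1/2"
    then have "2 - 2 * t y = 1" by simp
    then show "c = h (2 - 2 * t y, dir y)" using h1 by simp
  qed (use c in \<open>auto intro!: continuous_intros cont_t\<close>)
  show thesis
  proof (rule that[of f])
    show "singular_simplex (Suc k) X f"
      unfolding singular_simplex_def f_def
    proof (intro conjI restrict_extensional)
      show "continuous_map (subtopology ?P ?\<Delta>) X (\<lambda>y\<in>?\<Delta>. if t y \<le> 1/2 then c else h (2 - 2 * t y, dir y))"
        by (rule continuous_map_eq[OF cont_f]) auto
    qed
  next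
    fix i y assume i: "i \<le> Suc k" and y: "y \<in> ?\<Delta>" "y i = 0"
    have mny: "mn y = 0" using mn_le[OF i, of y] mn0[OF y(1)] y by simp
    then have ty: "t y = 1" by (simp add: t_def)
    have rp: "r y > 0" using r_pos[OF y(1)] ty by simp
    have sumy: "(\<Sum>i\<le>k. y i) + y (Suc k) = 1" using y by (simp add: standard_simplex_def)
    have hatd: "hat (dir y) i = (y i - 1 / N) / r y" if "i \<le> Suc k" for i
    proof (cases "i \<le> k")
      case True then show ?thesis by (simp add: hat_def dir_def)
    next
      case False
      then have i: "i = Suc k" using that by simp
      have "- (\<Sum>j\<le>k. dir y j) = - (\<Sum>j\<le>k. y j - 1 / N) / r y"
        by (simp add: dir_def sum_divide_distrib)
      also have "(\<Sum>j\<le>k. y j - 1 / N) = (1 - y (Suc k)) - (real k + 1) / N"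
        using sumy by (simp add: sum_subtractf add.commute eq_diff_eq)
      also have "- (1 - y (Suc k) - (real k + 1) / N) = y (Suc k) - 1 / N"
        using N by (simp add: N_def field_simps)
      finally show ?thesis by (simp add: hat_def i)
    qed
    have mnh: "mn (hat (dir y)) = - (1 / N) / r y"
    proof (rule antisym)
      show "mn (hat (dir y)) \<le> - (1 / N) / r y"
        using mn_le[OF i, of "hat (dir y)"] hatd[OF i] y by simp
      obtain j where j: "j \<le> Suc k" "mn (hat (dir y)) = hat (dir y) j" using mn_ex by blast
      have "0 \<le> y j" using y by (simp add: standard_simplex_def)
      then show "- (1 / N) / r y \<le> mn (hat (dir y))"
        unfolding j hatd[OF j(1)] using rp by (intro divide_right_mono) auto
    qed
    have "q (dir y) = y"
    proof
      fix j
      show "q (dir y) j = y j"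
      proof (cases "j \<le> Suc k")
        case True
        have "q (dir y) j = 1 / N + ((y j - 1 / N) / r y) / (N * ((1 / N) / r y))"
          using True by (simp add: q_def hatd mnh)
        also have "\<dots> = y j" using N rp by (simp add: field_simps)
        finally show ?thesis .
      next
        case False then show ?thesis using y by (simp add: q_def standard_simplex_def)
      qed
    qed
    then show "f y = b y" using y ty h0 by (simp add: f_def)
  qed
qed

text \<open>
  The vanishing of homotopy classes of spheres in the form needed to build the singular cone below.
\<close>

lemma fill_singular_faces:
  fixes g :: "nat \<Rightarrow> (nat \<Rightarrow> real) \<Rightarrow> 'a"
  assumes conn: "n_connected_space n X" and kn: "k \<le> n"
    and g: "\<And>i. i \<le> Suc k \<Longrightarrow> singular_simplex k X (g i)"
    and compat: "\<And>i j. \<lbrakk>0 < k; i < j; j \<le> Suc k\<rbrakk> \<Longrightarrow> singular_face k i (g j) = singular_face k (j - 1) (g i)"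
  obtains f where "singular_simplex (Suc k) X f" "\<And>i. i \<le> Suc k \<Longrightarrow> singular_face (Suc k) i f = g i"
proof -
  obtain b where b: "continuous_map (subtopology (powertop_real UNIV) {y \<in> standard_simplex (Suc k). \<exists>i\<le>Suc k. y i = 0}) X b"
    "\<And>i y. \<lbrakk>i \<le> Suc k; y \<in> standard_simplex (Suc k); y i = 0\<rbrakk> \<Longrightarrow> b y = g i (drop_coordinate i y)"
    using glue_singular_faces[OF g compat] by blast
  obtain f where f: "singular_simplex (Suc k) X f"
    "\<And>i y. \<lbrakk>i \<le> Suc k; y \<in> standard_simplex (Suc k); y i = 0\<rbrakk> \<Longrightarrow> f y = b y"
    using extend_over_standard_simplex[OF conn kn b(1)] by blast
  have "singular_face (Suc k) i f = g i" if i: "i \<le> Suc k" for i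
  proof
    fix x
    show "singular_face (Suc k) i f x = g i x"
    proof (cases "x \<in> standard_simplex k")
      case True
      have "simplical_face i x \<in> standard_simplex (Suc k)"
        using simplical_face_in_standard_simplex[of "Suc k" i x] True i by simp
      moreover have "simplical_face i x i = 0" by (simp add: simplical_face_def)
      ultimately show ?thesis
        using f(2)[OF i] b(2)[OF i] True
        by (simp add: singular_face_apply drop_coordinate_simplical_face)
    next
      case False
      then show ?thesis using g[OF i]
        by (auto simp: singular_face_def singular_simplex_def extensional_def)
    qed
  qed
  then show thesis using that f by blast
qed


section \<open>Cones and dominant vertices in a geometric realization\<close>

definition del_nth :: "nat \<Rightarrow> 'b list \<Rightarrow> 'b list" where
  "del_nth i xs = take i xs @ drop (Suc i) xs"

lemma length_del_nth: "i < length xs \<Longrightarrow> length (del_nth i xs) = length xs - 1"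
  by (auto simp: del_nth_def)

lemma nth_del_nth:
  "\<lbrakk>i < length xs; j < length xs - 1\<rbrakk> \<Longrightarrow> del_nth i xs ! j = (if j < i then xs ! j else xs ! Suc j)"
  by (auto simp: del_nth_def nth_append min_def)

lemma del_nth_del_nth:
  assumes "i < j" "j < length xs"
  shows "del_nth i (del_nth j xs) = del_nth (j - 1) (del_nth i xs)"
proof (rule nth_equalityI)
  show "length (del_nth i (del_nth j xs)) = length (del_nth (j - 1) (del_nth i xs))"
    using assms by (auto simp: length_del_nth)
  fix l assume "l < length (del_nth i (del_nth j xs))"
  then have l: "l < length xs - 2" using assms by (auto simp: length_del_nth)
  then show "del_nth i (del_nth j xs) ! l = del_nth (j - 1) (del_nth i xs) ! l"
    using assms nth_del_nth[of i "del_nth j xs" l] nth_del_nth[of j xs l] nth_del_nth[of j xs "Suc l"]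
      nth_del_nth[of "j - 1" "del_nth i xs" l] nth_del_nth[of i xs l] nth_del_nth[of i xs "Suc l"]
    by (auto simp: length_del_nth split: if_splits)
qed

lemma set_del_nth: "set (del_nth i xs) \<subseteq> set xs"
  using set_take_subset[of i xs] set_drop_subset[of "Suc i" xs] by (auto simp: del_nth_def)

lemma distinct_del_nth: "distinct xs \<Longrightarrow> distinct (del_nth i xs)"
  using set_take_disj_set_drop_if_distinct[of xs i "Suc i"] by (auto simp: del_nth_def)

lemma abstract_complex_face: "\<lbrakk>abstract_complex K; s \<in> K; t \<subseteq> s; t \<noteq> {}\<rbrakk> \<Longrightarrow> t \<in> K"
  unfolding abstract_complex_def by blast

lemma topspace_geometric_realization: "topspace (geometric_realization K) = (\<Union>s\<in>K. closed_simplex s)"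
proof
  show "topspace (geometric_realization K) \<subseteq> (\<Union>s\<in>K. closed_simplex s)"
    using openin_topspace[of "geometric_realization K"]
    unfolding openin_geometric_realization realization_open_def by blast
  have "realization_open K (\<Union>s\<in>K. closed_simplex s)"
    unfolding realization_open_def
  proof (intro conjI ballI)
    fix s assume "s \<in> K"
    then have "(\<Union>s\<in>K. closed_simplex s) \<inter> closed_simplex s = topspace (subtopology (powertop_real UNIV) (closed_simplex s))"
      by auto
    then show "openin (subtopology (powertop_real UNIV) (closed_simplex s)) ((\<Union>s\<in>K. closed_simplex s) \<inter> closed_simplex s)"
      by (simp only: openin_topspace)
  qed simp
  then show "(\<Union>s\<in>K. closed_simplex s) \<subseteq> topspace (geometric_realization K)"
    by (intro openin_subset) (simp add: openin_geometric_realization)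
qed

lemma continuous_map_into_geometric_realization:
  assumes s: "s \<in> K" and f: "continuous_map Z (subtopology (powertop_real UNIV) (closed_simplex s)) f"
  shows "continuous_map Z (geometric_realization K) f"
proof -
  have "continuous_map (subtopology (powertop_real UNIV) (closed_simplex s)) (geometric_realization K) (\<lambda>x. x)"
    unfolding continuous_map_def
  proof (intro conjI allI impI)
    show "(\<lambda>x. x) \<in> topspace (subtopology (powertop_real UNIV) (closed_simplex s)) \<rightarrow> topspace (geometric_realization K)"
      using s by (auto simp: topspace_geometric_realization)
    fix U assume "openin (geometric_realization K) U"
    then have "openin (subtopology (powertop_real UNIV) (closed_simplex s)) (U \<inter> closed_simplex s)"
      using s by (simp add: openin_geometric_realization realization_open_def)
    moreover have "{x \<in> topspace (subtopology (powertop_real UNIV) (closed_simplex s)). x \<in> U} = U \<inter> closed_simplex s" by auto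
    ultimately show "openin (subtopology (powertop_real UNIV) (closed_simplex s))
        {x \<in> topspace (subtopology (powertop_real UNIV) (closed_simplex s)). x \<in> U}" by simp
  qed
  from continuous_map_compose[OF f this] show ?thesis by (simp add: o_def)
qed

definition linear_simplex :: "'v list \<Rightarrow> (nat \<Rightarrow> real) \<Rightarrow> 'v \<Rightarrow> real" where
  "linear_simplex xs = (\<lambda>x\<in>standard_simplex (length xs - 1). \<lambda>v. \<Sum>i<length xs. if xs ! i = v then x i else 0)"

lemma linear_simplex_in_closed_simplex:
  assumes "xs \<noteq> []" "x \<in> standard_simplex (length xs - 1)"
  shows "linear_simplex xs x \<in> closed_simplex (set xs)"
proof -
  have "(\<Sum>v\<in>set xs. \<Sum>i<length xs. if xs ! i = v then x i else 0)
      = (\<Sum>i<length xs. \<Sum>v\<in>set xs. if v = xs ! i then x i else 0)"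
    by (subst sum.swap) (simp add: eq_commute)
  also have "\<dots> = (\<Sum>i<length xs. x i)" by (intro sum.cong) auto
  also have "(\<Sum>i<length xs. x i) = (\<Sum>i\<le>length xs - 1. x i)"
    using assms(1) by (intro sum.cong) (cases xs; auto)+
  also have "(\<Sum>i\<le>length xs - 1. x i) = 1" using assms(2) by (simp add: standard_simplex_def)
  finally have "(\<Sum>v\<in>set xs. linear_simplex xs x v) = 1" using assms(2) by (simp add: linear_simplex_def)
  moreover have "0 \<le> linear_simplex xs x v" for v
    using assms(2) by (auto simp: linear_simplex_def standard_simplex_def intro!: sum_nonneg)
  moreover have "linear_simplex xs x v = 0" if "v \<notin> set xs" for v
    using assms(2) that by (auto simp: linear_simplex_def intro!: sum.neutral)
  ultimately show ?thesis by (simp add: closed_simplex_def)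
qed

lemma continuous_map_linear_simplex:
  assumes "xs \<noteq> []"
  shows "continuous_map (subtopology (powertop_real UNIV) (standard_simplex (length xs - 1)))
     (subtopology (powertop_real UNIV) (closed_simplex (set xs))) (linear_simplex xs)"
  unfolding continuous_map_in_subtopology continuous_map_componentwise_UNIV
proof (intro conjI allI)
  fix v
  let ?Z = "subtopology (powertop_real UNIV) (standard_simplex (length xs - 1))"
  have "continuous_map ?Z euclideanreal (\<lambda>x. if xs ! i = v then x i else 0)" for i
    by (cases "xs ! i = v") (auto intro: continuous_map_from_subtopology continuous_map_product_projection)
  then have "continuous_map ?Z euclideanreal (\<lambda>x. \<Sum>i<length xs. if xs ! i = v then x i else 0)"
    by (intro continuous_map_sum) auto
  then show "continuous_map ?Z euclideanreal (\<lambda>x. linear_simplex xs x v)"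
    by (rule continuous_map_eq) (auto simp: linear_simplex_def)
qed (use assms linear_simplex_in_closed_simplex in auto)

lemma singular_simplex_linear_simplex:
  assumes "xs \<noteq> []" "set xs \<in> K"
  shows "singular_simplex (length xs - 1) (subtopology (geometric_realization K) (closed_simplex (set xs))) (linear_simplex xs)"
  unfolding singular_simplex_subtopology
proof
  show "singular_simplex (length xs - 1) (geometric_realization K) (linear_simplex xs)"
    unfolding singular_simplex_def
    using continuous_map_into_geometric_realization[OF assms(2) continuous_map_linear_simplex[OF assms(1)]]
    by (simp add: linear_simplex_def)
qed (use assms linear_simplex_in_closed_simplex in auto)

lemma singular_face_linear_simplex:
  assumes i: "i < length xs" and len: "2 \<le> length xs"
  shows "singular_face (length xs - 1) i (linear_simplex xs) = linear_simplex (del_nth i xs)"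
proof
  fix x
  let ?n = "length xs - 1"
  have n: "1 \<le> ?n" "i \<le> ?n" "length (del_nth i xs) - 1 = ?n - Suc 0" using i len by (auto simp: length_del_nth)
  show "singular_face ?n i (linear_simplex xs) x = linear_simplex (del_nth i xs) x"
  proof (cases "x \<in> standard_simplex (?n - Suc 0)")
    case True
    have fx: "simplical_face i x \<in> standard_simplex ?n"
      using simplical_face_in_standard_simplex[OF n(1,2) True] .
    show ?thesis
    proof
      fix v
      have "(\<Sum>j<length xs. if xs ! j = v then simplical_face i x j else 0)
          = (\<Sum>j\<in>{..<length xs} - {i}. if xs ! j = v then simplical_face i x j else 0)"
        by (rule sum.mono_neutral_right) (auto simp: simplical_face_def)
      also have "\<dots> = (\<Sum>j<length (del_nth i xs). if del_nth i xs ! j = v then x j else 0)"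
        by (rule sum.reindex_bij_witness[where i="\<lambda>j. if j < i then j else Suc j"
              and j="\<lambda>j. if j < i then j else j - 1"])
          (use i in \<open>auto simp: length_del_nth nth_del_nth simplical_face_def split: if_splits\<close>)
      finally show "singular_face ?n i (linear_simplex xs) x v = linear_simplex (del_nth i xs) x v"
        using True fx n(3) by (simp only: singular_face_apply linear_simplex_def restrict_apply' if_True)
    qed
  next
    case False
    then show ?thesis using n(3) by (simp only: singular_face_def linear_simplex_def restrict_apply if_False)
  qed
qed

definition top_vertex :: "('v \<Rightarrow> real) \<Rightarrow> 'v" where
  "top_vertex y = (SOME v. \<forall>w. y w \<le> y v)"

text \<open>
  An open cover of the realization indexed by the simplices: in the set of \<open>s\<close> the largest barycentric
  coordinate belongs to a vertex of \<open>s\<close>. Singular simplices that are small for this cover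
  can thus be replaced by tuples of vertices of one simplex of \<open>K\<close>.
\<close>

definition dominant_nbhd :: "'v set set \<Rightarrow> 'v set \<Rightarrow> ('v \<Rightarrow> real) set" where
  "dominant_nbhd K s = {y \<in> topspace (geometric_realization K). \<exists>v\<in>s. 0 < y v \<and> (\<forall>w. w \<notin> s \<longrightarrow> y w < y v)}"

lemma top_vertex_max:
  assumes "y \<in> closed_simplex s"
  shows "y w \<le> y (top_vertex y)" and "top_vertex y \<in> s"
proof -
  have s: "finite s" "s \<noteq> {}"
    using assms by (auto simp: closed_simplex_def intro: ccontr)
  have "Max (y ` s) \<in> y ` s" using s by (intro Max_in) auto
  then obtain v where v: "v \<in> s" "Max (y ` s) = y v" by auto
  have vs: "y w \<le> y v" if "w \<in> s" for w using s that Max_ge[of "y ` s" "y w"] v(2) by simp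
  have y0: "0 \<le> y v" using assms by (simp add: closed_simplex_def)
  have "\<forall>w. y w \<le> y v"
  proof
    fix w show "y w \<le> y v" using vs y0 assms by (cases "w \<in> s") (auto simp: closed_simplex_def)
  qed
  then have max: "\<forall>w. y w \<le> y (top_vertex y)" unfolding top_vertex_def by (rule someI)
  then show "y w \<le> y (top_vertex y)" by blast
  show "top_vertex y \<in> s"
  proof (rule ccontr)
    assume "top_vertex y \<notin> s"
    then have "y (top_vertex y) = 0" using assms by (simp add: closed_simplex_def)
    then have "\<forall>w\<in>s. y w = 0" using max assms by (auto simp: closed_simplex_def intro!: antisym)
    then show False using assms by (simp add: closed_simplex_def)
  qed
qed

lemma top_vertex_point: "top_vertex (\<lambda>w. if w = v then 1 else 0 :: real) = v"
proof -
  have "(\<lambda>w. if w = v then 1 else 0 :: real) \<in> closed_simplex {v}" by (auto simp: closed_simplex_def)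
  from top_vertex_max(2)[OF this] show ?thesis by simp
qed

lemma top_vertex_dominant_nbhd:
  assumes "y \<in> dominant_nbhd K s" shows "top_vertex y \<in> s"
proof (rule ccontr)
  assume n: "top_vertex y \<notin> s"
  obtain v where v: "v \<in> s" "\<And>w. w \<notin> s \<Longrightarrow> y w < y v" using assms by (auto simp: dominant_nbhd_def)
  obtain t where "y \<in> closed_simplex t"
    using assms by (auto simp: dominant_nbhd_def topspace_geometric_realization)
  then have "y v \<le> y (top_vertex y)" by (rule top_vertex_max)
  with v(2)[OF n] show False by simp
qed

lemma openin_dominant_nbhd:
  assumes K: "abstract_complex K" and s: "finite s"
  shows "openin (geometric_realization K) (dominant_nbhd K s)"
  unfolding openin_geometric_realization realization_open_def
proof (intro conjI ballI)
  show "dominant_nbhd K s \<subseteq> (\<Union>s\<in>K. closed_simplex s)"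
    by (auto simp: dominant_nbhd_def topspace_geometric_realization)
  fix t assume t: "t \<in> K"
  have fint: "finite t" using K t by (simp add: abstract_complex_def)
  let ?Z = "subtopology (powertop_real UNIV) (closed_simplex t)"
  have proj: "continuous_map ?Z euclideanreal (\<lambda>y. y v)" for v
    by (intro continuous_map_from_subtopology continuous_map_product_projection) auto
  let ?P = "\<lambda>v. {y \<in> topspace ?Z. y v \<in> {0<..}}"
  let ?Q = "\<lambda>v w. {y \<in> topspace ?Z. y v - y w \<in> {0<..}}"
  have 1: "openin ?Z (?P v)" for v
    by (rule openin_continuous_map_preimage[OF proj]) simp
  have 2: "openin ?Z (?Q v w)" for v w
    by (rule openin_continuous_map_preimage[where Y=euclideanreal]) (auto intro: continuous_intros proj)
  have "dominant_nbhd K s \<inter> closed_simplex t = (\<Union>v\<in>s. \<Inter>(insert (?P v) (?Q v ` (t - s))))"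
  proof (rule Set.set_eqI)
    fix y
    have "(\<forall>w. w \<notin> s \<longrightarrow> y w < y v) \<longleftrightarrow> (\<forall>w\<in>t - s. y w < y v)" if "y \<in> closed_simplex t" "0 < y v" for v
      using that by (auto simp: closed_simplex_def)
    then show "y \<in> dominant_nbhd K s \<inter> closed_simplex t \<longleftrightarrow> y \<in> (\<Union>v\<in>s. \<Inter>(insert (?P v) (?Q v ` (t - s))))"
      using t by (auto simp: dominant_nbhd_def topspace_geometric_realization)
  qed
  moreover have "openin ?Z (\<Union>v\<in>s. \<Inter>(insert (?P v) (?Q v ` (t - s))))"
  proof (rule openin_Union)
    fix U assume "U \<in> (\<lambda>v. \<Inter>(insert (?P v) (?Q v ` (t - s)))) ` s"
    then obtain v where U: "U = \<Inter>(insert (?P v) (?Q v ` (t - s)))" by blast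
    show "openin ?Z U" unfolding U
    proof (rule openin_Inter)
      fix V assume "V \<in> insert (?P v) (?Q v ` (t - s))"
      then consider "V = ?P v" | w where "V = ?Q v w" by blast
      then show "openin ?Z V" by cases (simp_all only: 1 2)
    qed (use fint in simp_all)
  qed
  ultimately show "openin ?Z (dominant_nbhd K s \<inter> closed_simplex t)" by simp
qed

lemma dominant_nbhd_cover:
  assumes K: "abstract_complex K"
  shows "topspace (geometric_realization K) \<subseteq> (\<Union>s\<in>K. dominant_nbhd K s)"
proof
  fix y assume y: "y \<in> topspace (geometric_realization K)"
  then obtain t where t: "t \<in> K" "y \<in> closed_simplex t" by (auto simp: topspace_geometric_realization)
  define s where "s = {v. y v \<noteq> 0}"
  have st: "s \<subseteq> t" using t by (auto simp: s_def closed_simplex_def)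
  have "s \<noteq> {}"
  proof
    assume "s = {}" then have "\<forall>v. y v = 0" by (auto simp: s_def)
    then show False using t by (simp add: closed_simplex_def)
  qed
  then have "s \<in> K" by (rule abstract_complex_face[OF K t(1) st])
  moreover obtain v where v: "v \<in> s" using \<open>s \<noteq> {}\<close> by auto
  then have "0 < y v" using t by (auto simp: s_def closed_simplex_def order_less_le)
  then have "y \<in> dominant_nbhd K s" 
    using y v unfolding dominant_nbhd_def by (intro CollectI conjI bexI[of _ v]) (auto simp: s_def)
  ultimately show "y \<in> (\<Union>s\<in>K. dominant_nbhd K s)" by blast
qed

text \<open>
  The map \<open>F\<close> is a singular cone over the linear simplices, with apex \<open>F []\<close>: the face opposite to the
  apex is the given simplex, and the other faces are the cones over its faces. These prescribed faces
  are compatible, so they can be filled by induction on the dimension.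
\<close>

lemma cone_filling:
  assumes conn: "n_connected_space n (geometric_realization K)" and K: "abstract_complex K"
  obtains F :: "'v list \<Rightarrow> (nat \<Rightarrow> real) \<Rightarrow> 'v \<Rightarrow> real" where
    "\<And>xs. \<lbrakk>length xs \<le> Suc n; xs = [] \<or> set xs \<in> K\<rbrakk> \<Longrightarrow> singular_simplex (length xs) (geometric_realization K) (F xs)"
    "\<And>xs. \<lbrakk>length xs \<le> Suc n; xs \<noteq> []; set xs \<in> K\<rbrakk> \<Longrightarrow> singular_face (length xs) 0 (F xs) = linear_simplex xs"
    "\<And>xs i. \<lbrakk>length xs \<le> Suc n; set xs \<in> K; i < length xs\<rbrakk> \<Longrightarrow>
        singular_face (length xs) (Suc i) (F xs) = F (del_nth i xs)"
proof -
  let ?X = "geometric_realization K"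
  define P where "P = (\<lambda>m (F :: 'v list \<Rightarrow> (nat \<Rightarrow> real) \<Rightarrow> 'v \<Rightarrow> real).
    (\<forall>xs. length xs \<le> m \<longrightarrow> xs = [] \<or> set xs \<in> K \<longrightarrow> singular_simplex (length xs) ?X (F xs)) \<and>
    (\<forall>xs. length xs \<le> m \<longrightarrow> xs \<noteq> [] \<longrightarrow> set xs \<in> K \<longrightarrow> singular_face (length xs) 0 (F xs) = linear_simplex xs) \<and>
    (\<forall>xs i. length xs \<le> m \<longrightarrow> set xs \<in> K \<longrightarrow> i < length xs \<longrightarrow>
        singular_face (length xs) (Suc i) (F xs) = F (del_nth i xs)))"
  have sub: "del_nth i xs = [] \<or> set (del_nth i xs) \<in> K" if "set xs \<in> K" for i and xs :: "'v list"
  proof (cases "del_nth i xs = []")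
    case False
    then have "set (del_nth i xs) \<noteq> {}" by simp
    then show ?thesis using abstract_complex_face[OF K that set_del_nth] by blast
  qed simp
  have "\<exists>F. P m F" if "m \<le> Suc n" for m
    using that
  proof (induction m)
    case 0
    have "topspace ?X \<noteq> {}" using conn unfolding n_connected_space_def by (rule conjunct1)
    then obtain c where c: "c \<in> topspace ?X" by blast
    define f0 where "f0 = restrict (\<lambda>_ :: nat \<Rightarrow> real. c) (standard_simplex 0)"
    have "singular_simplex 0 ?X f0"
      unfolding singular_simplex_def f0_def using c
      by (auto intro!: continuous_map_eq[of _ _ "\<lambda>_. c"])
    then show ?case by (intro exI[of _ "\<lambda>_. f0"]) (auto simp: P_def)
  next
    case (Suc k)
    then obtain F where F: "P k F" by auto
    have F1: "singular_simplex (length xs) ?X (F xs)" if "length xs \<le> k" "xs = [] \<or> set xs \<in> K" for xs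
      using conjunct1[OF F[unfolded P_def]] that by blast
    have F2: "singular_face (length xs) 0 (F xs) = linear_simplex xs" if "length xs \<le> k" "xs \<noteq> []" "set xs \<in> K" for xs
      using conjunct1[OF conjunct2[OF F[unfolded P_def]]] that by blast
    have F3': "singular_face (length xs) (Suc i) (F xs) = F (del_nth i xs)" if "length xs \<le> k" "set xs \<in> K" "i < length xs" for xs i
      using conjunct2[OF conjunct2[OF F[unfolded P_def]]] that by blast
    have kn: "k \<le> n" using Suc by simp
    have ex: "\<exists>f. singular_simplex (Suc k) ?X f \<and> singular_face (Suc k) 0 f = linear_simplex xs \<and>
        (\<forall>i<length xs. singular_face (Suc k) (Suc i) f = F (del_nth i xs))"
      if xs: "length xs = Suc k" "set xs \<in> K" for xs
    proof -
      define g where "g = (\<lambda>j. case j of 0 \<Rightarrow> linear_simplex xs | Suc i \<Rightarrow> F (del_nth i xs))"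
      have ne: "xs \<noteq> []" using xs by auto
      have ldel: "length (del_nth i xs) = k" if "i < Suc k" for i
        using length_del_nth[of i xs] that xs by (simp only: diff_Suc_1)
      have g: "singular_simplex k ?X (g j)" if "j \<le> Suc k" for j
      proof (cases j)
        case 0
        then show ?thesis using singular_simplex_linear_simplex[OF ne xs(2)] xs(1)
          by (simp add: g_def singular_simplex_subtopology)
      next
        case (Suc i)
        then have "length (del_nth i xs) = k" using ldel that by simp
        with sub[OF xs(2), of i] have "singular_simplex (length (del_nth i xs)) ?X (F (del_nth i xs))"
          by (intro F1) auto
        then show ?thesis using \<open>length (del_nth i xs) = k\<close> Suc by (simp only: g_def nat.case)
      qed
      have compat: "singular_face k i (g j) = singular_face k (j - 1) (g i)"
        if k0: "0 < k" and ij: "i < j" "j \<le> Suc k" for i j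
      proof -
        obtain j' where j: "j = Suc j'" using ij by (cases j) auto
        have ldj: "length (del_nth j' xs) = k" using ldel ij j by simp
        then have dj_ne: "del_nth j' xs \<noteq> []" using k0 by (metis list.size(3) less_irrefl)
        then have djK: "set (del_nth j' xs) \<in> K" using sub[OF xs(2), of j'] by (simp only: simp_thms)
        show ?thesis
        proof (cases i)
          case 0
          have "singular_face k 0 (F (del_nth j' xs)) = linear_simplex (del_nth j' xs)"
            using F2[of "del_nth j' xs"] ldj dj_ne djK by simp
          moreover have "singular_face k j' (linear_simplex xs) = linear_simplex (del_nth j' xs)"
            using singular_face_linear_simplex[of j' xs] xs ij j k0 by simp
          ultimately show ?thesis by (simp only: 0 j g_def nat.case diff_Suc_1)
        next
          case (Suc i')
          have ldi: "length (del_nth i' xs) = k" using ldel ij j Suc by simp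
          then have di_ne: "del_nth i' xs \<noteq> []" using k0 by (metis list.size(3) less_irrefl)
          then have diK: "set (del_nth i' xs) \<in> K" using sub[OF xs(2), of i'] by (simp only: simp_thms)
          have F3: "singular_face k (Suc l) (F ys) = F (del_nth l ys)" if "length ys = k" "set ys \<in> K" "l < k" for l ys
            using F3'[of ys l] that by simp
          have lts: "i' < k" "j' - 1 < k" "Suc (j' - 1) = j'" "i' < j'" "j' < length xs" using ij j Suc xs by auto
          show ?thesis
            using F3[OF ldj djK lts(1)] F3[OF ldi diK lts(2)] del_nth_del_nth[OF lts(4,5)]
            by (simp only: Suc j g_def nat.case diff_Suc_1 lts(3))
        qed
      qed
      obtain f where f: "singular_simplex (Suc k) ?X f" "\<And>i. i \<le> Suc k \<Longrightarrow> singular_face (Suc k) i f = g i"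
        using fill_singular_faces[OF conn kn g compat] by blast
      have "singular_face (Suc k) 0 f = linear_simplex xs" using f(2)[of 0] by (simp add: g_def)
      moreover have "singular_face (Suc k) (Suc i) f = F (del_nth i xs)" if "i < length xs" for i
        using f(2)[of "Suc i"] that xs(1) by (simp add: g_def)
      ultimately show ?thesis using f(1) by blast
    qed
    define good where "good = (\<lambda>xs f. singular_simplex (Suc k) ?X f \<and> singular_face (Suc k) 0 f = linear_simplex xs \<and>
        (\<forall>i<length xs. singular_face (Suc k) (Suc i) f = F (del_nth i xs)))"
    define F' where "F' = (\<lambda>xs. if length xs = Suc k then (SOME f. good xs f) else F xs)"
    have good: "good xs (F' xs)" if "length xs = Suc k" "set xs \<in> K" for xs
    proof -
      have "\<exists>f. good xs f" using ex[OF that] by (simp only: good_def)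
      then have "good xs (SOME f. good xs f)" by (rule someI_ex)
      then show ?thesis using that(1) by (simp add: F'_def)
    qed
    have F': "singular_simplex (Suc k) ?X (F' xs) \<and> singular_face (Suc k) 0 (F' xs) = linear_simplex xs \<and>
        (\<forall>i<length xs. singular_face (Suc k) (Suc i) (F' xs) = F (del_nth i xs))" if "length xs = Suc k" "set xs \<in> K" for xs
      using good[OF that] unfolding good_def .
    have F'_old: "F' xs = F xs" if "length xs \<le> k" for xs using that by (simp add: F'_def)
    have F'_del: "F' (del_nth i xs) = F (del_nth i xs)" if "length xs \<le> Suc k" "i < length xs" for i xs
      by (rule F'_old) (use that length_del_nth[of i xs] in linarith)
    have "P (Suc k) F'"
      unfolding P_def
    proof (intro conjI allI impI)
      fix xs :: "'v list" assume xs: "length xs \<le> Suc k" "xs = [] \<or> set xs \<in> K"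
      show "singular_simplex (length xs) ?X (F' xs)"
      proof (cases "length xs = Suc k")
        case True then show ?thesis using F'[of xs] xs by auto
      next
        case False then show ?thesis using F1[of xs] xs F'_old[of xs] by simp
      qed
    next
      fix xs :: "'v list" assume xs: "length xs \<le> Suc k" "xs \<noteq> []" "set xs \<in> K"
      show "singular_face (length xs) 0 (F' xs) = linear_simplex xs"
      proof (cases "length xs = Suc k")
        case True then show ?thesis using F'[of xs] xs by simp
      next
        case False then show ?thesis using F2[of xs] xs F'_old[of xs] by simp
      qed
    next
      fix xs :: "'v list" and i assume xs: "length xs \<le> Suc k" "set xs \<in> K" "i < length xs"
      show "singular_face (length xs) (Suc i) (F' xs) = F' (del_nth i xs)"
        unfolding F'_del[OF xs(1,3)]
      proof (cases "length xs = Suc k")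
        case True
        then show "singular_face (length xs) (Suc i) (F' xs) = F (del_nth i xs)"
          using F'[OF True xs(2)] xs(3) True by simp
      next
        case False
        then have le: "length xs \<le> k" using xs by simp
        show "singular_face (length xs) (Suc i) (F' xs) = F (del_nth i xs)"
          unfolding F'_old[OF le] using F3'[OF le xs(2,3)] .
      qed
    qed
    then show ?case by blast
  qed
  then obtain F where "P (Suc n) F" by blast
  then show thesis unfolding P_def by (intro that[of F]) blast+
qed


section \<open>Cocycles become coboundaries on finite subcomplexes\<close>

text \<open>
  The linear extension of a singular cochain \<open>W\<close> to chains.
\<close>

definition chain_eval :: "('f \<Rightarrow> complex) \<Rightarrow> ('f \<Rightarrow>\<^sub>0 int) \<Rightarrow> complex" where
  "chain_eval W c = (\<Sum>f\<in>Poly_Mapping.keys c. of_int (Poly_Mapping.lookup c f) * W f)"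

lemma chain_eval_superset:
  assumes "finite A" "Poly_Mapping.keys c \<subseteq> A"
  shows "chain_eval W c = (\<Sum>f\<in>A. of_int (Poly_Mapping.lookup c f) * W f)"
  unfolding chain_eval_def using assms by (intro sum.mono_neutral_left) (auto simp: in_keys_iff)

lemma chain_eval_0 [simp]: "chain_eval W 0 = 0"
  by (simp add: chain_eval_def)

lemma chain_eval_of [simp]: "chain_eval W (frag_of f) = W f"
  by (simp add: chain_eval_def)

lemma chain_eval_diff: "chain_eval W (a - b) = chain_eval W a - chain_eval W b"
proof -
  let ?A = "Poly_Mapping.keys a \<union> Poly_Mapping.keys b"
  have "chain_eval W (a - b) = (\<Sum>f\<in>?A. of_int (Poly_Mapping.lookup (a - b) f) * W f)"
    using keys_diff[of a b] by (intro chain_eval_superset) auto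
  also have "\<dots> = (\<Sum>f\<in>?A. of_int (Poly_Mapping.lookup a f) * W f) - (\<Sum>f\<in>?A. of_int (Poly_Mapping.lookup b f) * W f)"
    by (simp add: lookup_minus sum_subtractf[symmetric] left_diff_distrib)
  also have "\<dots> = chain_eval W a - chain_eval W b"
    by (simp add: chain_eval_superset[symmetric])
  finally show ?thesis .
qed

lemma chain_eval_add: "chain_eval W (a + b) = chain_eval W a + chain_eval W b"
proof -
  have "chain_eval W (a + b) = chain_eval W (a - (0 - b))" by simp
  also have "\<dots> = chain_eval W a + chain_eval W b" by (simp only: chain_eval_diff chain_eval_0) simp
  finally show ?thesis .
qed

lemma chain_eval_sum: "chain_eval W (\<Sum>i\<in>I. f i) = (\<Sum>i\<in>I. chain_eval W (f i))"
  by (induction I rule: infinite_finite_induct) (auto simp: chain_eval_add)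

lemma chain_eval_power_cmul: "chain_eval W (frag_cmul ((-1) ^ k) c) = (-1) ^ k * chain_eval W c"
proof -
  have m: "chain_eval W (- c) = - chain_eval W c"
    using chain_eval_diff[of W 0 c] by simp
  show ?thesis by (cases "even k") (auto simp: m)
qed

lemma chain_eval_compose:
  assumes H: "H 0 = 0" "\<And>a b. H (a - b) = H a - H b"
  shows "chain_eval W (H c) = chain_eval (\<lambda>f. chain_eval W (H (frag_of f))) c"
proof -
  have "Poly_Mapping.keys c \<subseteq> UNIV" by simp
  then show ?thesis
    by (induction c rule: frag_induction) (auto simp: H chain_eval_diff)
qed

lemma chain_eval_eq_0: "(\<And>f. f \<in> Poly_Mapping.keys c \<Longrightarrow> W f = 0) \<Longrightarrow> chain_eval W c = 0"
  by (simp add: chain_eval_def)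

lemma chain_eval_boundary_of:
  "0 < p \<Longrightarrow> chain_eval W (chain_boundary p (frag_of f)) = (\<Sum>k\<le>p. (-1) ^ k * W (singular_face p k f))"
  by (simp add: chain_boundary_of chain_eval_sum chain_eval_power_cmul)

lemma chain_eval_boundary:
  "0 < p \<Longrightarrow> chain_eval W (chain_boundary p c) = chain_eval (\<lambda>f. \<Sum>k\<le>p. (-1) ^ k * W (singular_face p k f)) c"
  by (subst chain_eval_compose[where H="chain_boundary p"])
    (simp_all add: chain_boundary_diff chain_eval_boundary_of)

text \<open>
  A cycle on the positions from \<open>a\<close> to \<open>b\<close>, for comparing the lists that arise from one list by
  deleting entries at different positions.
\<close>

definition cyclic_shift :: "nat \<Rightarrow> nat \<Rightarrow> nat \<Rightarrow> nat" where
  "cyclic_shift a b j = (if a \<le> j \<and> j < b then Suc j else if j = b \<and> a \<le> b then a else j)"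

lemma cyclic_shift_refl: "cyclic_shift a a = id"
  by (auto simp: cyclic_shift_def)

lemma cyclic_shift_step:
  "a < b \<Longrightarrow> cyclic_shift a b = Transposition.transpose a (Suc a) \<circ> cyclic_shift (Suc a) b"
  by (auto simp: fun_eq_iff cyclic_shift_def Transposition.transpose_def)

lemma cyclic_shift:
  assumes "a \<le> b"
  shows "cyclic_shift a b permutes {a..b}" and "sign (cyclic_shift a b) = (-1) ^ (b - a)"
proof -
  have "cyclic_shift a b permutes {a..b} \<and> sign (cyclic_shift a b) = (-1) ^ (b - a)"
    using assms
  proof (induction "b - a" arbitrary: a)
    case 0
    then have "b = a" by simp
    show ?case unfolding \<open>b = a\<close> cyclic_shift_refl by (rule conjI, rule permutes_id, simp add: sign_id)
  next
    case (Suc n)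
    then have ab: "a < b" by simp
    have IH: "cyclic_shift (Suc a) b permutes {Suc a..b}" "sign (cyclic_shift (Suc a) b) = (-1) ^ (b - Suc a)"
      using Suc.hyps(1)[of "Suc a"] Suc.hyps(2) ab by auto
    have "cyclic_shift (Suc a) b permutes {a..b}"
      by (rule permutes_subset[OF IH(1)]) auto
    then have perm: "cyclic_shift a b permutes {a..b}"
      unfolding cyclic_shift_step[OF ab]
      by (rule permutes_compose) (use ab in \<open>auto intro: permutes_swap_id\<close>)
    have "sign (cyclic_shift a b) = sign (Transposition.transpose a (Suc a)) * sign (cyclic_shift (Suc a) b)"
      unfolding cyclic_shift_step[OF ab]
      by (rule sign_compose[OF permutation_swap_id]) (use IH(1) in \<open>auto simp: permutation_permutes\<close>)
    also have "\<dots> = - ((-1) ^ (b - Suc a))" by (simp add: IH(2) sign_swap_id)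
    also have "\<dots> = (-1) ^ (b - a)" using ab by (metis Suc_diff_Suc mult_minus1 power_Suc)
    finally show ?case using perm by blast
  qed
  then show "cyclic_shift a b permutes {a..b}" "sign (cyclic_shift a b) = (-1) ^ (b - a)" by auto
qed

definition alternating_on :: "'v list set \<Rightarrow> nat \<Rightarrow> ('v list \<Rightarrow> complex) \<Rightarrow> bool" where
  "alternating_on S m z \<longleftrightarrow> (\<forall>xs\<in>S. \<forall>\<pi>. \<pi> permutes {..<m} \<longrightarrow> z (permute_list \<pi> xs) = of_int (sign \<pi>) * z xs)"

text \<open>
  If exactly one vertex is repeated, the two faces without repetition differ by a cyclic permutation, and
  their contributions cancel. So \<open>z\<close> remains a cocycle when it is extended by zero to degenerate
  simplices.
\<close>

lemma alternating_cocycle_degenerate: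
  assumes alt: "alternating_on (ordered_simplices L (Suc p)) (Suc p) z"
    and cocycle: "coboundary L (Suc p) z = (\<lambda>_. 0)" and L: "abstract_complex L"
    and ys: "length ys = p + 2" "set ys \<in> L"
  shows "(\<Sum>k\<le>Suc p. (-1) ^ k * (if distinct (del_nth k ys) then z (del_nth k ys) else 0)) = 0"
proof (cases "distinct ys")
  case True
  then have "coboundary L (Suc p) z ys = (\<Sum>k\<le>Suc p. (-1) ^ k * z (del_nth k ys))"
    using ys by (simp add: coboundary_def ordered_simplices_def del_nth_def)
  moreover have "coboundary L (Suc p) z ys = 0" using cocycle by simp
  ultimately show ?thesis using distinct_del_nth[OF True] by simp
next
  case False
  then obtain a b where ab: "a < b" "b < length ys" "ys ! a = ys ! b"
    unfolding distinct_conv_nth by (metis linorder_neqE_nat)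
  define t where "t = (\<lambda>k. if distinct (del_nth k ys) then z (del_nth k ys) else 0)"
  have other: "t k = 0" if k: "k \<le> Suc p" "k \<noteq> a" "k \<noteq> b" for k
  proof -
    define a' where "a' = (if a < k then a else a - 1)"
    define b' where "b' = (if b < k then b else b - 1)"
    have kl: "k < length ys" using k ys by simp
    have l: "a' < length ys - 1" "b' < length ys - 1" "a' \<noteq> b'"
      using ab k ys by (auto simp: a'_def b'_def)
    have "del_nth k ys ! a' = ys ! a" "del_nth k ys ! b' = ys ! b"
      using nth_del_nth[OF kl l(1)] nth_del_nth[OF kl l(2)] ab k by (auto simp: a'_def b'_def)
    then have "\<not> distinct (del_nth k ys)"
      using nth_eq_iff_index_eq[of "del_nth k ys" a' b'] l ab(3) length_del_nth[OF kl] by auto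
    then show ?thesis by (simp add: t_def)
  qed
  have perm: "del_nth a ys = permute_list (cyclic_shift a (b - 1)) (del_nth b ys)"
  proof (rule nth_equalityI)
    show "length (del_nth a ys) = length (permute_list (cyclic_shift a (b - 1)) (del_nth b ys))"
      using ab length_del_nth[of a ys] length_del_nth[of b ys] by simp
    fix j assume "j < length (del_nth a ys)"
    then have j: "j < length ys - 1" using ab length_del_nth[of a ys] by simp
    have "permute_list (cyclic_shift a (b - 1)) (del_nth b ys) ! j = del_nth b ys ! cyclic_shift a (b - 1) j"
      using j ab length_del_nth[of b ys] by (simp add: permute_list_def)
    moreover have "cyclic_shift a (b - 1) j < length ys - 1"
      using j ab by (auto simp: cyclic_shift_def)
    ultimately show "del_nth a ys ! j = permute_list (cyclic_shift a (b - 1)) (del_nth b ys) ! j"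
      using nth_del_nth[of a ys j] nth_del_nth[of b ys "cyclic_shift a (b - 1) j"] j ab
      by (auto simp: cyclic_shift_def split: if_splits)
  qed
  have sh: "cyclic_shift a (b - 1) permutes {..<Suc p}"
    by (rule permutes_subset[OF cyclic_shift(1)]) (use ab ys in auto)
  have lenb: "length (del_nth b ys) = Suc p" using length_del_nth[of b ys] ab ys by simp
  have mset: "mset (del_nth a ys) = mset (del_nth b ys)"
    unfolding perm by (rule mset_permute_list) (use sh lenb in simp)
  then have dist: "distinct (del_nth a ys) = distinct (del_nth b ys)" by (rule mset_eq_imp_distinct_iff)
  have ta: "t a = (-1) ^ (b - 1 - a) * t b"
  proof (cases "distinct (del_nth b ys)")
    case True
    have "set (del_nth b ys) \<in> L"
      by (rule abstract_complex_face[OF L ys(2) set_del_nth]) (use lenb in auto)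
    then have "del_nth b ys \<in> ordered_simplices L (Suc p)"
      using True lenb by (simp add: ordered_simplices_def)
    then have "z (del_nth a ys) = of_int (sign (cyclic_shift a (b - 1))) * z (del_nth b ys)"
      unfolding perm using alt sh by (simp add: alternating_on_def)
    then show ?thesis using True dist ab by (simp add: t_def cyclic_shift(2))
  qed (simp add: t_def dist)
  have "(\<Sum>k\<le>Suc p. (-1) ^ k * t k) = (\<Sum>k\<in>{a, b}. (-1) ^ k * t k)"
    using ab ys other by (intro sum.mono_neutral_right) auto
  also have "\<dots> = (-1) ^ a * t a + (-1) ^ b * t b" using ab by simp
  also have "\<dots> = ((-1) ^ (a + (b - 1 - a)) + (-1) ^ b) * t b"
    unfolding ta by (simp add: power_add algebra_simps)
  also have "a + (b - 1 - a) = b - 1" using ab by simp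
  also have "(-1 :: complex) ^ (b - 1) + (-1) ^ b = 0" using ab by (cases b) auto
  finally show ?thesis by (simp add: t_def)
qed

definition simplex_corner :: "nat \<Rightarrow> nat \<Rightarrow> real" where
  "simplex_corner k = (\<lambda>j. if j = k then 1 else 0)"

text \<open>
  A combinatorial approximation of a singular simplex: every corner is moved to a vertex with the
  largest barycentric coordinate. Vertices may be repeated.
\<close>

definition corner_list :: "nat \<Rightarrow> ((nat \<Rightarrow> real) \<Rightarrow> 'v \<Rightarrow> real) \<Rightarrow> 'v list" where
  "corner_list p f = map (\<lambda>k. top_vertex (f (simplex_corner k))) [0..<Suc p]"

lemma corner_list_singular_face:
  assumes "k \<le> Suc p"
  shows "corner_list p (singular_face (Suc p) k f) = del_nth k (corner_list (Suc p) f)"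
proof (rule nth_equalityI)
  show "length (corner_list p (singular_face (Suc p) k f)) = length (del_nth k (corner_list (Suc p) f))"
    using assms by (simp add: corner_list_def length_del_nth)
  fix j assume "j < length (corner_list p (singular_face (Suc p) k f))"
  then have j: "j < Suc p" by (simp add: corner_list_def)
  have "simplical_face k (simplex_corner j) = simplex_corner (if j < k then j else Suc j)"
    by (auto simp: simplical_face_def simplex_corner_def fun_eq_iff)
  moreover have "simplex_corner j \<in> standard_simplex p" using j by (simp add: simplex_corner_def)
  ultimately have "corner_list p (singular_face (Suc p) k f) ! j = top_vertex (f (simplex_corner (if j < k then j else Suc j)))"
    using j by (simp add: corner_list_def singular_face_def del: upt_Suc)
  also have "\<dots> = del_nth k (corner_list (Suc p) f) ! j"
    using j assms by (subst nth_del_nth) (auto simp: corner_list_def simp del: upt_Suc)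
  finally show "corner_list p (singular_face (Suc p) k f) ! j = del_nth k (corner_list (Suc p) f) ! j" .
qed

lemma corner_list_linear_simplex:
  assumes "length xs = Suc p" shows "corner_list p (linear_simplex xs) = xs"
proof (rule nth_equalityI)
  fix k assume "k < length (corner_list p (linear_simplex xs))"
  then have k: "k < Suc p" by (simp add: corner_list_def)
  have "linear_simplex xs (simplex_corner k) = (\<lambda>v. if v = xs ! k then 1 else 0)"
  proof
    fix v
    have "simplex_corner k \<in> standard_simplex (length xs - 1)"
      using k assms by (simp add: simplex_corner_def)
    then have "linear_simplex xs (simplex_corner k) v = (\<Sum>i<length xs. if xs ! i = v then simplex_corner k i else 0)"
      by (simp add: linear_simplex_def)
    also have "\<dots> = (\<Sum>i<length xs. if i = k then (if xs ! i = v then 1 else 0) else 0)"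
      by (rule sum.cong) (auto simp: simplex_corner_def)
    also have "\<dots> = (if xs ! k = v then 1 else 0)" using k assms by simp
    finally show "linear_simplex xs (simplex_corner k) v = (if v = xs ! k then 1 else 0)" by auto
  qed
  then show "corner_list p (linear_simplex xs) ! k = xs ! k"
    using k by (simp add: corner_list_def top_vertex_point del: upt_Suc)
qed (use assms in \<open>simp add: corner_list_def\<close>)

lemma finite_ordered_simplices:
  assumes "finite Y" "abstract_complex Y" shows "finite (ordered_simplices Y m)"
proof -
  have "ordered_simplices Y m \<subseteq> {xs. set xs \<subseteq> \<Union>Y \<and> length xs = m}"
    by (auto simp: ordered_simplices_def)
  moreover have "finite (\<Union>Y)" using assms by (auto simp: abstract_complex_def)
  ultimately show ?thesis using finite_lists_length_eq finite_subset by metis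
qed

text \<open>
  Evaluation on the approximating tuples makes \<open>z\<close> a singular cochain \<open>W\<close>, which is a cocycle on those
  singular simplices that lie in one dominant neighbourhood or one closed simplex. Subdivided often
  enough, the cone over a simplex of \<open>Y\<close> consists of such simplices, so \<open>W\<close> on the subdivided simplex is
  the coboundary of its value on the cones over the faces. The chain homotopy \<open>h\<close> from subdivision
  to the identity gives the correction from the subdivided simplex to the simplex itself. Only the
  finitely many simplices in \<open>B\<close> occur, and they depend on \<open>Y\<close> alone; hence \<open>j0\<close> serves all \<open>z\<close>.
\<close>

theorem cocycle_is_coboundary_on_finite_subcomplex:
  fixes K :: "'v set set"
  assumes conn: "n_connected_space n (geometric_realization K)" and pn: "p \<le> n"
    and K: "abstract_complex K"
    and L: "\<And>i. abstract_complex (L i)" "\<And>i. L i \<subseteq> L (Suc i)" "(\<Union>i. L i) = K"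
    and Y: "finite Y" "Y \<subseteq> K" "abstract_complex Y"
  shows "\<exists>j0. \<forall>j\<ge>j0. \<forall>z. alternating_on (ordered_simplices (L j) (Suc p)) (Suc p) z \<longrightarrow>
     coboundary (L j) (Suc p) z = (\<lambda>_. 0) \<longrightarrow>
     (\<exists>u. \<forall>xs\<in>ordered_simplices Y (Suc p). z xs = (\<Sum>i\<le>p. (-1) ^ i * u (del_nth i xs)))"
proof -
  let ?X = "geometric_realization K"
  have mono: "L i \<subseteq> L j" if "i \<le> j" for i j using lift_Suc_mono_le[of L, OF L(2) that] .
  have into_L: "\<exists>j. \<forall>s\<in>A. s \<in> L j" if A: "finite A" "A \<subseteq> K" for A
    using A
  proof (induction A rule: finite_induct)
    case (insert s A)
    then obtain j where j: "\<forall>s\<in>A. s \<in> L j" by auto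
    obtain i where i: "s \<in> L i" using insert L(3) by auto
    show ?case
    proof (intro exI ballI)
      fix t assume "t \<in> insert s A"
      then show "t \<in> L (max i j)" using i j mono[of i "max i j"] mono[of j "max i j"] by auto
    qed
  qed simp
  obtain F where F: "\<And>xs. \<lbrakk>length xs \<le> Suc n; xs = [] \<or> set xs \<in> K\<rbrakk> \<Longrightarrow> singular_simplex (length xs) ?X (F xs)"
    "\<And>xs. \<lbrakk>length xs \<le> Suc n; xs \<noteq> []; set xs \<in> K\<rbrakk> \<Longrightarrow> singular_face (length xs) 0 (F xs) = linear_simplex xs"
    "\<And>xs i. \<lbrakk>length xs \<le> Suc n; set xs \<in> K; i < length xs\<rbrakk> \<Longrightarrow>
        singular_face (length xs) (Suc i) (F xs) = F (del_nth i xs)"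
    using cone_filling[OF conn K] by blast
  define A where "A = ordered_simplices Y (Suc p)"
  have finA: "finite A" unfolding A_def by (rule finite_ordered_simplices[OF Y(1,3)])
  have Alen: "length xs = Suc p" and AY: "set xs \<in> Y" and AK: "set xs \<in> K" and Adist: "distinct xs" if "xs \<in> A" for xs
    using that Y(2) by (auto simp: A_def ordered_simplices_def)
  let ?Sd = "\<lambda>q m c. (singular_subdivision q ^^ m) c"
  have FA: "singular_chain (Suc p) ?X (frag_of (F xs))" if "xs \<in> A" for xs
    using F(1)[of xs] Alen[OF that] AK[OF that] pn by (simp add: singular_chain_of)
  have "\<exists>m. \<forall>xs\<in>A. \<forall>m'\<ge>m. \<forall>f\<in>Poly_Mapping.keys (?Sd (Suc p) m' (frag_of (F xs))).
      \<exists>s\<in>K. f ` standard_simplex (Suc p) \<subseteq> dominant_nbhd K s"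
  proof -
    have "\<exists>m. \<forall>m'\<ge>m. \<forall>f\<in>Poly_Mapping.keys (?Sd (Suc p) m' (frag_of (F xs))).
      \<exists>s\<in>K. f ` standard_simplex (Suc p) \<subseteq> dominant_nbhd K s" if xs: "xs \<in> A" for xs
    proof -
      have op: "openin ?X U" if U: "U \<in> dominant_nbhd K ` K" for U
      proof -
        obtain s where s: "U = dominant_nbhd K s" "s \<in> K" using U by blast
        then have "finite s" using K by (simp add: abstract_complex_def)
        then show ?thesis unfolding s(1) by (rule openin_dominant_nbhd[OF K])
      qed
      show ?thesis
      proof (rule sufficient_iterated_singular_subdivision_exists[OF op dominant_nbhd_cover[OF K] FA[OF xs]])
        fix m assume m: "\<And>m' f. \<lbrakk>m \<le> m'; f \<in> Poly_Mapping.keys (?Sd (Suc p) m' (frag_of (F xs)))\<rbrakk>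
          \<Longrightarrow> \<exists>V\<in>dominant_nbhd K ` K. f \<in> standard_simplex (Suc p) \<rightarrow> V"
        show ?thesis
        proof (intro exI allI impI ballI)
          fix m' f assume "m \<le> m'" "f \<in> Poly_Mapping.keys (?Sd (Suc p) m' (frag_of (F xs)))"
          from m[OF this] show "\<exists>s\<in>K. f ` standard_simplex (Suc p) \<subseteq> dominant_nbhd K s" by blast
        qed
      qed
    qed
    then obtain M where M: "\<And>xs m' f. \<lbrakk>xs \<in> A; M xs \<le> m'; f \<in> Poly_Mapping.keys (?Sd (Suc p) m' (frag_of (F xs)))\<rbrakk>
      \<Longrightarrow> \<exists>s\<in>K. f ` standard_simplex (Suc p) \<subseteq> dominant_nbhd K s" by metis
    have "M xs \<le> (\<Sum>xs\<in>A. M xs)" if "xs \<in> A" for xs using finA that by (intro member_le_sum) auto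
    then show ?thesis using M by (meson order_trans)
  qed
  then obtain m where m: "\<And>xs f. \<lbrakk>xs \<in> A; f \<in> Poly_Mapping.keys (?Sd (Suc p) m (frag_of (F xs)))\<rbrakk>
      \<Longrightarrow> \<exists>s\<in>K. f ` standard_simplex (Suc p) \<subseteq> dominant_nbhd K s" by blast
  then obtain sx where sx: "\<And>xs f. \<lbrakk>xs \<in> A; f \<in> Poly_Mapping.keys (?Sd (Suc p) m (frag_of (F xs)))\<rbrakk>
      \<Longrightarrow> sx xs f \<in> K \<and> f ` standard_simplex (Suc p) \<subseteq> dominant_nbhd K (sx xs f)" by metis
  define B where "B = Y \<union> (\<Union>xs\<in>A. sx xs ` Poly_Mapping.keys (?Sd (Suc p) m (frag_of (F xs))))"
  have finB: "finite B" using Y finA by (simp add: B_def)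
  have BK: "B \<subseteq> K" using Y(2) sx by (auto simp: B_def)
  obtain j0 where j0: "\<forall>s\<in>B. s \<in> L j0" using into_L[OF finB BK] by blast
  obtain h :: "nat \<Rightarrow> ('v \<Rightarrow> real) chain \<Rightarrow> ('v \<Rightarrow> real) chain" where h: "\<And>p. h p 0 = 0"
        "\<And>p c1 c2. h p (c1-c2) = h p c1 - h p c2"
        "\<And>p X c. singular_chain p X c \<Longrightarrow> singular_chain (Suc p) X (h p c)"
        "\<And>p X c. singular_chain p X c
                 \<Longrightarrow> chain_boundary (Suc p) (h p c) + h (p - Suc 0) (chain_boundary p c)
                   = (singular_subdivision p ^^ m) c - c"
    using chain_homotopic_iterated_singular_subdivision[of m] by blast
  show ?thesis
  proof (intro exI[of _ j0] allI impI)
    fix j z assume j: "j0 \<le> j" and alt: "alternating_on (ordered_simplices (L j) (Suc p)) (Suc p) z"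
      and coc: "coboundary (L j) (Suc p) z = (\<lambda>_. 0)"
    have BL: "s \<in> L j" if "s \<in> B" for s using j0 that mono[OF j] by blast
    define W where "W = (\<lambda>f. if distinct (corner_list p f) then z (corner_list p f) else 0)"
    have W0: "(\<Sum>k\<le>Suc p. (-1) ^ k * W (singular_face (Suc p) k f)) = 0"
      if f: "s \<in> L j" "\<And>x. x \<in> standard_simplex (Suc p) \<Longrightarrow> top_vertex (f x) \<in> s" for f s
    proof -
      let ?ys = "corner_list (Suc p) f"
      have "top_vertex (f (simplex_corner k)) \<in> s" if "k \<le> Suc p" for k
        using that by (intro f(2)) (simp add: simplex_corner_def)
      then have sub: "set ?ys \<subseteq> s" by (auto simp: corner_list_def simp del: upt_Suc)
      have "set ?ys \<in> L j"
        by (rule abstract_complex_face[OF L(1) f(1) sub]) (simp add: corner_list_def)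
      moreover have "length ?ys = p + 2" by (simp add: corner_list_def)
      ultimately have "(\<Sum>k\<le>Suc p. (-1) ^ k * (if distinct (del_nth k ?ys) then z (del_nth k ?ys) else 0)) = 0"
        by (intro alternating_cocycle_degenerate[OF alt coc L(1)])
      moreover have "(\<Sum>k\<le>Suc p. (-1) ^ k * W (singular_face (Suc p) k f)) =
          (\<Sum>k\<le>Suc p. (-1) ^ k * (if distinct (del_nth k ?ys) then z (del_nth k ?ys) else 0))"
        by (rule sum.cong[OF refl]) (simp only: W_def corner_list_singular_face atMost_iff)
      ultimately show ?thesis by simp
    qed
    define V where "V = (\<lambda>f. chain_eval W (?Sd p m (frag_of f)))"
    define U where "U = (\<lambda>f. chain_eval W (h (p - 1) (frag_of f)))"
    \<comment> \<open>points have no boundary, so that there is no correction in degree zero\<close>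
    define u where "u = (\<lambda>ys. V (F ys) - (if p = 0 then 0 else U (linear_simplex ys)))"
    have V_eq: "chain_eval W (?Sd p m c) = chain_eval V c" for c
      unfolding V_def by (rule chain_eval_compose) (simp_all add: singular_subdivision_power_diff)
    have U_eq: "chain_eval W (h (p - 1) c) = chain_eval U c" for c
      unfolding U_def by (rule chain_eval_compose) (simp_all add: h)
    have "z xs = (\<Sum>i\<le>p. (-1) ^ i * u (del_nth i xs))" if xs: "xs \<in> A" for xs
    proof -
      have len: "length xs = Suc p" and ne: "xs \<noteq> []" using Alen[OF xs] by auto
      have lenn: "length xs \<le> Suc n" using len pn by simp
      let ?lin = "linear_simplex xs"
      \<comment> \<open>the boundary of the cone over \<open>xs\<close> is \<open>xs\<close> minus the cone over its boundary\<close>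
      have bd_F: "chain_eval V (chain_boundary (Suc p) (frag_of (F xs))) = V ?lin - (\<Sum>i\<le>p. (-1) ^ i * V (F (del_nth i xs)))"
      proof -
        have "chain_eval V (chain_boundary (Suc p) (frag_of (F xs))) =
            (\<Sum>k\<le>Suc p. (-1) ^ k * V (singular_face (Suc p) k (F xs)))"
          by (rule chain_eval_boundary_of) simp
        also have "\<dots> = V (singular_face (Suc p) 0 (F xs)) + (\<Sum>i\<le>p. (-1) ^ Suc i * V (singular_face (Suc p) (Suc i) (F xs)))"
          by (subst sum.atMost_Suc_shift) simp
        also have "singular_face (Suc p) 0 (F xs) = ?lin" using F(2)[OF lenn ne AK[OF xs]] len by simp
        also have "(\<Sum>i\<le>p. (-1) ^ Suc i * V (singular_face (Suc p) (Suc i) (F xs))) = (\<Sum>i\<le>p. - ((-1) ^ i * V (F (del_nth i xs))))"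
        proof (rule sum.cong[OF refl])
          fix i assume "i \<in> {..p}"
          then have "singular_face (Suc p) (Suc i) (F xs) = F (del_nth i xs)"
            using F(3)[OF lenn AK[OF xs], of i] len by simp
          then show "(-1) ^ Suc i * V (singular_face (Suc p) (Suc i) (F xs)) = - ((-1) ^ i * V (F (del_nth i xs)))" by simp
        qed
        finally show ?thesis by (simp add: sum_negf)
      qed
      have Sd_bd: "chain_boundary (Suc p) (?Sd (Suc p) k c) = ?Sd p k (chain_boundary (Suc p) c)"
        if c: "singular_chain (Suc p) ?X c" for k c
      proof (induction k)
        case (Suc k)
        have "singular_chain (Suc p) ?X (?Sd (Suc p) k c)"
          by (induction k) (auto simp: c singular_chain_singular_subdivision)
        from chain_boundary_singular_subdivision[OF this] show ?case using Suc by simp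
      qed simp
      have "chain_eval W (chain_boundary (Suc p) (?Sd (Suc p) m (frag_of (F xs)))) = 0"
        unfolding chain_eval_boundary[OF zero_less_Suc]
      proof (rule chain_eval_eq_0)
        fix f assume f: "f \<in> Poly_Mapping.keys (?Sd (Suc p) m (frag_of (F xs)))"
        have "sx xs f \<in> B" unfolding B_def using f xs by blast
        then show "(\<Sum>k\<le>Suc p. (-1) ^ k * W (singular_face (Suc p) k f)) = 0"
        proof (rule W0[OF BL])
          fix x assume "x \<in> standard_simplex (Suc p)"
          then have "f x \<in> dominant_nbhd K (sx xs f)" using sx[OF xs f] by blast
          then show "top_vertex (f x) \<in> sx xs f" by (rule top_vertex_dominant_nbhd)
        qed
      qed
      then have 1: "V ?lin = (\<Sum>i\<le>p. (-1) ^ i * V (F (del_nth i xs)))"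
        using Sd_bd[OF FA[OF xs]] bd_F by (simp add: V_eq)
      have slin: "singular_chain p (subtopology ?X (closed_simplex (set xs))) (frag_of ?lin)"
        using singular_simplex_linear_simplex[OF ne AK[OF xs]] len by (simp add: singular_chain_of)
      have "chain_eval W (chain_boundary (Suc p) (h p (frag_of ?lin))) = 0"
        unfolding chain_eval_boundary[OF zero_less_Suc]
      proof (rule chain_eval_eq_0)
        fix f assume f: "f \<in> Poly_Mapping.keys (h p (frag_of ?lin))"
        then have fs: "f ` standard_simplex (Suc p) \<subseteq> closed_simplex (set xs)"
          using h(3)[OF slin] by (simp add: singular_chain_subtopology)
        have "set xs \<in> B" using AY[OF xs] by (simp add: B_def)
        then show "(\<Sum>k\<le>Suc p. (-1) ^ k * W (singular_face (Suc p) k f)) = 0"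
        proof (rule W0[OF BL])
          fix x assume "x \<in> standard_simplex (Suc p)"
          then have "f x \<in> closed_simplex (set xs)" using fs by blast
          then show "top_vertex (f x) \<in> set xs" by (rule top_vertex_max(2))
        qed
      qed
      moreover have "chain_eval W (chain_boundary (Suc p) (h p (frag_of ?lin)) + h (p - Suc 0) (chain_boundary p (frag_of ?lin)))
          = V ?lin - W ?lin"
        unfolding h(4)[OF slin] by (simp add: chain_eval_diff V_def)
      ultimately have 2: "chain_eval U (chain_boundary p (frag_of ?lin)) = V ?lin - W ?lin"
        by (simp add: chain_eval_add U_eq[unfolded One_nat_def])
      have "W ?lin = z xs" using Adist[OF xs] corner_list_linear_simplex[OF len] by (simp add: W_def)
      moreover have "chain_eval U (chain_boundary p (frag_of ?lin)) =
          (\<Sum>i\<le>p. (-1) ^ i * (if p = 0 then 0 else U (linear_simplex (del_nth i xs))))"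
      proof (cases "p = 0")
        case True then show ?thesis by (simp add: chain_boundary_def)
      next
        case False
        then have "chain_eval U (chain_boundary p (frag_of ?lin)) = (\<Sum>k\<le>p. (-1) ^ k * U (singular_face p k ?lin))"
          by (intro chain_eval_boundary_of) simp
        also have "\<dots> = (\<Sum>i\<le>p. (-1) ^ i * (if p = 0 then 0 else U (linear_simplex (del_nth i xs))))"
        proof (rule sum.cong[OF refl])
          fix i assume "i \<in> {..p}"
          then have "singular_face p i ?lin = linear_simplex (del_nth i xs)"
            using singular_face_linear_simplex[of i xs] len False by simp
          then show "(-1) ^ i * U (singular_face p i ?lin) = (-1) ^ i * (if p = 0 then 0 else U (linear_simplex (del_nth i xs)))"
            using False by simp
        qed
        finally show ?thesis .
      qed
      ultimately have "z xs = V ?lin - (\<Sum>i\<le>p. (-1) ^ i * (if p = 0 then 0 else U (linear_simplex (del_nth i xs))))"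
        using 2 by (metis add_diff_cancel_left' diff_add_cancel)
      also have "\<dots> = (\<Sum>i\<le>p. (-1) ^ i * u (del_nth i xs))"
        unfolding 1 u_def sum_subtractf[symmetric] by (intro sum.cong refl) (simp only: right_diff_distrib)
      finally show ?thesis .
    qed
    then show "\<exists>u. \<forall>xs\<in>ordered_simplices Y (Suc p). z xs = (\<Sum>i\<le>p. (-1) ^ i * u (del_nth i xs))"
      unfolding A_def by blast
  qed
qed


section \<open>Square-summable functions and orthogonal projections\<close>

definition l2_sq :: "'s set \<Rightarrow> ('s \<Rightarrow> complex) \<Rightarrow> real" where
  "l2_sq S f = (\<Sum>\<^sub>\<infinity>s\<in>S. (cmod (f s))\<^sup>2)"

lemma l2_norm_sqrt: "l2_norm S f = sqrt (l2_sq S f)"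
  by (simp add: l2_norm_def l2_sq_def)

lemma l2_sq_nonneg: "0 \<le> l2_sq S f"
  unfolding l2_sq_def by (rule infsum_nonneg) simp

lemma l2_I:
  assumes "\<And>s. s \<notin> S \<Longrightarrow> f s = 0" "\<And>A. \<lbrakk>finite A; A \<subseteq> S\<rbrakk> \<Longrightarrow> (\<Sum>s\<in>A. (cmod (f s))\<^sup>2) \<le> B"
  shows "f \<in> l2 S" and "l2_sq S f \<le> B"
proof -
  have "(\<lambda>s. (cmod (f s))\<^sup>2) summable_on S"
    by (rule nonneg_bdd_above_summable_on) (use assms(2) in \<open>auto intro!: bdd_aboveI[of _ B]\<close>)
  then show "f \<in> l2 S" using assms(1) by (simp add: l2_def)
  show "l2_sq S f \<le> B" unfolding l2_sq_def
    by (rule infsum_le_finite_sums) (use \<open>(\<lambda>s. (cmod (f s))\<^sup>2) summable_on S\<close> assms(2) in auto)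
qed

lemma sum_le_l2_sq:
  assumes "f \<in> l2 S" "finite A" "A \<subseteq> S"
  shows "(\<Sum>s\<in>A. (cmod (f s))\<^sup>2) \<le> l2_sq S f"
  unfolding l2_sq_def using assms by (intro finite_sum_le_infsum) (auto simp: l2_def)

lemma l2_finite_support:
  assumes "finite A" "A \<subseteq> S" "\<And>s. s \<notin> A \<Longrightarrow> f s = 0"
  shows "f \<in> l2 S"
proof (rule l2_I(1))
  fix B assume B: "finite B" "B \<subseteq> S"
  have "(\<Sum>s\<in>B. (cmod (f s))\<^sup>2) = (\<Sum>s\<in>B \<inter> A. (cmod (f s))\<^sup>2)"
    using B assms by (intro sum.mono_neutral_right) auto
  also have "\<dots> \<le> (\<Sum>s\<in>A. (cmod (f s))\<^sup>2)" using assms by (intro sum_mono2) auto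
  finally show "(\<Sum>s\<in>B. (cmod (f s))\<^sup>2) \<le> (\<Sum>s\<in>A. (cmod (f s))\<^sup>2)" .
qed (use assms in auto)

lemma l2_zero [simp]: "(\<lambda>_. 0) \<in> l2 S"
  by (simp add: l2_def)

lemma l2_sum_le_norm:
  assumes "f \<in> l2 S" "finite A" "A \<subseteq> S"
  shows "L2_set (\<lambda>s. cmod (f s)) A \<le> l2_norm S f"
  unfolding L2_set_def l2_norm_sqrt using sum_le_l2_sq[OF assms] by simp

lemma l2_add_norm:
  assumes "f \<in> l2 S" "g \<in> l2 S"
  shows "(\<lambda>s. f s + g s) \<in> l2 S" and "l2_norm S (\<lambda>s. f s + g s) \<le> l2_norm S f + l2_norm S g"
proof -
  have le: "(\<Sum>s\<in>A. (cmod (f s + g s))\<^sup>2) \<le> (l2_norm S f + l2_norm S g)\<^sup>2" if A: "finite A" "A \<subseteq> S" for A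
  proof -
    have "(\<Sum>s\<in>A. (cmod (f s + g s))\<^sup>2) = (L2_set (\<lambda>s. cmod (f s + g s)) A)\<^sup>2"
      by (simp add: L2_set_def sum_nonneg)
    also have "\<dots> \<le> (L2_set (\<lambda>s. cmod (f s) + cmod (g s)) A)\<^sup>2"
      by (intro power_mono L2_set_mono) (auto simp: norm_triangle_ineq L2_set_nonneg)
    also have "\<dots> \<le> (L2_set (\<lambda>s. cmod (f s)) A + L2_set (\<lambda>s. cmod (g s)) A)\<^sup>2"
      by (intro power_mono L2_set_triangle_ineq L2_set_nonneg)
    also have "\<dots> \<le> (l2_norm S f + l2_norm S g)\<^sup>2"
      using l2_sum_le_norm[OF assms(1) A] l2_sum_le_norm[OF assms(2) A]
      by (intro power_mono add_mono add_nonneg_nonneg L2_set_nonneg)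
    finally show ?thesis .
  qed
  show "(\<lambda>s. f s + g s) \<in> l2 S"
    by (rule l2_I(1)[OF _ le]) (use assms in \<open>auto simp: l2_def\<close>)
  have "l2_sq S (\<lambda>s. f s + g s) \<le> (l2_norm S f + l2_norm S g)\<^sup>2"
    by (rule l2_I(2)[OF _ le]) (use assms in \<open>auto simp: l2_def\<close>)
  then show "l2_norm S (\<lambda>s. f s + g s) \<le> l2_norm S f + l2_norm S g"
    unfolding l2_norm_sqrt[of S "\<lambda>s. f s + g s"]
    by (intro real_le_lsqrt) (auto simp: l2_norm_sqrt l2_sq_nonneg)
qed

lemma l2_scale:
  assumes "f \<in> l2 S" shows "(\<lambda>s. c * f s) \<in> l2 S" and "l2_sq S (\<lambda>s. c * f s) = (cmod c)\<^sup>2 * l2_sq S f"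
proof -
  have "(\<lambda>s. (cmod c)\<^sup>2 * (cmod (f s))\<^sup>2) summable_on S"
    using assms by (intro summable_on_cmult_right) (simp add: l2_def)
  then show "(\<lambda>s. c * f s) \<in> l2 S"
    using assms by (simp add: l2_def norm_mult power_mult_distrib)
  show "l2_sq S (\<lambda>s. c * f s) = (cmod c)\<^sup>2 * l2_sq S f"
    by (simp add: l2_sq_def norm_mult power_mult_distrib infsum_cmult_right')
qed

lemma l2_diff: "\<lbrakk>f \<in> l2 S; g \<in> l2 S\<rbrakk> \<Longrightarrow> (\<lambda>s. f s - g s) \<in> l2 S"
  using l2_add_norm(1)[of f S "\<lambda>s. (-1) * g s"] l2_scale(1)[of g S "-1"] by simp

lemma l2_norm_minus_commute: "l2_norm S (\<lambda>s. f s - g s) = l2_norm S (\<lambda>s. g s - f s)"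
  by (simp add: l2_norm_def norm_minus_commute)

lemma l2_norm_triangle:
  assumes "f \<in> l2 S" "g \<in> l2 S" "h \<in> l2 S"
  shows "l2_norm S (\<lambda>s. f s - h s) \<le> l2_norm S (\<lambda>s. f s - g s) + l2_norm S (\<lambda>s. g s - h s)"
  using l2_add_norm(2)[OF l2_diff[OF assms(1,2)] l2_diff[OF assms(2,3)]] by simp

lemma cmod_le_l2_norm: "f \<in> l2 S \<Longrightarrow> cmod (f s) \<le> l2_norm S f"
proof (cases "s \<in> S")
  case True
  assume "f \<in> l2 S"
  from l2_sum_le_norm[OF this, of "{s}"] True show ?thesis by simp
next
  case False
  assume "f \<in> l2 S"
  with False show ?thesis by (simp add: l2_def l2_norm_sqrt l2_sq_nonneg)
qed

lemma l2_inner_summable: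
  assumes "f \<in> l2 S" "g \<in> l2 S"
  shows "(\<lambda>s. f s * cnj (g s)) summable_on S"
proof -
  have "(\<lambda>s. (cmod (f s))\<^sup>2 + (cmod (g s))\<^sup>2) summable_on S"
    using assms by (intro summable_on_add) (simp_all add: l2_def)
  moreover have "cmod (f s * cnj (g s)) \<le> (cmod (f s))\<^sup>2 + (cmod (g s))\<^sup>2" for s
  proof -
    have "2 * (cmod (f s) * cmod (g s)) \<le> (cmod (f s))\<^sup>2 + (cmod (g s))\<^sup>2"
      using sum_squares_bound[of "cmod (f s)" "cmod (g s)"] by simp
    moreover have "0 \<le> cmod (f s) * cmod (g s)" by simp
    ultimately show ?thesis unfolding norm_mult complex_mod_cnj by linarith
  qed
  ultimately have "(\<lambda>s. norm (f s * cnj (g s))) summable_on S"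
    by (rule Infinite_Sum.abs_summable_on_comparison_test')
  then show ?thesis by (rule abs_summable_summable)
qed

lemma l2_inner_add_left:
  "\<lbrakk>f \<in> l2 S; g \<in> l2 S; h \<in> l2 S\<rbrakk> \<Longrightarrow> l2_inner S (\<lambda>s. f s + g s) h = l2_inner S f h + l2_inner S g h"
  unfolding l2_inner_def distrib_right by (rule infsum_add) (rule l2_inner_summable; assumption)+

lemma l2_inner_scale_left: "l2_inner S (\<lambda>s. c * f s) g = c * l2_inner S f g"
  unfolding l2_inner_def mult.assoc by (rule infsum_cmult_right')

lemma l2_inner_cnj: "cnj (l2_inner S f g) = l2_inner S g f"
  unfolding l2_inner_def infsum_cnj[symmetric] by (simp add: mult.commute)

lemma l2_inner_diff_left:
  assumes "f \<in> l2 S" "g \<in> l2 S" "h \<in> l2 S"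
  shows "l2_inner S (\<lambda>s. f s - g s) h = l2_inner S f h - l2_inner S g h"
  using l2_inner_add_left[OF assms(1) l2_scale(1)[OF assms(2), of "-1"] assms(3)]
    l2_inner_scale_left[of S "-1" g h] by simp

lemma l2_inner_scale_right: "l2_inner S g (\<lambda>s. c * f s) = cnj c * l2_inner S g f"
  using arg_cong[OF l2_inner_scale_left[of S c f g], of cnj] by (simp add: l2_inner_cnj)

lemma l2_inner_diff_right:
  "\<lbrakk>f \<in> l2 S; g \<in> l2 S; h \<in> l2 S\<rbrakk> \<Longrightarrow> l2_inner S h (\<lambda>s. f s - g s) = l2_inner S h f - l2_inner S h g"
  using arg_cong[OF l2_inner_diff_left[of f S g h], of cnj] by (simp add: l2_inner_cnj)

lemma l2_inner_self: "l2_inner S f f = of_real (l2_sq S f)"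
proof -
  have "f s * cnj (f s) = of_real ((cmod (f s))\<^sup>2)" for s by (rule complex_norm_square[symmetric])
  then have "l2_inner S f f = (\<Sum>\<^sub>\<infinity>s\<in>S. of_real ((cmod (f s))\<^sup>2))" by (simp only: l2_inner_def)
  also have "\<dots> = of_real (l2_sq S f)"
  proof (cases "(\<lambda>s. (cmod (f s))\<^sup>2) summable_on S")
    case True
    show ?thesis unfolding l2_sq_def
      by (rule infsumI) (simp only: has_sum_of_real_iff has_sum_infsum[OF True])
  next
    case False
    then have "\<not> (\<lambda>s. complex_of_real ((cmod (f s))\<^sup>2)) summable_on S"
      using summable_on_bounded_linear[OF bounded_linear_Re, of "\<lambda>s. complex_of_real ((cmod (f s))\<^sup>2)" S]
      by (auto simp: o_def)
    with False show ?thesis by (simp add: l2_sq_def infsum_not_exists)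
  qed
  finally show ?thesis .
qed

lemma l2_sq_diff:
  assumes "f \<in> l2 S" "g \<in> l2 S"
  shows "l2_sq S (\<lambda>s. f s - g s) = l2_sq S f - 2 * Re (l2_inner S f g) + l2_sq S g"
proof -
  have "complex_of_real (l2_sq S (\<lambda>s. f s - g s)) = l2_inner S (\<lambda>s. f s - g s) (\<lambda>s. f s - g s)"
    by (rule l2_inner_self[symmetric])
  also have "\<dots> = l2_inner S f f - l2_inner S f g - (l2_inner S g f - l2_inner S g g)"
    using assms l2_diff[OF assms] by (simp add: l2_inner_diff_left l2_inner_diff_right)
  also have "l2_inner S g f = cnj (l2_inner S f g)" by (rule l2_inner_cnj[symmetric])
  finally have "Re (complex_of_real (l2_sq S (\<lambda>s. f s - g s))) =
      Re (l2_inner S f f - l2_inner S f g - (cnj (l2_inner S f g) - l2_inner S g g))" by simp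
  then show ?thesis by (simp add: l2_inner_self)
qed

lemma l2_sq_eq_0_imp: "\<lbrakk>f \<in> l2 S; l2_sq S f = 0\<rbrakk> \<Longrightarrow> f s = 0"
  using cmod_le_l2_norm[of f S s] by (simp add: l2_norm_sqrt)

lemma l2_inner_point_mass:
  assumes "s \<in> S" shows "l2_inner S f (point_mass s) = f s"
proof -
  have "l2_inner S f (point_mass s) = (\<Sum>\<^sub>\<infinity>t\<in>{s}. f t * cnj (point_mass s t))"
    unfolding l2_inner_def by (rule infsum_cong_neutral) (use assms in \<open>auto simp: point_mass_def\<close>)
  then show ?thesis by (simp add: point_mass_def)
qed

lemma point_mass_l2: "s \<in> S \<Longrightarrow> point_mass s \<in> l2 S"
  by (rule l2_finite_support[of "{s}"]) (auto simp: point_mass_def)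

lemma l2_complete:
  fixes g :: "nat \<Rightarrow> 's \<Rightarrow> complex"
  assumes g: "\<And>n. g n \<in> l2 S"
    and cauchy: "\<And>e. 0 < e \<Longrightarrow> \<exists>N. \<forall>m\<ge>N. \<forall>n\<ge>N. l2_norm S (\<lambda>s. g m s - g n s) < e"
  obtains h where "h \<in> l2 S" "\<And>e. 0 < e \<Longrightarrow> \<exists>N. \<forall>n\<ge>N. l2_norm S (\<lambda>s. h s - g n s) \<le> e"
proof -
  have "Cauchy (\<lambda>n. g n s)" for s
  proof (rule metric_CauchyI)
    fix e :: real assume "0 < e"
    then obtain N where N: "\<forall>m\<ge>N. \<forall>n\<ge>N. l2_norm S (\<lambda>s. g m s - g n s) < e" using cauchy by blast
    have "dist (g m s) (g n s) < e" if "m \<ge> N" "n \<ge> N" for m n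
      using cmod_le_l2_norm[OF l2_diff[OF g[of m] g[of n]], of s] N that by (force simp: dist_norm)
    then show "\<exists>M. \<forall>m\<ge>M. \<forall>n\<ge>M. dist (g m s) (g n s) < e" by blast
  qed
  then have "\<exists>l. (\<lambda>n. g n s) \<longlonglongrightarrow> l" for s by (simp add: Cauchy_convergent_iff convergent_def)
  then obtain h where h: "\<And>s. (\<lambda>n. g n s) \<longlonglongrightarrow> h s" by metis
  have h0: "h s = 0" if "s \<notin> S" for s
  proof -
    have "(\<lambda>n. g n s) = (\<lambda>n. 0)" using g that by (simp add: l2_def)
    then show ?thesis using h[of s] by (simp add: LIMSEQ_const_iff)
  qed
  have bound: "(\<Sum>s\<in>A. (cmod (h s - g n s))\<^sup>2) \<le> e\<^sup>2"
    if A: "finite A" "A \<subseteq> S" and N: "\<forall>m\<ge>N. \<forall>n\<ge>N. l2_norm S (\<lambda>s. g m s - g n s) < e" and n: "n \<ge> N" for A N e n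
  proof (rule LIMSEQ_le_const2)
    show "(\<lambda>m. \<Sum>s\<in>A. (cmod (g m s - g n s))\<^sup>2) \<longlonglongrightarrow> (\<Sum>s\<in>A. (cmod (h s - g n s))\<^sup>2)"
      by (intro tendsto_sum tendsto_power tendsto_norm tendsto_diff h tendsto_const)
    show "\<exists>M. \<forall>m\<ge>M. (\<Sum>s\<in>A. (cmod (g m s - g n s))\<^sup>2) \<le> e\<^sup>2"
    proof (intro exI[of _ N] allI impI)
      fix m assume m: "m \<ge> N"
      have "(\<Sum>s\<in>A. (cmod (g m s - g n s))\<^sup>2) \<le> l2_sq S (\<lambda>s. g m s - g n s)"
        by (rule sum_le_l2_sq[OF l2_diff[OF g g] A])
      also have "\<dots> = (l2_norm S (\<lambda>s. g m s - g n s))\<^sup>2" by (simp add: l2_norm_sqrt l2_sq_nonneg)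
      also have "\<dots> \<le> e\<^sup>2" using N m n by (intro power_mono) (auto simp: l2_norm_sqrt l2_sq_nonneg intro: less_imp_le)
      finally show "(\<Sum>s\<in>A. (cmod (g m s - g n s))\<^sup>2) \<le> e\<^sup>2" .
    qed
  qed
  obtain N0 where N0: "\<forall>m\<ge>N0. \<forall>n\<ge>N0. l2_norm S (\<lambda>s. g m s - g n s) < 1" using cauchy[of 1] by auto
  have "(\<lambda>s. h s - g N0 s) \<in> l2 S"
    by (rule l2_I(1)[where B="1\<^sup>2"]) (use bound[OF _ _ N0] h0 g in \<open>auto simp: l2_def\<close>)
  from l2_add_norm(1)[OF this g[of N0]] have hl2: "h \<in> l2 S" by simp
  show thesis
  proof (rule that[OF hl2])
    fix e :: real assume e: "0 < e"
    obtain N where N: "\<forall>m\<ge>N. \<forall>n\<ge>N. l2_norm S (\<lambda>s. g m s - g n s) < e" using cauchy[OF e] by blast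
    have "l2_norm S (\<lambda>s. h s - g n s) \<le> e" if "n \<ge> N" for n
    proof -
      have "l2_sq S (\<lambda>s. h s - g n s) \<le> e\<^sup>2"
        by (rule l2_I(2)) (use bound[OF _ _ N that] h0 g in \<open>auto simp: l2_def\<close>)
      then show ?thesis unfolding l2_norm_sqrt using e by (intro real_le_lsqrt) auto
    qed
    then show "\<exists>N. \<forall>n\<ge>N. l2_norm S (\<lambda>s. h s - g n s) \<le> e" by blast
  qed
qed

definition l2_subspace :: "'s set \<Rightarrow> ('s \<Rightarrow> complex) set \<Rightarrow> bool" where
  "l2_subspace S V \<longleftrightarrow> V \<subseteq> l2 S \<and> (\<lambda>_. 0) \<in> V \<and> (\<forall>f\<in>V. \<forall>g\<in>V. (\<lambda>s. f s + g s) \<in> V) \<and>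
     (\<forall>f\<in>V. \<forall>c. (\<lambda>s. c * f s) \<in> V)"

definition closed_l2_subspace :: "'s set \<Rightarrow> ('s \<Rightarrow> complex) set \<Rightarrow> bool" where
  "closed_l2_subspace S V \<longleftrightarrow> l2_subspace S V \<and> l2_closure S V \<subseteq> V"

lemma l2_subspaceD:
  assumes "l2_subspace S V"
  shows "f \<in> V \<Longrightarrow> f \<in> l2 S" "(\<lambda>_. 0) \<in> V" "\<lbrakk>f \<in> V; g \<in> V\<rbrakk> \<Longrightarrow> (\<lambda>s. f s + g s) \<in> V"
    "f \<in> V \<Longrightarrow> (\<lambda>s. c * f s) \<in> V" "\<lbrakk>f \<in> V; g \<in> V\<rbrakk> \<Longrightarrow> (\<lambda>s. f s - g s) \<in> V"
proof -
  show add: "(\<lambda>s. f s + g s) \<in> V" if "f \<in> V" "g \<in> V" for f g using assms that by (simp add: l2_subspace_def)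
  show scale: "(\<lambda>s. c * f s) \<in> V" if "f \<in> V" for f c using assms that by (simp add: l2_subspace_def)
  show "(\<lambda>s. f s - g s) \<in> V" if "f \<in> V" "g \<in> V"
    using add[OF that(1) scale[OF that(2), of "-1"]] by simp
qed (use assms in \<open>auto simp: l2_subspace_def\<close>)

lemma l2_closure_subset: "A \<subseteq> l2 S \<Longrightarrow> A \<subseteq> l2_closure S A"
proof
  fix f assume "A \<subseteq> l2 S" "f \<in> A"
  then show "f \<in> l2_closure S A"
    unfolding l2_closure_def by (intro CollectI conjI allI impI bexI[of _ f]) (auto simp: l2_norm_def)
qed

lemma closed_l2_subspace_closure:
  assumes V: "l2_subspace S V" shows "closed_l2_subspace S (l2_closure S V)"
  unfolding closed_l2_subspace_def
proof
  note VD = l2_subspaceD[OF V]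
  show "l2_subspace S (l2_closure S V)"
    unfolding l2_subspace_def
  proof (intro conjI ballI allI)
    show "l2_closure S V \<subseteq> l2 S" by (auto simp: l2_closure_def)
    show "(\<lambda>_. 0) \<in> l2_closure S V" using l2_closure_subset[of V S] VD(1,2) by blast
    fix f g assume f: "f \<in> l2_closure S V" and g: "g \<in> l2_closure S V"
    have fl: "f \<in> l2 S" and gl: "g \<in> l2 S" using f g by (auto simp: l2_closure_def)
    show "(\<lambda>s. f s + g s) \<in> l2_closure S V"
      unfolding l2_closure_def
    proof (intro CollectI conjI allI impI)
      show "(\<lambda>s. f s + g s) \<in> l2 S" using l2_add_norm(1)[OF fl gl] .
      fix e :: real assume e: "0 < e"
      then obtain f' g' where f': "f' \<in> V" "l2_norm S (\<lambda>s. f s - f' s) < e / 2" and g': "g' \<in> V" "l2_norm S (\<lambda>s. g s - g' s) < e / 2"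
        using f g unfolding l2_closure_def by (auto dest!: spec[of _ "e/2"])
      have "l2_norm S (\<lambda>s. (f s - f' s) + (g s - g' s)) \<le> l2_norm S (\<lambda>s. f s - f' s) + l2_norm S (\<lambda>s. g s - g' s)"
        using fl gl f' g' VD(1) by (intro l2_add_norm(2) l2_diff)
      then have "l2_norm S (\<lambda>s. (f s + g s) - (f' s + g' s)) < e" using f' g' by (simp add: algebra_simps)
      then show "\<exists>h\<in>V. l2_norm S (\<lambda>s. f s + g s - h s) < e" by (intro bexI[of _ "\<lambda>s. f' s + g' s"] VD(3) f'(1) g'(1))
    qed
    fix c :: complex
    show "(\<lambda>s. c * f s) \<in> l2_closure S V"
      unfolding l2_closure_def
    proof (intro CollectI conjI allI impI)
      show "(\<lambda>s. c * f s) \<in> l2 S" using l2_scale(1)[OF fl] .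
      fix e :: real assume e: "0 < e"
      let ?d = "e / (1 + cmod c)"
      have d: "0 < ?d" using e by (simp add: add_pos_nonneg)
      then obtain f' where f': "f' \<in> V" "l2_norm S (\<lambda>s. f s - f' s) < ?d"
        using f unfolding l2_closure_def by blast
      have "l2_norm S (\<lambda>s. c * f s - c * f' s) = l2_norm S (\<lambda>s. c * (f s - f' s))" by (simp add: right_diff_distrib)
      also have "\<dots> = cmod c * l2_norm S (\<lambda>s. f s - f' s)"
        using l2_scale(2)[OF l2_diff[OF fl VD(1)[OF f'(1)]], of c] by (simp add: l2_norm_sqrt real_sqrt_mult)
      also have "\<dots> \<le> cmod c * ?d" using f' by (intro mult_left_mono) auto
      also have "\<dots> < e"
      proof -
        have "0 < 1 + cmod c" by (simp add: add_pos_nonneg)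
        then show ?thesis using e by (simp add: field_simps)
      qed
      finally show "\<exists>h\<in>V. l2_norm S (\<lambda>s. c * f s - h s) < e" by (intro bexI[of _ "\<lambda>s. c * f' s"] VD(4) f'(1))
    qed
  qed
  show "l2_closure S (l2_closure S V) \<subseteq> l2_closure S V"
  proof
    fix f assume f: "f \<in> l2_closure S (l2_closure S V)"
    then have fl: "f \<in> l2 S" by (simp add: l2_closure_def)
    show "f \<in> l2_closure S V"
      unfolding l2_closure_def
    proof (intro CollectI conjI allI impI)
      fix e :: real assume e: "0 < e"
      obtain g where g: "g \<in> l2_closure S V" "l2_norm S (\<lambda>s. f s - g s) < e / 2"
        using f e unfolding l2_closure_def[of S "l2_closure S V"] by (auto dest!: spec[of _ "e/2"])
      obtain h where h: "h \<in> V" "l2_norm S (\<lambda>s. g s - h s) < e / 2"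
        using g(1) e unfolding l2_closure_def by (auto dest!: spec[of _ "e/2"])
      have "g \<in> l2 S" using g(1) by (simp add: l2_closure_def)
      then have "l2_norm S (\<lambda>s. f s - h s) < e"
        using l2_norm_triangle[OF fl _ VD(1)[OF h(1)], of g] g(2) h(2) by simp
      then show "\<exists>h\<in>V. l2_norm S (\<lambda>s. f s - h s) < e" using h(1) by blast
    qed (rule fl)
  qed
qed

text \<open>
  A finite combination of values is continuous for the norm.
\<close>

lemma l2_closure_finite_condition:
  assumes A: "A \<subseteq> l2 S" and X: "finite X" and cond: "\<And>f. f \<in> A \<Longrightarrow> (\<Sum>x\<in>X. c x * f x) = 0"
    and f: "f \<in> l2_closure S A"
  shows "(\<Sum>x\<in>X. c x * f x) = 0"
proof -
  have fl: "f \<in> l2 S" using f by (simp add: l2_closure_def)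
  let ?C = "\<Sum>x\<in>X. cmod (c x)"
  have C0: "0 \<le> ?C" by (rule sum_nonneg) simp
  have "cmod (\<Sum>x\<in>X. c x * f x) \<le> e" if e: "0 < e" for e
  proof -
    obtain g where g: "g \<in> A" "l2_norm S (\<lambda>s. f s - g s) < e / (1 + ?C)"
    proof -
      have "0 < e / (1 + ?C)" using e C0 by (intro divide_pos_pos) auto
      then show thesis using f that unfolding l2_closure_def by blast
    qed
    have gl: "g \<in> l2 S" using g A by auto
    have "(\<Sum>x\<in>X. c x * f x) = (\<Sum>x\<in>X. c x * (f x - g x)) + (\<Sum>x\<in>X. c x * g x)"
      by (simp add: sum.distrib[symmetric] algebra_simps)
    also have "\<dots> = (\<Sum>x\<in>X. c x * (f x - g x))" using cond[OF g(1)] by simp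
    finally have "cmod (\<Sum>x\<in>X. c x * f x) \<le> (\<Sum>x\<in>X. cmod (c x) * cmod (f x - g x))"
      using norm_sum[of "\<lambda>x. c x * (f x - g x)" X] by (simp add: norm_mult)
    also have "\<dots> \<le> (\<Sum>x\<in>X. cmod (c x) * (e / (1 + ?C)))"
    proof (intro sum_mono mult_left_mono)
      fix x show "cmod (f x - g x) \<le> e / (1 + ?C)"
        using cmod_le_l2_norm[OF l2_diff[OF fl gl], of x] g(2) by simp
    qed simp
    also have "\<dots> = ?C * (e / (1 + ?C))" by (rule sum_distrib_right[symmetric])
    also have "\<dots> \<le> e" using e C0 by (simp add: field_simps)
    finally show ?thesis .
  qed
  then have "cmod (\<Sum>x\<in>X. c x * f x) \<le> 0" by (rule field_le_epsilon[of _ 0, simplified])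
  then show ?thesis by simp
qed

text \<open>
  A minimizing sequence for the distance to \<open>f\<close> is Cauchy by the parallelogram law, and at the limit a
  step in the direction of \<open>v\<close> would shorten the distance unless the difference is orthogonal to \<open>v\<close>.
\<close>

lemma l2_projection_exists:
  assumes V: "closed_l2_subspace S V" and f: "f \<in> l2 S"
  shows "\<exists>!g. g \<in> V \<and> (\<forall>v\<in>V. l2_inner S (\<lambda>s. f s - g s) v = 0)"
proof -
  have Vs: "l2_subspace S V" using V by (simp add: closed_l2_subspace_def)
  note VD = l2_subspaceD[OF Vs]
  let ?q = "\<lambda>g. l2_sq S (\<lambda>s. f s - g s)"
  define d where "d = (INF g\<in>V. ?q g)"
  have bdd: "bdd_below (?q ` V)" by (rule bdd_belowI2[of _ 0]) (simp add: l2_sq_nonneg)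
  have d_le: "d \<le> ?q g" if "g \<in> V" for g unfolding d_def by (rule cINF_lower[OF bdd that])
  have "\<exists>g\<in>V. ?q g < d + 1 / Suc n" for n
  proof -
    have "(INF g\<in>V. ?q g) < d + 1 / Suc n" by (simp add: d_def)
    then show ?thesis using VD(2) by (subst (asm) cINF_less_iff[OF _ bdd]) auto
  qed
  then obtain g where g: "\<And>n. g n \<in> V" "\<And>n. ?q (g n) < d + 1 / Suc n" by metis
  have gl: "g n \<in> l2 S" for n using g(1) VD(1) by blast
  have close: "l2_sq S (\<lambda>s. g m s - g n s) \<le> 2 / Suc m + 2 / Suc n" for m n
  proof -
    let ?a = "\<lambda>s. f s - g n s" and ?b = "\<lambda>s. f s - g m s"
    have ab: "?a \<in> l2 S" "?b \<in> l2 S" using f gl l2_diff by blast+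
    let ?mid = "\<lambda>s. (1/2) * (g n s + g m s)"
    have mid: "?mid \<in> V" by (intro VD(4) VD(3) g(1))
    have "l2_sq S (\<lambda>s. ?a s - ?b s) = l2_sq S ?a - 2 * Re (l2_inner S ?a ?b) + l2_sq S ?b"
      by (rule l2_sq_diff[OF ab])
    moreover have "l2_sq S (\<lambda>s. ?a s - (-1) * ?b s) = l2_sq S ?a - 2 * Re (l2_inner S ?a (\<lambda>s. (-1) * ?b s)) + l2_sq S (\<lambda>s. (-1) * ?b s)"
      by (rule l2_sq_diff[OF ab(1) l2_scale(1)[OF ab(2)]])
    moreover have "(\<lambda>s. ?a s - (-1) * ?b s) = (\<lambda>s. 2 * (f s - ?mid s))" by (auto simp: fun_eq_iff field_simps)
    then have "l2_sq S (\<lambda>s. ?a s - (-1) * ?b s) = 4 * ?q ?mid"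
      using l2_scale(2)[OF l2_diff[OF f VD(1)[OF mid]], of 2] by simp
    ultimately have "l2_sq S (\<lambda>s. ?a s - ?b s) = 2 * l2_sq S ?a + 2 * l2_sq S ?b - 4 * ?q ?mid"
      unfolding l2_inner_scale_right l2_scale(2)[OF ab(2)] by simp
    moreover have "(\<lambda>s. ?a s - ?b s) = (\<lambda>s. g m s - g n s)" by auto
    ultimately show ?thesis using g(2)[of m] g(2)[of n] d_le[OF mid] by simp
  qed
  have cauchy: "\<exists>N. \<forall>m\<ge>N. \<forall>n\<ge>N. l2_norm S (\<lambda>s. g m s - g n s) < e" if e: "0 < e" for e
  proof -
    obtain N where "4 / e\<^sup>2 < real N" using reals_Archimedean2 by blast
    then have N: "4 / e\<^sup>2 < real (Suc N)" by simp
    have "l2_norm S (\<lambda>s. g m s - g n s) < e" if mn: "m \<ge> N" "n \<ge> N" for m n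
    proof -
      have "2 / Suc m + 2 / Suc n \<le> 2 / Suc N + 2 / Suc N"
        using mn by (intro add_mono divide_left_mono) auto
      also have "\<dots> = 4 / Suc N" by simp
      also have "\<dots> < e\<^sup>2" using N e by (simp add: field_simps)
      finally have "l2_sq S (\<lambda>s. g m s - g n s) < e\<^sup>2" using close[of m n] by linarith
      then show ?thesis unfolding l2_norm_sqrt using e by (intro real_less_lsqrt) auto
    qed
    then show ?thesis by blast
  qed
  obtain h where h: "h \<in> l2 S" "\<And>e. 0 < e \<Longrightarrow> \<exists>N. \<forall>n\<ge>N. l2_norm S (\<lambda>s. h s - g n s) \<le> e"
    using l2_complete[OF gl cauchy] by blast
  have "h \<in> l2_closure S V"
    unfolding l2_closure_def
  proof (intro CollectI conjI allI impI h(1))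
    fix e :: real assume e: "0 < e"
    obtain N where "\<forall>n\<ge>N. l2_norm S (\<lambda>s. h s - g n s) \<le> e / 2" using h(2)[of "e/2"] e by auto
    then have "l2_norm S (\<lambda>s. h s - g N s) < e" using e by force
    then show "\<exists>v\<in>V. l2_norm S (\<lambda>s. h s - v s) < e" using g(1) by blast
  qed
  then have hV: "h \<in> V" using V by (auto simp: closed_l2_subspace_def)
  have "sqrt (?q h) \<le> sqrt d + e" if e: "0 < e" for e
  proof -
    have d0: "0 \<le> d" unfolding d_def by (rule cINF_greatest) (use VD(2) l2_sq_nonneg in auto)
    obtain N where N: "\<forall>n\<ge>N. l2_norm S (\<lambda>s. h s - g n s) \<le> e / 2" using h(2)[of "e/2"] e by auto
    obtain M where M: "4 / e\<^sup>2 < real M" using reals_Archimedean2 by blast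
    define n where "n = max N M"
    have "1 / Suc n \<le> (e / 2)\<^sup>2"
    proof -
      have "4 / e\<^sup>2 \<le> real (Suc n)" using M by (simp add: n_def)
      then show ?thesis using e by (simp add: field_simps power2_eq_square)
    qed
    then have "?q (g n) \<le> d + (e / 2)\<^sup>2" using g(2)[of n] by linarith
    also have "\<dots> \<le> (sqrt d + e / 2)\<^sup>2" using d0 e by (simp add: power2_sum)
    finally have 1: "l2_norm S (\<lambda>s. f s - g n s) \<le> sqrt d + e / 2"
      unfolding l2_norm_sqrt using d0 e by (intro real_le_lsqrt) auto
    have 2: "l2_norm S (\<lambda>s. g n s - h s) \<le> e / 2"
      using N by (subst l2_norm_minus_commute) (simp add: n_def)
    have "l2_norm S (\<lambda>s. f s - h s) \<le> sqrt d + e"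
      using l2_norm_triangle[OF f gl h(1), of n] 1 2 by simp
    then show ?thesis by (simp add: l2_norm_sqrt)
  qed
  then have "sqrt (?q h) \<le> sqrt d" by (rule field_le_epsilon)
  then have qh: "?q h \<le> d" by simp
  have orth: "l2_inner S (\<lambda>s. f s - h s) v = 0" if v: "v \<in> V" for v
  proof -
    let ?r = "\<lambda>s. f s - h s"
    have rl: "?r \<in> l2 S" using l2_diff[OF f h(1)] .
    define c where "c = l2_inner S ?r v"
    define t where "t = 1 / (1 + l2_sq S v)"
    have pos: "0 < 1 + l2_sq S v" using l2_sq_nonneg[of S v] by simp
    then have t: "0 < t" "t * l2_sq S v \<le> 1" by (auto simp: t_def field_simps)
    let ?w = "\<lambda>s. (of_real t * c) * v s"
    have wV: "?w \<in> V" using VD(4)[OF v] .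
    have "d \<le> ?q (\<lambda>s. h s + ?w s)" by (rule d_le) (rule VD(3)[OF hV wV])
    also have "\<dots> = l2_sq S (\<lambda>s. ?r s - ?w s)" by (simp add: algebra_simps)
    also have "\<dots> = l2_sq S ?r - 2 * Re (l2_inner S ?r ?w) + l2_sq S ?w"
      by (rule l2_sq_diff[OF rl VD(1)[OF wV]])
    also have "l2_inner S ?r ?w = of_real t * of_real ((cmod c)\<^sup>2)"
    proof -
      have "cnj c * c = of_real ((cmod c)\<^sup>2)" by (simp only: complex_norm_square mult.commute)
      then show ?thesis
        unfolding l2_inner_scale_right c_def[symmetric] by (simp only: complex_cnj_mult complex_cnj_complex_of_real mult.assoc)
    qed
    also have "l2_sq S ?w = (t * cmod c)\<^sup>2 * l2_sq S v"
      using t by (simp add: l2_scale(2)[OF VD(1)[OF v]] norm_mult)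
    finally have "d \<le> ?q h - 2 * t * (cmod c)\<^sup>2 + t * (cmod c)\<^sup>2 * (t * l2_sq S v)"
      by (simp add: power2_eq_square algebra_simps)
    moreover have "t * (cmod c)\<^sup>2 * (t * l2_sq S v) \<le> t * (cmod c)\<^sup>2 * 1"
      using t by (intro mult_left_mono) auto
    ultimately have "t * (cmod c)\<^sup>2 \<le> 0" using qh by linarith
    then have "(cmod c)\<^sup>2 \<le> 0" using t(1) by (simp add: mult_le_0_iff)
    then show ?thesis by (simp add: c_def)
  qed
  show ?thesis
  proof (rule ex1I[of _ h])
    show "h \<in> V \<and> (\<forall>v\<in>V. l2_inner S (\<lambda>s. f s - h s) v = 0)" using hV orth by blast
    fix k assume k: "k \<in> V \<and> (\<forall>v\<in>V. l2_inner S (\<lambda>s. f s - k s) v = 0)"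
    have kl: "k \<in> l2 S" using k VD(1) by blast
    let ?v = "\<lambda>s. h s - k s"
    have vV: "?v \<in> V" using VD(5) hV k by blast
    have "l2_inner S ?v ?v = l2_inner S (\<lambda>s. (f s - k s) - (f s - h s)) ?v" by simp
    also have "\<dots> = l2_inner S (\<lambda>s. f s - k s) ?v - l2_inner S (\<lambda>s. f s - h s) ?v"
      by (rule l2_inner_diff_left) (use f kl h(1) l2_diff in blast)+
    also have "\<dots> = 0" using k orth vV by simp
    finally have "l2_sq S ?v = 0" by (simp add: l2_inner_self)
    then have "h s - k s = 0" for s using l2_sq_eq_0_imp[OF VD(1)[OF vV]] by blast
    then show "k = h" by (auto simp: fun_eq_iff)
  qed
qed

lemma l2_proj:
  assumes "closed_l2_subspace S V" "f \<in> l2 S"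
  shows l2_proj_in: "l2_proj S V f \<in> V"
    and l2_proj_orthogonal: "v \<in> V \<Longrightarrow> l2_inner S (\<lambda>s. f s - l2_proj S V f s) v = 0"
  using theI'[OF l2_projection_exists[OF assms]] unfolding l2_proj_def by blast+

lemma l2_proj_eqI:
  assumes "closed_l2_subspace S V" "f \<in> l2 S" "g \<in> V" "\<And>v. v \<in> V \<Longrightarrow> l2_inner S (\<lambda>s. f s - g s) v = 0"
  shows "l2_proj S V f = g"
  unfolding l2_proj_def by (rule the1_equality[OF l2_projection_exists]) (use assms in auto)

text \<open>
  Imposing one more condition \<open>x d = 0\<close> splits off from the subspace the single direction
  \<open>l2_proj S V (point_mass d)\<close>, which contributes at most one to the trace. After all the conditions in \<open>D\<close>
  nothing is left of the trace over \<open>X\<close>.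
\<close>

lemma l2_proj_trace_le_card:
  assumes V: "closed_l2_subspace S V" and X: "finite X" "X \<subseteq> S" and D: "finite D" "D \<subseteq> S"
    and det: "\<And>x s. \<lbrakk>x \<in> V; \<And>d. d \<in> D \<Longrightarrow> x d = 0; s \<in> X\<rbrakk> \<Longrightarrow> x s = 0"
  shows "(\<Sum>s\<in>X. Re (l2_inner S (l2_proj S V (point_mass s)) (point_mass s))) \<le> card D"
  using D V det
proof (induction D arbitrary: V rule: finite_induct)
  case empty
  have "Re (l2_inner S (l2_proj S V (point_mass s)) (point_mass s)) = 0" if "s \<in> X" for s
  proof -
    have sS: "s \<in> S" using that X by auto
    have "l2_proj S V (point_mass s) s = 0"
      by (rule empty.prems(3)[OF l2_proj_in[OF empty.prems(2) point_mass_l2[OF sS]] _ that]) simp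
    then show ?thesis by (simp add: l2_inner_point_mass[OF sS])
  qed
  then show ?case by simp
next
  case (insert d D)
  have dS: "d \<in> S" using insert.prems by simp
  have Vs: "l2_subspace S V" and Vc: "l2_closure S V \<subseteq> V"
    using insert.prems(2) by (auto simp: closed_l2_subspace_def)
  note VD = l2_subspaceD[OF Vs]
  define e where "e = l2_proj S V (point_mass d)"
  have eV: "e \<in> V" unfolding e_def by (rule l2_proj_in[OF insert.prems(2) point_mass_l2[OF dS]])
  have el: "e \<in> l2 S" using VD(1)[OF eV] .
  \<comment> \<open>\<open>e\<close> represents evaluation at \<open>d\<close> on the subspace\<close>
  have xd: "l2_inner S x e = x d" if x: "x \<in> V" for x
  proof -
    have "l2_inner S (\<lambda>s. point_mass d s - e s) x = 0"
      unfolding e_def by (rule l2_proj_orthogonal[OF insert.prems(2) point_mass_l2[OF dS] x])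
    then have "l2_inner S (point_mass d) x = l2_inner S e x"
      using l2_inner_diff_left[OF point_mass_l2[OF dS] el VD(1)[OF x]] by simp
    from arg_cong[OF this, of cnj] have "l2_inner S x (point_mass d) = l2_inner S x e"
      by (simp add: l2_inner_cnj)
    then show ?thesis using l2_inner_point_mass[OF dS] by simp
  qed
  define V' where "V' = {x \<in> V. x d = 0}"
  have V'c: "closed_l2_subspace S V'"
    unfolding closed_l2_subspace_def
  proof
    show "l2_subspace S V'" unfolding l2_subspace_def V'_def using VD by auto
    show "l2_closure S V' \<subseteq> V'"
    proof
      fix x assume x: "x \<in> l2_closure S V'"
      have V'l: "V' \<subseteq> l2 S" using VD(1) by (auto simp: V'_def)
      have "l2_closure S V' \<subseteq> l2_closure S V" by (auto simp: l2_closure_def V'_def)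
      then have "x \<in> V" using x Vc by blast
      moreover have "(\<Sum>y\<in>{d}. 1 * x y) = 0"
        by (rule l2_closure_finite_condition[OF V'l _ _ x]) (auto simp: V'_def)
      ultimately show "x \<in> V'" by (simp add: V'_def)
    qed
  qed
  have IH: "(\<Sum>s\<in>X. Re (l2_inner S (l2_proj S V' (point_mass s)) (point_mass s))) \<le> card D"
  proof (rule insert.IH[OF _ V'c])
    fix x s assume x: "x \<in> V'" "\<And>d. d \<in> D \<Longrightarrow> x d = 0" "s \<in> X"
    show "x s = 0"
    proof (rule insert.prems(3)[OF _ _ x(3)])
      show "x \<in> V" using x(1) by (simp add: V'_def)
      fix d' assume "d' \<in> insert d D"
      then show "x d' = 0" using x(1,2) by (auto simp: V'_def)
    qed
  qed (use insert.prems(1) in simp)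
  show ?case
  proof (cases "l2_sq S e = 0")
    case True
    then have "e = (\<lambda>_. 0)" using l2_sq_eq_0_imp[OF el] by blast
    then have "V' = V" using xd by (auto simp: V'_def l2_inner_def)
    then show ?thesis using IH insert.hyps by simp
  next
    case False
    let ?n = "l2_sq S e"
    have n0: "?n > 0" using False l2_sq_nonneg[of S e] by linarith
    have ed: "e d = of_real ?n" using xd[OF eV] by (simp add: l2_inner_self)
    have proj: "l2_proj S V' f = (\<lambda>s. l2_proj S V f s - (l2_inner S f e / of_real ?n) * e s)" if f: "f \<in> l2 S" for f
    proof (rule l2_proj_eqI[OF V'c f])
      let ?P = "l2_proj S V f" and ?k = "l2_inner S f e / of_real ?n"
      have PV: "?P \<in> V" by (rule l2_proj_in[OF insert.prems(2) f])
      have Pl: "?P \<in> l2 S" using VD(1)[OF PV] .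
      have orth: "l2_inner S (\<lambda>s. f s - ?P s) v = 0" if "v \<in> V" for v
        by (rule l2_proj_orthogonal[OF insert.prems(2) f that])
      have "l2_inner S ?P e = l2_inner S f e"
        using orth[OF eV] l2_inner_diff_left[OF f Pl el] by simp
      then have "?P d = l2_inner S f e" using xd[OF PV] by simp
      then have "?P d - ?k * e d = 0" using n0 by (simp add: ed)
      moreover have "(\<lambda>s. ?P s - ?k * e s) \<in> V" by (rule VD(5)[OF PV VD(4)[OF eV]])
      ultimately show "(\<lambda>s. ?P s - ?k * e s) \<in> V'" by (simp only: V'_def mem_Collect_eq simp_thms)
      fix v assume "v \<in> V'"
      then have v: "v \<in> V" "v d = 0" by (auto simp: V'_def)
      have "l2_inner S e v = cnj (v d)" using arg_cong[OF xd[OF v(1)], of cnj] by (simp add: l2_inner_cnj)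
      then have ev: "l2_inner S e v = 0" using v by simp
      have eq: "(\<lambda>s. f s - (?P s - ?k * e s)) = (\<lambda>s. (f s - ?P s) + ?k * e s)" by (auto simp: fun_eq_iff)
      show "l2_inner S (\<lambda>s. f s - (?P s - ?k * e s)) v = 0"
        unfolding eq l2_inner_add_left[OF l2_diff[OF f Pl] l2_scale(1)[OF el] VD(1)[OF v(1)]]
          orth[OF v(1)] l2_inner_scale_left ev by simp
    qed
    have diag: "Re (l2_inner S (l2_proj S V (point_mass s)) (point_mass s)) =
        Re (l2_inner S (l2_proj S V' (point_mass s)) (point_mass s)) + (cmod (e s))\<^sup>2 / ?n" if s: "s \<in> X" for s
    proof -
      have sS: "s \<in> S" using s X by auto
      have "l2_inner S (point_mass s) e = cnj (e s)"
        using arg_cong[OF l2_inner_point_mass[OF sS, of e], of cnj] by (simp add: l2_inner_cnj)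
      then have eq: "l2_proj S V' (point_mass s) s = l2_proj S V (point_mass s) s - cnj (e s) / of_real ?n * e s"
        using proj[OF point_mass_l2[OF sS]] by simp
      define r where "r = (cmod (e s))\<^sup>2 / ?n"
      have k: "cnj (e s) / of_real ?n * e s = of_real r"
        unfolding r_def by (simp only: complex_norm_square of_real_divide) (simp add: mult.commute)
      have "Re (l2_proj S V' (point_mass s) s) = Re (l2_proj S V (point_mass s) s) - r"
        unfolding eq k by simp
      then show ?thesis by (simp add: l2_inner_point_mass[OF sS] r_def)
    qed
    have "(\<Sum>s\<in>X. (cmod (e s))\<^sup>2 / ?n) = (\<Sum>s\<in>X. (cmod (e s))\<^sup>2) / ?n" by (simp add: sum_divide_distrib)
    also have "\<dots> \<le> 1" using sum_le_l2_sq[OF el X] n0 by simp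
    finally have "(\<Sum>s\<in>X. Re (l2_inner S (l2_proj S V (point_mass s)) (point_mass s))) \<le> card D + 1"
      using IH diag by (simp add: sum.distrib)
    then show ?thesis using insert.hyps by simp
  qed
qed


section \<open>Free actions on complexes and invariant subspaces\<close>

text \<open>
  Deleting position \<open>i\<close> of a list permuted by \<open>\<pi>\<close> gives a permutation of the list without position
  \<open>\<pi> i\<close>, and the sign of this permutation differs from that of \<open>\<pi>\<close> by \<open>(-1) ^ (i + \<pi> i)\<close>.
\<close>

lemma alternating_on_coboundary:
  assumes alt: "alternating_on (ordered_simplices M m) m c" and M: "abstract_complex M"
  shows "alternating_on (ordered_simplices M (Suc m)) (Suc m) (coboundary M m c)"
  unfolding alternating_on_def
proof (intro ballI allI impI)
  fix xs \<pi> assume xs: "xs \<in> ordered_simplices M (Suc m)" and \<pi>: "\<pi> permutes {..<Suc m}"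
  have len: "length xs = Suc m" and dist: "distinct xs" and xsM: "set xs \<in> M"
    using xs by (auto simp: ordered_simplices_def)
  have pxs: "permute_list \<pi> xs \<in> ordered_simplices M (Suc m)"
    using xs \<pi> len by (simp add: ordered_simplices_def)
  have eq: "coboundary M m c ys = (\<Sum>i\<le>m. (- 1) ^ i * c (del_nth i ys))" if "ys \<in> ordered_simplices M (Suc m)" for ys
    using that by (simp add: coboundary_def del_nth_def)
  show "coboundary M m c (permute_list \<pi> xs) = of_int (sign \<pi>) * coboundary M m c xs"
  proof (cases "m = 0")
    case True
    then have "\<pi> = id" using \<pi> by (simp add: lessThan_Suc)
    then show ?thesis by (simp add: sign_id)
  next
    case False
    have summand: "(-1) ^ i * c (del_nth i (permute_list \<pi> xs)) = of_int (sign \<pi>) * ((-1) ^ \<pi> i * c (del_nth (\<pi> i) xs))"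
      if i: "i \<in> {..m}" for i
    proof -
      have \<pi>i: "\<pi> i \<le> m" using \<pi> i permutes_in_image[OF \<pi>, of i] by simp
      let ?c = "cyclic_shift i m" and ?d = "cyclic_shift (\<pi> i) m"
      have cp: "?c permutes {..<Suc m}" and dp: "?d permutes {..<Suc m}"
        by (rule permutes_subset[OF cyclic_shift(1)]; use i \<pi>i in auto)+
      define \<rho> where "\<rho> = inv_into UNIV ?d \<circ> (\<pi> \<circ> ?c)"
      have \<rho>p: "\<rho> permutes {..<Suc m}" unfolding \<rho>_def
        by (intro permutes_compose permutes_inv cp dp \<pi>)
      have "?c m = i" "?d m = \<pi> i" using i \<pi>i by (auto simp: cyclic_shift_def)
      then have "\<rho> m = m" unfolding \<rho>_def o_def using permutes_inverses(2)[OF dp, of m] by simp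
      then have \<rho>m: "\<rho> permutes {..<m}"
        using \<rho>p unfolding permutes_def by (metis lessThan_iff less_Suc_eq)
      have d\<rho>: "?d (\<rho> l) = \<pi> (?c l)" for l
        unfolding \<rho>_def o_def by (rule permutes_inverses(1)[OF dp])
      have perm: "permutation \<pi>" "permutation ?c" "permutation ?d" "permutation (inv_into UNIV ?d)"
        using \<pi> cp dp permutes_inv[OF dp] by (auto simp: permutation_permutes)
      have "sign \<rho> = sign (inv_into UNIV ?d) * (sign \<pi> * sign ?c)"
        unfolding \<rho>_def using perm by (simp add: sign_compose permutation_compose)
      also have "sign (inv_into UNIV ?d) = (-1) ^ (m - \<pi> i)" using sign_inverse[OF perm(3)] \<pi>i by (simp add: cyclic_shift(2))
      also have "sign ?c = (-1) ^ (m - i)" using i by (simp add: cyclic_shift(2))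
      finally have sgn: "sign \<rho> = (-1) ^ (m - \<pi> i) * (sign \<pi> * (-1) ^ (m - i))" .
      have shift_lt: "cyclic_shift k m l = (if l < k then l else Suc l)" if "l < m" "k \<le> m" for k l
        using that by (auto simp: cyclic_shift_def)
      have "del_nth i (permute_list \<pi> xs) = permute_list \<rho> (del_nth (\<pi> i) xs)"
      proof (rule nth_equalityI)
        show "length (del_nth i (permute_list \<pi> xs)) = length (permute_list \<rho> (del_nth (\<pi> i) xs))"
          using i \<pi>i len by (simp add: length_del_nth)
        fix l assume "l < length (del_nth i (permute_list \<pi> xs))"
        then have l: "l < m" using i len by (simp add: length_del_nth)
        have cl: "?c l < Suc m" using l i by (auto simp: cyclic_shift_def)
        have \<rho>l: "\<rho> l < m" using permutes_in_image[OF \<rho>m, of l] l by simp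
        have "del_nth i (permute_list \<pi> xs) ! l = permute_list \<pi> xs ! ?c l"
          using nth_del_nth[of i "permute_list \<pi> xs" l] i l len shift_lt[OF l, of i] by simp
        also have "\<dots> = xs ! \<pi> (?c l)" using cl len \<pi> by (simp add: permute_list_nth)
        also have "\<dots> = xs ! ?d (\<rho> l)" by (simp add: d\<rho>)
        also have "\<dots> = del_nth (\<pi> i) xs ! \<rho> l"
          using nth_del_nth[of "\<pi> i" xs "\<rho> l"] \<pi>i \<rho>l len shift_lt[OF \<rho>l, of "\<pi> i"] by simp
        also have "\<dots> = permute_list \<rho> (del_nth (\<pi> i) xs) ! l"
          using l \<rho>m len \<pi>i by (simp add: permute_list_nth length_del_nth)
        finally show "del_nth i (permute_list \<pi> xs) ! l = permute_list \<rho> (del_nth (\<pi> i) xs) ! l" .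
      qed
      moreover have "del_nth (\<pi> i) xs \<in> ordered_simplices M m"
      proof -
        have l: "length (del_nth (\<pi> i) xs) = m" using \<pi>i len by (simp add: length_del_nth)
        then have "set (del_nth (\<pi> i) xs) \<noteq> {}" using False by auto
        then have "set (del_nth (\<pi> i) xs) \<in> M" by (rule abstract_complex_face[OF M xsM set_del_nth])
        then show ?thesis using l distinct_del_nth[OF dist] by (simp add: ordered_simplices_def)
      qed
      ultimately have "c (del_nth i (permute_list \<pi> xs)) = of_int (sign \<rho>) * c (del_nth (\<pi> i) xs)"
        using alt \<rho>m by (simp add: alternating_on_def)
      then have "(-1) ^ i * c (del_nth i (permute_list \<pi> xs)) =
          ((-1) ^ i * (-1) ^ (m - i)) * (-1) ^ (m - \<pi> i) * of_int (sign \<pi>) * c (del_nth (\<pi> i) xs)"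
        unfolding sgn by (simp add: algebra_simps)
      also have "((-1) ^ i * (-1) ^ (m - i)) * (-1) ^ (m - \<pi> i) = (-1 :: complex) ^ \<pi> i"
      proof -
        have "(-1 :: complex) ^ i * (-1) ^ (m - i) = (-1) ^ m" using i by (simp add: power_add[symmetric])
        also have "\<dots> = (-1) ^ (\<pi> i + (m - \<pi> i))" using \<pi>i by simp
        finally have "(-1 :: complex) ^ i * (-1) ^ (m - i) * (-1) ^ (m - \<pi> i) = (-1) ^ \<pi> i * ((-1) ^ (m - \<pi> i) * (-1) ^ (m - \<pi> i))"
          by (simp add: power_add)
        then show ?thesis by (simp add: power_mult_distrib[symmetric])
      qed
      finally show ?thesis by (simp add: algebra_simps)
    qed
    have "coboundary M m c (permute_list \<pi> xs) = (\<Sum>i\<le>m. of_int (sign \<pi>) * ((-1) ^ \<pi> i * c (del_nth (\<pi> i) xs)))"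
      unfolding eq[OF pxs] by (rule sum.cong[OF refl summand])
    also have "\<dots> = of_int (sign \<pi>) * (\<Sum>i\<le>m. (-1) ^ \<pi> i * c (del_nth (\<pi> i) xs))"
      by (rule sum_distrib_left[symmetric])
    also have "(\<Sum>i\<le>m. (-1) ^ \<pi> i * c (del_nth (\<pi> i) xs)) = (\<Sum>i\<le>m. (-1) ^ i * c (del_nth i xs))"
      using sum.permute[OF \<pi>, of "\<lambda>i. (-1) ^ i * c (del_nth i xs)"] by (simp add: o_def lessThan_Suc_atMost)
    finally show ?thesis using eq[OF xs] by simp
  qed
qed

text \<open>
  Testing against coboundaries of alternating cochains is testing against all coboundaries:
  antisymmetrizing the test cochain only multiplies the pairing by a factorial.
\<close>

lemma alternating_pairing_antisymmetrize:
  assumes alt: "alternating_on A (Suc m) x" and A: "finite A"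
    and perm: "\<And>xs \<pi>. \<lbrakk>xs \<in> A; \<pi> permutes {..<Suc m}\<rbrakk> \<Longrightarrow> permute_list \<pi> xs \<in> A"
    and len: "\<And>xs. xs \<in> A \<Longrightarrow> length xs = Suc m"
  shows "(\<Sum>xs\<in>A. cnj (x xs) * (\<Sum>k\<le>m. (-1) ^ k * (\<Sum>\<pi> | \<pi> permutes {..<m}. of_int (sign \<pi>) * u (permute_list \<pi> (del_nth k xs)))))
     = of_nat (fact m) * (\<Sum>xs\<in>A. cnj (x xs) * (\<Sum>k\<le>m. (-1) ^ k * u (del_nth k xs)))"
proof -
  let ?\<Pi> = "{\<pi>. \<pi> permutes {..<m}}"
  have fin\<Pi>: "finite ?\<Pi>" and card\<Pi>: "card ?\<Pi> = fact m"
    by (auto simp: finite_permutations card_permutations)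
  have key: "(\<Sum>xs\<in>A. cnj (x xs) * (of_int (sign \<pi>) * u (permute_list \<pi> (del_nth k xs))))
      = (\<Sum>xs\<in>A. cnj (x xs) * u (del_nth k xs))" if k: "k \<le> m" and \<pi>: "\<pi> permutes {..<m}" for k \<pi>
  proof -
    let ?c = "cyclic_shift k m"
    have cp: "?c permutes {..<Suc m}" by (rule permutes_subset[OF cyclic_shift(1)]; use k in auto)
    have \<pi>S: "\<pi> permutes {..<Suc m}" by (rule permutes_subset[OF \<pi>]) auto
    \<comment> \<open>\<open>\<rho>\<close> extends the permutation \<open>\<pi>\<close> of the remaining positions to all positions, fixing position \<open>k\<close>\<close>
    define \<rho> where "\<rho> = ?c \<circ> (\<pi> \<circ> inv_into UNIV ?c)"
    have \<rho>p: "\<rho> permutes {..<Suc m}" unfolding \<rho>_def by (intro permutes_compose permutes_inv cp \<pi>S)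
    have perms: "permutation \<pi>" "permutation ?c" "permutation (inv_into UNIV ?c)"
      using \<pi>S cp permutes_inv[OF cp] by (auto simp: permutation_permutes)
    have "sign \<rho> = sign ?c * (sign \<pi> * sign ?c)"
      unfolding \<rho>_def using perms by (simp add: sign_compose permutation_compose sign_inverse)
    then have sgn: "sign \<rho> = sign \<pi>" by (simp add: sign_def)
    have \<rho>c: "\<rho> (?c l) = ?c (\<pi> l)" for l
      unfolding \<rho>_def o_def by (simp add: permutes_inverses(2)[OF cp])
    have shift_lt: "?c l = (if l < k then l else Suc l)" if "l < m" for l
      using that k by (auto simp: cyclic_shift_def)
    have del: "del_nth k (permute_list \<rho> xs) = permute_list \<pi> (del_nth k xs)" if xs: "xs \<in> A" for xs
    proof (rule nth_equalityI)
      show "length (del_nth k (permute_list \<rho> xs)) = length (permute_list \<pi> (del_nth k xs))"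
        using k len[OF xs] by (simp add: length_del_nth)
      fix l assume "l < length (del_nth k (permute_list \<rho> xs))"
      then have l: "l < m" using k len[OF xs] by (simp add: length_del_nth)
      have cl: "?c l < Suc m" using l k by (auto simp: cyclic_shift_def)
      have \<pi>l: "\<pi> l < m" using permutes_in_image[OF \<pi>, of l] l by simp
      have "del_nth k (permute_list \<rho> xs) ! l = permute_list \<rho> xs ! ?c l"
        using nth_del_nth[of k "permute_list \<rho> xs" l] k l len[OF xs] shift_lt[OF l] by simp
      also have "\<dots> = xs ! \<rho> (?c l)" using cl len[OF xs] \<rho>p by (simp add: permute_list_nth)
      also have "\<dots> = del_nth k xs ! \<pi> l"
        using nth_del_nth[of k xs "\<pi> l"] k \<pi>l len[OF xs] shift_lt[OF \<pi>l] by (simp add: \<rho>c)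
      also have "\<dots> = permute_list \<pi> (del_nth k xs) ! l"
        using l \<pi> len[OF xs] k by (simp add: permute_list_nth length_del_nth)
      finally show "del_nth k (permute_list \<rho> xs) ! l = permute_list \<pi> (del_nth k xs) ! l" .
    qed
    have bij: "bij_betw (permute_list \<rho>) A A"
    proof (rule bij_betw_byWitness[where f'="permute_list (inv_into UNIV \<rho>)"])
      have inv: "inv_into UNIV \<rho> permutes {..<Suc m}" by (rule permutes_inv[OF \<rho>p])
      show "\<forall>xs\<in>A. permute_list (inv_into UNIV \<rho>) (permute_list \<rho> xs) = xs"
        using \<rho>p inv len by (simp add: permute_list_compose[symmetric] permutes_inv_o)
      show "\<forall>xs\<in>A. permute_list \<rho> (permute_list (inv_into UNIV \<rho>) xs) = xs"
        using \<rho>p inv len by (simp add: permute_list_compose[symmetric] permutes_inv_o)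
      show "permute_list \<rho> ` A \<subseteq> A" "permute_list (inv_into UNIV \<rho>) ` A \<subseteq> A" using perm \<rho>p inv by auto
    qed
    have "(\<Sum>xs\<in>A. cnj (x xs) * u (del_nth k xs)) = (\<Sum>xs\<in>A. cnj (x (permute_list \<rho> xs)) * u (del_nth k (permute_list \<rho> xs)))"
      by (rule sum.reindex_bij_betw[OF bij, symmetric])
    also have "\<dots> = (\<Sum>xs\<in>A. cnj (x xs) * (of_int (sign \<pi>) * u (permute_list \<pi> (del_nth k xs))))"
    proof (rule sum.cong[OF refl])
      fix xs assume xs: "xs \<in> A"
      have "x (permute_list \<rho> xs) = of_int (sign \<pi>) * x xs"
        using alt xs \<rho>p by (simp add: alternating_on_def sgn)
      then show "cnj (x (permute_list \<rho> xs)) * u (del_nth k (permute_list \<rho> xs)) =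
          cnj (x xs) * (of_int (sign \<pi>) * u (permute_list \<pi> (del_nth k xs)))"
        by (simp add: del[OF xs])
    qed
    finally show ?thesis by simp
  qed
  have "(\<Sum>xs\<in>A. cnj (x xs) * (\<Sum>k\<le>m. (-1) ^ k * (\<Sum>\<pi>\<in>?\<Pi>. of_int (sign \<pi>) * u (permute_list \<pi> (del_nth k xs)))))
      = (\<Sum>xs\<in>A. \<Sum>k\<le>m. \<Sum>\<pi>\<in>?\<Pi>. (-1) ^ k * (cnj (x xs) * (of_int (sign \<pi>) * u (permute_list \<pi> (del_nth k xs)))))"
    by (simp add: sum_distrib_left mult_ac)
  also have "\<dots> = (\<Sum>k\<le>m. \<Sum>xs\<in>A. \<Sum>\<pi>\<in>?\<Pi>. (-1) ^ k * (cnj (x xs) * (of_int (sign \<pi>) * u (permute_list \<pi> (del_nth k xs)))))"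
    by (rule sum.swap)
  also have "\<dots> = (\<Sum>k\<le>m. \<Sum>\<pi>\<in>?\<Pi>. \<Sum>xs\<in>A. (-1) ^ k * (cnj (x xs) * (of_int (sign \<pi>) * u (permute_list \<pi> (del_nth k xs)))))"
    by (rule sum.cong[OF refl], rule sum.swap)
  also have "\<dots> = (\<Sum>k\<le>m. \<Sum>\<pi>\<in>?\<Pi>. (-1) ^ k * (\<Sum>xs\<in>A. cnj (x xs) * u (del_nth k xs)))"
    by (intro sum.cong refl) (simp add: sum_distrib_left[symmetric] key)
  also have "\<dots> = of_nat (fact m) * (\<Sum>k\<le>m. (-1) ^ k * (\<Sum>xs\<in>A. cnj (x xs) * u (del_nth k xs)))"
    by (simp add: card\<Pi> sum_distrib_left)
  also have "(\<Sum>k\<le>m. (-1) ^ k * (\<Sum>xs\<in>A. cnj (x xs) * u (del_nth k xs)))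
      = (\<Sum>xs\<in>A. cnj (x xs) * (\<Sum>k\<le>m. (-1) ^ k * u (del_nth k xs)))"
    unfolding sum_distrib_left by (subst sum.swap) (simp add: mult_ac)
  finally show ?thesis .
qed

locale free_complex =
  fixes \<Gamma> :: "('g, 'm) monoid_scheme" (structure) and K :: "'v set set" and a :: "'g \<Rightarrow> 'v \<Rightarrow> 'v"
  assumes free: "free_simplicial_action \<Gamma> K a"
begin

lemma complex: "abstract_complex K"
  and action: "group_action \<Gamma> (\<Union>K) a"
  and a_simplex: "\<lbrakk>g \<in> carrier \<Gamma>; s \<in> K\<rbrakk> \<Longrightarrow> a g ` s \<in> K"
  and a_free: "\<lbrakk>g \<in> carrier \<Gamma>; s \<in> K; a g ` s = s\<rbrakk> \<Longrightarrow> g = \<one>"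
  using free unfolding free_simplicial_action_def by blast+

lemma group: "group \<Gamma>"
  using action unfolding group_action_def group_hom_def by blast

lemma a_one: "v \<in> \<Union>K \<Longrightarrow> a \<one> v = v"
  using group_action.id_eq_one[OF action] by (metis restrict_apply)

lemma a_mult: "\<lbrakk>g \<in> carrier \<Gamma>; h \<in> carrier \<Gamma>; v \<in> \<Union>K\<rbrakk> \<Longrightarrow> a g (a h v) = a (g \<otimes> h) v"
  using group_action.composition_rule[OF action, of v g h] by simp

lemma a_inj: "g \<in> carrier \<Gamma> \<Longrightarrow> inj_on (a g) (\<Union>K)"
  by (rule group_action.inj_prop[OF action])

lemma map_a_mult: "\<lbrakk>g \<in> carrier \<Gamma>; h \<in> carrier \<Gamma>; set xs \<subseteq> \<Union>K\<rbrakk> \<Longrightarrow> map (a g) (map (a h) xs) = map (a (g \<otimes> h)) xs"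
  using a_mult by (auto simp: subset_iff)

lemma map_a_one: "set xs \<subseteq> \<Union>K \<Longrightarrow> map (a \<one>) xs = xs"
  using a_one by (intro map_idI) (auto simp: subset_iff)

lemma image_a_mult: "\<lbrakk>g \<in> carrier \<Gamma>; h \<in> carrier \<Gamma>; s \<subseteq> \<Union>K\<rbrakk> \<Longrightarrow> a g ` a h ` s = a (g \<otimes> h) ` s"
  using a_mult by (auto simp: image_image subset_iff intro!: image_cong)

lemma image_a_one: "s \<subseteq> \<Union>K \<Longrightarrow> a \<one> ` s = s"
  using a_one by (auto simp: subset_iff image_iff)

lemma set_ordered_simplex: "\<lbrakk>xs \<in> ordered_simplices M m; M \<subseteq> K\<rbrakk> \<Longrightarrow> set xs \<subseteq> \<Union>K"
  by (auto simp: ordered_simplices_def)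

lemma a_free_eq:
  assumes g: "g \<in> carrier \<Gamma>" "h \<in> carrier \<Gamma>" and s: "s \<in> K" and eq: "a g ` s = a h ` s"
  shows "g = h"
proof -
  interpret group \<Gamma> by (rule group)
  have sK: "s \<subseteq> \<Union>K" using s by auto
  have "a (inv h) ` a g ` s = a (inv h) ` a h ` s" using eq by simp
  then have "a (inv h \<otimes> g) ` s = s" using g sK by (simp add: image_a_mult image_a_one)
  then have "inv h \<otimes> g = \<one>" using g s by (intro a_free[of _ s]) auto
  then show "g = h" using g by (metis inv_closed inv_equality inv_inv)
qed

definition invariant_subcomplex :: "'v set set \<Rightarrow> bool" where
  "invariant_subcomplex M \<longleftrightarrow> abstract_complex M \<and> M \<subseteq> K \<and> (\<forall>g\<in>carrier \<Gamma>. \<forall>s\<in>M. a g ` s \<in> M)"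

lemma map_a_ordered_simplices:
  assumes M: "invariant_subcomplex M" and xs: "xs \<in> ordered_simplices M m" and g: "g \<in> carrier \<Gamma>"
  shows "map (a g) xs \<in> ordered_simplices M m"
proof -
  have "set xs \<subseteq> \<Union>K" using set_ordered_simplex[OF xs] M by (simp add: invariant_subcomplex_def)
  then have "inj_on (a g) (set xs)" using a_inj[OF g] inj_on_subset by blast
  then show ?thesis using M xs g by (auto simp: ordered_simplices_def distinct_map invariant_subcomplex_def)
qed

lemma bij_map_a:
  assumes M: "invariant_subcomplex M" and g: "g \<in> carrier \<Gamma>"
  shows "bij_betw (map (a g)) (ordered_simplices M m) (ordered_simplices M m)"
proof -
  interpret group \<Gamma> by (rule group)
  have MK: "M \<subseteq> K" using M by (simp add: invariant_subcomplex_def)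
  show ?thesis
  proof (rule bij_betw_byWitness[where f'="map (a (inv g))"])
    show "\<forall>xs\<in>ordered_simplices M m. map (a (inv g)) (map (a g) xs) = xs"
      using map_a_mult[of "inv g" g] map_a_one set_ordered_simplex[OF _ MK] g by simp
    show "\<forall>xs\<in>ordered_simplices M m. map (a g) (map (a (inv g)) xs) = xs"
      using map_a_mult[of g "inv g"] map_a_one set_ordered_simplex[OF _ MK] g by simp
    show "map (a g) ` ordered_simplices M m \<subseteq> ordered_simplices M m"
      "map (a (inv g)) ` ordered_simplices M m \<subseteq> ordered_simplices M m"
      using map_a_ordered_simplices[OF M] g by auto
  qed
qed

definition translate :: "'v set set \<Rightarrow> nat \<Rightarrow> 'g \<Rightarrow> ('v list \<Rightarrow> complex) \<Rightarrow> 'v list \<Rightarrow> complex" where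
  "translate M m g f = (\<lambda>xs. if xs \<in> ordered_simplices M m then f (map (a g) xs) else 0)"

lemma translate_l2:
  assumes M: "invariant_subcomplex M" and g: "g \<in> carrier \<Gamma>" and f: "f \<in> l2 (ordered_simplices M m)"
  shows "translate M m g f \<in> l2 (ordered_simplices M m)"
proof -
  let ?S = "ordered_simplices M m"
  have "(\<lambda>xs. (cmod (f xs))\<^sup>2) summable_on ?S" using f by (simp add: l2_def)
  then have "(\<lambda>xs. (cmod (f (map (a g) xs)))\<^sup>2) summable_on ?S"
    by (subst summable_on_reindex_bij_betw[OF bij_map_a[OF M g], of "\<lambda>xs. (cmod (f xs))\<^sup>2"])
  moreover have "(\<lambda>xs. (cmod (translate M m g f xs))\<^sup>2) summable_on ?S \<longleftrightarrow> (\<lambda>xs. (cmod (f (map (a g) xs)))\<^sup>2) summable_on ?S"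
    by (rule summable_on_cong) (simp add: translate_def)
  ultimately show ?thesis by (simp add: l2_def translate_def)
qed

lemma l2_inner_translate:
  assumes M: "invariant_subcomplex M" and g: "g \<in> carrier \<Gamma>"
  shows "l2_inner (ordered_simplices M m) (translate M m g f) (translate M m g h) = l2_inner (ordered_simplices M m) f h"
proof -
  let ?S = "ordered_simplices M m"
  have "l2_inner ?S (translate M m g f) (translate M m g h) = (\<Sum>\<^sub>\<infinity>xs\<in>?S. f (map (a g) xs) * cnj (h (map (a g) xs)))"
    unfolding l2_inner_def by (rule infsum_cong) (simp add: translate_def)
  also have "\<dots> = l2_inner ?S f h"
    unfolding l2_inner_def by (rule infsum_reindex_bij_betw[OF bij_map_a[OF M g]])
  finally show ?thesis .
qed

lemma l2_norm_translate:
  assumes M: "invariant_subcomplex M" and g: "g \<in> carrier \<Gamma>"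
  shows "l2_norm (ordered_simplices M m) (\<lambda>xs. translate M m g f xs - translate M m g h xs) = l2_norm (ordered_simplices M m) (\<lambda>xs. f xs - h xs)"
proof -
  let ?S = "ordered_simplices M m"
  have "(\<Sum>\<^sub>\<infinity>xs\<in>?S. (cmod (translate M m g f xs - translate M m g h xs))\<^sup>2) = (\<Sum>\<^sub>\<infinity>xs\<in>?S. (cmod (f (map (a g) xs) - h (map (a g) xs)))\<^sup>2)"
    by (rule infsum_cong) (simp add: translate_def)
  also have "\<dots> = (\<Sum>\<^sub>\<infinity>xs\<in>?S. (cmod (f xs - h xs))\<^sup>2)"
    by (rule infsum_reindex_bij_betw[OF bij_map_a[OF M g], of "\<lambda>xs. (cmod (f xs - h xs))\<^sup>2"])
  finally show ?thesis by (simp add: l2_norm_def)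
qed

lemma translate_inv:
  assumes M: "invariant_subcomplex M" and g: "g \<in> carrier \<Gamma>" and f: "f \<in> l2 (ordered_simplices M m)"
  shows "translate M m g (translate M m (inv\<^bsub>\<Gamma>\<^esub> g) f) = f"
proof
  interpret group \<Gamma> by (rule group)
  fix xs
  have MK: "M \<subseteq> K" using M by (simp add: invariant_subcomplex_def)
  show "translate M m g (translate M m (inv g) f) xs = f xs"
  proof (cases "xs \<in> ordered_simplices M m")
    case True
    have "map (a (inv g)) (map (a g) xs) = xs"
      using map_a_mult[of "inv g" g] map_a_one set_ordered_simplex[OF True MK] g by simp
    then show ?thesis using True map_a_ordered_simplices[OF M True g] by (simp add: translate_def del: map_map)
  next
    case False
    then show ?thesis using f by (simp add: translate_def l2_def)
  qed
qed

definition invariant_functions :: "'v set set \<Rightarrow> nat \<Rightarrow> ('v list \<Rightarrow> complex) set \<Rightarrow> bool" where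
  "invariant_functions M m V \<longleftrightarrow> (\<forall>g\<in>carrier \<Gamma>. \<forall>f\<in>V. translate M m g f \<in> V)"

lemma invariant_functions_closure:
  assumes M: "invariant_subcomplex M" and V: "invariant_functions M m V"
  shows "invariant_functions M m (l2_closure (ordered_simplices M m) V)"
  unfolding invariant_functions_def
proof (intro ballI)
  fix g f assume g: "g \<in> carrier \<Gamma>" and f: "f \<in> l2_closure (ordered_simplices M m) V"
  show "translate M m g f \<in> l2_closure (ordered_simplices M m) V"
    unfolding l2_closure_def
  proof (intro CollectI conjI allI impI)
    show "translate M m g f \<in> l2 (ordered_simplices M m)"
      using translate_l2[OF M g] f by (simp add: l2_closure_def)
    fix e :: real assume "0 < e"
    then obtain h where h: "h \<in> V" "l2_norm (ordered_simplices M m) (\<lambda>xs. f xs - h xs) < e"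
      using f unfolding l2_closure_def by blast
    show "\<exists>h\<in>V. l2_norm (ordered_simplices M m) (\<lambda>xs. translate M m g f xs - h xs) < e"
    proof (rule bexI[of _ "translate M m g h"])
      show "l2_norm (ordered_simplices M m) (\<lambda>xs. translate M m g f xs - translate M m g h xs) < e"
        using h(2) by (simp only: l2_norm_translate[OF M g])
      show "translate M m g h \<in> V" using V g h(1) by (simp add: invariant_functions_def)
    qed
  qed
qed

lemma orthogonal_translate:
  assumes M: "invariant_subcomplex M" and W: "invariant_functions M m W" "W \<subseteq> l2 (ordered_simplices M m)"
    and g: "g \<in> carrier \<Gamma>" and orth: "\<And>w. w \<in> W \<Longrightarrow> l2_inner (ordered_simplices M m) f w = 0" and w: "w \<in> W"
  shows "l2_inner (ordered_simplices M m) (translate M m g f) w = 0"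
proof -
  interpret group \<Gamma> by (rule group)
  have w': "translate M m (inv g) w \<in> W" using W(1) g w by (simp add: invariant_functions_def)
  have "l2_inner (ordered_simplices M m) (translate M m g f) w =
      l2_inner (ordered_simplices M m) (translate M m g f) (translate M m g (translate M m (inv g) w))"
    using translate_inv[OF M g] W(2) w by (simp add: subset_iff)
  also have "\<dots> = l2_inner (ordered_simplices M m) f (translate M m (inv g) w)"
    by (rule l2_inner_translate[OF M g])
  finally show ?thesis using orth[OF w'] by simp
qed

lemma translate_diff: "translate M m g (\<lambda>xs. f xs - h xs) = (\<lambda>xs. translate M m g f xs - translate M m g h xs)"
  by (auto simp: translate_def)

lemma l2_proj_translate:
  assumes M: "invariant_subcomplex M" and V: "closed_l2_subspace (ordered_simplices M m) V" "invariant_functions M m V"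
    and g: "g \<in> carrier \<Gamma>" and f: "f \<in> l2 (ordered_simplices M m)"
  shows "l2_proj (ordered_simplices M m) V (translate M m g f) = translate M m g (l2_proj (ordered_simplices M m) V f)"
proof (rule l2_proj_eqI[OF V(1) translate_l2[OF M g f]])
  show "translate M m g (l2_proj (ordered_simplices M m) V f) \<in> V"
    using V(2) g l2_proj_in[OF V(1) f] by (simp add: invariant_functions_def)
  have Vl: "V \<subseteq> l2 (ordered_simplices M m)" using V(1) by (simp add: closed_l2_subspace_def l2_subspace_def)
  fix v assume v: "v \<in> V"
  show "l2_inner (ordered_simplices M m) (\<lambda>xs. translate M m g f xs - translate M m g (l2_proj (ordered_simplices M m) V f) xs) v = 0"
    unfolding translate_diff[symmetric]
    by (rule orthogonal_translate[OF M V(2) Vl g _ v]) (rule l2_proj_orthogonal[OF V(1) f])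
qed

text \<open>
  The projection onto an invariant subspace commutes with the translations, which are unitary. Hence
  the trace in the definition of the von Neumann dimension does not depend on the representatives
  of the orbits.
\<close>

lemma diagonal_entry_invariant:
  assumes M: "invariant_subcomplex M" and V: "closed_l2_subspace (ordered_simplices M m) V" "invariant_functions M m V"
    and g: "g \<in> carrier \<Gamma>" and xs: "xs \<in> ordered_simplices M m"
  shows "l2_inner (ordered_simplices M m) (l2_proj (ordered_simplices M m) V (point_mass (map (a g) xs))) (point_mass (map (a g) xs))
    = l2_inner (ordered_simplices M m) (l2_proj (ordered_simplices M m) V (point_mass xs)) (point_mass xs)"
proof -
  let ?S = "ordered_simplices M m"
  have gxs: "map (a g) xs \<in> ?S" by (rule map_a_ordered_simplices[OF M xs g])
  have "map (a g) ys = map (a g) xs \<longleftrightarrow> ys = xs" if "ys \<in> ?S" for ys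
    using bij_betw_imp_inj_on[OF bij_map_a[OF M g]] that xs by (auto simp: inj_on_def simp del: map_eq_conv)
  then have pm: "translate M m g (point_mass (map (a g) xs)) = point_mass xs"
    using xs by (auto simp: translate_def point_mass_def fun_eq_iff simp del: map_eq_conv)
  have "l2_inner ?S (l2_proj ?S V (point_mass (map (a g) xs))) (point_mass (map (a g) xs)) =
      l2_inner ?S (translate M m g (l2_proj ?S V (point_mass (map (a g) xs)))) (translate M m g (point_mass (map (a g) xs)))"
    by (rule l2_inner_translate[OF M g, symmetric])
  also have "translate M m g (l2_proj ?S V (point_mass (map (a g) xs))) = l2_proj ?S V (translate M m g (point_mass (map (a g) xs)))"
    by (rule l2_proj_translate[OF M V g point_mass_l2[OF gxs], symmetric])
  finally show ?thesis by (simp only: pm)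
qed

end


section \<open>Square-summable cochains of cocompact complexes\<close>

lemma alternating_on_closure:
  assumes A: "A \<subseteq> l2 S" and alt: "\<And>f. f \<in> A \<Longrightarrow> alternating_on S m f" and f: "f \<in> l2_closure S A"
  shows "alternating_on S m f"
  unfolding alternating_on_def
proof (intro ballI allI impI)
  fix xs \<pi> assume xs: "xs \<in> S" and \<pi>: "\<pi> permutes {..<m}"
  show "f (permute_list \<pi> xs) = of_int (sign \<pi>) * f xs"
  proof (cases "permute_list \<pi> xs = xs")
    case True
    let ?c = "\<lambda>x. 1 - complex_of_int (sign \<pi>)"
    have "(\<Sum>x\<in>{xs}. ?c x * f x) = 0"
    proof (rule l2_closure_finite_condition[OF A _ _ f])
      fix h assume "h \<in> A"
      then have "h (permute_list \<pi> xs) = of_int (sign \<pi>) * h xs"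
        using alt xs \<pi> by (simp add: alternating_on_def)
      then show "(\<Sum>x\<in>{xs}. ?c x * h x) = 0" using True by (simp add: left_diff_distrib)
    qed simp
    then show ?thesis using True by (simp add: left_diff_distrib)
  next
    case False
    let ?c = "\<lambda>x. if x = xs then - complex_of_int (sign \<pi>) else 1"
    have "(\<Sum>x\<in>{xs, permute_list \<pi> xs}. ?c x * f x) = 0"
    proof (rule l2_closure_finite_condition[OF A _ _ f])
      fix h assume "h \<in> A"
      then have "h (permute_list \<pi> xs) = of_int (sign \<pi>) * h xs"
        using alt xs \<pi> by (simp add: alternating_on_def)
      then show "(\<Sum>x\<in>{xs, permute_list \<pi> xs}. ?c x * h x) = 0" using False by auto
    qed simp
    moreover have "(\<Sum>x\<in>{xs, permute_list \<pi> xs}. ?c x * f x) = f (permute_list \<pi> xs) - of_int (sign \<pi>) * f xs"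
      using False by auto
    ultimately show ?thesis by simp
  qed
qed

lemma l2_cochains_alt: "l2_cochains M m = {c \<in> l2 (ordered_simplices M m). alternating_on (ordered_simplices M m) m c}"
  by (simp add: l2_cochains_def alternating_on_def)

lemma l2_subspace_cochains: "l2_subspace (ordered_simplices M m) (l2_cochains M m)"
  unfolding l2_subspace_def l2_cochains_alt
  by (auto simp: l2_add_norm(1) l2_scale(1) alternating_on_def algebra_simps)

lemma coboundary_add: "coboundary M m (\<lambda>x. c x + d x) = (\<lambda>xs. coboundary M m c xs + coboundary M m d xs)"
  by (auto simp: coboundary_def sum.distrib[symmetric] algebra_simps fun_eq_iff intro!: sum.cong)

lemma coboundary_scale: "coboundary M m (\<lambda>x. t * c x) = (\<lambda>xs. t * coboundary M m c xs)"
  by (auto simp: coboundary_def sum_distrib_left algebra_simps fun_eq_iff intro!: sum.cong)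

lemma coboundary_zero: "coboundary M m (\<lambda>_. 0) = (\<lambda>_. 0)"
  by (auto simp: coboundary_def)

lemma coboundary_apply:
  "xs \<in> ordered_simplices M (Suc m) \<Longrightarrow> coboundary M m c xs = (\<Sum>i\<le>m. (-1) ^ i * c (del_nth i xs))"
  by (simp add: coboundary_def del_nth_def)

lemma l2_subspace_cocycles: "l2_subspace (ordered_simplices M (Suc p)) (l2_cocycles M p)"
  using l2_subspace_cochains[of M "Suc p"] unfolding l2_subspace_def l2_cocycles_def
  by (auto simp: coboundary_add coboundary_scale coboundary_zero)

lemma l2_subspace_hilbert_quotient:
  assumes V: "l2_subspace S V" and W: "W \<subseteq> l2 S"
  shows "l2_subspace S (hilbert_quotient S V W)"
  unfolding l2_subspace_def hilbert_quotient_def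
proof (intro conjI ballI allI)
  note VD = l2_subspaceD[OF V]
  show "{v \<in> V. \<forall>w\<in>W. l2_inner S v w = 0} \<subseteq> l2 S" using VD(1) by auto
  show "(\<lambda>_. 0) \<in> {v \<in> V. \<forall>w\<in>W. l2_inner S v w = 0}" using VD(2) by (simp add: l2_inner_def)
  fix f g assume f: "f \<in> {v \<in> V. \<forall>w\<in>W. l2_inner S v w = 0}" and g: "g \<in> {v \<in> V. \<forall>w\<in>W. l2_inner S v w = 0}"
  have "l2_inner S (\<lambda>s. f s + g s) w = 0" if "w \<in> W" for w
    using l2_inner_add_left[of f S g w] f g VD(1) W that by (simp add: subset_iff)
  then show "(\<lambda>s. f s + g s) \<in> {v \<in> V. \<forall>w\<in>W. l2_inner S v w = 0}" using f g VD(3) by simp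
  fix c
  show "(\<lambda>s. c * f s) \<in> {v \<in> V. \<forall>w\<in>W. l2_inner S v w = 0}" using f VD(4) by (simp add: l2_inner_scale_left)
qed

lemma l2_proj_add:
  assumes V: "closed_l2_subspace S V" and f: "f \<in> l2 S" and g: "g \<in> l2 S"
  shows "l2_proj S V (\<lambda>s. f s + g s) = (\<lambda>s. l2_proj S V f s + l2_proj S V g s)"
proof (rule l2_proj_eqI[OF V l2_add_norm(1)[OF f g]])
  have Vs: "l2_subspace S V" using V by (simp add: closed_l2_subspace_def)
  note VD = l2_subspaceD[OF Vs]
  have P: "l2_proj S V f \<in> V" "l2_proj S V g \<in> V" using l2_proj_in[OF V] f g by auto
  show "(\<lambda>s. l2_proj S V f s + l2_proj S V g s) \<in> V" by (rule VD(3)[OF P])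
  fix v assume v: "v \<in> V"
  have eq: "(\<lambda>s. f s + g s - (l2_proj S V f s + l2_proj S V g s)) = (\<lambda>s. (f s - l2_proj S V f s) + (g s - l2_proj S V g s))"
    by (auto simp: fun_eq_iff)
  show "l2_inner S (\<lambda>s. f s + g s - (l2_proj S V f s + l2_proj S V g s)) v = 0"
    unfolding eq l2_inner_add_left[OF l2_diff[OF f VD(1)[OF P(1)]] l2_diff[OF g VD(1)[OF P(2)]] VD(1)[OF v]]
    by (simp add: l2_proj_orthogonal[OF V f v] l2_proj_orthogonal[OF V g v])
qed

lemma l2_proj_scale:
  assumes V: "closed_l2_subspace S V" and f: "f \<in> l2 S"
  shows "l2_proj S V (\<lambda>s. c * f s) = (\<lambda>s. c * l2_proj S V f s)"
proof (rule l2_proj_eqI[OF V l2_scale(1)[OF f]])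
  have Vs: "l2_subspace S V" using V by (simp add: closed_l2_subspace_def)
  show "(\<lambda>s. c * l2_proj S V f s) \<in> V" by (rule l2_subspaceD(4)[OF Vs l2_proj_in[OF V f]])
  fix v assume v: "v \<in> V"
  have eq: "(\<lambda>s. c * f s - c * l2_proj S V f s) = (\<lambda>s. c * (f s - l2_proj S V f s))"
    by (auto simp: fun_eq_iff right_diff_distrib)
  show "l2_inner S (\<lambda>s. c * f s - c * l2_proj S V f s) v = 0"
    unfolding eq l2_inner_scale_left by (simp add: l2_proj_orthogonal[OF V f v])
qed

context free_complex begin

lemma invariant_subcomplexD:
  assumes "invariant_subcomplex M"
  shows "abstract_complex M" "M \<subseteq> K" "\<lbrakk>g \<in> carrier \<Gamma>; s \<in> M\<rbrakk> \<Longrightarrow> a g ` s \<in> M"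
  using assms by (auto simp: invariant_subcomplex_def)

lemma translate_apply:
  assumes M: "invariant_subcomplex M" and g: "g \<in> carrier \<Gamma>" and f: "f \<in> l2 (ordered_simplices M m)"
    and ys: "set ys \<subseteq> \<Union>K"
  shows "translate M m g f ys = f (map (a g) ys)"
proof (cases "ys \<in> ordered_simplices M m")
  case False
  interpret group \<Gamma> by (rule group)
  have "map (a g) ys \<notin> ordered_simplices M m"
  proof
    assume "map (a g) ys \<in> ordered_simplices M m"
    then have "map (a (inv g)) (map (a g) ys) \<in> ordered_simplices M m"
      using map_a_ordered_simplices[OF M] g by blast
    moreover have "map (a (inv g)) (map (a g) ys) = ys"
      using map_a_mult[of "inv g" g ys] map_a_one[OF ys] g ys by simp
    ultimately show False using False by simp
  qed
  then show ?thesis using f False by (simp add: translate_def l2_def)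
qed (simp add: translate_def)

lemma alternating_on_translate:
  assumes M: "invariant_subcomplex M" and g: "g \<in> carrier \<Gamma>"
    and alt: "alternating_on (ordered_simplices M m) m f"
  shows "alternating_on (ordered_simplices M m) m (translate M m g f)"
  unfolding alternating_on_def
proof (intro ballI allI impI)
  fix xs \<pi> assume xs: "xs \<in> ordered_simplices M m" and \<pi>: "\<pi> permutes {..<m}"
  have len: "length xs = m" using xs by (simp add: ordered_simplices_def)
  have "permute_list \<pi> xs \<in> ordered_simplices M m"
    using xs \<pi> by (auto simp: ordered_simplices_def)
  moreover have "map (a g) (permute_list \<pi> xs) = permute_list \<pi> (map (a g) xs)"
    using \<pi> len by (simp add: permute_list_map)
  moreover have "f (permute_list \<pi> (map (a g) xs)) = of_int (sign \<pi>) * f (map (a g) xs)"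
    using alt \<pi> map_a_ordered_simplices[OF M xs g] by (simp add: alternating_on_def)
  ultimately show "translate M m g f (permute_list \<pi> xs) = of_int (sign \<pi>) * translate M m g f xs"
    using xs by (simp add: translate_def)
qed

lemma invariant_cochains:
  assumes M: "invariant_subcomplex M"
  shows "invariant_functions M m (l2_cochains M m)"
  unfolding invariant_functions_def l2_cochains_alt
  using translate_l2[OF M] alternating_on_translate[OF M] by simp

lemma coboundary_translate:
  assumes M: "invariant_subcomplex M" and g: "g \<in> carrier \<Gamma>" and c: "c \<in> l2 (ordered_simplices M m)"
  shows "coboundary M m (translate M m g c) = translate M (Suc m) g (coboundary M m c)"
proof
  fix xs
  show "coboundary M m (translate M m g c) xs = translate M (Suc m) g (coboundary M m c) xs"
  proof (cases "xs \<in> ordered_simplices M (Suc m)")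
    case True
    have xsK: "set xs \<subseteq> \<Union>K" using set_ordered_simplex[OF True] M by (simp add: invariant_subcomplex_def)
    have "translate M m g c (del_nth i xs) = c (del_nth i (map (a g) xs))" for i
    proof -
      have "set (del_nth i xs) \<subseteq> \<Union>K" using xsK set_del_nth[of i xs] by blast
      then have "translate M m g c (del_nth i xs) = c (map (a g) (del_nth i xs))" by (rule translate_apply[OF M g c])
      then show ?thesis by (simp add: del_nth_def take_map drop_map)
    qed
    then show ?thesis
      using True map_a_ordered_simplices[OF M True g] by (simp add: coboundary_apply translate_def)
  qed (simp add: coboundary_def translate_def)
qed

lemma orbit_representatives:
  assumes M: "invariant_subcomplex M" and cc: "cocompact_complex \<Gamma> M a"
  obtains C0 where "finite C0" "C0 \<subseteq> M" "\<And>s. s \<in> M \<Longrightarrow> \<exists>g\<in>carrier \<Gamma>. \<exists>c\<in>C0. s = a g ` c"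
proof -
  interpret group \<Gamma> by (rule group)
  let ?orb = "orbit \<Gamma> (\<lambda>g. image (a g))"
  have fin: "finite (?orb ` M)"
    using cc unfolding cocompact_complex_def orbits_def by (simp add: Setcompr_eq_image)
  then obtain C0 where C0: "C0 \<subseteq> M" "finite C0" "?orb ` M = ?orb ` C0"
    using finite_subset_image[OF fin order_refl] by auto
  show thesis
  proof (rule that[OF C0(2,1)])
    fix s assume s: "s \<in> M"
    then obtain c where c: "c \<in> C0" "?orb s = ?orb c" using C0(3) by blast
    have "s \<subseteq> \<Union>K" using s invariant_subcomplexD(2)[OF M] by auto
    then have "a \<one> ` s = s" by (rule image_a_one)
    then have "s \<in> ?orb s" unfolding orbit_def by (auto intro!: exI[of _ \<one>])
    then have "s \<in> ?orb c" using c(2) by simp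
    then show "\<exists>g\<in>carrier \<Gamma>. \<exists>c\<in>C0. s = a g ` c" using c(1) by (auto simp: orbit_def)
  qed
qed

lemma ordered_representatives:
  assumes M: "invariant_subcomplex M" and C: "C \<subseteq> M" "\<And>s. s \<in> M \<Longrightarrow> \<exists>g\<in>carrier \<Gamma>. \<exists>c\<in>C. s = a g ` c"
    and xs: "xs \<in> ordered_simplices M m"
  obtains g r where "g \<in> carrier \<Gamma>" "r \<in> ordered_simplices C m" "xs = map (a g) r"
proof -
  interpret group \<Gamma> by (rule group)
  have xsK: "set xs \<subseteq> \<Union>K" using set_ordered_simplex[OF xs invariant_subcomplexD(2)[OF M]] .
  obtain g c where g: "g \<in> carrier \<Gamma>" and c: "c \<in> C" "set xs = a g ` c"
    using C(2)[of "set xs"] xs by (auto simp: ordered_simplices_def)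
  have cK: "c \<subseteq> \<Union>K" using c C(1) invariant_subcomplexD(2)[OF M] by auto
  define r where "r = map (a (inv g)) xs"
  have "r \<in> ordered_simplices M m" unfolding r_def using map_a_ordered_simplices[OF M xs] g by simp
  moreover have "set r = c"
    using image_a_mult[of "inv g" g c] image_a_one[OF cK] g c cK by (simp add: r_def)
  ultimately have "r \<in> ordered_simplices C m" using c by (simp add: ordered_simplices_def)
  moreover have "xs = map (a g) r"
    unfolding r_def using map_a_mult[of g "inv g" xs] map_a_one[OF xsK] g xsK by simp
  ultimately show thesis using that g by blast
qed

text \<open>
  By freeness a simplex arises by deleting position \<open>i\<close> from at most as many ordered simplices as there are
  ordered representatives of the orbits, so the coboundary is a bounded operator.
\<close>

lemma coboundary_l2:
  assumes M: "invariant_subcomplex M" and cc: "cocompact_complex \<Gamma> M a" and c: "c \<in> l2 (ordered_simplices M m)"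
  shows "coboundary M m c \<in> l2 (ordered_simplices M (Suc m))"
proof (cases "m = 0")
  case True
  have "c [] = 0" using c invariant_subcomplexD(1)[OF M]
    by (auto simp: l2_def ordered_simplices_def abstract_complex_def)
  then have "coboundary M m c = (\<lambda>_. 0)" using True by (auto simp: coboundary_def ordered_simplices_def fun_eq_iff)
  then show ?thesis by simp
next
  case False
  obtain C0 where C0: "finite C0" "C0 \<subseteq> M" "\<And>s. s \<in> M \<Longrightarrow> \<exists>g\<in>carrier \<Gamma>. \<exists>c\<in>C0. s = a g ` c"
    using orbit_representatives[OF M cc] by blast
  define R where "R = ordered_simplices C0 (Suc m)"
  have finR: "finite R"
  proof -
    have "R \<subseteq> {xs. set xs \<subseteq> \<Union>C0 \<and> length xs = Suc m}" by (auto simp: R_def ordered_simplices_def)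
    moreover have "finite (\<Union>C0)" using C0(1,2) invariant_subcomplexD(1)[OF M] by (auto simp: abstract_complex_def)
    ultimately show ?thesis using finite_lists_length_eq finite_subset by metis
  qed
  let ?S = "ordered_simplices M m" and ?S' = "ordered_simplices M (Suc m)"
  have Mc: "abstract_complex M" and MK: "M \<subseteq> K" using invariant_subcomplexD[OF M] by auto
  have del: "del_nth i xs \<in> ?S" if "xs \<in> ?S'" "i \<le> m" for i xs
  proof -
    have l: "length (del_nth i xs) = m" using that by (simp add: ordered_simplices_def length_del_nth)
    then have "set (del_nth i xs) \<noteq> {}" using False by auto
    then have "set (del_nth i xs) \<in> M"
      using abstract_complex_face[OF Mc _ set_del_nth] that by (simp add: ordered_simplices_def)
    then show ?thesis using l distinct_del_nth[of xs i] that by (simp add: ordered_simplices_def)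
  qed
  have rep: "\<exists>r. r \<in> R \<and> (\<exists>g\<in>carrier \<Gamma>. xs = map (a g) r)" if "xs \<in> ?S'" for xs
    using ordered_representatives[OF M C0(2,3) that] unfolding R_def by blast
  define rp where "rp = (\<lambda>xs. SOME r. r \<in> R \<and> (\<exists>g\<in>carrier \<Gamma>. xs = map (a g) r))"
  have rp: "rp xs \<in> R \<and> (\<exists>g\<in>carrier \<Gamma>. xs = map (a g) (rp xs))" if "xs \<in> ?S'" for xs
    unfolding rp_def by (rule someI_ex[OF rep[OF that]])
  have fibre: "card {xs \<in> A. del_nth i xs = ys} \<le> card R" if A: "A \<subseteq> ?S'" and i: "i \<le> m" for A i ys
  proof (rule card_inj_on_le[of rp])
    show "rp ` {xs \<in> A. del_nth i xs = ys} \<subseteq> R" using rp A by auto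
    show "inj_on rp {xs \<in> A. del_nth i xs = ys}"
    proof (rule inj_onI)
      fix xs xs' assume x: "xs \<in> {xs \<in> A. del_nth i xs = ys}" "xs' \<in> {xs \<in> A. del_nth i xs = ys}" and eq: "rp xs = rp xs'"
      have xS: "xs \<in> ?S'" "xs' \<in> ?S'" using x A by auto
      obtain g where g: "g \<in> carrier \<Gamma>" "xs = map (a g) (rp xs)" using rp[OF xS(1)] by blast
      obtain g' where g': "g' \<in> carrier \<Gamma>" "xs' = map (a g') (rp xs)" using rp[OF xS(2)] eq by auto
      let ?z = "del_nth i (rp xs)"
      have rS: "rp xs \<in> ?S'" using rp[OF xS(1)] C0(2) by (auto simp: R_def ordered_simplices_def)
      have "map (a g) ?z = del_nth i xs" "map (a g') ?z = del_nth i xs'"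
        by (subst g(2) g'(2), simp add: del_nth_def take_map drop_map)+
      then have "map (a g) ?z = map (a g') ?z" using x by simp
      then have "a g ` set ?z = a g' ` set ?z" by (metis set_map)
      moreover have "set ?z \<in> K" using del[OF rS i] MK by (auto simp: ordered_simplices_def)
      ultimately have "g = g'" by (intro a_free_eq[OF g(1) g'(1)])
      then show "xs = xs'" using g g' by simp
    qed
  qed (rule finR)
  show ?thesis
  proof (rule l2_I(1))
    show "coboundary M m c xs = 0" if "xs \<notin> ?S'" for xs using that by (simp add: coboundary_def)
    fix A assume A: "finite A" "A \<subseteq> ?S'"
    have "(\<Sum>xs\<in>A. (cmod (coboundary M m c xs))\<^sup>2) \<le> (\<Sum>xs\<in>A. real (Suc m) * (\<Sum>i\<le>m. (cmod (c (del_nth i xs)))\<^sup>2))"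
    proof (rule sum_mono)
      fix xs assume "xs \<in> A"
      then have "cmod (coboundary M m c xs) \<le> (\<Sum>i\<le>m. cmod (c (del_nth i xs)))"
        using A norm_sum[of "\<lambda>i. (-1) ^ i * c (del_nth i xs)" "{..m}"]
        by (simp add: coboundary_apply subset_iff norm_mult norm_power)
      then have "(cmod (coboundary M m c xs))\<^sup>2 \<le> (\<Sum>i\<le>m. cmod (c (del_nth i xs)))\<^sup>2"
        by (intro power_mono) auto
      also have "\<dots> \<le> (\<Sum>i\<le>m. (cmod (c (del_nth i xs)))\<^sup>2) * (\<Sum>i\<le>m. 1\<^sup>2)"
        using Cauchy_Schwarz_ineq_sum[of "\<lambda>i. cmod (c (del_nth i xs))" "\<lambda>_. 1" "{..m}"] by simp
      finally show "(cmod (coboundary M m c xs))\<^sup>2 \<le> real (Suc m) * (\<Sum>i\<le>m. (cmod (c (del_nth i xs)))\<^sup>2)"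
        by (simp add: mult.commute)
    qed
    also have "\<dots> = real (Suc m) * (\<Sum>i\<le>m. \<Sum>xs\<in>A. (cmod (c (del_nth i xs)))\<^sup>2)"
      by (subst sum.swap) (simp add: sum_distrib_left)
    also have "\<dots> \<le> real (Suc m) * (\<Sum>i\<le>m. card R * l2_sq ?S c)"
    proof (intro mult_left_mono sum_mono)
      fix i assume i: "i \<in> {..m}"
      have "(\<Sum>xs\<in>A. (cmod (c (del_nth i xs)))\<^sup>2) = (\<Sum>ys\<in>del_nth i ` A. \<Sum>xs\<in>{xs \<in> A. del_nth i xs = ys}. (cmod (c (del_nth i xs)))\<^sup>2)"
        by (rule sum.image_gen[OF A(1)])
      also have "\<dots> = (\<Sum>ys\<in>del_nth i ` A. card {xs \<in> A. del_nth i xs = ys} * (cmod (c ys))\<^sup>2)"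
        by (intro sum.cong refl) simp
      also have "\<dots> \<le> (\<Sum>ys\<in>del_nth i ` A. card R * (cmod (c ys))\<^sup>2)"
        using fibre[OF A(2)] i by (intro sum_mono mult_right_mono) auto
      also have "\<dots> = card R * (\<Sum>ys\<in>del_nth i ` A. (cmod (c ys))\<^sup>2)" by (rule sum_distrib_left[symmetric])
      also have "\<dots> \<le> card R * l2_sq ?S c"
        using A del i by (intro mult_left_mono sum_le_l2_sq[OF c]) auto
      finally show "(\<Sum>xs\<in>A. (cmod (c (del_nth i xs)))\<^sup>2) \<le> card R * l2_sq ?S c" .
    qed simp
    finally show "(\<Sum>xs\<in>A. (cmod (coboundary M m c xs))\<^sup>2) \<le> real (Suc m) * (\<Sum>i\<le>m. card R * l2_sq ?S c)" .
  qed
qed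

lemma coboundaries_closure:
  assumes M: "invariant_subcomplex M" and cc: "cocompact_complex \<Gamma> M a"
  shows coboundaries_subset: "coboundary M p ` l2_cochains M p \<subseteq> l2 (ordered_simplices M (Suc p))"
    and closed_coboundaries: "closed_l2_subspace (ordered_simplices M (Suc p)) (l2_coboundaries_closure M p)"
    and invariant_coboundaries: "invariant_functions M (Suc p) (l2_coboundaries_closure M p)"
    and alternating_coboundaries: "b \<in> l2_coboundaries_closure M p \<Longrightarrow> alternating_on (ordered_simplices M (Suc p)) (Suc p) b"
proof -
  show sub: "coboundary M p ` l2_cochains M p \<subseteq> l2 (ordered_simplices M (Suc p))"
    using coboundary_l2[OF M cc] by (auto simp: l2_cochains_alt)
  note CD = l2_subspaceD[OF l2_subspace_cochains[of M p]]
  have "l2_subspace (ordered_simplices M (Suc p)) (coboundary M p ` l2_cochains M p)"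
    unfolding l2_subspace_def
  proof (intro conjI ballI allI sub)
    show "(\<lambda>_. 0) \<in> coboundary M p ` l2_cochains M p"
      by (rule rev_image_eqI[OF CD(2)]) (simp add: coboundary_zero)
    fix f h assume "f \<in> coboundary M p ` l2_cochains M p" "h \<in> coboundary M p ` l2_cochains M p"
    then obtain f' h' where f': "f' \<in> l2_cochains M p" "f = coboundary M p f'"
      and h': "h' \<in> l2_cochains M p" "h = coboundary M p h'" by blast
    show "(\<lambda>s. f s + h s) \<in> coboundary M p ` l2_cochains M p"
      by (rule rev_image_eqI[OF CD(3)[OF f'(1) h'(1)]]) (simp add: coboundary_add f' h')
    fix c show "(\<lambda>s. c * f s) \<in> coboundary M p ` l2_cochains M p"
      by (rule rev_image_eqI[OF CD(4)[OF f'(1)]]) (simp add: coboundary_scale f')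
  qed
  then show "closed_l2_subspace (ordered_simplices M (Suc p)) (l2_coboundaries_closure M p)"
    unfolding l2_coboundaries_closure_def by (rule closed_l2_subspace_closure)
  have "invariant_functions M (Suc p) (coboundary M p ` l2_cochains M p)"
    unfolding invariant_functions_def
  proof (intro ballI)
    fix g f assume g: "g \<in> carrier \<Gamma>" and "f \<in> coboundary M p ` l2_cochains M p"
    then obtain c where c: "c \<in> l2_cochains M p" "f = coboundary M p c" by blast
    have "translate M p g c \<in> l2_cochains M p"
      using invariant_cochains[OF M] g c(1) by (simp add: invariant_functions_def)
    moreover have "translate M (Suc p) g f = coboundary M p (translate M p g c)"
      using coboundary_translate[OF M g] c by (simp add: l2_cochains_alt)
    ultimately show "translate M (Suc p) g f \<in> coboundary M p ` l2_cochains M p" by blast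
  qed
  then show "invariant_functions M (Suc p) (l2_coboundaries_closure M p)"
    unfolding l2_coboundaries_closure_def by (rule invariant_functions_closure[OF M])
  assume b: "b \<in> l2_coboundaries_closure M p"
  show "alternating_on (ordered_simplices M (Suc p)) (Suc p) b"
  proof (rule alternating_on_closure[OF sub _ b[unfolded l2_coboundaries_closure_def]])
    fix f assume "f \<in> coboundary M p ` l2_cochains M p"
    then show "alternating_on (ordered_simplices M (Suc p)) (Suc p) f"
      using alternating_on_coboundary[OF _ invariant_subcomplexD(1)[OF M]] by (auto simp: l2_cochains_alt)
  qed
qed

lemma reduced_cohomology:
  assumes M: "invariant_subcomplex M"
  shows l2_subspace_reduced: "l2_subspace (ordered_simplices M (Suc p)) (reduced_l2_cohomology M p)"
    and invariant_reduced: "\<lbrakk>cocompact_complex \<Gamma> M a\<rbrakk> \<Longrightarrow> invariant_functions M (Suc p) (reduced_l2_cohomology M p)"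
proof -
  have Bl: "l2_coboundaries_closure M p \<subseteq> l2 (ordered_simplices M (Suc p))"
    by (auto simp: l2_coboundaries_closure_def l2_closure_def)
  show "l2_subspace (ordered_simplices M (Suc p)) (reduced_l2_cohomology M p)"
    unfolding reduced_l2_cohomology_def by (rule l2_subspace_hilbert_quotient[OF l2_subspace_cocycles Bl])
  assume cc: "cocompact_complex \<Gamma> M a"
  show "invariant_functions M (Suc p) (reduced_l2_cohomology M p)"
    unfolding invariant_functions_def
  proof (intro ballI)
    fix g f assume g: "g \<in> carrier \<Gamma>" and f: "f \<in> reduced_l2_cohomology M p"
    have fc: "f \<in> l2_cochains M (Suc p)" "coboundary M (Suc p) f = (\<lambda>_. 0)"
      and orth: "\<And>w. w \<in> l2_coboundaries_closure M p \<Longrightarrow> l2_inner (ordered_simplices M (Suc p)) f w = 0"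
      using f by (auto simp: reduced_l2_cohomology_def hilbert_quotient_def l2_cocycles_def)
    have "translate M (Suc p) g f \<in> l2_cochains M (Suc p)"
      using invariant_cochains[OF M] g fc by (simp add: invariant_functions_def)
    moreover have "coboundary M (Suc p) (translate M (Suc p) g f) = (\<lambda>_. 0)"
      using coboundary_translate[OF M g, of f "Suc p"] fc by (auto simp: l2_cochains_alt translate_def)
    moreover have "l2_inner (ordered_simplices M (Suc p)) (translate M (Suc p) g f) w = 0" if "w \<in> l2_coboundaries_closure M p" for w
      by (rule orthogonal_translate[OF M invariant_coboundaries[OF M cc] Bl g orth that])
    ultimately show "translate M (Suc p) g f \<in> reduced_l2_cohomology M p"
      by (simp add: reduced_l2_cohomology_def hilbert_quotient_def l2_cocycles_def)
  qed
qed

lemma restrict_cochain_l2: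
  assumes MN: "M \<subseteq> N" and f: "f \<in> l2 (ordered_simplices N (Suc p))"
  shows "restrict_cochain M p f \<in> l2 (ordered_simplices M (Suc p))"
proof (rule l2_I(1))
  fix A assume A: "finite A" "A \<subseteq> ordered_simplices M (Suc p)"
  have "(\<Sum>s\<in>A. (cmod (restrict_cochain M p f s))\<^sup>2) = (\<Sum>s\<in>A. (cmod (f s))\<^sup>2)"
    using A by (intro sum.cong) (auto simp: restrict_cochain_def)
  also have "\<dots> \<le> l2_sq (ordered_simplices N (Suc p)) f"
    using A MN by (intro sum_le_l2_sq[OF f]) (auto simp: ordered_simplices_def)
  finally show "(\<Sum>s\<in>A. (cmod (restrict_cochain M p f s))\<^sup>2) \<le> l2_sq (ordered_simplices N (Suc p)) f" .
qed (simp add: restrict_cochain_def)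

text \<open>
  Two of these properties confine the elements of \<open>W\<close> on a finite part of the complex: they are
  restrictions of cocycles of \<open>N\<close> up to limits of coboundaries, and they are orthogonal to all coboundaries.
\<close>

lemma restriction_image:
  fixes p :: nat
  assumes M: "invariant_subcomplex M" "cocompact_complex \<Gamma> M a"
    and N: "invariant_subcomplex N" "cocompact_complex \<Gamma> N a" and MN: "M \<subseteq> N"
  defines "S \<equiv> ordered_simplices M (Suc p)" and "W \<equiv> restriction_map M p ` reduced_l2_cohomology N p"
  shows l2_subspace_restriction_image: "l2_subspace S W"
    and invariant_restriction_image: "invariant_functions M (Suc p) W"
    and alternating_restriction_image: "w \<in> W \<Longrightarrow> alternating_on S (Suc p) w"
    and orthogonal_restriction_image: "\<lbrakk>w \<in> W; b \<in> l2_coboundaries_closure M p\<rbrakk> \<Longrightarrow> l2_inner S w b = 0"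
    and restriction_image_decompose: "w \<in> W \<Longrightarrow> \<exists>z b. z \<in> l2_cocycles N p \<and> b \<in> l2_coboundaries_closure M p \<and>
          w = (\<lambda>xs. restrict_cochain M p z xs - b xs)"
proof -
  let ?B = "l2_coboundaries_closure M p" and ?Z = "reduced_l2_cohomology N p"
  let ?P = "l2_proj S ?B"
  note RD = l2_subspaceD[OF l2_subspace_reduced[OF N(1), of p]]
  have closed: "closed_l2_subspace S ?B" unfolding S_def by (rule closed_coboundaries[OF M])
  have Bs: "l2_subspace S ?B" using closed by (simp add: closed_l2_subspace_def)
  note BD = l2_subspaceD[OF Bs]
  have rl: "restrict_cochain M p z \<in> l2 S" if "z \<in> ?Z" for z
    unfolding S_def by (rule restrict_cochain_l2[OF MN RD(1)[OF that]])
  have rm: "restriction_map M p z = (\<lambda>xs. restrict_cochain M p z xs - ?P (restrict_cochain M p z) xs)" for z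
    by (simp add: restriction_map_def quotient_class_def S_def)
  have PB: "?P (restrict_cochain M p z) \<in> ?B" if "z \<in> ?Z" for z by (rule l2_proj_in[OF closed rl[OF that]])
  have Wl: "W \<subseteq> l2 S" unfolding W_def using l2_diff[OF rl BD(1)[OF PB]] by (auto simp: rm)
  have add: "restriction_map M p (\<lambda>s. z s + y s) = (\<lambda>s. restriction_map M p z s + restriction_map M p y s)" if zy: "z \<in> ?Z" "y \<in> ?Z" for z y
  proof -
    have "restrict_cochain M p (\<lambda>s. z s + y s) = (\<lambda>s. restrict_cochain M p z s + restrict_cochain M p y s)"
      by (auto simp: restrict_cochain_def)
    note r = this
    show ?thesis unfolding rm r l2_proj_add[OF closed rl[OF zy(1)] rl[OF zy(2)]] by (auto simp: fun_eq_iff)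
  qed
  have scale: "restriction_map M p (\<lambda>s. c * z s) = (\<lambda>s. c * restriction_map M p z s)" if z: "z \<in> ?Z" for z c
  proof -
    have "restrict_cochain M p (\<lambda>s. c * z s) = (\<lambda>s. c * restrict_cochain M p z s)"
      by (auto simp: restrict_cochain_def)
    then show ?thesis unfolding rm by (simp add: l2_proj_scale[OF closed rl[OF z]] algebra_simps)
  qed
  show "l2_subspace S W"
    unfolding l2_subspace_def
  proof (intro conjI ballI allI Wl)
    have "(\<lambda>s. 0 * restriction_map M p (\<lambda>_. 0) s) \<in> W"
      unfolding W_def by (rule rev_image_eqI[OF RD(4)[OF RD(2), of 0]]) (simp only: scale[OF RD(2), of 0, symmetric])
    then show "(\<lambda>_. 0) \<in> W" by simp
    fix f h assume "f \<in> W" "h \<in> W"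
    then obtain f' h' where f': "f' \<in> ?Z" "f = restriction_map M p f'" and h': "h' \<in> ?Z" "h = restriction_map M p h'"
      unfolding W_def by blast
    show "(\<lambda>s. f s + h s) \<in> W"
      unfolding W_def by (rule rev_image_eqI[OF RD(3)[OF f'(1) h'(1)]]) (simp add: add[OF f'(1) h'(1)] f' h')
    fix c show "(\<lambda>s. c * f s) \<in> W"
      unfolding W_def by (rule rev_image_eqI[OF RD(4)[OF f'(1)]]) (simp add: scale[OF f'(1)] f')
  qed
  show "invariant_functions M (Suc p) W"
    unfolding invariant_functions_def
  proof (intro ballI)
    fix g w assume g: "g \<in> carrier \<Gamma>" and "w \<in> W"
    then obtain z where z: "z \<in> ?Z" "w = restriction_map M p z" unfolding W_def by blast
    have tz: "translate N (Suc p) g z \<in> ?Z" using invariant_reduced[OF N] g z(1) by (simp add: invariant_functions_def)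
    have "restrict_cochain M p (translate N (Suc p) g z) = translate M (Suc p) g (restrict_cochain M p z)"
      using map_a_ordered_simplices[OF M(1) _ g] MN by (auto simp: restrict_cochain_def translate_def fun_eq_iff ordered_simplices_def)
    then have "restriction_map M p (translate N (Suc p) g z) = translate M (Suc p) g w"
      using l2_proj_translate[OF M(1) closed[unfolded S_def] invariant_coboundaries[OF M] g rl[OF z(1), unfolded S_def]]
      by (simp add: z(2) rm translate_diff S_def)
    then show "translate M (Suc p) g w \<in> W" unfolding W_def using tz by (metis imageI)
  qed
  fix w assume "w \<in> W"
  then obtain z where z: "z \<in> ?Z" "w = restriction_map M p z" unfolding W_def by blast
  have zc: "z \<in> l2_cocycles N p" using z(1) by (simp add: reduced_l2_cohomology_def hilbert_quotient_def)
  show "\<exists>z b. z \<in> l2_cocycles N p \<and> b \<in> ?B \<and> w = (\<lambda>xs. restrict_cochain M p z xs - b xs)"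
    using zc PB[OF z(1)] z(2) rm by blast
  show "l2_inner S w b = 0" if "b \<in> ?B"
    using l2_proj_orthogonal[OF closed rl[OF z(1)] that] by (simp add: z(2) rm)
  have "alternating_on (ordered_simplices N (Suc p)) (Suc p) z"
    using zc by (simp add: l2_cocycles_def l2_cochains_alt)
  then have "alternating_on S (Suc p) (restrict_cochain M p z)"
    using MN unfolding alternating_on_def restrict_cochain_def S_def ordered_simplices_def
    by (auto simp: subset_iff)
  moreover have "alternating_on S (Suc p) (?P (restrict_cochain M p z))"
    unfolding S_def by (rule alternating_coboundaries[OF M PB[OF z(1), unfolded S_def]])
  ultimately show "alternating_on S (Suc p) w"
    unfolding z(2) rm by (simp add: alternating_on_def right_diff_distrib)
qed

end


section \<open>Vanishing of reduced cohomology for Folner groups\<close>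

lemma ordered_simplices_mono: "Y \<subseteq> M \<Longrightarrow> ordered_simplices Y m \<subseteq> ordered_simplices M m"
  by (auto simp: ordered_simplices_def)

lemma l2_proj_diagonal_nonneg:
  assumes V: "closed_l2_subspace S V" and f: "f \<in> l2 S"
  shows "0 \<le> Re (l2_inner S (l2_proj S V f) f)"
proof -
  have Vs: "l2_subspace S V" using V by (simp add: closed_l2_subspace_def)
  let ?P = "l2_proj S V f"
  have P: "?P \<in> V" by (rule l2_proj_in[OF V f])
  have Pl: "?P \<in> l2 S" by (rule l2_subspaceD(1)[OF Vs P])
  have "l2_inner S f ?P = l2_inner S ?P ?P"
    using l2_proj_orthogonal[OF V f P] l2_inner_diff_left[OF f Pl Pl] by simp
  from arg_cong[OF this, of cnj] have "l2_inner S ?P f = of_real (l2_sq S ?P)"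
    by (simp add: l2_inner_cnj l2_inner_self)
  then show ?thesis by (simp add: l2_sq_nonneg)
qed

context free_complex begin

lemma orbit_map_a:
  assumes M: "invariant_subcomplex M" and xs: "xs \<in> ordered_simplices M m" and h: "h \<in> carrier \<Gamma>"
  shows "orbit \<Gamma> (\<lambda>g. map (a g)) (map (a h) xs) = orbit \<Gamma> (\<lambda>g. map (a g)) xs"
proof -
  interpret group \<Gamma> by (rule group)
  have xsK: "set xs \<subseteq> \<Union>K" using set_ordered_simplex[OF xs invariant_subcomplexD(2)[OF M]] .
  show ?thesis
  proof (rule Set.set_eqI, rule iffI)
    fix z assume "z \<in> orbit \<Gamma> (\<lambda>g. map (a g)) (map (a h) xs)"
    then obtain g where g: "g \<in> carrier \<Gamma>" "z = map (a g) (map (a h) xs)" unfolding orbit_def by blast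
    then have "z = map (a (g \<otimes> h)) xs" using map_a_mult[OF g(1) h xsK] by simp
    then show "z \<in> orbit \<Gamma> (\<lambda>g. map (a g)) xs" unfolding orbit_def using g(1) h by blast
  next
    fix z assume "z \<in> orbit \<Gamma> (\<lambda>g. map (a g)) xs"
    then obtain g where g: "g \<in> carrier \<Gamma>" "z = map (a g) xs" unfolding orbit_def by blast
    have "map (a (g \<otimes> inv h)) (map (a h) xs) = map (a (g \<otimes> inv h \<otimes> h)) xs"
      using map_a_mult[of "g \<otimes> inv h" h xs] g(1) h xsK by simp
    then have "z = map (a (g \<otimes> inv h)) (map (a h) xs)" using g h by (simp add: m_assoc)
    then show "z \<in> orbit \<Gamma> (\<lambda>g. map (a g)) (map (a h) xs)" unfolding orbit_def using g(1) h by blast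
  qed
qed

text \<open>
  The translates of \<open>C\<close> by \<open>F\<close> contain \<open>card F\<close> simplices of each orbit, at which the projection
  has equal diagonal entries. So \<open>card F\<close> times the dimension is at most the part of the trace that is
  carried by these translates.
\<close>

lemma vn_dim_le_boundary:
  assumes M: "invariant_subcomplex M"
    and C: "finite C" "C \<subseteq> M" "abstract_complex C" "\<And>s. s \<in> M \<Longrightarrow> \<exists>g\<in>carrier \<Gamma>. \<exists>c\<in>C. s = a g ` c"
    and F: "finite F" "F \<subseteq> carrier \<Gamma>"
    and V: "closed_l2_subspace (ordered_simplices M (Suc p)) V" "invariant_functions M (Suc p) V"
    and D: "finite D" "D \<subseteq> ordered_simplices M (Suc p)"
    and det: "\<And>x xs. \<lbrakk>x \<in> V; \<And>d. d \<in> D \<Longrightarrow> x d = 0; xs \<in> ordered_simplices ((\<lambda>(g, c). a g ` c) ` (F \<times> C)) (Suc p)\<rbrakk> \<Longrightarrow> x xs = 0"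
  shows "card F * vn_dim \<Gamma> (ordered_simplices M (Suc p)) (\<lambda>g. map (a g)) V \<le> card D"
    and "0 \<le> vn_dim \<Gamma> (ordered_simplices M (Suc p)) (\<lambda>g. map (a g)) V"
proof -
  interpret group \<Gamma> by (rule group)
  let ?S = "ordered_simplices M (Suc p)"
  define Y where "Y = (\<lambda>(g, c). a g ` c) ` (F \<times> C)"
  note det' = det[folded Y_def]
  let ?X = "ordered_simplices Y (Suc p)" and ?orb = "orbit \<Gamma> (\<lambda>g. map (a g))"
  have MK: "M \<subseteq> K" using invariant_subcomplexD(2)[OF M] .
  define d where "d = (\<lambda>xs. Re (l2_inner ?S (l2_proj ?S V (point_mass xs)) (point_mass xs)))"
  have d0: "0 \<le> d xs" if "xs \<in> ?S" for xs
    unfolding d_def by (rule l2_proj_diagonal_nonneg[OF V(1) point_mass_l2[OF that]])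
  have d_inv: "d (map (a g) xs) = d xs" if "xs \<in> ?S" "g \<in> carrier \<Gamma>" for g xs
    unfolding d_def using diagonal_entry_invariant[OF M V that(2,1)] by (simp only:)
  define Or where "Or = orbits \<Gamma> ?S (\<lambda>g. map (a g))"
  have Or: "\<exists>x\<in>?S. Q = ?orb x" if "Q \<in> Or" for Q using that by (auto simp: Or_def orbits_def)
  have orb_mem: "z \<in> ?S \<and> Q = ?orb z" if Q: "Q \<in> Or" and z: "z \<in> Q" for Q z
  proof -
    obtain x where x: "x \<in> ?S" "Q = ?orb x" using Or[OF Q] by blast
    obtain g where g: "g \<in> carrier \<Gamma>" "z = map (a g) x" using z x(2) unfolding orbit_def by blast
    show ?thesis using map_a_ordered_simplices[OF M x(1) g(1)] orbit_map_a[OF M x(1) g(1)] g(2) x(2) by simp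
  qed
  have "\<exists>y. y \<in> ordered_simplices C (Suc p) \<and> y \<in> Q" if Q: "Q \<in> Or" for Q
  proof -
    obtain x where x: "x \<in> ?S" "Q = ?orb x" using Or[OF Q] by blast
    obtain g r where g: "g \<in> carrier \<Gamma>" and r: "r \<in> ordered_simplices C (Suc p)" "x = map (a g) r"
      using ordered_representatives[OF M C(2,4) x(1)] by blast
    have rS: "r \<in> ?S" using r(1) C(2) by (auto simp: ordered_simplices_def)
    have "?orb x = ?orb r" unfolding r(2) by (rule orbit_map_a[OF M rS g])
    moreover have "r \<in> ?orb r"
      unfolding orbit_def using map_a_one[OF set_ordered_simplex[OF rS MK]] by (metis (mono_tags, lifting) mem_Collect_eq one_closed)
    ultimately show ?thesis using r(1) x(2) by blast
  qed
  then obtain y where y: "\<And>Q. Q \<in> Or \<Longrightarrow> y Q \<in> ordered_simplices C (Suc p)" "\<And>Q. Q \<in> Or \<Longrightarrow> y Q \<in> Q" by metis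
  have yS: "y Q \<in> ?S" if "Q \<in> Or" for Q using orb_mem[OF that y(2)[OF that]] by blast
  have finC: "finite (ordered_simplices C (Suc p))" by (rule finite_ordered_simplices[OF C(1,3)])
  have "inj_on y Or" by (rule inj_onI) (metis orb_mem y(2))
  moreover have "y ` Or \<subseteq> ordered_simplices C (Suc p)" using y(1) by blast
  ultimately have finOr: "finite Or" using finC by (metis finite_subset finite_imageD)
  have "d (SOME s. s \<in> Q) = d (y Q)" if Q: "Q \<in> Or" for Q
  proof -
    have s: "(SOME s. s \<in> Q) \<in> Q" using y(2)[OF Q] by (rule someI)
    then have "(SOME s. s \<in> Q) \<in> ?orb (y Q)" using orb_mem[OF Q y(2)[OF Q]] by blast
    then obtain g where "g \<in> carrier \<Gamma>" "(SOME s. s \<in> Q) = map (a g) (y Q)" unfolding orbit_def by blast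
    then show ?thesis using d_inv[OF yS[OF Q]] by simp
  qed
  then have dim: "vn_dim \<Gamma> ?S (\<lambda>g. map (a g)) V = (\<Sum>Q\<in>Or. d (y Q))"
    unfolding vn_dim_def Or_def[symmetric] Let_def d_def[symmetric] by (intro sum.cong refl)
  show "0 \<le> vn_dim \<Gamma> ?S (\<lambda>g. map (a g)) V" unfolding dim by (rule sum_nonneg) (rule d0[OF yS])
  let ?f = "\<lambda>(Q, g). map (a g) (y Q)"
  have inj: "inj_on ?f (Or \<times> F)"
  proof (rule inj_onI)
    fix s t assume s: "s \<in> Or \<times> F" and t: "t \<in> Or \<times> F" and eq: "?f s = ?f t"
    obtain Q g where s: "s = (Q, g)" "Q \<in> Or" "g \<in> F" using s by auto
    obtain R h where t: "t = (R, h)" "R \<in> Or" "h \<in> F" using t by auto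
    have gh: "g \<in> carrier \<Gamma>" "h \<in> carrier \<Gamma>" using s t F by auto
    have eq: "map (a g) (y Q) = map (a h) (y R)" using eq s t by simp
    have "Q = ?orb (map (a g) (y Q))" using orb_mem[OF s(2) y(2)[OF s(2)]] orbit_map_a[OF M yS[OF s(2)] gh(1)] by simp
    moreover have "R = ?orb (map (a h) (y R))" using orb_mem[OF t(2) y(2)[OF t(2)]] orbit_map_a[OF M yS[OF t(2)] gh(2)] by simp
    ultimately have QR: "Q = R" using eq by simp
    have "a g ` set (y Q) = a h ` set (y Q)" using eq QR by (metis set_map)
    moreover have "set (y Q) \<in> K" using yS[OF s(2)] MK by (auto simp: ordered_simplices_def)
    ultimately have "g = h" by (intro a_free_eq[OF gh])
    then show "s = t" using s t QR by simp
  qed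
  have img: "?f ` (Or \<times> F) \<subseteq> ?X"
  proof (rule image_subsetI)
    fix s assume "s \<in> Or \<times> F"
    then obtain Q g where s: "s = (Q, g)" "Q \<in> Or" "g \<in> F" by auto
    then have gG: "g \<in> carrier \<Gamma>" using F by auto
    have "map (a g) (y Q) \<in> ?S" by (rule map_a_ordered_simplices[OF M yS[OF s(2)] gG])
    moreover have "set (y Q) \<in> C" using y(1)[OF s(2)] by (simp add: ordered_simplices_def)
    then have "a g ` set (y Q) \<in> Y" unfolding Y_def using s(3) by (intro rev_image_eqI[of "(g, set (y Q))"]) auto
    ultimately show "?f s \<in> ?X" using s(1) by (simp add: ordered_simplices_def)
  qed
  have YM: "Y \<subseteq> M"
  proof
    fix s assume "s \<in> Y"
    then obtain g c where "g \<in> F" "c \<in> C" "s = a g ` c" unfolding Y_def by auto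
    then show "s \<in> M" using C(2) F(2) by (auto intro!: invariant_subcomplexD(3)[OF M])
  qed
  then have XS: "?X \<subseteq> ?S" by (rule ordered_simplices_mono)
  have Ycomp: "finite Y" "finite ?X"
  proof -
    show finY: "finite Y" using F C by (simp add: Y_def)
    have "finite (\<Union>Y)"
      using finY YM invariant_subcomplexD(1)[OF M] by (intro finite_Union) (auto simp: abstract_complex_def)
    moreover have "?X \<subseteq> {xs. set xs \<subseteq> \<Union>Y \<and> length xs = Suc p}" by (auto simp: ordered_simplices_def)
    ultimately show "finite ?X" using finite_lists_length_eq[of "\<Union>Y"] finite_subset by blast
  qed
  have "card F * (\<Sum>Q\<in>Or. d (y Q)) = (\<Sum>Q\<in>Or. \<Sum>g\<in>F. d (y Q))" by (simp add: sum_distrib_left)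
  also have "\<dots> = (\<Sum>Q\<in>Or. \<Sum>g\<in>F. d (map (a g) (y Q)))"
    using d_inv yS F by (intro sum.cong refl) (auto simp: subset_iff)
  also have "\<dots> = (\<Sum>s\<in>Or \<times> F. d (?f s))" by (simp add: sum.cartesian_product case_prod_unfold)
  also have "\<dots> = (\<Sum>xs\<in>?f ` (Or \<times> F). d xs)" by (rule sum.reindex_cong[OF inj refl, symmetric]) simp
  also have "\<dots> \<le> (\<Sum>xs\<in>?X. d xs)" using img XS d0 Ycomp by (intro sum_mono2) auto
  also have "\<dots> \<le> card D"
    unfolding d_def
  proof (rule l2_proj_trace_le_card[OF V(1) Ycomp(2) XS D])
    fix x xs assume "x \<in> V" "\<And>d. d \<in> D \<Longrightarrow> x d = 0" "xs \<in> ?X"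
    then show "x xs = 0" by (rule det')
  qed
  finally show "card F * vn_dim \<Gamma> ?S (\<lambda>g. map (a g)) V \<le> card D" unfolding dim .
qed

text \<open>
  In positive degree the conjugate of \<open>x\<close> is a cycle of \<open>Y\<close>: since \<open>x\<close> vanishes on \<open>B\<close>, orthogonality to
  the coboundary of a cochain supported in \<open>Y\<close> only involves the simplices of \<open>Y\<close>. On the other hand \<open>x\<close>
  annihilates the cycles of \<open>Y\<close>, being a limit of functions that are coboundaries on \<open>Y\<close>. Therefore \<open>x\<close> is
  orthogonal to itself on \<open>Y\<close>. In degree zero the difference of two points is a cycle, so \<open>x\<close> is
  constant on \<open>Y\<close>, and its value at one point determines it.
\<close>

lemma restriction_image_determined_by_boundary:
  fixes p :: nat
  assumes M: "invariant_subcomplex M" "cocompact_complex \<Gamma> M a"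
    and N: "invariant_subcomplex N" "cocompact_complex \<Gamma> N a" and MN: "M \<subseteq> N"
    and Y: "finite Y" "Y \<subseteq> M" "abstract_complex Y"
  defines "S \<equiv> ordered_simplices M (Suc p)" and "X \<equiv> ordered_simplices Y (Suc p)"
  defines "B \<equiv> {xs \<in> S. set xs \<notin> Y \<and> (\<exists>k\<le>p. set (del_nth k xs) \<in> Y)}"
  assumes fill: "\<And>z. z \<in> l2_cocycles N p \<Longrightarrow> \<exists>u. \<forall>xs\<in>X. z xs = (\<Sum>k\<le>p. (-1) ^ k * u (del_nth k xs))"
    and x: "x \<in> l2_closure S (restriction_map M p ` reduced_l2_cohomology N p)"
    and finB: "finite B" and zeroB: "\<And>xs. xs \<in> B \<Longrightarrow> x xs = 0"
    and zero0: "p = 0 \<Longrightarrow> X \<noteq> {} \<Longrightarrow> x0 \<in> X \<and> x x0 = 0"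
    and xs0: "xs0 \<in> X"
  shows "x xs0 = 0"
proof -
  let ?W = "restriction_map M p ` reduced_l2_cohomology N p"
  note RI = restriction_image[OF M N MN, where p=p, folded S_def]
  have Wl: "?W \<subseteq> l2 S" using RI(1) by (simp add: l2_subspace_def)
  have XS: "X \<subseteq> S" using Y(2) by (auto simp: X_def S_def ordered_simplices_def)
  have finX: "finite X" unfolding X_def by (rule finite_ordered_simplices[OF Y(1,3)])
  have Mc: "abstract_complex M" using invariant_subcomplexD(1)[OF M(1)] .
  \<comment> \<open>the hypothesis says that \<open>c\<close> is a cycle of \<open>Y\<close>\<close>
  have kills: "(\<Sum>xs\<in>X. c xs * x xs) = 0"
    if c: "\<And>u. (\<Sum>xs\<in>X. c xs * (\<Sum>k\<le>p. (-1) ^ k * u (del_nth k xs))) = 0" for c :: "'v list \<Rightarrow> complex"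
  proof (rule l2_closure_finite_condition[OF Wl finX _ x])
    fix w assume "w \<in> ?W"
    then obtain z b where z: "z \<in> l2_cocycles N p" and b: "b \<in> l2_coboundaries_closure M p"
      and w: "w = (\<lambda>xs. restrict_cochain M p z xs - b xs)" using RI(5) by blast
    obtain u where u: "\<forall>xs\<in>X. z xs = (\<Sum>k\<le>p. (-1) ^ k * u (del_nth k xs))" using fill[OF z] by blast
    have "(\<Sum>xs\<in>X. c xs * restrict_cochain M p z xs) = (\<Sum>xs\<in>X. c xs * (\<Sum>k\<le>p. (-1) ^ k * u (del_nth k xs)))"
      using XS u by (intro sum.cong refl) (auto simp: restrict_cochain_def S_def)
    moreover have "(\<Sum>xs\<in>X. c xs * b xs) = 0"
    proof (rule l2_closure_finite_condition[OF _ finX])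
      show "coboundary M p ` l2_cochains M p \<subseteq> l2 S" unfolding S_def by (rule coboundaries_subset[OF M])
      show "b \<in> l2_closure S (coboundary M p ` l2_cochains M p)" using b by (simp add: l2_coboundaries_closure_def S_def)
      fix f assume "f \<in> coboundary M p ` l2_cochains M p"
      then obtain v where v: "f = coboundary M p v" by blast
      have "(\<Sum>xs\<in>X. c xs * f xs) = (\<Sum>xs\<in>X. c xs * (\<Sum>k\<le>p. (-1) ^ k * v (del_nth k xs)))"
        using XS unfolding v by (intro sum.cong refl) (auto simp: coboundary_apply S_def)
      then show "(\<Sum>xs\<in>X. c xs * f xs) = 0" using c by simp
    qed
    ultimately show "(\<Sum>xs\<in>X. c xs * w xs) = 0" using c[of u] by (simp add: w right_diff_distrib sum_subtractf)
  qed
  show ?thesis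
  proof (cases "p = 0")
    case True
    have x0: "x0 \<in> X" "x x0 = 0" using zero0[OF True] xs0 by auto
    show ?thesis
    proof (cases "xs0 = x0")
      case False
      let ?c = "\<lambda>xs. if xs = xs0 then 1 else if xs = x0 then -1 else (0 :: complex)"
      have sum_c: "(\<Sum>xs\<in>X. ?c xs * h xs) = h xs0 - h x0" for h
      proof -
        have "(\<Sum>xs\<in>X. ?c xs * h xs) = (\<Sum>xs\<in>{xs0, x0}. ?c xs * h xs)"
          using finX xs0 x0(1) by (intro sum.mono_neutral_right) auto
        then show ?thesis using False by simp
      qed
      have "(\<Sum>xs\<in>X. ?c xs * x xs) = 0"
      proof (rule kills)
        fix u
        have "del_nth 0 xs0 = []" "del_nth 0 x0 = []"
          using xs0 x0(1) True by (auto simp: X_def ordered_simplices_def del_nth_def)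
        then show "(\<Sum>xs\<in>X. ?c xs * (\<Sum>k\<le>p. (-1) ^ k * u (del_nth k xs))) = 0"
          unfolding sum_c by (simp add: True)
      qed
      then show ?thesis unfolding sum_c using x0(2) by simp
    qed (use x0 in simp)
  next
    case False
    have alt: "alternating_on S (Suc p) x" by (rule alternating_on_closure[OF Wl RI(3) x])
    have altX: "alternating_on X (Suc p) x" using alt XS by (auto simp: alternating_on_def)
    have permX: "permute_list \<pi> xs \<in> X" if "xs \<in> X" "\<pi> permutes {..<Suc p}" for xs \<pi>
      using that by (auto simp: X_def ordered_simplices_def)
    have lenX: "length xs = Suc p" if "xs \<in> X" for xs using that by (simp add: X_def ordered_simplices_def)
    have finYp: "finite (ordered_simplices Y p)" by (rule finite_ordered_simplices[OF Y(1,3)])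
    have "(\<Sum>xs\<in>X. cnj (x xs) * (\<Sum>k\<le>p. (-1) ^ k * u (del_nth k xs))) = 0" for u :: "'v list \<Rightarrow> complex"
    proof -
      \<comment> \<open>the test cochain has to be alternating and supported in \<open>Y\<close>\<close>
      define u' where "u' = (\<lambda>ys. if ys \<in> ordered_simplices Y p then u ys else 0)"
      define v where "v = (\<lambda>ys. if ys \<in> ordered_simplices Y p then (\<Sum>\<pi> | \<pi> permutes {..<p}. of_int (sign \<pi>) * u' (permute_list \<pi> ys)) else 0)"
      have YM: "ordered_simplices Y p \<subseteq> ordered_simplices M p" using Y(2) by (auto simp: ordered_simplices_def)
      have v_alt: "alternating_on (ordered_simplices M p) p v"
        unfolding alternating_on_def
      proof (intro ballI allI impI)
        fix ys \<rho> assume ys: "ys \<in> ordered_simplices M p" and \<rho>: "\<rho> permutes {..<p}"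
        have len: "length ys = p" using ys by (simp add: ordered_simplices_def)
        have iff: "permute_list \<rho> ys \<in> ordered_simplices Y p \<longleftrightarrow> ys \<in> ordered_simplices Y p"
          using \<rho> len by (simp add: ordered_simplices_def)
        show "v (permute_list \<rho> ys) = of_int (sign \<rho>) * v ys"
        proof (cases "ys \<in> ordered_simplices Y p")
          case True
          have perm\<rho>: "permutation \<rho>" using \<rho> by (auto simp: permutation_permutes)
          let ?\<Pi> = "{\<pi>. \<pi> permutes {..<p}}"
          have bij: "bij_betw (\<lambda>\<pi>. \<rho> \<circ> \<pi>) ?\<Pi> ?\<Pi>"
            using \<rho> by (auto intro!: bij_betw_byWitness[where f'="\<lambda>\<pi>. inv_into UNIV \<rho> \<circ> \<pi>"]
                permutes_compose permutes_inv simp: o_assoc permutes_inv_o)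
          have "v ys = (\<Sum>\<pi>\<in>?\<Pi>. of_int (sign \<pi>) * u' (permute_list \<pi> ys))" using True by (simp add: v_def)
          also have "\<dots> = (\<Sum>\<pi>\<in>?\<Pi>. of_int (sign (\<rho> \<circ> \<pi>)) * u' (permute_list (\<rho> \<circ> \<pi>) ys))"
            by (rule sum.reindex_bij_betw[OF bij, symmetric])
          also have "\<dots> = (\<Sum>\<pi>\<in>?\<Pi>. of_int (sign \<rho>) * (of_int (sign \<pi>) * u' (permute_list \<pi> (permute_list \<rho> ys))))"
          proof (rule sum.cong[OF refl])
            fix \<pi> assume \<pi>: "\<pi> \<in> ?\<Pi>"
            then have "permutation \<pi>" by (auto simp: permutation_permutes)
            then have "sign (\<rho> \<circ> \<pi>) = sign \<rho> * sign \<pi>" by (rule sign_compose[OF perm\<rho>])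
            moreover have "permute_list (\<rho> \<circ> \<pi>) ys = permute_list \<pi> (permute_list \<rho> ys)"
              using \<pi> len by (intro permute_list_compose) simp
            ultimately show "of_int (sign (\<rho> \<circ> \<pi>)) * u' (permute_list (\<rho> \<circ> \<pi>) ys) =
                of_int (sign \<rho>) * (of_int (sign \<pi>) * u' (permute_list \<pi> (permute_list \<rho> ys)))" by simp
          qed
          also have "\<dots> = of_int (sign \<rho>) * v (permute_list \<rho> ys)"
            using True iff by (simp add: v_def sum_distrib_left)
          finally have "v ys = of_int (sign \<rho>) * v (permute_list \<rho> ys)" .
          moreover have "of_int (sign \<rho>) * (of_int (sign \<rho>) :: complex) = 1" by (simp add: sign_def)
          ultimately show ?thesis by (metis mult.assoc mult_1)
        qed (simp add: v_def iff)
      qed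
      have v_l2: "v \<in> l2 (ordered_simplices M p)"
        by (rule l2_finite_support[OF finYp YM]) (simp add: v_def)
      let ?b = "coboundary M p v"
      have bB: "?b \<in> l2_coboundaries_closure M p"
        unfolding l2_coboundaries_closure_def
        using l2_closure_subset[OF coboundaries_subset[OF M]] v_l2 v_alt by (auto simp: l2_cochains_alt)
      have supp: "?b xs = 0" if "xs \<in> S" "xs \<notin> X \<union> B" for xs
      proof -
        have "v (del_nth k xs) = 0" if k: "k \<le> p" for k
        proof -
          have "set xs \<notin> Y" using \<open>xs \<in> S\<close> \<open>xs \<notin> X \<union> B\<close> by (auto simp: S_def X_def ordered_simplices_def)
          then have "set (del_nth k xs) \<notin> Y" using \<open>xs \<in> S\<close> \<open>xs \<notin> X \<union> B\<close> k by (auto simp: B_def)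
          then show ?thesis by (simp add: v_def ordered_simplices_def)
        qed
        then show ?thesis using that(1) by (simp add: coboundary_apply S_def)
      qed
      have XB: "X \<union> B \<subseteq> S" using XS by (auto simp: B_def)
      have "(\<Sum>xs\<in>X \<union> B. cnj (?b xs) * x xs) = 0"
      proof (rule l2_closure_finite_condition[OF Wl _ _ x])
        show "finite (X \<union> B)" using finX finB by simp
        fix w assume w: "w \<in> ?W"
        have "0 = l2_inner S w ?b" using RI(4)[OF w bB] by simp
        also have "\<dots> = (\<Sum>\<^sub>\<infinity>xs\<in>X \<union> B. w xs * cnj (?b xs))"
          unfolding l2_inner_def by (rule infsum_cong_neutral) (use XB supp in auto)
        also have "\<dots> = (\<Sum>xs\<in>X \<union> B. cnj (?b xs) * w xs)" using finX finB by (simp add: mult.commute)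
        finally show "(\<Sum>xs\<in>X \<union> B. cnj (?b xs) * w xs) = 0" by simp
      qed
      also have "(\<Sum>xs\<in>X \<union> B. cnj (?b xs) * x xs) = (\<Sum>xs\<in>X. cnj (?b xs) * x xs)"
        using finX finB zeroB by (intro sum.mono_neutral_right) auto
      finally have "cnj (\<Sum>xs\<in>X. cnj (?b xs) * x xs) = 0" by simp
      then have "(\<Sum>xs\<in>X. cnj (x xs) * ?b xs) = 0" by (simp add: mult.commute)
      moreover have del: "del_nth k xs \<in> ordered_simplices Y p" if "xs \<in> X" "k \<le> p" for k xs
      proof -
        have l: "length (del_nth k xs) = p" using that by (simp add: X_def ordered_simplices_def length_del_nth)
        then have "set (del_nth k xs) \<noteq> {}" using False by auto
        then have "set (del_nth k xs) \<in> Y"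
          using abstract_complex_face[OF Y(3) _ set_del_nth[of k xs]] that by (simp add: X_def ordered_simplices_def)
        then show ?thesis using l distinct_del_nth[of xs k] that by (simp add: X_def ordered_simplices_def)
      qed
      then have "(\<Sum>xs\<in>X. cnj (x xs) * ?b xs) =
          (\<Sum>xs\<in>X. cnj (x xs) * (\<Sum>k\<le>p. (-1) ^ k * (\<Sum>\<pi> | \<pi> permutes {..<p}. of_int (sign \<pi>) * u' (permute_list \<pi> (del_nth k xs)))))"
        using XS by (intro sum.cong refl arg_cong2[where f="(*)"]) (auto simp: coboundary_apply S_def v_def intro!: sum.cong)
      ultimately have "of_nat (fact p) * (\<Sum>xs\<in>X. cnj (x xs) * (\<Sum>k\<le>p. (-1) ^ k * u' (del_nth k xs))) = 0"
        using alternating_pairing_antisymmetrize[OF altX finX permX lenX, of u'] by simp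
      then have "(\<Sum>xs\<in>X. cnj (x xs) * (\<Sum>k\<le>p. (-1) ^ k * u' (del_nth k xs))) = 0" by simp
      also have "(\<Sum>xs\<in>X. cnj (x xs) * (\<Sum>k\<le>p. (-1) ^ k * u' (del_nth k xs))) =
          (\<Sum>xs\<in>X. cnj (x xs) * (\<Sum>k\<le>p. (-1) ^ k * u (del_nth k xs)))"
        using del by (intro sum.cong refl arg_cong2[where f="(*)"]) (auto simp: u'_def)
      finally show ?thesis .
    qed
    then have "(\<Sum>xs\<in>X. cnj (x xs) * x xs) = 0" by (rule kills)
    moreover have "(\<Sum>xs\<in>X. cnj (x xs) * x xs) = of_real (\<Sum>xs\<in>X. (cmod (x xs))\<^sup>2)"
    proof -
      have "cnj z * z = of_real ((cmod z)\<^sup>2)" for z by (simp only: complex_norm_square mult.commute)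
      then show ?thesis by (simp only: of_real_sum)
    qed
    ultimately have "(\<Sum>xs\<in>X. (cmod (x xs))\<^sup>2) = 0" by (simp only: of_real_eq_0_iff)
    then have "(cmod (x xs0))\<^sup>2 = 0" using finX xs0 by (simp add: sum_nonneg_eq_0_iff)
    then show ?thesis by simp
  qed
qed

text \<open>
  Let \<open>Y\<close> be the union of the translates of a fundamental domain \<open>C\<close> by a Folner set \<open>F\<close>. A simplex
  that has a face in \<open>Y\<close> without being in \<open>Y\<close> is a translate of a simplex of \<open>C\<close> by an element of
  \<open>(F <#> T) - F\<close>, where \<open>T\<close> consists of the finitely many elements that move some simplex of \<open>C\<close>
  into \<open>C\<close>. In degree zero a single point takes the place of these simplices, and it is
  negligible because \<open>\<Gamma>\<close> has arbitrarily large finite subsets.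
\<close>

theorem folner_restriction_image_dim_small:
  fixes p :: nat and \<epsilon> :: real
  assumes conn: "n_connected_space n (geometric_realization K)" and pn: "p \<le> n"
    and ex: "cocompact_exhaustion \<Gamma> K a L" and inf: "infinite (carrier \<Gamma>)"
    and fol: "\<And>T \<delta> :: real. \<lbrakk>finite T; T \<subseteq> carrier \<Gamma>; 0 < \<delta>\<rbrakk> \<Longrightarrow>
       \<exists>F. finite F \<and> F \<noteq> {} \<and> F \<subseteq> carrier \<Gamma> \<and> real (card ((F <#> T) - F)) \<le> \<delta> * real (card F)"
    and \<epsilon>: "0 < \<epsilon>"
  shows "\<exists>j0. \<forall>j\<ge>j0. 0 \<le> restriction_image_dim \<Gamma> a p (L j) (L i) \<and> restriction_image_dim \<Gamma> a p (L j) (L i) \<le> \<epsilon>"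
proof -
  interpret group \<Gamma> by (rule group)
  have Lc: "abstract_complex (L j)" and Linv: "\<And>g s. \<lbrakk>g \<in> carrier \<Gamma>; s \<in> L j\<rbrakk> \<Longrightarrow> a g ` s \<in> L j"
    and Lcc: "cocompact_complex \<Gamma> (L j) a" and LSuc: "L j \<subseteq> L (Suc j)" and LU: "(\<Union>j. L j) = K" for j
    using ex unfolding cocompact_exhaustion_def by blast+
  have LK: "L j \<subseteq> K" for j using LU by blast
  have inv: "invariant_subcomplex (L j)" for j using Lc LK Linv by (simp add: invariant_subcomplex_def)
  have mono: "L i \<subseteq> L j" if "i \<le> j" for i j using lift_Suc_mono_le[of L, OF LSuc that] .
  obtain C0 where C0: "finite C0" "C0 \<subseteq> L i" "\<And>s. s \<in> L i \<Longrightarrow> \<exists>g\<in>carrier \<Gamma>. \<exists>c\<in>C0. s = a g ` c"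
    by (rule orbit_representatives[OF inv[of i] Lcc[of i]]) (rule that, assumption+)
  \<comment> \<open>closing the representatives under faces makes \<open>Y\<close> below a complex\<close>
  define C where "C = {t. t \<noteq> {} \<and> (\<exists>c\<in>C0. t \<subseteq> c)}"
  have fc: "finite c" "c \<noteq> {}" if "c \<in> L j" for c j using Lc[of j] that by (auto simp: abstract_complex_def)
  have CL: "C \<subseteq> L i" using C0(2) abstract_complex_face[OF Lc[of i]] unfolding C_def by blast
  have finC: "finite C"
  proof -
    have "C \<subseteq> (\<Union>c\<in>C0. Pow c)" by (auto simp: C_def)
    moreover have "finite (\<Union>c\<in>C0. Pow c)" using C0 fc by auto
    ultimately show ?thesis by (rule finite_subset)
  qed
  have CC: "abstract_complex C"
    unfolding abstract_complex_def
  proof (intro conjI ballI allI impI)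
    fix s assume s: "s \<in> C"
    show "finite s" "s \<noteq> {}" using fc[of s i] s CL by auto
    fix t assume "t \<subseteq> s \<and> t \<noteq> {}"
    then show "t \<in> C" using s unfolding C_def by blast
  qed
  have C0C: "C0 \<subseteq> C" using C0(2) fc(2)[of _ i] by (auto simp: C_def)
  have rep: "\<exists>g\<in>carrier \<Gamma>. \<exists>c\<in>C. s = a g ` c" if "s \<in> L i" for s using C0(3)[OF that] C0C by blast
  let ?S = "ordered_simplices (L i) (Suc p)"
  define R where "R = ordered_simplices C (Suc p)"
  have finR: "finite R" unfolding R_def by (rule finite_ordered_simplices[OF finC CC])
  define T where "T = {g \<in> carrier \<Gamma>. \<exists>c\<in>C. a g ` c \<in> C}"
  have finT: "finite T"
  proof -
    have injT: "inj_on (\<lambda>g. SOME z. fst z \<in> C \<and> snd z \<in> C \<and> a g ` fst z = snd z) T"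
    proof (rule inj_onI)
      let ?P = "\<lambda>g z. fst z \<in> C \<and> snd z \<in> C \<and> a g ` fst z = snd z"
      have P: "?P g (SOME z. ?P g z)" if g: "g \<in> T" for g
      proof (rule someI_ex)
        obtain c where "c \<in> C" "a g ` c \<in> C" using g by (auto simp: T_def)
        then show "\<exists>z. ?P g z" by (intro exI[of _ "(c, a g ` c)"]) simp
      qed
      fix g h assume gh: "g \<in> T" "h \<in> T" and eq: "(SOME z. ?P g z) = (SOME z. ?P h z)"
      have "a g ` fst (SOME z. ?P g z) = a h ` fst (SOME z. ?P g z)" using P[OF gh(1)] P[OF gh(2)] eq by simp
      moreover have "fst (SOME z. ?P g z) \<in> K" using P[OF gh(1)] CL LK by blast
      ultimately show "g = h" using gh by (intro a_free_eq) (auto simp: T_def)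
    qed
    have imgT: "(\<lambda>g. SOME z. fst z \<in> C \<and> snd z \<in> C \<and> a g ` fst z = snd z) ` T \<subseteq> C \<times> C"
    proof (rule image_subsetI)
      let ?P = "\<lambda>g z. fst z \<in> C \<and> snd z \<in> C \<and> a g ` fst z = snd z"
      fix g assume "g \<in> T"
      then obtain c where "c \<in> C" "a g ` c \<in> C" by (auto simp: T_def)
      then have "\<exists>z. ?P g z" by (intro exI[of _ "(c, a g ` c)"]) simp
      then have "?P g (SOME z. ?P g z)" by (rule someI_ex)
      then show "(SOME z. ?P g z) \<in> C \<times> C" by (simp add: mem_Times_iff)
    qed
    show ?thesis
      by (rule finite_imageD[OF finite_subset[OF imgT finite_cartesian_product[OF finC finC]] injT])
  qed
  have TG: "T \<subseteq> carrier \<Gamma>" by (auto simp: T_def)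
  obtain F where F: "finite F" "F \<noteq> {}" "F \<subseteq> carrier \<Gamma>"
    and Fsmall: "0 < p \<Longrightarrow> real (card ((F <#> T) - F)) * card R \<le> \<epsilon> * card F" and Fbig: "p = 0 \<Longrightarrow> 1 \<le> \<epsilon> * card F"
  proof (cases "p = 0")
    case True
    obtain N where N: "1 / \<epsilon> < real N" using reals_Archimedean2 by blast
    obtain F where F: "finite F" "card F = Suc N" "F \<subseteq> carrier \<Gamma>"
      using infinite_arbitrarily_large[OF inf] by blast
    have "1 \<le> \<epsilon> * real (Suc N)" using N \<epsilon> by (simp add: field_simps)
    then have "1 \<le> \<epsilon> * card F" by (simp only: F(2))
    moreover have "F \<noteq> {}" using F(2) by force
    ultimately show thesis using True F by (intro that[of F]) simp_all
  next
    case False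
    let ?\<delta> = "\<epsilon> / (1 + card R)"
    have "0 < ?\<delta>" using \<epsilon> by simp
    then obtain F where F: "finite F" "F \<noteq> {}" "F \<subseteq> carrier \<Gamma>" "real (card ((F <#> T) - F)) \<le> ?\<delta> * real (card F)"
      using fol[OF finT TG] by blast
    have "real (card ((F <#> T) - F)) * card R \<le> ?\<delta> * real (card F) * card R"
      using F(4) by (intro mult_right_mono) auto
    also have "\<dots> = (?\<delta> * card R) * card F" by simp
    also have "\<dots> \<le> \<epsilon> * card F"
      using \<epsilon> by (intro mult_right_mono) (auto simp: field_simps)
    finally have small: "real (card ((F <#> T) - F)) * card R \<le> \<epsilon> * card F" .
    show thesis
    proof (rule that[OF F(1-3)])
      show "real (card ((F <#> T) - F)) * card R \<le> \<epsilon> * card F" by (rule small)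
      show "1 \<le> \<epsilon> * card F" if "p = 0" using that False by contradiction
    qed
  qed
  have cardF: "0 < card F" using F by (simp add: card_gt_0_iff)
  define Y where "Y = (\<lambda>(g, c). a g ` c) ` (F \<times> C)"
  have Y_mem: "s \<in> Y \<longleftrightarrow> (\<exists>g\<in>F. \<exists>c\<in>C. s = a g ` c)" for s unfolding Y_def by auto
  have finY: "finite Y" using F finC by (simp add: Y_def)
  have YL: "Y \<subseteq> L i"
  proof
    fix s assume "s \<in> Y"
    then obtain g c where "g \<in> F" "c \<in> C" "s = a g ` c" using Y_mem by blast
    then show "s \<in> L i" using F(3) CL by (auto intro!: Linv)
  qed
  have YC: "abstract_complex Y"
    unfolding abstract_complex_def
  proof (intro conjI ballI allI impI)
    fix s assume s: "s \<in> Y"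
    show "finite s" "s \<noteq> {}" using fc[of s i] s YL by auto
    fix t assume t: "t \<subseteq> s \<and> t \<noteq> {}"
    obtain g c where gc: "g \<in> F" "c \<in> C" "s = a g ` c" using s Y_mem by blast
    then obtain c' where c': "c' \<subseteq> c" "t = a g ` c'" using t subset_imageE by metis
    then have "c' \<in> C" using abstract_complex_face[OF CC gc(2) c'(1)] t by auto
    then show "t \<in> Y" using gc(1) c'(2) Y_mem by blast
  qed
  define B where "B = {xs \<in> ?S. set xs \<notin> Y \<and> (\<exists>k\<le>p. set (del_nth k xs) \<in> Y)}"
  have B_sub: "B \<subseteq> (\<lambda>(h, r). map (a h) r) ` (((F <#> T) - F) \<times> R)"
  proof
    fix xs assume xs: "xs \<in> B"
    then have xsS: "xs \<in> ?S" and nY: "set xs \<notin> Y" by (auto simp: B_def)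
    obtain k where k: "k \<le> p" "set (del_nth k xs) \<in> Y" using xs by (auto simp: B_def)
    obtain h r where h: "h \<in> carrier \<Gamma>" and r: "r \<in> R" "xs = map (a h) r"
    proof (rule ordered_representatives[OF inv CL _ xsS])
      show "\<exists>g\<in>carrier \<Gamma>. \<exists>c\<in>C. s = a g ` c" if "s \<in> L i" for s by (rule rep[OF that])
      fix g r assume "g \<in> carrier \<Gamma>" "r \<in> ordered_simplices C (Suc p)" "xs = map (a g) r"
      then show thesis by (intro that[of g r]) (simp_all add: R_def)
    qed
    have rC: "set r \<in> C" using r(1) by (simp add: R_def ordered_simplices_def)
    have "h \<notin> F"
    proof
      assume "h \<in> F"
      then have "a h ` set r \<in> Y" using rC Y_mem by blast
      then show False using nY r(2) by simp
    qed
    obtain f c where f: "f \<in> F" and c: "c \<in> C" "set (del_nth k xs) = a f ` c" using k(2) Y_mem by blast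
    have fG: "f \<in> carrier \<Gamma>" using f F by auto
    let ?c' = "set (del_nth k r)"
    have eq: "a h ` ?c' = a f ` c" using c(2) r(2) by (simp add: del_nth_def take_map drop_map image_Un)
    have cne: "c \<noteq> {}" using c(1) CC by (auto simp: abstract_complex_def)
    then have "?c' \<noteq> {}" using eq by auto
    then have c'C: "?c' \<in> C" by (rule abstract_complex_face[OF CC rC set_del_nth])
    have sub: "?c' \<subseteq> \<Union>K" "c \<subseteq> \<Union>K" using c'C c(1) CL LK by blast+
    have "a (inv f \<otimes> h) ` ?c' = a (inv f) ` a h ` ?c'" using image_a_mult[of "inv f" h] fG h sub by simp
    also have "\<dots> = a (inv f) ` a f ` c" using eq by simp
    also have "\<dots> = c" using image_a_mult[of "inv f" f c] image_a_one[OF sub(2)] fG sub by simp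
    finally have "inv f \<otimes> h \<in> T" using c'C c(1) fG h by (auto simp: T_def)
    moreover have "f \<otimes> (inv f \<otimes> h) = h" using fG h by (simp add: m_assoc[symmetric])
    ultimately have "h \<in> F <#> T" using f unfolding set_mult_def by force
    then show "xs \<in> (\<lambda>(h, r). map (a h) r) ` (((F <#> T) - F) \<times> R)"
      using \<open>h \<notin> F\<close> r by (intro rev_image_eqI[of "(h, r)"]) auto
  qed
  have finFT: "finite ((F <#> T) - F)" using F finT by (auto simp: set_mult_def)
  have finB: "finite B" by (rule finite_subset[OF B_sub]) (use finFT finR in simp)
  have cardB: "card B \<le> card ((F <#> T) - F) * card R"
    using card_mono[OF _ B_sub] card_image_le[of "((F <#> T) - F) \<times> R" "\<lambda>(h, r). map (a h) r"] finFT finR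
    by (simp add: card_cartesian_product)
  let ?X = "ordered_simplices Y (Suc p)"
  define x0 where "x0 = (SOME xs. xs \<in> ?X)"
  have x0: "x0 \<in> ?X" if "?X \<noteq> {}" using that unfolding x0_def by (metis some_in_eq)
  define D where "D = (if p = 0 then (if ?X = {} then {} else {x0}) else B)"
  have XS: "?X \<subseteq> ?S" using YL by (rule ordered_simplices_mono)
  have D: "finite D" "D \<subseteq> ?S" using finB x0 XS by (auto simp: D_def B_def)
  have Bempty: "B = {}" if "p = 0"
    using that YL fc(2)[of _ i] by (auto simp: B_def ordered_simplices_def del_nth_def)
  have cardD: "card D \<le> \<epsilon> * card F"
  proof (cases "p = 0")
    case True
    then have "card D \<le> 1" by (simp add: D_def)
    then show ?thesis using Fbig[OF True] by linarith
  next
    case False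
    then have "real (card D) \<le> real (card ((F <#> T) - F) * card R)" using cardB by (simp add: D_def del: of_nat_mult)
    then show ?thesis using Fsmall False by simp
  qed
  obtain j0 where j0: "\<forall>j\<ge>j0. \<forall>z. alternating_on (ordered_simplices (L j) (Suc p)) (Suc p) z \<longrightarrow>
     coboundary (L j) (Suc p) z = (\<lambda>_. 0) \<longrightarrow>
     (\<exists>u. \<forall>xs\<in>?X. z xs = (\<Sum>i\<le>p. (-1) ^ i * u (del_nth i xs)))"
    using cocycle_is_coboundary_on_finite_subcomplex[OF conn pn complex Lc LSuc LU finY _ YC] YL LK by blast
  show ?thesis
  proof (intro exI[of _ "max i j0"] allI impI)
    fix j assume j: "max i j0 \<le> j"
    then have MN: "L i \<subseteq> L j" by (intro mono) simp
    define V where "V = l2_closure ?S (restriction_map (L i) p ` reduced_l2_cohomology (L j) p)"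
    note RI = restriction_image[OF inv Lcc inv Lcc MN, where p=p]
    have V1: "closed_l2_subspace ?S V" unfolding V_def by (rule closed_l2_subspace_closure[OF RI(1)])
    have V2: "invariant_functions (L i) (Suc p) V" unfolding V_def by (rule invariant_functions_closure[OF inv RI(2)])
    have fill: "\<exists>u. \<forall>xs\<in>?X. z xs = (\<Sum>k\<le>p. (-1) ^ k * u (del_nth k xs))" if "z \<in> l2_cocycles (L j) p" for z
      using j0 j that by (auto simp: l2_cocycles_def l2_cochains_alt)
    have det: "x xs = 0" if x: "x \<in> V" and zero: "\<And>d. d \<in> D \<Longrightarrow> x d = 0" and xs: "xs \<in> ?X" for x xs
    proof (rule restriction_image_determined_by_boundary[OF inv Lcc inv Lcc MN finY YL YC fill])
      show "x \<in> l2_closure ?S (restriction_map (L i) p ` reduced_l2_cohomology (L j) p)" using x by (simp add: V_def)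
      show "finite {xs \<in> ?S. set xs \<notin> Y \<and> (\<exists>k\<le>p. set (del_nth k xs) \<in> Y)}" using finB by (simp only: B_def)
      show "x ys = 0" if "ys \<in> {xs \<in> ?S. set xs \<notin> Y \<and> (\<exists>k\<le>p. set (del_nth k xs) \<in> Y)}" for ys
      proof (cases "p = 0")
        case True
        then show ?thesis using that Bempty unfolding B_def by blast
      next
        case False
        then show ?thesis using that zero unfolding D_def B_def by simp
      qed
      show "x0 \<in> ?X \<and> x x0 = 0" if "p = 0" "?X \<noteq> {}" using that x0 zero by (simp add: D_def)
      show "xs \<in> ?X" by (rule xs)
    qed
    have bound: "card F * vn_dim \<Gamma> ?S (\<lambda>g. map (a g)) V \<le> card D" and nonneg: "0 \<le> vn_dim \<Gamma> ?S (\<lambda>g. map (a g)) V"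
      using vn_dim_le_boundary[OF inv finC CL CC rep F(1,3) V1 V2 D] det unfolding Y_def by blast+
    have "card F * vn_dim \<Gamma> ?S (\<lambda>g. map (a g)) V \<le> card F * \<epsilon>" using bound cardD by (simp add: mult.commute)
    then have "vn_dim \<Gamma> ?S (\<lambda>g. map (a g)) V \<le> \<epsilon>" using cardF by simp
    then show "0 \<le> restriction_image_dim \<Gamma> a p (L j) (L i) \<and> restriction_image_dim \<Gamma> a p (L j) (L i) \<le> \<epsilon>"
      using nonneg by (simp add: restriction_image_dim_def V_def)
  qed
qed

end


section \<open>Compact subsets of a geometric realization\<close>

lemma group_action_if_permutes:
  fixes G (structure)
  assumes G: "group G"
    and ext: "\<And>g. g \<in> carrier G \<Longrightarrow> \<phi> g \<in> extensional E"
    and closed: "\<And>g x. \<lbrakk>g \<in> carrier G; x \<in> E\<rbrakk> \<Longrightarrow> \<phi> g x \<in> E"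
    and one: "\<And>x. x \<in> E \<Longrightarrow> \<phi> \<one> x = x"
    and mult: "\<And>g h x. \<lbrakk>g \<in> carrier G; h \<in> carrier G; x \<in> E\<rbrakk> \<Longrightarrow> \<phi> g (\<phi> h x) = \<phi> (g \<otimes> h) x"
  shows "group_action G E \<phi>"
proof -
  interpret group G by fact
  have bij: "\<phi> g \<in> Bij E" if g: "g \<in> carrier G" for g
  proof -
    have "bij_betw (\<phi> g) E E"
      by (rule bij_betwI[where g = "\<phi> (inv g)"]) (use g in \<open>auto simp: closed one mult\<close>)
    then show ?thesis using ext[OF g] by (simp add: Bij_def)
  qed
  have "\<phi> (g \<otimes> h) = compose E (\<phi> g) (\<phi> h)" if "g \<in> carrier G" "h \<in> carrier G" for g h
    by (rule extensionalityI[where A = E]) (use that in \<open>auto simp: ext mult compose_def\<close>)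
  then have "group_hom G (BijGroup E) \<phi>"
    using bij by (simp add: group_hom_def group_hom_axioms_def G group_BijGroup hom_def Pi_iff)
      (simp add: BijGroup_def)
  then show ?thesis by (simp add: group_action_def)
qed

lemma compact_space_nsphere: "compact_space (nsphere k)"
proof -
  let ?S = "{x :: nat \<Rightarrow> real. (\<Sum>i\<le>k. x i ^ 2) = 1 \<and> (\<forall>i>k. x i = 0)}"
  have coord: "continuous_map (powertop_real UNIV) euclideanreal (\<lambda>x. x i)" for i :: nat
    by (intro continuous_map_product_projection) auto
  have "closedin (powertop_real UNIV) {x \<in> topspace (powertop_real UNIV). (\<Sum>i\<le>k. x i ^ 2) \<in> {1 :: real}}"
    by (rule closedin_continuous_map_preimage) (auto intro!: continuous_map_sum continuous_map_real_pow coord)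
  moreover have "closedin (powertop_real UNIV) (\<Inter>i\<in>{k<..}. {x \<in> topspace (powertop_real UNIV). x i \<in> {0 :: real}})"
  proof (rule closedin_INT)
    show "closedin (powertop_real UNIV) {x \<in> topspace (powertop_real UNIV). x i \<in> {0 :: real}}" for i :: nat
      by (rule closedin_continuous_map_preimage[OF coord]) simp
  qed auto
  ultimately have "closedin (powertop_real UNIV)
      ({x \<in> topspace (powertop_real UNIV). (\<Sum>i\<le>k. x i ^ 2) \<in> {1 :: real}} \<inter>
       (\<Inter>i\<in>{k<..}. {x \<in> topspace (powertop_real UNIV). x i \<in> {0 :: real}}))"
    by (rule closedin_Int)
  moreover have "{x \<in> topspace (powertop_real UNIV). (\<Sum>i\<le>k. x i ^ 2) \<in> {1 :: real}} \<inter>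
       (\<Inter>i\<in>{k<..}. {x \<in> topspace (powertop_real UNIV). x i \<in> {0 :: real}}) = ?S" by auto
  ultimately have cl: "closedin (powertop_real UNIV) ?S" by simp
  have "compactin (powertop_real UNIV) (\<Pi>\<^sub>E i\<in>UNIV. {-1 .. 1 :: real})"
    by (simp add: compactin_PiE)
  moreover have "?S \<subseteq> (\<Pi>\<^sub>E i\<in>UNIV. {-1 .. 1 :: real})"
  proof
    fix x assume x: "x \<in> ?S"
    have "- 1 \<le> x i \<and> x i \<le> 1" for i
    proof (cases "i \<le> k")
      case True
      have "x i ^ 2 \<le> (\<Sum>i\<le>k. x i ^ 2)" by (rule member_le_sum) (use True in auto)
      also have "\<dots> = 1" using x by simp
      finally show ?thesis by (simp add: abs_square_le_1 abs_le_iff)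
    next
      case False then show ?thesis using x by simp
    qed
    then show "x \<in> (\<Pi>\<^sub>E i\<in>UNIV. {-1 .. 1 :: real})" by auto
  qed
  ultimately have "compactin (powertop_real UNIV) ?S" using cl by (rule closed_compactin)
  then show ?thesis unfolding nsphere by (rule compact_space_subtopology)
qed

lemma continuous_map_barycentric_coordinate:
  "continuous_map (geometric_realization K) euclideanreal (\<lambda>y. y v)"
  unfolding continuous_map_def
proof (intro conjI allI impI)
  fix U :: "real set" assume "openin euclideanreal U"
  show "openin (geometric_realization K) {y \<in> topspace (geometric_realization K). y v \<in> U}"
    unfolding openin_geometric_realization realization_open_def
  proof (intro conjI ballI)
    fix s assume s: "s \<in> K"
    have "continuous_map (subtopology (powertop_real UNIV) (closed_simplex s)) euclideanreal (\<lambda>y. y v)"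
      by (intro continuous_map_from_subtopology continuous_map_product_projection) auto
    from openin_continuous_map_preimage[OF this \<open>openin euclideanreal U\<close>]
    have "openin (subtopology (powertop_real UNIV) (closed_simplex s)) {y \<in> topspace (subtopology (powertop_real UNIV) (closed_simplex s)). y v \<in> U}" .
    moreover have "{y \<in> topspace (geometric_realization K). y v \<in> U} \<inter> closed_simplex s = {y \<in> topspace (subtopology (powertop_real UNIV) (closed_simplex s)). y v \<in> U}"
      using s by (auto simp: topspace_geometric_realization)
    ultimately show "openin (subtopology (powertop_real UNIV) (closed_simplex s)) ({y \<in> topspace (geometric_realization K). y v \<in> U} \<inter> closed_simplex s)" by simp
  qed (auto simp: topspace_geometric_realization)
qed simp

lemma closed_simplex_carried:
  assumes "y \<in> closed_simplex t" "finite t" "finite s" "{v. y v \<noteq> 0} \<subseteq> s"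
  shows "y \<in> closed_simplex s"
proof -
  have "(\<Sum>v\<in>s. y v) = (\<Sum>v\<in>s \<inter> t. y v)"
    using assms by (intro sum.mono_neutral_right) (auto simp: closed_simplex_def)
  also have "\<dots> = (\<Sum>v\<in>t. y v)"
    using assms by (intro sum.mono_neutral_left) auto
  finally show ?thesis using assms by (auto simp: closed_simplex_def)
qed

lemma closed_simplex_support:
  assumes "abstract_complex K" "s \<in> K" "y \<in> closed_simplex s"
  shows "{v. y v \<noteq> 0} \<subseteq> s" "{v. y v \<noteq> 0} \<in> K" "y \<in> closed_simplex {v. y v \<noteq> 0}"
proof -
  have fin: "finite s" using assms(1,2) by (auto simp: abstract_complex_def)
  show sub: "{v. y v \<noteq> 0} \<subseteq> s" using assms(3) by (auto simp: closed_simplex_def)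
  have "{v. y v \<noteq> 0} \<noteq> {}"
  proof
    assume "{v. y v \<noteq> 0} = {}"
    then have "(\<Sum>v\<in>s. y v) = 0" by (intro sum.neutral) auto
    then show False using assms(3) by (simp add: closed_simplex_def)
  qed
  then show "{v. y v \<noteq> 0} \<in> K" using sub by (intro abstract_complex_face[OF assms(1,2)])
  show "y \<in> closed_simplex {v. y v \<noteq> 0}"
    by (rule closed_simplex_carried[OF assms(3) fin]) (use sub fin finite_subset in auto)
qed

lemma closedin_closed_simplex:
  assumes K: "abstract_complex K" and s: "s \<in> K"
  shows "closedin (geometric_realization K) (closed_simplex s)"
proof -
  let ?R = "geometric_realization K"
  have fin: "finite t" if "t \<in> K" for t using K that by (auto simp: abstract_complex_def)
  have "openin ?R {y \<in> topspace ?R. y v \<in> - {0}}" for v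
    by (rule openin_continuous_map_preimage[OF continuous_map_barycentric_coordinate]) auto
  then have "openin ?R (\<Union>v\<in>-s. {y \<in> topspace ?R. y v \<in> - {0}})"
    by (intro openin_Union) auto
  moreover have "topspace ?R - closed_simplex s = (\<Union>v\<in>-s. {y \<in> topspace ?R. y v \<in> - {0}})"
  proof (rule Set.set_eqI)
    fix y
    have "y \<in> closed_simplex s" if y: "y \<in> closed_simplex t" "t \<in> K" "\<forall>v. v \<notin> s \<longrightarrow> y v = 0" for t
      by (rule closed_simplex_carried[OF y(1) fin[OF y(2)] fin[OF s]]) (use y(3) in auto)
    moreover have "y v = 0" if "y \<in> closed_simplex s" "v \<notin> s" for v
      using that by (simp add: closed_simplex_def)
    ultimately show "y \<in> topspace ?R - closed_simplex s \<longleftrightarrow> y \<in> (\<Union>v\<in>-s. {y \<in> topspace ?R. y v \<in> - {0}})"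
      by (auto simp: topspace_geometric_realization)
  qed
  ultimately have "openin ?R (topspace ?R - closed_simplex s)" by simp
  then show ?thesis using s by (auto simp: closedin_def topspace_geometric_realization)
qed

text \<open>
  Choose one point of \<open>C\<close> for each support that occurs. These points meet every closed simplex in a
  finite set, so in the weak topology every set of them is closed. If there were infinitely
  many, they would have no accumulation point, contrary to compactness.
\<close>

lemma compactin_geometric_realization_finite:
  assumes K: "abstract_complex K" and C: "compactin (geometric_realization K) C"
  obtains \<F> where "finite \<F>" "\<F> \<subseteq> K" "C \<subseteq> (\<Union>s\<in>\<F>. closed_simplex s)"
proof -
  let ?R = "geometric_realization K"
  define supp where "supp y = {v. y v \<noteq> (0 :: real)}" for y :: "'a \<Rightarrow> real"
  have CR: "C \<subseteq> topspace ?R" using C by (rule compactin_subset_topspace)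
  have C_supp: "supp y \<in> K \<and> y \<in> closed_simplex (supp y)" if "y \<in> C" for y
  proof -
    obtain s where "s \<in> K" "y \<in> closed_simplex s" using CR \<open>y \<in> C\<close> by (auto simp: topspace_geometric_realization)
    then show ?thesis using closed_simplex_support[OF K] by (simp add: supp_def)
  qed
  have fin_s: "finite s" if "s \<in> K" for s using K that by (simp add: abstract_complex_def)
  have "finite (supp ` C)"
  proof (rule ccontr)
    assume inf: "infinite (supp ` C)"
    obtain P where P: "P \<subseteq> C" "inj_on supp P" "supp ` C = supp ` P"
      using subset_image_inj[of "supp ` C" supp C] by auto
    have infP: "infinite P" using inf P(3) by auto
    have "C \<inter> ?R derived_set_of P \<noteq> {}"
      using compactin_imp_Bolzano_Weierstrass[OF C] infP P(1) by blast
    then obtain x where x: "x \<in> C" "x \<in> ?R derived_set_of P" by blast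
    have "openin ?R (topspace ?R - (P - {x}))" (is "openin _ ?U")
      unfolding openin_geometric_realization realization_open_def
    proof (intro conjI ballI)
      fix s assume s: "s \<in> K"
      let ?S = "subtopology (powertop_real UNIV) (closed_simplex s)"
      have top: "topspace ?S = closed_simplex s" by simp
      have "finite (supp ` ((P - {x}) \<inter> closed_simplex s))"
        by (rule finite_subset[of _ "Pow s"]) (use fin_s[OF s] in \<open>auto simp: supp_def closed_simplex_def\<close>)
      moreover have "inj_on supp ((P - {x}) \<inter> closed_simplex s)" by (rule inj_on_subset[OF P(2)]) auto
      ultimately have fin: "finite ((P - {x}) \<inter> closed_simplex s)" by (rule finite_imageD)
      have "Hausdorff_space ?S"
        by (intro Hausdorff_space_subtopology) (simp add: Hausdorff_space_product_topology Hausdorff_space_euclidean)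
      then have "closedin ?S ((P - {x}) \<inter> closed_simplex s)"
        using fin by (intro closedin_Hausdorff_finite) auto
      then have "openin ?S (closed_simplex s - (P - {x}) \<inter> closed_simplex s)"
        unfolding closedin_def top by blast
      moreover have "(topspace ?R - (P - {x})) \<inter> closed_simplex s = closed_simplex s - (P - {x}) \<inter> closed_simplex s"
        using s by (auto simp: topspace_geometric_realization)
      ultimately show "openin ?S ((topspace ?R - (P - {x})) \<inter> closed_simplex s)" by simp
    qed (auto simp: topspace_geometric_realization)
    moreover have "x \<in> ?U" using x CR by auto
    ultimately have "\<exists>y\<noteq>x. y \<in> P \<and> y \<in> ?U"
      by (intro x(2)[unfolded in_derived_set_of, THEN conjunct2, THEN spec[of _ ?U], THEN mp] conjI)
    then show False by auto
  qed
  then show ?thesis by (rule that) (use C_supp in auto)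
qed

text \<open>
  The straight-line homotopy to the vertex \<open>w\<close>. It is continuous for the weak topology because it stays
  in one simplex \<open>insert w s\<close> over each of finitely many closed pieces of \<open>X\<close>.
\<close>

lemma cone_contracts:
  assumes K: "abstract_complex K" and \<F>: "finite \<F>" "\<F> \<subseteq> K"
    and f: "continuous_map X (geometric_realization K) f"
    and img: "f ` topspace X \<subseteq> (\<Union>s\<in>\<F>. closed_simplex s)"
    and w: "\<And>s. s \<in> \<F> \<Longrightarrow> w \<notin> s \<and> insert w s \<in> K"
  shows "homotopic_with (\<lambda>_. True) X (geometric_realization K) f (\<lambda>_ v. if v = w then 1 else 0)"
proof -
  let ?R = "geometric_realization K" and ?Z = "prod_topology (top_of_set {0..1 :: real}) X"
  define h where "h = (\<lambda>z v. (1 - fst z) * f (snd z) v + fst z * (if v = w then 1 else 0 :: real))"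
  define T where "T s = {z \<in> topspace ?Z. (f \<circ> snd) z \<in> closed_simplex s}" for s
  have fsnd: "continuous_map ?Z ?R (f \<circ> snd)" by (rule continuous_map_compose[OF continuous_map_snd f])
  have fin_s: "finite s" if "s \<in> K" for s using K that by (simp add: abstract_complex_def)
  have contT: "continuous_map (subtopology ?Z (T s)) ?R h" if s: "s \<in> \<F>" for s
  proof (rule continuous_map_into_geometric_realization)
    show "insert w s \<in> K" using w[OF s] by simp
    have coord: "continuous_map ?Z euclideanreal (\<lambda>z. f (snd z) v)" for v
      using continuous_map_compose[OF fsnd continuous_map_barycentric_coordinate[of K v]] by (simp add: o_def)
    have fst: "continuous_map ?Z euclideanreal fst"
      using continuous_map_fst[of "top_of_set {0..1 :: real}" X] by (simp add: continuous_map_in_subtopology)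
    have "continuous_map (subtopology ?Z (T s)) (powertop_real UNIV) h"
      unfolding continuous_map_componentwise_UNIV
    proof
      fix v
      have "continuous_map ?Z euclideanreal (\<lambda>z. h z v)"
        unfolding h_def by (intro continuous_intros coord fst)
      then show "continuous_map (subtopology ?Z (T s)) euclideanreal (\<lambda>z. h z v)" by (rule continuous_map_from_subtopology)
    qed
    moreover have "h z \<in> closed_simplex (insert w s)" if z: "z \<in> T s" for z
    proof -
      have t: "0 \<le> fst z" "fst z \<le> 1" and fz: "f (snd z) \<in> closed_simplex s" using z by (auto simp: T_def)
      have ws: "w \<notin> s" using w[OF s] by simp
      have fw: "f (snd z) w = 0" using fz ws by (simp add: closed_simplex_def)
      have "(\<Sum>v\<in>insert w s. h z v) = h z w + (\<Sum>v\<in>s. h z v)"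
        using ws fin_s s \<F>(2) by (intro sum.insert) auto
      also have "(\<Sum>v\<in>s. h z v) = (\<Sum>v\<in>s. (1 - fst z) * f (snd z) v)"
        using ws by (intro sum.cong) (auto simp: h_def)
      also have "\<dots> = (1 - fst z) * 1" using fz by (simp add: closed_simplex_def flip: sum_distrib_left)
      finally have "(\<Sum>v\<in>insert w s. h z v) = 1" by (simp add: h_def fw)
      then show ?thesis using fz t by (auto simp: closed_simplex_def h_def)
    qed
    ultimately show "continuous_map (subtopology ?Z (T s)) (subtopology (powertop_real UNIV) (closed_simplex (insert w s))) h"
      by (auto simp: continuous_map_in_subtopology)
  qed
  have "continuous_map ?Z ?R h"
  proof (rule pasting_lemma_closed[OF \<F>(1), where T = T and f = "\<lambda>_. h"])
    show "closedin ?Z (T s)" if "s \<in> \<F>" for s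
      unfolding T_def using that \<F>(2) by (intro closedin_continuous_map_preimage[OF fsnd] closedin_closed_simplex[OF K]) auto
    show "\<exists>s. s \<in> \<F> \<and> z \<in> T s \<and> h z = h z" if "z \<in> topspace ?Z" for z
    proof -
      have "snd z \<in> topspace X" using that by (cases z) auto
      then obtain s where "s \<in> \<F>" "f (snd z) \<in> closed_simplex s" using img by blast
      then show ?thesis using that by (auto simp: T_def simp del: topspace_prod_topology)
    qed
  qed (use contT in auto)
  then show ?thesis
    unfolding homotopic_with_def by (intro exI[of _ h]) (auto simp: h_def)
qed


section \<open>The infinite join of a group with itself\<close>

text \<open>
  Milnor's model of a contractible complex with a free action: the join of infinitely many copies of the
  group. The second component of a vertex is its level, and a simplex has at most one vertex on each
  level. A translation preserves levels, so that it can only preserve a simplex by fixing its vertices.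
\<close>

definition milnor_join :: "('g, 'm) monoid_scheme \<Rightarrow> ('g \<times> nat) set set" where
  "milnor_join \<Gamma> = {s. finite s \<and> s \<noteq> {} \<and> s \<subseteq> carrier \<Gamma> \<times> UNIV \<and> inj_on snd s}"

definition milnor_translate :: "('g, 'm) monoid_scheme \<Rightarrow> 'g \<Rightarrow> 'g \<times> nat \<Rightarrow> 'g \<times> nat" where
  "milnor_translate \<Gamma> g = (\<lambda>(h, k)\<in>carrier \<Gamma> \<times> UNIV. (g \<otimes>\<^bsub>\<Gamma>\<^esub> h, k))"

text \<open>
  Finiteness modulo translation is enforced by bounding the levels and the quotients of the group
  components, since the quotients are invariant under left translation.
\<close>

definition milnor_stage :: "('g, 'm) monoid_scheme \<Rightarrow> nat \<Rightarrow> ('g \<times> nat) set set" where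
  "milnor_stage \<Gamma> i = {s \<in> milnor_join \<Gamma>. snd ` s \<subseteq> {..i} \<and>
     (\<forall>x\<in>s. \<forall>y\<in>s. to_nat_on (carrier \<Gamma>) (inv\<^bsub>\<Gamma>\<^esub> fst x \<otimes>\<^bsub>\<Gamma>\<^esub> fst y) \<le> i)}"

lemma abstract_complex_milnor_join: "abstract_complex (milnor_join \<Gamma>)"
  unfolding abstract_complex_def
proof (intro conjI ballI allI impI)
  fix s t assume s: "s \<in> milnor_join \<Gamma>" and t: "t \<subseteq> s \<and> t \<noteq> {}"
  then have "finite t" "inj_on snd t" "t \<subseteq> carrier \<Gamma> \<times> UNIV"
    unfolding milnor_join_def using finite_subset[of t s] inj_on_subset[of snd s t] subset_trans[of t s] by simp_all
  then show "t \<in> milnor_join \<Gamma>" using t by (simp add: milnor_join_def)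
qed (simp_all add: milnor_join_def)

lemma abstract_complex_milnor_stage: "abstract_complex (milnor_stage \<Gamma> i)"
  unfolding abstract_complex_def
proof (intro conjI ballI allI impI)
  fix s t assume s: "s \<in> milnor_stage \<Gamma> i" and t: "t \<subseteq> s \<and> t \<noteq> {}"
  have sub: "x \<in> s" if "x \<in> t" for x using t that by blast
  have "t \<in> milnor_join \<Gamma>"
    by (rule abstract_complex_face[OF abstract_complex_milnor_join, of s]) (use s t in \<open>simp_all add: milnor_stage_def\<close>)
  then show "t \<in> milnor_stage \<Gamma> i"
    using s sub by (simp add: milnor_stage_def image_subset_iff)
qed (simp_all add: milnor_stage_def milnor_join_def)

lemma Union_milnor_join: "\<Union>(milnor_join \<Gamma>) = carrier \<Gamma> \<times> UNIV"
proof
  show "carrier \<Gamma> \<times> UNIV \<subseteq> \<Union>(milnor_join \<Gamma>)"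
  proof
    fix x :: "'a \<times> nat" assume "x \<in> carrier \<Gamma> \<times> UNIV"
    then have "{x} \<in> milnor_join \<Gamma>" by (auto simp: milnor_join_def)
    then show "x \<in> \<Union>(milnor_join \<Gamma>)" by blast
  qed
qed (auto simp: milnor_join_def)

context group
begin

lemma milnor_translate_apply [simp]:
  "x \<in> carrier G \<times> UNIV \<Longrightarrow> milnor_translate G g x = (g \<otimes> fst x, snd x)"
  by (auto simp: milnor_translate_def split: prod.splits)

lemma milnor_translate_image_join:
  assumes g: "g \<in> carrier G" and s: "s \<in> milnor_join G"
  shows "milnor_translate G g ` s \<in> milnor_join G"
proof -
  have sub: "x \<in> carrier G \<times> UNIV" if "x \<in> s" for x using s that by (auto simp: milnor_join_def)
  have eq: "snd (milnor_translate G g x) = snd x" if "x \<in> s" for x using sub[OF that] by simp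
  have inj: "inj_on snd s" using s by (simp add: milnor_join_def)
  have "inj_on snd (milnor_translate G g ` s)"
  proof (rule inj_onI)
    fix x y assume "x \<in> milnor_translate G g ` s" "y \<in> milnor_translate G g ` s" "snd x = snd y"
    then obtain x' y' where "x' \<in> s" "y' \<in> s" "x = milnor_translate G g x'" "y = milnor_translate G g y'" by auto
    then show "x = y" using inj eq \<open>snd x = snd y\<close> by (metis inj_onD)
  qed
  moreover have "milnor_translate G g ` s \<subseteq> carrier G \<times> UNIV" using sub g by auto
  ultimately show ?thesis using s by (simp add: milnor_join_def)
qed

lemma free_simplicial_action_milnor_join:
  "free_simplicial_action G (milnor_join G) (milnor_translate G)"
  unfolding free_simplicial_action_def
proof (intro conjI ballI impI)
  show "group_action G (\<Union>(milnor_join G)) (milnor_translate G)"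
    unfolding Union_milnor_join
  proof (rule group_action_if_permutes)
    show "group G" by (rule is_group)
    show "milnor_translate G g \<in> extensional (carrier G \<times> UNIV)" for g
      by (auto simp: milnor_translate_def)
  qed (auto simp: m_assoc)
  fix g s assume g: "g \<in> carrier G" and s: "s \<in> milnor_join G"
  show "milnor_translate G g ` s \<in> milnor_join G" by (rule milnor_translate_image_join[OF g s])
  assume "g \<noteq> \<one>"
  show "milnor_translate G g ` s \<noteq> s"
  proof
    assume eq: "milnor_translate G g ` s = s"
    obtain x where x: "x \<in> s" "x \<in> carrier G \<times> UNIV" using s by (auto simp: milnor_join_def)
    have "milnor_translate G g x \<in> s" using imageI[OF x(1), of "milnor_translate G g"] unfolding eq .
    moreover have "inj_on snd s" using s by (simp add: milnor_join_def)
    ultimately have "milnor_translate G g x = x" using x by (intro inj_onD[of snd s]) auto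
    then have "g \<otimes> fst x = fst x" using x by (metis fst_conv milnor_translate_apply)
    then show False using g x \<open>g \<noteq> \<one>\<close> by (auto simp: r_cancel_one)
  qed
qed (rule abstract_complex_milnor_join)

lemma milnor_stage_translate:
  assumes g: "g \<in> carrier G" and s: "s \<in> milnor_stage G i"
  shows "milnor_translate G g ` s \<in> milnor_stage G i"
proof -
  have sj: "s \<in> milnor_join G" using s by (simp add: milnor_stage_def)
  have sub: "x \<in> carrier G \<times> UNIV" if "x \<in> s" for x using sj that by (auto simp: milnor_join_def)
  have diff: "inv (g \<otimes> fst x) \<otimes> (g \<otimes> fst y) = inv fst x \<otimes> fst y" if "x \<in> s" "y \<in> s" for x y
  proof -
    have c: "fst x \<in> carrier G" "fst y \<in> carrier G" using sub[OF that(1)] sub[OF that(2)] by auto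
    have "inv g \<otimes> (g \<otimes> fst y) = fst y" using inv_solve_left[of "fst y" g "g \<otimes> fst y"] c g by simp
    then show ?thesis using c g by (simp add: inv_mult_group m_assoc)
  qed
  show ?thesis
    using s milnor_translate_image_join[OF g sj] sub diff
    by (auto simp: milnor_stage_def image_subset_iff)
qed

lemma cocompact_exhaustion_milnor:
  assumes cnt: "countable (carrier G)"
  shows "cocompact_exhaustion G (milnor_join G) (milnor_translate G) (milnor_stage G)"
proof -
  interpret free_complex G "milnor_join G" "milnor_translate G"
    by unfold_locales (rule free_simplicial_action_milnor_join)
  let ?act = "\<lambda>g. image (milnor_translate G g)"
  have "cocompact_complex G (milnor_stage G i) (milnor_translate G)" for i
  proof -
    define B where "B = {h \<in> carrier G. to_nat_on (carrier G) h \<le> i} \<times> {..i}"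
    have "finite {h \<in> carrier G. to_nat_on (carrier G) h \<le> i}"
      by (rule inj_on_finite[of "to_nat_on (carrier G)" _ "{..i}"])
        (use inj_on_subset[OF inj_on_to_nat_on[OF cnt]] in auto)
    then have finB: "finite (Pow B)" by (simp add: B_def)
    have "orbits G (milnor_stage G i) ?act \<subseteq> orbit G ?act ` Pow B"
    proof
      fix orb assume "orb \<in> orbits G (milnor_stage G i) ?act"
      then obtain s where s: "s \<in> milnor_stage G i" and orb: "orb = orbit G ?act s" by (auto simp: orbits_def)
      have sj: "s \<in> milnor_join G" using s by (simp add: milnor_stage_def)
      then have sK: "s \<subseteq> \<Union>(milnor_join G)" by blast
      have sub: "x \<in> carrier G \<times> UNIV" if "x \<in> s" for x using sj that by (auto simp: milnor_join_def)
      obtain x where x: "x \<in> s" using sj by (auto simp: milnor_join_def)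
      have gx: "fst x \<in> carrier G" using sub[OF x] by auto
      define s' where "s' = milnor_translate G (inv fst x) ` s"
      have "s' \<subseteq> B"
      proof
        fix z assume "z \<in> s'"
        then obtain y where y: "y \<in> s" "z = milnor_translate G (inv fst x) y" by (auto simp: s'_def)
        then have "z = (inv fst x \<otimes> fst y, snd y)" using sub by simp
        moreover have "to_nat_on (carrier G) (inv fst x \<otimes> fst y) \<le> i" "snd y \<le> i"
          using s x y(1) by (auto simp: milnor_stage_def)
        ultimately show "z \<in> B" using gx sub[OF y(1)] by (auto simp: B_def)
      qed
      moreover have "orbit G ?act s = orbit G ?act s'"
      proof (intro subset_antisym subsetI)
        fix t assume "t \<in> orbit G ?act s"
        then obtain g where g: "g \<in> carrier G" "t = ?act g s" by (auto simp: orbit_def)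
        have "?act (g \<otimes> fst x) s' = ?act (g \<otimes> fst x \<otimes> inv fst x) s"
          unfolding s'_def using g gx sK by (intro image_a_mult) auto
        also have "\<dots> = t" using g gx by (simp add: m_assoc)
        finally show "t \<in> orbit G ?act s'" using g gx by (auto simp: orbit_def intro!: exI[of _ "g \<otimes> fst x"])
      next
        fix t assume "t \<in> orbit G ?act s'"
        then obtain g where g: "g \<in> carrier G" "t = ?act g s'" by (auto simp: orbit_def)
        have "t = ?act (g \<otimes> inv fst x) s"
          unfolding g(2) s'_def using g gx sK by (intro image_a_mult) auto
        then show "t \<in> orbit G ?act s" using g gx by (auto simp: orbit_def)
      qed
      ultimately show "orb \<in> orbit G ?act ` Pow B" using orb by auto
    qed
    then show ?thesis unfolding cocompact_complex_def using finB by (meson finite_imageI finite_subset)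
  qed
  moreover have "milnor_stage G i \<subseteq> milnor_stage G (Suc i)" for i
    by (auto simp: milnor_stage_def intro: le_SucI)
  moreover have "(\<Union>i. milnor_stage G i) = milnor_join G"
  proof
    show "milnor_join G \<subseteq> (\<Union>i. milnor_stage G i)"
    proof
      fix s assume s: "s \<in> milnor_join G"
      then have fin: "finite s" by (simp add: milnor_join_def)
      define N where "N = snd ` s \<union> (\<lambda>(x, y). to_nat_on (carrier G) (inv fst x \<otimes> fst y)) ` (s \<times> s)"
      have "finite N" using fin by (simp add: N_def)
      then have le: "n \<in> N \<Longrightarrow> n \<le> Max N" for n by simp
      have "s \<in> milnor_stage G (Max N)"
        unfolding milnor_stage_def
      proof (intro CollectI conjI ballI s subsetI)
        fix x y assume "x \<in> s" "y \<in> s"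
        then have "to_nat_on (carrier G) (inv fst x \<otimes> fst y) \<in> N" unfolding N_def by (intro UnI2 image_eqI[of _ _ "(x, y)"]) auto
        then show "to_nat_on (carrier G) (inv fst x \<otimes> fst y) \<le> Max N" by (rule le)
      qed (use le in \<open>auto simp: N_def\<close>)
      then show "s \<in> (\<Union>i. milnor_stage G i)" by blast
    qed
  qed (auto simp: milnor_stage_def)
  ultimately show ?thesis
    unfolding cocompact_exhaustion_def
    by (intro conjI allI ballI) (simp_all add: abstract_complex_milnor_stage milnor_stage_translate)
qed

lemma n_connected_milnor_join: "n_connected_space n (geometric_realization (milnor_join G))"
proof -
  let ?R = "geometric_realization (milnor_join G)"
  have point: "(\<lambda>v. if v = w then 1 else 0 :: real) \<in> topspace ?R" if "w \<in> carrier G \<times> UNIV" for w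
  proof -
    have "{w} \<in> milnor_join G" using that by (auto simp: milnor_join_def)
    moreover have "(\<lambda>v. if v = w then 1 else 0 :: real) \<in> closed_simplex {w}" by (auto simp: closed_simplex_def)
    ultimately show ?thesis by (auto simp: topspace_geometric_realization)
  qed
  have "\<exists>c\<in>topspace ?R. homotopic_with (\<lambda>_. True) (nsphere k) ?R f (\<lambda>_. c)"
    if f: "continuous_map (nsphere k) ?R f" for k f
  proof -
    have "compactin ?R (f ` topspace (nsphere k))"
      by (rule image_compactin[OF _ f]) (use compact_space_nsphere in \<open>simp add: compact_space_def\<close>)
    then obtain \<F> where \<F>: "finite \<F>" "\<F> \<subseteq> milnor_join G" "f ` topspace (nsphere k) \<subseteq> (\<Union>s\<in>\<F>. closed_simplex s)"
      by (rule compactin_geometric_realization_finite[OF abstract_complex_milnor_join])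
    \<comment> \<open>a level above all simplices that the compact image meets; its vertex \<open>(\<one>, N)\<close> is the apex\<close>
    define N where "N = Suc (Max (insert 0 (snd ` \<Union>\<F>)))"
    have fin: "finite (snd ` \<Union>\<F>)" using \<F>(1,2) by (auto simp: milnor_join_def)
    have above: "snd x < N" if "s \<in> \<F>" "x \<in> s" for s x
    proof -
      have "snd x \<in> snd ` \<Union>\<F>" using that by blast
      then have "snd x \<le> Max (insert 0 (snd ` \<Union>\<F>))" using fin by (intro Max_ge) auto
      then show ?thesis by (simp add: N_def)
    qed
    have "homotopic_with (\<lambda>_. True) (nsphere k) ?R f (\<lambda>_ v. if v = (\<one>, N) then 1 else 0)"
    proof (rule cone_contracts[OF abstract_complex_milnor_join \<F>(1,2) f \<F>(3)])
      fix s assume s: "s \<in> \<F>"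
      then have sj: "s \<in> milnor_join G" using \<F>(2) by blast
      have new: "N \<notin> snd ` s" using above[OF s] by fastforce
      have "(\<one>, N) \<notin> s" using above[OF s] by fastforce
      moreover have "insert (\<one>, N) s \<in> milnor_join G"
        using sj new by (auto simp: milnor_join_def)
      ultimately show "(\<one>, N) \<notin> s \<and> insert (\<one>, N) s \<in> milnor_join G" by simp
    qed
    then show ?thesis using point[of "(\<one>, N)"] by (intro bexI) auto
  qed
  then show ?thesis unfolding n_connected_space_def using point[of "(\<one>, 0)"] by auto
qed

end

text \<open>
  The infinite join shows that the l2-Betti number is chosen from a nonempty set of values, and for each
  of these values the inner limits in its definition are zero.
\<close>

theorem folner_l2_betti_number_eq_0:
  fixes \<Gamma> :: "('g, 'm) monoid_scheme" and p :: nat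
  assumes grp: "group \<Gamma>" and cnt: "countable (carrier \<Gamma>)" and inf: "infinite (carrier \<Gamma>)"
    and fol: "\<And>T \<delta> :: real. \<lbrakk>finite T; T \<subseteq> carrier \<Gamma>; 0 < \<delta>\<rbrakk> \<Longrightarrow>
       \<exists>F. finite F \<and> F \<noteq> {} \<and> F \<subseteq> carrier \<Gamma> \<and> real (card ((F <#>\<^bsub>\<Gamma>\<^esub> T) - F)) \<le> \<delta> * real (card F)"
  shows "l2_betti_number \<Gamma> p = 0"
proof -
  interpret group \<Gamma> by (rule grp)
  let ?P = "\<lambda>b. \<exists>(K :: ('g \<times> nat) set set) a L n.
        free_simplicial_action \<Gamma> K a \<and> p \<le> n \<and> n_connected_space n (geometric_realization K) \<and>
        cocompact_exhaustion \<Gamma> K a L \<and> b = l2_betti_exhaustion \<Gamma> a L p"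
  have "\<exists>b. ?P b"
    using free_simplicial_action_milnor_join n_connected_milnor_join[of p] cocompact_exhaustion_milnor[OF cnt]
    by (intro exI[of _ "l2_betti_exhaustion \<Gamma> (milnor_translate \<Gamma>) (milnor_stage \<Gamma>) p"]
        exI[of _ "milnor_join \<Gamma>"] exI[of _ "milnor_translate \<Gamma>"] exI[of _ "milnor_stage \<Gamma>"] exI[of _ p]) simp
  then have "?P (l2_betti_number \<Gamma> p)" unfolding l2_betti_number_def by (rule someI_ex)
  then obtain K a L n where K: "free_simplicial_action \<Gamma> (K :: ('g \<times> nat) set set) a" and pn: "p \<le> n"
    and conn: "n_connected_space n (geometric_realization K)"
    and ex: "cocompact_exhaustion \<Gamma> K a L" and b: "l2_betti_number \<Gamma> p = l2_betti_exhaustion \<Gamma> a L p" by blast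
  have fc: "free_complex \<Gamma> K a" using K by (rule free_complex.intro)
  have "(\<lambda>j. ereal (restriction_image_dim \<Gamma> a p (L j) (L i))) \<longlonglongrightarrow> 0" for i
  proof -
    have "(\<lambda>j. restriction_image_dim \<Gamma> a p (L j) (L i)) \<longlonglongrightarrow> 0"
    proof (rule LIMSEQ_I)
      fix r :: real assume r: "0 < r"
      have "\<exists>j0. \<forall>j\<ge>j0. 0 \<le> restriction_image_dim \<Gamma> a p (L j) (L i) \<and> restriction_image_dim \<Gamma> a p (L j) (L i) \<le> r / 2"
        by (rule free_complex.folner_restriction_image_dim_small[OF fc conn pn ex inf])
          (rule fol, assumption+, use r in simp)
      then obtain j0 where j0: "\<And>j. j \<ge> j0 \<Longrightarrow> 0 \<le> restriction_image_dim \<Gamma> a p (L j) (L i) \<and> restriction_image_dim \<Gamma> a p (L j) (L i) \<le> r / 2" by blast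
      have "norm (restriction_image_dim \<Gamma> a p (L j) (L i) - 0) < r" if "j \<ge> j0" for j
        using j0[OF that] r by simp
      then show "\<exists>no. \<forall>j\<ge>no. norm (restriction_image_dim \<Gamma> a p (L j) (L i) - 0) < r" by blast
    qed
    then show ?thesis unfolding zero_ereal_def by (simp only: lim_ereal)
  qed
  then have "lim (\<lambda>j. ereal (restriction_image_dim \<Gamma> a p (L j) (L i))) = 0" for i by (rule limI)
  then show ?thesis unfolding b l2_betti_exhaustion_def by (simp add: limI)
qed


section \<open>Algebraic shifts and convolution maps\<close>

lemma continuous_map_discrete_binop:
  assumes "continuous_map Z (discrete_topology UNIV) f" "continuous_map Z (discrete_topology UNIV) g"
  shows "continuous_map Z (discrete_topology UNIV) (\<lambda>z. h (f z) (g z))"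
proof -
  have "continuous_map Z (discrete_topology (UNIV \<times> UNIV)) (\<lambda>z. (f z, g z))"
    unfolding prod_topology_discrete_topology by (rule continuous_map_pairedI[OF assms])
  then have "continuous_map Z (discrete_topology UNIV) ((\<lambda>(a, b). h a b) \<circ> (\<lambda>z. (f z, g z)))"
    by (rule continuous_map_compose) auto
  then show ?thesis by (simp add: o_def)
qed

lemma continuous_map_discrete_unop:
  assumes "continuous_map Z (discrete_topology UNIV) f"
  shows "continuous_map Z (discrete_topology UNIV) (\<lambda>z. h (f z))"
  by (rule continuous_map_discrete_binop[OF assms assms])

lemma continuous_map_discrete_sum:
  fixes f :: "'i \<Rightarrow> 'z \<Rightarrow> int"
  assumes "\<And>i. i \<in> A \<Longrightarrow> continuous_map Z (discrete_topology UNIV) (f i)"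
  shows "continuous_map Z (discrete_topology UNIV) (\<lambda>z. \<Sum>i\<in>A. f i z)"
  using assms
proof (induction A rule: infinite_finite_induct)
  case (insert i A)
  have "continuous_map Z (discrete_topology UNIV) (\<lambda>z. f i z + (\<Sum>i\<in>A. f i z))"
    by (rule continuous_map_discrete_binop) (use insert in auto)
  then show ?case using insert(1,2) by simp
qed auto

text \<open>
  The compact groups of functions from \<open>G \<times> {..<k}\<close> to the integers modulo \<open>q\<close>, realized on sequences of
  real numbers: the injection \<open>site\<close> numbers the pairs \<open>(g, i)\<close>, and the residue at \<open>(g, i)\<close> is stored at
  \<open>site g i\<close>. Positions outside \<open>sites k\<close> carry \<open>0\<close>.
\<close>

locale cyclic_shift_group = group G for G :: "('g, 'm) monoid_scheme" (structure) +
  fixes q :: int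
  assumes cnt: "countable (carrier G)" and q: "1 < q"
begin

definition site :: "'g \<Rightarrow> nat \<Rightarrow> nat" where
  "site g i = to_nat_on (carrier G \<times> UNIV) (g, i)"

definition sites :: "nat \<Rightarrow> nat set" where
  "sites k = (\<lambda>(g, i). site g i) ` (carrier G \<times> {..<k})"

definition alphabet :: "nat \<Rightarrow> nat \<Rightarrow> real set" where
  "alphabet k n = (if n \<in> sites k then real_of_int ` {0..<q} else {0})"

definition shift_top :: "nat \<Rightarrow> (nat \<Rightarrow> real) topology" where
  "shift_top k = product_topology (\<lambda>n. discrete_topology (alphabet k n)) UNIV"

definition decode :: "(nat \<Rightarrow> real) \<Rightarrow> 'g \<Rightarrow> nat \<Rightarrow> int" where
  "decode x g i = \<lfloor>x (site g i)\<rfloor>"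

definition encode :: "nat \<Rightarrow> ('g \<Rightarrow> nat \<Rightarrow> int) \<Rightarrow> nat \<Rightarrow> real" where
  "encode k v n = (if n \<in> sites k
     then real_of_int (case_prod v (inv_into (carrier G \<times> UNIV) (to_nat_on (carrier G \<times> UNIV)) n) mod q) else 0)"

definition shift_group :: "nat \<Rightarrow> (nat \<Rightarrow> real) monoid" where
  "shift_group k = \<lparr>carrier = topspace (shift_top k),
     mult = (\<lambda>x y. encode k (\<lambda>g i. decode x g i + decode y g i)), one = encode k (\<lambda>g i. 0)\<rparr>"

definition shift :: "nat \<Rightarrow> 'g \<Rightarrow> (nat \<Rightarrow> real) \<Rightarrow> nat \<Rightarrow> real" where
  "shift k g = (\<lambda>x\<in>topspace (shift_top k). encode k (\<lambda>h i. decode x (inv g \<otimes> h) i))"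

lemma in_shift_top_iff: "x \<in> topspace (shift_top k) \<longleftrightarrow> (\<forall>n. x n \<in> alphabet k n)"
  by (auto simp: shift_top_def)

lemma inj_site: "inj_on (to_nat_on (carrier G \<times> (UNIV :: nat set))) (carrier G \<times> UNIV)"
  by (rule inj_on_to_nat_on) (simp add: cnt)

lemma encode_in: "encode k v \<in> topspace (shift_top k)"
  using q by (auto simp: in_shift_top_iff alphabet_def encode_def intro!: imageI)

lemma encode_site:
  assumes "g \<in> carrier G" "i < k" shows "encode k v (site g i) = real_of_int (v g i mod q)"
proof -
  have "site g i \<in> sites k" using assms by (auto simp: sites_def)
  moreover have "inv_into (carrier G \<times> UNIV) (to_nat_on (carrier G \<times> UNIV)) (site g i) = (g, i)"
    unfolding site_def by (rule inv_into_f_f[OF inj_site]) (use assms in auto)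
  ultimately show ?thesis by (simp add: encode_def)
qed

lemma decode_encode: "\<lbrakk>g \<in> carrier G; i < k\<rbrakk> \<Longrightarrow> decode (encode k v) g i = v g i mod q"
  by (simp add: decode_def encode_site)

lemma decode_range:
  assumes "x \<in> topspace (shift_top k)" "g \<in> carrier G" "i < k"
  shows "decode x g i \<in> {0..<q}" "x (site g i) = real_of_int (decode x g i)"
proof -
  have "site g i \<in> sites k" using assms by (auto simp: sites_def)
  then have "x (site g i) \<in> real_of_int ` {0..<q}"
    using assms(1) unfolding in_shift_top_iff by (auto simp: alphabet_def dest: spec[of _ "site g i"])
  then show "decode x g i \<in> {0..<q}" "x (site g i) = real_of_int (decode x g i)" by (auto simp: decode_def)
qed

lemma shift_top_eqI:
  assumes x: "x \<in> topspace (shift_top k)" and y: "y \<in> topspace (shift_top k)"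
    and eq: "\<And>g i. \<lbrakk>g \<in> carrier G; i < k\<rbrakk> \<Longrightarrow> [decode x g i = decode y g i] (mod q)"
  shows "x = y"
proof
  fix n
  show "x n = y n"
  proof (cases "n \<in> sites k")
    case True
    then obtain g i where gi: "g \<in> carrier G" "i < k" "n = site g i" by (auto simp: sites_def)
    have "decode x g i = decode y g i"
      using eq[OF gi(1,2)] decode_range(1)[OF x gi(1,2)] decode_range(1)[OF y gi(1,2)] by (simp add: cong_def)
    then show ?thesis using decode_range(2)[OF x gi(1,2)] decode_range(2)[OF y gi(1,2)] gi(3) by simp
  next
    case False
    then have "x n \<in> {0}" "y n \<in> {0}" using x y unfolding in_shift_top_iff alphabet_def by metis+
    then show ?thesis by simp
  qed
qed

lemma decode_encode_cong: "\<lbrakk>g \<in> carrier G; i < k\<rbrakk> \<Longrightarrow> [decode (encode k v) g i = v g i] (mod q)"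
  by (simp add: decode_encode cong_def)

lemma encode_eqI:
  assumes "\<And>g i. \<lbrakk>g \<in> carrier G; i < k\<rbrakk> \<Longrightarrow> [v g i = w g i] (mod q)"
  shows "encode k v = encode k w"
  by (rule shift_top_eqI[OF encode_in encode_in]) (use assms in \<open>simp add: decode_encode cong_def\<close>)

lemma compact_space_shift_top: "compact_space (shift_top k)"
  unfolding shift_top_def alphabet_def
  by (simp add: compact_space_product_topology compact_space_discrete_topology)

lemma metrizable_space_shift_top: "metrizable_space (shift_top k)"
  unfolding shift_top_def
  by (simp add: metrizable_space_product_topology metrizable_space_discrete_topology)

lemma continuous_map_decode:
  "\<lbrakk>g \<in> carrier G; i < k\<rbrakk> \<Longrightarrow> continuous_map (shift_top k) (discrete_topology UNIV) (\<lambda>x. decode x g i)"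
proof -
  have "continuous_map (shift_top k) (discrete_topology (alphabet k (site g i))) (\<lambda>x. x (site g i))"
    unfolding shift_top_def by (rule continuous_map_product_projection) simp
  then have "continuous_map (shift_top k) (discrete_topology UNIV) ((\<lambda>r. \<lfloor>r\<rfloor>) \<circ> (\<lambda>x. x (site g i)))"
    by (rule continuous_map_compose) auto
  then show ?thesis by (simp add: decode_def o_def)
qed

lemma continuous_map_encode:
  assumes w: "\<And>g i. \<lbrakk>g \<in> carrier G; i < k\<rbrakk> \<Longrightarrow> continuous_map Z (discrete_topology UNIV) (\<lambda>z. w z g i)"
  shows "continuous_map Z (shift_top k) (\<lambda>z. encode k (w z))"
proof -
  have "continuous_map Z (discrete_topology (alphabet k n)) (\<lambda>z. encode k (w z) n)" for n
  proof (cases "n \<in> sites k")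
    case True
    then obtain g i where gi: "g \<in> carrier G" "i < k" "n = site g i" by (auto simp: sites_def)
    have "continuous_map Z (discrete_topology (alphabet k n)) ((\<lambda>a. real_of_int (a mod q)) \<circ> (\<lambda>z. w z g i))"
      by (rule continuous_map_compose[OF w[OF gi(1,2)]]) (use q True in \<open>auto simp: alphabet_def\<close>)
    then show ?thesis by (simp add: o_def gi(3) encode_site[OF gi(1,2)])
  next
    case False
    then show ?thesis by (simp add: encode_def alphabet_def)
  qed
  then show ?thesis unfolding shift_top_def by (simp add: continuous_map_componentwise_UNIV)
qed

lemma group_shift_group: "group (shift_group k)"
proof (rule groupI)
  fix x y z assume "x \<in> carrier (shift_group k)" "y \<in> carrier (shift_group k)" "z \<in> carrier (shift_group k)"
  then show "x \<otimes>\<^bsub>shift_group k\<^esub> y \<otimes>\<^bsub>shift_group k\<^esub> z = x \<otimes>\<^bsub>shift_group k\<^esub> (y \<otimes>\<^bsub>shift_group k\<^esub> z)"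
    by (auto simp: shift_group_def decode_encode cong_def mod_simps add.assoc intro!: encode_eqI)
next
  fix x assume x: "x \<in> carrier (shift_group k)"
  then have xt: "x \<in> topspace (shift_top k)" by (simp add: shift_group_def)
  show "\<one>\<^bsub>shift_group k\<^esub> \<otimes>\<^bsub>shift_group k\<^esub> x = x"
    by (rule shift_top_eqI) (use xt in \<open>auto simp: shift_group_def encode_in decode_encode cong_def\<close>)
  show "\<exists>y\<in>carrier (shift_group k). y \<otimes>\<^bsub>shift_group k\<^esub> x = \<one>\<^bsub>shift_group k\<^esub>"
    by (rule bexI[of _ "encode k (\<lambda>g i. - decode x g i)"])
      (auto simp: shift_group_def encode_in decode_encode cong_def mod_simps intro!: encode_eqI)
qed (auto simp: shift_group_def encode_in)

lemma inv_shift_group: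
  assumes "x \<in> topspace (shift_top k)"
  shows "inv\<^bsub>shift_group k\<^esub> x = encode k (\<lambda>g i. - decode x g i)"
  by (rule group.inv_equality[OF group_shift_group])
    (use assms in \<open>auto simp: shift_group_def encode_in decode_encode cong_def mod_simps intro!: encode_eqI\<close>)

lemma compact_metrizable_shift_group: "compact_metrizable_group (shift_group k) (shift_top k)"
proof -
  let ?Z = "prod_topology (shift_top k) (shift_top k)"
  have "continuous_map ?Z (shift_top k) (\<lambda>z. encode k (\<lambda>g i. decode (fst z) g i + decode (snd z) g i))"
  proof (rule continuous_map_encode)
    fix g i assume gi: "g \<in> carrier G" "i < k"
    have "continuous_map ?Z (discrete_topology UNIV) (\<lambda>z. decode (fst z) g i)"
      using continuous_map_compose[OF continuous_map_fst continuous_map_decode[OF gi]] by (simp add: o_def)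
    moreover have "continuous_map ?Z (discrete_topology UNIV) (\<lambda>z. decode (snd z) g i)"
      using continuous_map_compose[OF continuous_map_snd continuous_map_decode[OF gi]] by (simp add: o_def)
    ultimately show "continuous_map ?Z (discrete_topology UNIV) (\<lambda>z. decode (fst z) g i + decode (snd z) g i)"
      by (rule continuous_map_discrete_binop)
  qed
  moreover have "continuous_map (shift_top k) (shift_top k) (\<lambda>x. encode k (\<lambda>g i. - decode x g i))"
    by (rule continuous_map_encode, rule continuous_map_discrete_unop[where h = uminus], rule continuous_map_decode)
  then have "continuous_map (shift_top k) (shift_top k) (\<lambda>x. inv\<^bsub>shift_group k\<^esub> x)"
    by (rule continuous_map_eq) (simp add: inv_shift_group)
  moreover have "carrier (shift_group k) = topspace (shift_top k)"
    "x \<otimes>\<^bsub>shift_group k\<^esub> y = encode k (\<lambda>g i. decode x g i + decode y g i)" for x y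
    by (simp_all add: shift_group_def)
  ultimately show ?thesis
    by (simp add: compact_metrizable_group_def topological_group_on_def group_shift_group
        compact_space_shift_top metrizable_space_shift_top case_prod_unfold)
qed

lemma decode_shift:
  "\<lbrakk>x \<in> topspace (shift_top k); h \<in> carrier G; i < k\<rbrakk> \<Longrightarrow> decode (shift k g x) h i = decode x (inv g \<otimes> h) i mod q"
  by (simp add: shift_def decode_encode)

lemma shift_in: "x \<in> topspace (shift_top k) \<Longrightarrow> shift k g x \<in> topspace (shift_top k)"
  by (simp add: shift_def encode_in)

lemma shift_one: "x \<in> topspace (shift_top k) \<Longrightarrow> shift k \<one> x = x"
  by (rule shift_top_eqI[OF shift_in]) (auto simp: decode_shift cong_def)

lemma shift_mult:
  assumes "g \<in> carrier G" "h \<in> carrier G" and x: "x \<in> topspace (shift_top k)"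
  shows "shift k g (shift k h x) = shift k (g \<otimes> h) x"
  by (rule shift_top_eqI[OF shift_in[OF shift_in[OF x]] shift_in[OF x]])
    (use assms in \<open>simp add: decode_shift shift_in cong_def inv_mult_group m_assoc\<close>)

lemma continuous_map_shift:
  assumes g: "g \<in> carrier G" shows "continuous_map (shift_top k) (shift_top k) (shift k g)"
proof -
  have "continuous_map (shift_top k) (shift_top k) (\<lambda>x. encode k (\<lambda>h i. decode x (inv g \<otimes> h) i))"
    by (intro continuous_map_encode continuous_map_decode) (use g in auto)
  then show ?thesis by (rule continuous_map_eq) (simp add: shift_def)
qed

lemma group_action_shift: "group_action G (topspace (shift_top k)) (shift k)"
  by (rule group_action_if_permutes[OF is_group])
    (simp_all add: shift_in shift_one shift_mult, simp add: shift_def)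

lemma acts_by_automorphisms_shift:
  "acts_by_continuous_automorphisms G (shift_group k) (shift_top k) (shift k)"
proof -
  interpret group_action G "topspace (shift_top k)" "shift k" by (rule group_action_shift)
  have "shift k g \<in> iso (shift_group k) (shift_group k)" if g: "g \<in> carrier G" for g
  proof -
    have "bij_betw (shift k g) (topspace (shift_top k)) (topspace (shift_top k))"
      using inj_prop[OF g] surj_prop[OF g] by (simp add: bij_betw_def)
    moreover have "shift k g (encode k (\<lambda>h i. decode x h i + decode y h i)) =
        encode k (\<lambda>h i. decode (shift k g x) h i + decode (shift k g y) h i)"
      if "x \<in> topspace (shift_top k)" "y \<in> topspace (shift_top k)" for x y
      by (rule shift_top_eqI[OF shift_in[OF encode_in] encode_in])
        (use that g in \<open>simp add: decode_shift decode_encode encode_in cong_def mod_simps\<close>)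
    ultimately show ?thesis
      by (simp add: iso_def hom_def shift_group_def shift_in Pi_iff)
  qed
  then show ?thesis
    using group_action_shift continuous_map_shift
    by (simp add: acts_by_continuous_automorphisms_def shift_group_def)
qed

lemma sofic_entropy_shift:
  assumes sof: "sofic_approximation G D \<sigma>"
  shows "sofic_entropy G (shift_top k) (shift k) D \<sigma> = ereal (real k * ln q)"
proof -
  define C where "C = ({..<k} \<rightarrow>\<^sub>E {0..<q})"
  define c where "c x = (\<lambda>i\<in>{..<k}. decode x \<one> i)" for x
  define \<rho> where "\<rho> = (SOME \<rho>. generating_pseudometric G (shift_top k) (shift k) \<rho>)"
  have gen: "generating_pseudometric G (shift_top k) (shift k) \<rho>"
  proof -
    have "\<exists>\<rho>. generating_pseudometric G (shift_top k) (shift k) \<rho>"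
      by (rule generating_pseudometric_exists[OF metrizable_space_shift_top is_group], rule shift_one)
    then show ?thesis unfolding \<rho>_def by (rule someI_ex)
  qed
  have c_shift: "c (shift k g x) = (\<lambda>i\<in>{..<k}. decode x (inv g) i)"
    if "g \<in> carrier G" "x \<in> topspace (shift_top k)" for g x
  proof -
    have "decode x (inv g) i mod q = decode x (inv g) i" if "i < k" for i
      using decode_range(1)[OF \<open>x \<in> topspace (shift_top k)\<close> inv_closed[OF \<open>g \<in> carrier G\<close>] that] by simp
    then show ?thesis using that by (auto simp: c_def decode_shift)
  qed
  interpret coded_system G "shift_top k" "shift k" c C \<rho>
  proof
    show "compact_space (shift_top k)" by (rule compact_space_shift_top)
    show "continuous_map (shift_top k) (shift_top k) (shift k g)" if "g \<in> carrier G" for g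
      by (rule continuous_map_shift[OF that])
    show "finite C" by (simp add: C_def finite_PiE)
    show "generating_pseudometric G (shift_top k) (shift k) \<rho>" by (rule gen)
    show "continuous_map (shift_top k) (discrete_topology C) c"
    proof -
      have "openin (shift_top k) {x \<in> topspace (shift_top k). c x \<in> U}" if U: "U \<subseteq> C" for U
      proof -
        have "openin (shift_top k) ((\<Inter>i\<in>{..<k}. {x \<in> topspace (shift_top k). decode x \<one> i \<in> {a i}}) \<inter> topspace (shift_top k))" for a
          by (rule openin_INT, simp, rule openin_continuous_map_preimage[OF continuous_map_decode]) auto
        then have "openin (shift_top k) (\<Union>a\<in>U. (\<Inter>i\<in>{..<k}. {x \<in> topspace (shift_top k). decode x \<one> i \<in> {a i}}) \<inter> topspace (shift_top k))"
          by (intro openin_Union) auto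
        moreover have "(\<Union>a\<in>U. (\<Inter>i\<in>{..<k}. {x \<in> topspace (shift_top k). decode x \<one> i \<in> {a i}}) \<inter> topspace (shift_top k)) =
            {x \<in> topspace (shift_top k). c x \<in> U}"
        proof -
          have "c x = a \<longleftrightarrow> (\<forall>i<k. decode x \<one> i = a i)" if "a \<in> U" for a x
          proof -
            have "a \<in> extensional {..<k}" using that U by (auto simp: C_def PiE_def)
            then show ?thesis by (auto simp: c_def extensional_def restrict_def fun_eq_iff)
          qed
          note eq = this
          show ?thesis
          proof (rule Set.set_eqI, rule iffI)
            fix x assume "x \<in> (\<Union>a\<in>U. (\<Inter>i\<in>{..<k}. {x \<in> topspace (shift_top k). decode x \<one> i \<in> {a i}}) \<inter> topspace (shift_top k))"
            then obtain a where "a \<in> U" "\<forall>i<k. decode x \<one> i = a i" "x \<in> topspace (shift_top k)" by auto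
            then show "x \<in> {x \<in> topspace (shift_top k). c x \<in> U}" using eq[of a x] by simp
          next
            fix x assume "x \<in> {x \<in> topspace (shift_top k). c x \<in> U}"
            then have "c x \<in> U" "x \<in> topspace (shift_top k)" by simp_all
            moreover then have "\<forall>i<k. decode x \<one> i = c x i" using eq[of "c x" x] by simp
            ultimately show "x \<in> (\<Union>a\<in>U. (\<Inter>i\<in>{..<k}. {x \<in> topspace (shift_top k). decode x \<one> i \<in> {a i}}) \<inter> topspace (shift_top k))"
              by (intro UN_I[of "c x"]) auto
          qed
        qed
        ultimately show ?thesis by simp
      qed
      moreover have "c x \<in> C" if "x \<in> topspace (shift_top k)" for x
        unfolding C_def c_def by (rule restrict_PiE_iff[THEN iffD2]) (use decode_range(1)[OF that one_closed] in auto)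
      ultimately show ?thesis by (auto simp: continuous_map_def)
    qed
    show "\<exists>g\<in>carrier G. c (shift k g x) \<noteq> c (shift k g y)"
      if xy: "x \<in> topspace (shift_top k)" "y \<in> topspace (shift_top k)" "x \<noteq> y" for x y
    proof (rule ccontr)
      assume no: "\<not> ?thesis"
      have "x = y"
      proof (rule shift_top_eqI[OF xy(1,2)])
        fix g i assume gi: "g \<in> carrier G" "i < k"
        have "c (shift k (inv g) x) i = c (shift k (inv g) y) i" using no gi by auto
        then show "[decode x g i = decode y g i] (mod q)" using gi xy by (simp add: c_shift)
      qed
      then show False using xy by simp
    qed
    show "\<exists>x\<in>topspace (shift_top k). \<forall>g\<in>carrier G. c (shift k g x) = \<omega> g"
      if \<omega>: "\<And>g. g \<in> carrier G \<Longrightarrow> \<omega> g \<in> C" for \<omega>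
    proof (intro bexI ballI)
      fix g assume g: "g \<in> carrier G"
      have "\<omega> g i mod q = \<omega> g i" if "i < k" for i
        using \<omega>[OF g] that by (auto simp: C_def PiE_def Pi_iff)
      moreover have "\<omega> g i = undefined" if "\<not> i < k" for i
        using \<omega>[OF g] that by (auto simp: C_def PiE_def extensional_def)
      ultimately show "c (shift k g (encode k (\<lambda>h. \<omega> (inv h)))) = \<omega> g"
        using g by (auto simp: c_shift encode_in decode_encode restrict_def)
    qed (rule encode_in)
  qed (auto simp: shift_one shift_mult)
  have "C \<noteq> {}" using q by (auto simp: C_def PiE_eq_empty_iff)
  then have "sofic_entropy_wrt \<rho> G (shift_top k) (shift k) D \<sigma> = ereal (ln (card C))"
    using entropy_upper_bound[OF sof] entropy_lower_bound[OF sof] by (simp add: antisym)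
  moreover have "card C = nat q ^ k" using q by (simp add: C_def card_PiE)
  moreover have "ln (real (nat q ^ k)) = real k * ln q" using q by (simp add: ln_realpow)
  ultimately show ?thesis by (simp add: sofic_entropy_def \<rho>_def)
qed

lemma convolution_cong:
  assumes "\<And>s y. (s, y) \<in> P \<Longrightarrow> [v (g \<otimes> s) y = w (g \<otimes> s) y] (mod q)"
  shows "[convolution P \<tau> v g k = convolution P \<tau> w g k] (mod q)"
  unfolding convolution_def by (rule cong_sum) (use assms in \<open>auto intro!: cong_mult\<close>)

lemma convolution_add:
  "convolution P \<tau> (\<lambda>h i. v h i + w h i) g k = convolution P \<tau> v g k + convolution P \<tau> w g k"
  by (simp add: convolution_def case_prod_unfold distrib_right sum.distrib)

definition convolution_map :: "('g \<times> nat) set \<Rightarrow> ('g \<times> nat \<Rightarrow> int) \<Rightarrow> nat \<Rightarrow> (nat \<Rightarrow> real) \<Rightarrow> nat \<Rightarrow> real" where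
  "convolution_map P \<tau> m x = encode (Suc m) (convolution P \<tau> (decode x))"

lemma decode_convolution_map:
  "\<lbrakk>g \<in> carrier G; k \<le> m\<rbrakk> \<Longrightarrow> decode (convolution_map P \<tau> m x) g k = convolution P \<tau> (decode x) g k mod q"
  by (simp add: convolution_map_def decode_encode)

context
  fixes P :: "('g \<times> nat) set" and m :: nat
  assumes P: "P \<subseteq> carrier G \<times> {..<m}"
begin

lemma convolution_map_hom: "convolution_map P \<tau> m \<in> hom (shift_group m) (shift_group (Suc m))"
proof (rule homI)
  fix x y assume "x \<in> carrier (shift_group m)" "y \<in> carrier (shift_group m)"
  have "[convolution P \<tau> (decode (encode m (\<lambda>g i. decode x g i + decode y g i))) g k =
      convolution P \<tau> (decode x) g k + convolution P \<tau> (decode y) g k] (mod q)" if "g \<in> carrier G" for g k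
    unfolding convolution_add[symmetric] by (rule convolution_cong, rule decode_encode_cong) (use P that in auto)
  then show "convolution_map P \<tau> m (x \<otimes>\<^bsub>shift_group m\<^esub> y) =
      convolution_map P \<tau> m x \<otimes>\<^bsub>shift_group (Suc m)\<^esub> convolution_map P \<tau> m y"
    by (auto simp: shift_group_def convolution_map_def decode_encode cong_def mod_simps intro!: encode_eqI)
qed (simp add: shift_group_def convolution_map_def encode_in)

lemma continuous_convolution_map: "continuous_map (shift_top m) (shift_top (Suc m)) (convolution_map P \<tau> m)"
proof -
  have "continuous_map (shift_top m) (discrete_topology UNIV) (\<lambda>x. convolution P \<tau> (decode x) g k)"
    if "g \<in> carrier G" for g k
    unfolding convolution_def case_prod_unfold
    by (intro continuous_map_discrete_sum continuous_map_discrete_unop[where h = "\<lambda>a. a * b" for b] continuous_map_decode)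
      (use P that in auto)
  then show ?thesis unfolding convolution_map_def by (intro continuous_map_encode)
qed

lemma convolution_map_equivariant:
  assumes g: "g \<in> carrier G" and x: "x \<in> topspace (shift_top m)"
  shows "convolution_map P \<tau> m (shift m g x) = shift (Suc m) g (convolution_map P \<tau> m x)"
proof (rule shift_top_eqI)
  show "convolution_map P \<tau> m (shift m g x) \<in> topspace (shift_top (Suc m))"
    "shift (Suc m) g (convolution_map P \<tau> m x) \<in> topspace (shift_top (Suc m))"
    by (simp_all add: convolution_map_def encode_in shift_in)
  fix h k assume hk: "h \<in> carrier G" "k < Suc m"
  have "[convolution P \<tau> (decode (shift m g x)) h k = convolution P \<tau> (\<lambda>h. decode x (inv g \<otimes> h)) h k] (mod q)"
    by (rule convolution_cong) (use P hk x in \<open>auto simp: decode_shift cong_def\<close>)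
  also have "convolution P \<tau> (\<lambda>h. decode x (inv g \<otimes> h)) h k = convolution P \<tau> (decode x) (inv g \<otimes> h) k"
    unfolding convolution_def by (rule sum.cong) (use P hk g in \<open>auto simp: m_assoc\<close>)
  finally show "[decode (convolution_map P \<tau> m (shift m g x)) h k = decode (shift (Suc m) g (convolution_map P \<tau> m x)) h k] (mod q)"
    using hk g by (simp add: decode_shift decode_convolution_map convolution_map_def[of _ _ _ x, THEN arg_cong[where f = "\<lambda>z. z \<in> topspace (shift_top (Suc m))"]] encode_in cong_def)
qed

text \<open>
  The conditions at the elements of \<open>G\<close> define closed sets, and any finitely many of them can be met
  simultaneously, so compactness provides a common solution.
\<close>

lemma convolution_map_surjective:
  assumes fin: "\<And>F b. \<lbrakk>finite F; F \<subseteq> carrier G\<rbrakk> \<Longrightarrow> \<exists>v. \<forall>g\<in>F. \<forall>k\<le>m. [convolution P \<tau> v g k = b g k] (mod q)"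
  shows "convolution_map P \<tau> m ` topspace (shift_top m) = topspace (shift_top (Suc m))"
proof
  show "convolution_map P \<tau> m ` topspace (shift_top m) \<subseteq> topspace (shift_top (Suc m))"
    by (auto simp: convolution_map_def encode_in)
  show "topspace (shift_top (Suc m)) \<subseteq> convolution_map P \<tau> m ` topspace (shift_top m)"
  proof
    fix y assume y: "y \<in> topspace (shift_top (Suc m))"
    define A where "A g = {x \<in> topspace (shift_top m). \<forall>k\<le>m. decode (convolution_map P \<tau> m x) g k = decode y g k}" for g
    have "closedin (shift_top m) (A g)" if g: "g \<in> carrier G" for g
    proof -
      have "closedin (shift_top m) (\<Inter>k\<in>{..m}. {x \<in> topspace (shift_top m). decode (convolution_map P \<tau> m x) g k \<in> {decode y g k}})"
      proof (rule closedin_INT)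
        fix k assume "k \<in> {..m}"
        then have "continuous_map (shift_top m) (discrete_topology UNIV) (\<lambda>x. decode (convolution_map P \<tau> m x) g k)"
          using continuous_map_compose[OF continuous_convolution_map continuous_map_decode[OF g, of k "Suc m"], of \<tau>] by (simp add: o_def less_Suc_eq_le)
        then show "closedin (shift_top m) {x \<in> topspace (shift_top m). decode (convolution_map P \<tau> m x) g k \<in> {decode y g k}}"
          by (rule closedin_continuous_map_preimage) simp
      qed simp
      moreover have "(\<Inter>k\<in>{..m}. {x \<in> topspace (shift_top m). decode (convolution_map P \<tau> m x) g k \<in> {decode y g k}}) = A g"
        by (auto simp: A_def)
      ultimately show ?thesis by simp
    qed
    moreover have "\<Inter>\<F> \<noteq> {}" if \<F>: "finite \<F>" "\<F> \<subseteq> A ` carrier G" for \<F>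
    proof -
      obtain F where F: "finite F" "F \<subseteq> carrier G" "\<F> = A ` F"
        using finite_subset_image[OF \<F>] by blast
      obtain v where v: "\<forall>g\<in>F. \<forall>k\<le>m. [convolution P \<tau> v g k = decode y g k] (mod q)" using fin[OF F(1,2)] by blast
      have "encode m v \<in> A g" if g: "g \<in> F" for g
        unfolding A_def
      proof (intro CollectI conjI allI impI encode_in)
        fix k assume k: "k \<le> m"
        have gG: "g \<in> carrier G" using g F by auto
        have "[convolution P \<tau> (decode (encode m v)) g k = convolution P \<tau> v g k] (mod q)"
          by (rule convolution_cong, rule decode_encode_cong) (use P gG in auto)
        then have "[convolution P \<tau> (decode (encode m v)) g k = decode y g k] (mod q)"
          by (rule cong_trans) (use v g k in auto)
        moreover have "decode y g k mod q = decode y g k" using decode_range(1)[OF y gG, of k] k by simp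
        ultimately show "decode (convolution_map P \<tau> m (encode m v)) g k = decode y g k"
          using gG k by (simp add: decode_convolution_map cong_def)
      qed
      then show ?thesis using F(3) by blast
    qed
    ultimately have "\<Inter>(A ` carrier G) \<noteq> {}"
      using compact_space_shift_top[of m] unfolding compact_space_fip by (elim allE[of _ "A ` carrier G"] impE) auto
    then obtain x where x: "\<And>g. g \<in> carrier G \<Longrightarrow> x \<in> A g" by blast
    have "x \<in> topspace (shift_top m)" using x[OF one_closed] by (simp add: A_def)
    moreover have "convolution_map P \<tau> m x = y"
      by (rule shift_top_eqI[OF _ y]) (use x in \<open>auto simp: A_def less_Suc_eq_le convolution_map_def encode_in\<close>)
    ultimately show "y \<in> convolution_map P \<tau> m ` topspace (shift_top m)" by blast
  qed
qed

end

end


section \<open>Failure of the addition formula\<close>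

text \<open>
  The convolution map goes from \<open>m\<close> coordinates onto \<open>m + 1\<close>. The identity of the kernel is a fixed
  point, and this already makes the entropy of the kernel nonnegative.
\<close>

theorem not_folner_subgroup_violates_addition:
  fixes G :: "('g, 'm) monoid_scheme" (structure) and \<Gamma> :: "'g set"
  assumes grp: "group G" and cnt: "countable (carrier G)" and \<Gamma>: "subgroup \<Gamma> G"
    and nf: "\<not> folner (G\<lparr>carrier := \<Gamma>\<rparr>)"
  shows "\<exists>(H :: (nat \<Rightarrow> real) monoid) T \<alpha> (H' :: (nat \<Rightarrow> real) monoid) T' \<alpha>' \<phi>.
    compact_metrizable_group H T \<and> compact_metrizable_group H' T' \<and>
    acts_by_continuous_automorphisms G H T \<alpha> \<and> acts_by_continuous_automorphisms G H' T' \<alpha>' \<and>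
    \<phi> \<in> hom H H' \<and> continuous_map T T' \<phi> \<and> \<phi> ` carrier H = carrier H' \<and>
    (\<forall>g\<in>carrier G. \<forall>x\<in>carrier H. \<phi> (\<alpha> g x) = \<alpha>' g (\<phi> x)) \<and>
    (\<forall>(D :: nat \<Rightarrow> nat set) \<sigma>. sofic_approximation G D \<sigma> \<longrightarrow>
       sofic_entropy G T \<alpha> D \<sigma> \<noteq>
         sofic_entropy G (subtopology T (kernel H H' \<phi>)) \<alpha> D \<sigma> + sofic_entropy G T' \<alpha>' D \<sigma>)"
proof -
  interpret group G by (rule grp)
  obtain S m X where S: "finite S" "S \<subseteq> carrier G"
    and priv: "\<And>F. \<lbrakk>finite F; F \<noteq> {}; F \<subseteq> carrier G\<rbrakk> \<Longrightarrow> \<exists>g\<in>F. (m :: nat) <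
       card {(s, y). s \<in> S \<and> y < m \<and> y \<in> X s \<and> (\<forall>t\<in>S. t \<noteq> s \<longrightarrow> g \<otimes> s \<otimes> inv t \<in> F \<longrightarrow> y \<notin> X t)}"
    using not_folner_private_coordinates[OF \<Gamma> nf] by blast
  define P where "P = {(s, y). s \<in> S \<and> y < m \<and> y \<in> X s}"
  have finP: "finite P" unfolding P_def by (rule finite_subset[of _ "S \<times> {..<m}"]) (use S in auto)
  \<comment> \<open>the pairs in \<open>P\<close> must receive distinct residues \<open>\<tau>\<close>\<close>
  obtain p :: nat where p: "prime p" "card P < p" using bigger_prime by blast
  define q where "q = int p"
  have pq: "prime q" "1 < q" using p prime_gt_1_nat[OF p(1)] by (simp_all add: q_def)
  obtain e where e: "bij_betw e P {0..<card P}" using ex_bij_betw_finite_nat[OF finP] by blast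
  define \<tau> where "\<tau> x = int (e x)" for x
  have \<tau>: "x = y" if "x \<in> P" "y \<in> P" "[\<tau> x = \<tau> y] (mod q)" for x y
  proof -
    have "e x < card P" "e y < card P" using e that by (auto simp: bij_betw_def)
    then have "e x = e y" using that(3) p(2) by (simp add: \<tau>_def q_def cong_def)
    then show ?thesis using e that by (auto simp: bij_betw_def inj_on_def)
  qed
  interpret cyclic_shift_group G q by unfold_locales (use cnt pq in auto)
  let ?\<phi> = "convolution_map P \<tau> m"
  have P: "P \<subseteq> carrier G \<times> {..<m}" using S by (auto simp: P_def)
  have surj: "?\<phi> ` topspace (shift_top m) = topspace (shift_top (Suc m))"
    by (rule convolution_map_surjective[OF P], rule convolution_finitely_surjective[OF S P_def priv pq(1) \<tau>])
  have carr: "carrier (shift_group k) = topspace (shift_top k)" for k by (simp add: shift_group_def)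
  have "sofic_entropy G (shift_top m) (shift m) D \<sigma> \<noteq>
         sofic_entropy G (subtopology (shift_top m) (kernel (shift_group m) (shift_group (Suc m)) ?\<phi>)) (shift m) D \<sigma> +
         sofic_entropy G (shift_top (Suc m)) (shift (Suc m)) D \<sigma>"
    if sof: "sofic_approximation G D \<sigma>" for D :: "nat \<Rightarrow> nat set" and \<sigma>
  proof -
    let ?N = "kernel (shift_group m) (shift_group (Suc m)) ?\<phi>"
    let ?one = "\<one>\<^bsub>shift_group m\<^esub>"
    have NT: "?N \<subseteq> topspace (shift_top m)" by (auto simp: kernel_def carr)
    have "0 \<le> sofic_entropy G (subtopology (shift_top m) ?N) (shift m) D \<sigma>"
    proof (rule sofic_entropy_nonneg[where x = ?one])
      show "metrizable_space (subtopology (shift_top m) ?N)"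
        by (rule metrizable_space_subtopology[OF metrizable_space_shift_top])
      show "shift m \<one> x = x" if "x \<in> topspace (subtopology (shift_top m) ?N)" for x
        using that by (simp add: shift_one)
      have one: "?one \<in> topspace (shift_top m)" by (simp add: shift_group_def encode_in)
      have "?\<phi> ?one = \<one>\<^bsub>shift_group (Suc m)\<^esub>"
        by (rule hom_one[OF convolution_map_hom[OF P] group_shift_group group_shift_group])
      then show "?one \<in> topspace (subtopology (shift_top m) ?N)"
        using one by (simp add: kernel_def carr)
      show "shift m g ?one = ?one" if "g \<in> carrier G" for g
        by (rule shift_top_eqI[OF shift_in[OF one] one])
          (use that one in \<open>simp add: decode_shift shift_group_def decode_encode\<close>)
    qed (rule is_group sof)+
    then have le: "ereal (real (Suc m) * ln q) \<le> sofic_entropy G (subtopology (shift_top m) ?N) (shift m) D \<sigma> + ereal (real (Suc m) * ln q)"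
      using add_right_mono[of 0] by fastforce
    have "real m * ln q < real (Suc m) * ln q" using q by (simp add: algebra_simps)
    then have "ereal (real m * ln q) < ereal (real (Suc m) * ln q)" by simp
    from this le have "ereal (real m * ln q) \<noteq> sofic_entropy G (subtopology (shift_top m) ?N) (shift m) D \<sigma> + ereal (real (Suc m) * ln q)"
      by (metis less_le_not_le)
    then show ?thesis unfolding sofic_entropy_shift[OF sof] .
  qed
  then show ?thesis
    by (intro exI[of _ "shift_group m"] exI[of _ "shift_top m"] exI[of _ "shift m"]
        exI[of _ "shift_group (Suc m)"] exI[of _ "shift_top (Suc m)"] exI[of _ "shift (Suc m)"] exI[of _ ?\<phi>]
        conjI ballI allI impI compact_metrizable_shift_group acts_by_automorphisms_shift
        convolution_map_hom[OF P] continuous_convolution_map[OF P] convolution_map_equivariant[OF P])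
      (simp_all add: carr surj)
qed

theorem theorem6p3:
  fixes G :: "('g, 'm) monoid_scheme" and \<Gamma> :: "'g set" and p :: nat
  assumes "sofic_group G"
    and "subgroup \<Gamma> G"
    and "infinite \<Gamma>"
    and "l2_betti_number (G\<lparr>carrier := \<Gamma>\<rparr>) p > 0"
  shows "\<exists>(H :: (nat \<Rightarrow> real) monoid) T \<alpha> (H' :: (nat \<Rightarrow> real) monoid) T' \<alpha>' \<phi>.
    compact_metrizable_group H T \<and> compact_metrizable_group H' T' \<and>
    acts_by_continuous_automorphisms G H T \<alpha> \<and> acts_by_continuous_automorphisms G H' T' \<alpha>' \<and>
    \<phi> \<in> hom H H' \<and> continuous_map T T' \<phi> \<and> \<phi> ` carrier H = carrier H' \<and>
    (\<forall>g\<in>carrier G. \<forall>x\<in>carrier H. \<phi> (\<alpha> g x) = \<alpha>' g (\<phi> x)) \<and>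
    (\<forall>(D :: nat \<Rightarrow> nat set) \<sigma>. sofic_approximation G D \<sigma> \<longrightarrow>
       sofic_entropy G T \<alpha> D \<sigma> \<noteq>
         sofic_entropy G (subtopology T (kernel H H' \<phi>)) \<alpha> D \<sigma> + sofic_entropy G T' \<alpha>' D \<sigma>)"
proof -
  have G: "group G" "countable (carrier G)" using assms(1) by (simp_all add: sofic_group_def)
  have grp: "group (G\<lparr>carrier := \<Gamma>\<rparr>)" by (rule subgroup.subgroup_is_group[OF assms(2) G(1)])
  have cnt: "countable (carrier (G\<lparr>carrier := \<Gamma>\<rparr>))"
    using countable_subset[OF subgroup.subset[OF assms(2)] G(2)] by simp
  have "\<not> folner (G\<lparr>carrier := \<Gamma>\<rparr>)"
  proof
    assume "folner (G\<lparr>carrier := \<Gamma>\<rparr>)"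
    then have "l2_betti_number (G\<lparr>carrier := \<Gamma>\<rparr>) p = 0"
      by (intro folner_l2_betti_number_eq_0[OF grp cnt]) (use assms(3) in \<open>simp_all add: folner_def\<close>)
    then show False using assms(4) by simp
  qed
  then show ?thesis by (rule not_folner_subgroup_violates_addition[OF G assms(2)])
qed

end
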